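(* Let $w$ be an admissible weight on $\mathbb Z^d$, and set $$a_w:=\max\Bigl\{0,-\min_{k\in[-\pi,\pi]^d}\widehat w(k)\Bigr\},\qquad b(w):=\sum_{x\in\mathbb Z^d:\ |x|_1\text{ odd}}w(x),\qquad q_w:=\min\Bigl\{1,\frac{e\,w(0)}{b(w)}\Bigr\}.$$ Then $$\liminf_{L\to\infty,\ L\in2\mathbb N}M^{\mathrm{per}}_{L,w}\ \ge\ \frac{2}{1+a_w}-g_{d,w},$$ and, if $b(w)>0$, $$\liminf_{L\to\infty,\ L\in2\mathbb N}M^{\mathrm{mdd}}_{L,w}\ \ge\ \frac{2-q_w}{1+a_w}-g_{d,w}.$$ Moreover, for either model $A\in\{\mathrm{per},\mathrm{mdd}\}$, if the corresponding right-hand side above is positive, then there exists a constant $c=c(w,d)>0$ such that $$G^A_{L,w}(ne_1)\ge c$$ for every sufficiently large even $L$ and every odd integer $n\in(0,cL)$.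
   Context: Weights. A weight is a function $w:\mathbb Z^d\times\mathbb Z^d\to[0,\infty)$. For translation-invariant $w$ write $w(x):=w_{0,x}$, $\widehat w(k):=\sum_{x\in\mathbb Z^d}w(x)e^{\mathrm i k\cdot x}$, and $$g_{d,w}:=\sum_{n\ge0}w^{*n}(0)=\int_{(-\pi,\pi]^d}\frac{1}{1-\widehat w(k)}\frac{\mathrm dk}{(2\pi)^d}\in[1,\infty].$$ Let $\mathbb T_L:=(\mathbb Z/L\mathbb Z)^d$ and $\mathbb T_L^*:=\frac{2\pi}{L}\mathbb T_L$, represented in $(-\pi,\pi]^d$. The weight $w$ is called admissible if: (i) $w_{x,y}=w_{y,x}$; (ii) $w_{x,y}=w_{x+z,y+z}$ for all $x,y,z$; (iii) the additive subgroup generated by $\{x:w_{0,x}>0\}$ is $\mathbb Z^d$; (iv) $\sum_yw_{0,y}=1$; (v) (OS-positivity) for every $i\in\{1,\dots,d\}$, with $\theta_ix:=x-2(x\cdot e_i)e_i+e_i$ and $\mathbb Z^d_{i,+}:=\{x:x\cdot e_i>0\}$, one has $\sum_{x,y\in\mathbb Z^d_{i,+}}\overline{f(x)}\,w_{x,\theta_iy}f(y)\ge0$ for every finitely supported $f:\mathbb Z^d_{i,+}\to\mathbb C$; (vi) if $g_{d,w}<\infty$, then $\lim_{L\to\infty,\,L\in2\mathbb N}L^{-d}\sum_{k\in\mathbb T_L^*\setminus\{0\}}\frac1{1-\widehat w(k)}=g_{d,w}$. The periodised weights on $\mathbb T_L$ are $w^{(L)}_{x,y}:=\sum_{z\in\mathbb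 Z^d}w_{x,y+Lz}$. Two-point function of the monomer double-dimer model (mdd). Let $V$ be a finite set with symmetric weights $w_{x,y}\ge0$, $x,y\in V$, and let $E$ be the set of unordered pairs $\{x,y\}$, $x\ne y$, with $w_{x,y}>0$. For $m\in\{0,1\}^E$ put $n_x(m):=\sum_{y:\{x,y\}\in E}m_{x,y}$. Let $\Omega$ be the set of $(m^1,m^2)\in\{0,1\}^E\times\{0,1\}^E$ with $n_x(m^1)=n_x(m^2)\in\{0,1\}$ for all $x\in V$, and $Z^{\mathrm{mdd}}:=\sum_{(m^1,m^2)\in\Omega}\prod_{x\in V}w_{x,x}^{1-n_x(m^1)}\prod_{\{x,y\}\in E}w_{x,y}^{m^1_{x,y}+m^2_{x,y}}$ (with $0^0=1$). For $x\neq y$ let $\Omega_{x,y}$ be the set of $(m^1,m^2)\in\{0,1\}^E\times\{0,1\}^E$ with $n_z(m^1)=n_z(m^2)\in\{0,1\}$ for $z\notin\{x,y\}$, $n_x(m^1)=n_y(m^1)=0$, $n_x(m^2)=n_y(m^2)=1$; then $$G^{\mathrm{mdd}}(x,y):=\frac1{Z^{\mathrm{mdd}}}\sum_{(m^1,m^2)\in\Omega_{x,y}}\ \prod_{z\in V\setminus\{x,y\}}w_{z,z}^{1-n_z(m^1)}\prod_{\{u,v\}\in E}w_{u,v}^{m^1_{u,v}+m^2_{u,v}},$$ and $G^{\mathrm{mdd}}(x,x):=0$. Two-point function of random lattice permutations (per). $Z^{\mathrm{per}}:=\sum_\pi\prod_{x\in V}w_{x,\pi(x)}$, the sum over all permutations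 $\pi$ of $V$, and for $x,y\in V$ (possibly equal) $G^{\mathrm{per}}(x,y):=\frac1{Z^{\mathrm{per}}}\sum_\pi\prod_{z\in V\setminus\{y\}}w_{z,\pi(z)}$, the sum over all bijections $\pi:V\setminus\{y\}\to V\setminus\{x\}$. The subscript $_{L,w}$ means that the model is taken on $V=\mathbb T_L$ with weights $w^{(L)}$; $G^A_{L,w}(x):=G^A_{L,w}(0,x)$ and $M^A_{L,w}:=L^{-d}\sum_{x\in\mathbb T_L}G^A_{L,w}(x)$. $e_1$ is the first coordinate unit vector. *)

theory Defs
  imports "HOL-Analysis.Analysis" "HOL-Computational_Algebra.Group_Closure"
begin

text \<open>
  The lattice is \<^typ>\<open>int ^ 'd\<close> with an arbitrary finite index type for the coordinates, so the
  dimension is \<^term>\<open>CARD('d)\<close>. Limits along even side lengths use the following filter.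
\<close>

definition even_at_top :: "nat filter" where
  "even_at_top = inf at_top (principal {L. even L})"


section \<open>Weights on the lattice\<close>

definition lattice_dot :: "real ^ 'd \<Rightarrow> int ^ 'd \<Rightarrow> real" where
  "lattice_dot k x = (\<Sum>j\<in>UNIV. k $ j * of_int (x $ j))"

text \<open>Complex-valued in general; real if the weight is symmetric and translation invariant.\<close>

definition weight_hat :: "(int ^ 'd \<Rightarrow> int ^ 'd \<Rightarrow> real) \<Rightarrow> real ^ 'd \<Rightarrow> complex" where
  "weight_hat w k = (\<Sum>\<^sub>\<infinity>x. complex_of_real (w 0 x) * exp (\<i> * complex_of_real (lattice_dot k x)))"

primrec conv_power :: "(int ^ 'd \<Rightarrow> real) \<Rightarrow> nat \<Rightarrow> int ^ 'd \<Rightarrow> real" where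
  "conv_power u 0 = (\<lambda>x. if x = 0 then 1 else 0)"
| "conv_power u (Suc n) = (\<lambda>x. \<Sum>\<^sub>\<infinity>y. conv_power u n y * u (x - y))"

definition green :: "(int ^ 'd \<Rightarrow> int ^ 'd \<Rightarrow> real) \<Rightarrow> ennreal" where
  "green w = (\<Sum>n. ennreal (conv_power (w 0) n 0))"

text \<open>The representatives in $(-\pi,\pi]^d$ of the dual torus.\<close>

definition dual_torus :: "nat \<Rightarrow> (real ^ 'd) set" where
  "dual_torus L = {k. (\<exists>m :: int ^ 'd. k = (\<chi> j. 2 * pi / of_nat L * of_int (m $ j))) \<and>
                      (\<forall>j. - pi < k $ j \<and> k $ j \<le> pi)}"

definition half_space :: "'d \<Rightarrow> (int ^ 'd) set" where
  "half_space i = {x. 0 < x $ i}"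

definition reflect :: "'d \<Rightarrow> int ^ 'd \<Rightarrow> int ^ 'd" where
  "reflect i x = x - (2 * (x $ i)) *s axis i 1 + axis i 1"

definition OS_positive :: "(int ^ 'd \<Rightarrow> int ^ 'd \<Rightarrow> real) \<Rightarrow> bool" where
  "OS_positive w \<longleftrightarrow>
     (\<forall>i. \<forall>f :: int ^ 'd \<Rightarrow> complex.
        finite {x. f x \<noteq> 0} \<and> {x. f x \<noteq> 0} \<subseteq> half_space i \<longrightarrow>
        (\<Sum>x | f x \<noteq> 0. \<Sum>y | f y \<noteq> 0.
            cnj (f x) * complex_of_real (w x (reflect i y)) * f y) \<in> \<real>\<^sub>\<ge>\<^sub>0)"

definition admissible :: "(int ^ 'd \<Rightarrow> int ^ 'd \<Rightarrow> real) \<Rightarrow> bool" where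
  "admissible w \<longleftrightarrow>
     (\<forall>x y. 0 \<le> w x y) \<and>
     (\<forall>x y. w x y = w y x) \<and>
     (\<forall>x y z. w x y = w (x + z) (y + z)) \<and>
     group_closure {x. 0 < w 0 x} = UNIV \<and>
     ((\<lambda>y. w 0 y) has_sum 1) UNIV \<and>
     OS_positive w \<and>
     (green w < \<infinity> \<longrightarrow>
        ((\<lambda>L. (\<Sum>k\<in>dual_torus L - {0}. 1 / (1 - weight_hat w k)) / of_nat L ^ CARD('d))
           \<longlongrightarrow> complex_of_real (enn2real (green w))) even_at_top)"

text \<open>For admissible \<open>w\<close> the transform is real and continuous, so the infimum over the compact
  box is attained.\<close>

definition a_const :: "(int ^ 'd \<Rightarrow> int ^ 'd \<Rightarrow> real) \<Rightarrow> real" where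
  "a_const w = max 0 (- (INF k\<in>cbox (\<chi> j. - pi) (\<chi> j. pi). Re (weight_hat w k)))"

definition b_const :: "(int ^ 'd \<Rightarrow> int ^ 'd \<Rightarrow> real) \<Rightarrow> real" where
  "b_const w = (\<Sum>\<^sub>\<infinity>x\<in>{x. odd (\<Sum>j\<in>UNIV. \<bar>x $ j\<bar>)}. w 0 x)"

definition q_const :: "(int ^ 'd \<Rightarrow> int ^ 'd \<Rightarrow> real) \<Rightarrow> real" where
  "q_const w = min 1 (exp 1 * w 0 0 / b_const w)"


section \<open>Monomer double-dimer model\<close>

definition edges :: "'v set \<Rightarrow> ('v \<Rightarrow> 'v \<Rightarrow> real) \<Rightarrow> 'v set set" where
  "edges V W = {{x, y} | x y. x \<in> V \<and> y \<in> V \<and> x \<noteq> y \<and> 0 < W x y}"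

text \<open>Well defined because the weights are symmetric on \<open>V\<close>.\<close>

definition edge_weight :: "('v \<Rightarrow> 'v \<Rightarrow> real) \<Rightarrow> 'v set \<Rightarrow> real" where
  "edge_weight W e = (THE c. \<exists>x y. e = {x, y} \<and> c = W x y)"

definition dimer_configs :: "'v set \<Rightarrow> ('v \<Rightarrow> 'v \<Rightarrow> real) \<Rightarrow> ('v set \<Rightarrow> nat) set" where
  "dimer_configs V W = edges V W \<rightarrow>\<^sub>E {0, 1}"

definition occ :: "'v set \<Rightarrow> ('v \<Rightarrow> 'v \<Rightarrow> real) \<Rightarrow> ('v set \<Rightarrow> nat) \<Rightarrow> 'v \<Rightarrow> nat" where
  "occ V W m x = (\<Sum>y | {x, y} \<in> edges V W. m {x, y})"

definition mdd_configs ::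
    "'v set \<Rightarrow> ('v \<Rightarrow> 'v \<Rightarrow> real) \<Rightarrow> (('v set \<Rightarrow> nat) \<times> ('v set \<Rightarrow> nat)) set" where
  "mdd_configs V W = {(m1, m2) \<in> dimer_configs V W \<times> dimer_configs V W.
     \<forall>x\<in>V. occ V W m1 x = occ V W m2 x \<and> occ V W m1 x \<in> {0, 1}}"

definition mdd_configs_at ::
    "'v set \<Rightarrow> ('v \<Rightarrow> 'v \<Rightarrow> real) \<Rightarrow> 'v \<Rightarrow> 'v \<Rightarrow> (('v set \<Rightarrow> nat) \<times> ('v set \<Rightarrow> nat)) set" where
  "mdd_configs_at V W x y = {(m1, m2) \<in> dimer_configs V W \<times> dimer_configs V W.
     (\<forall>z\<in>V - {x, y}. occ V W m1 z = occ V W m2 z \<and> occ V W m1 z \<in> {0, 1}) \<and>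
     occ V W m1 x = 0 \<and> occ V W m1 y = 0 \<and> occ V W m2 x = 1 \<and> occ V W m2 y = 1}"

definition Z_mdd :: "'v set \<Rightarrow> ('v \<Rightarrow> 'v \<Rightarrow> real) \<Rightarrow> real" where
  "Z_mdd V W = (\<Sum>(m1, m2)\<in>mdd_configs V W.
     (\<Prod>x\<in>V. W x x ^ (1 - occ V W m1 x)) *
     (\<Prod>e\<in>edges V W. edge_weight W e ^ (m1 e + m2 e)))"

definition G_mdd :: "'v set \<Rightarrow> ('v \<Rightarrow> 'v \<Rightarrow> real) \<Rightarrow> 'v \<Rightarrow> 'v \<Rightarrow> real" where
  "G_mdd V W x y = (if x = y then 0 else
     (\<Sum>(m1, m2)\<in>mdd_configs_at V W x y.
        (\<Prod>z\<in>V - {x, y}. W z z ^ (1 - occ V W m1 z)) *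
        (\<Prod>e\<in>edges V W. edge_weight W e ^ (m1 e + m2 e))) / Z_mdd V W)"


section \<open>Random lattice permutations\<close>

definition Z_per :: "'v set \<Rightarrow> ('v \<Rightarrow> 'v \<Rightarrow> real) \<Rightarrow> real" where
  "Z_per V W = (\<Sum>\<pi> | \<pi> permutes V. \<Prod>x\<in>V. W x (\<pi> x))"

text \<open>Functions in an extensional function space have a fixed value outside their domain, so each
  bijection between the two punctured sets is counted once.\<close>

definition G_per :: "'v set \<Rightarrow> ('v \<Rightarrow> 'v \<Rightarrow> real) \<Rightarrow> 'v \<Rightarrow> 'v \<Rightarrow> real" where
  "G_per V W x y =
     (\<Sum>\<pi> | \<pi> \<in> (V - {y}) \<rightarrow>\<^sub>E (V - {x}) \<and> bij_betw \<pi> (V - {y}) (V - {x}).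
        \<Prod>z\<in>V - {y}. W z (\<pi> z)) / Z_per V W"


section \<open>The models on the torus\<close>

text \<open>The discrete torus is represented by the points of the lattice with coordinates in
  $\{0,\dots,L-1\}$; an arbitrary lattice point is read modulo \<open>L\<close>.\<close>

definition torus :: "nat \<Rightarrow> (int ^ 'd) set" where
  "torus L = {x. \<forall>j. 0 \<le> x $ j \<and> x $ j < int L}"

definition torus_rep :: "nat \<Rightarrow> int ^ 'd \<Rightarrow> int ^ 'd" where
  "torus_rep L x = (\<chi> j. x $ j mod int L)"

definition periodised ::
    "nat \<Rightarrow> (int ^ 'd \<Rightarrow> int ^ 'd \<Rightarrow> real) \<Rightarrow> int ^ 'd \<Rightarrow> int ^ 'd \<Rightarrow> real" where
  "periodised L w x y = (\<Sum>\<^sub>\<infinity>z. w x (y + int L *s z))"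

text \<open>In the next two definitions, \<open>G\<close> is \<^const>\<open>G_per\<close> or \<^const>\<open>G_mdd\<close>.\<close>

definition torus_G ::
    "((int ^ 'd) set \<Rightarrow> (int ^ 'd \<Rightarrow> int ^ 'd \<Rightarrow> real) \<Rightarrow> int ^ 'd \<Rightarrow> int ^ 'd \<Rightarrow> real) \<Rightarrow>
     nat \<Rightarrow> (int ^ 'd \<Rightarrow> int ^ 'd \<Rightarrow> real) \<Rightarrow> int ^ 'd \<Rightarrow> real" where
  "torus_G G L w x = G (torus L) (periodised L w) 0 (torus_rep L x)"

definition torus_M ::
    "((int ^ 'd) set \<Rightarrow> (int ^ 'd \<Rightarrow> int ^ 'd \<Rightarrow> real) \<Rightarrow> int ^ 'd \<Rightarrow> int ^ 'd \<Rightarrow> real) \<Rightarrow>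
     nat \<Rightarrow> (int ^ 'd \<Rightarrow> int ^ 'd \<Rightarrow> real) \<Rightarrow> real" where
  "torus_M G L w = (\<Sum>x\<in>torus L. torus_G G L w x) / of_nat L ^ CARD('d)"


section \<open>The two lower bounds\<close>

text \<open>Extended real, since \<^const>\<open>green\<close> may be infinite.\<close>

definition per_bound :: "(int ^ 'd \<Rightarrow> int ^ 'd \<Rightarrow> real) \<Rightarrow> ereal" where
  "per_bound w = ereal (2 / (1 + a_const w)) - enn2ereal (green w)"

definition mdd_bound :: "(int ^ 'd \<Rightarrow> int ^ 'd \<Rightarrow> real) \<Rightarrow> ereal" where
  "mdd_bound w = ereal ((2 - q_const w) / (1 + a_const w)) - enn2ereal (green w)"

end

theory Submission
  imports Defs
begin

text \<open>
  Both models are limits, as \<open>\<epsilon> \<rightarrow> 0\<close>, of spin systems with two signs \<open>\<plusminus>\<epsilon>\<close> per site, a possibly signed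
  single-site weight and coupling given by the periodised weight. OS-positivity makes these systems
  reflection positive on the torus, which yields a chessboard estimate and thereby Gaussian domination
  and the infrared bound: the Fourier transform of the two-point function is at most
  \<open>1 / (1 - what k)\<close> for \<open>k \<noteq> 0\<close>. Completing or opening a path by one step gives the sum rule
  \<open>(w * G) 0 = 1 - p\<close>, where \<open>p\<close> is \<open>0\<close> for permutations and the monomer density for mdd. Writing
  the sum rule in Fourier space and splitting off the zero mode, whose coefficient is the mean \<open>M\<close>, gives
  the lower bounds on \<open>M\<close>. The monomer density is controlled by two further chessboard estimates: one
  bounds it by a power of the partition function, the other bounds the partition function from below
  by the pure dimer model of the odd part of the weight.

  For the pointwise bound, reflection positivity makes the two-point function log-convex along odd
  multiples of a unit vector, so that a small value at \<open>n e\<^sub>1\<close> forces small values on all of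
  the torus except a slab of width \<open>2 n\<close>, contradicting a positive mean.
\<close>

section \<open>Positive semidefinite kernels\<close>

text \<open>No probability measure is available, since the site weights are signed. Reflection
  positivity and the chessboard estimate nevertheless work: they use Cauchy--Schwarz for finite sums
  and the positivity of the partition functions with equal data at all sites. For weights of long
  range the delicate point is that the periodised weight stays positive: its images are sorted into
  slices, and each slice is handled by averaging over large boxes. The constants arise as follows.
  An upper bound on the transform of the two-point function cannot be multiplied by the transform of
  \<open>w\<close> where the latter is negative; adding \<open>a_const w\<close> repairs the sign at
  the price of a factor 1 + a. The 2 in the bounds is one unit from the sum rule and one from (u +
  a) / (1 - u) = (1 + a) / (1 - u) - 1, summed over the nonzero modes. The e in
  \<open>q_const\<close> is the partition function per site of a comparison system of constant
  spins, and \<open>b_const\<close> enters through the odd part of the weight, whose dimers join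
  sites of opposite parity.\<close>

definition psd_on :: "'a set \<Rightarrow> ('a \<Rightarrow> 'a \<Rightarrow> real) \<Rightarrow> bool" where
  "psd_on S M \<longleftrightarrow> (\<forall>f. 0 \<le> (\<Sum>x\<in>S. \<Sum>y\<in>S. f x * f y * M x y))"

lemma psd_onD: "psd_on S M \<Longrightarrow> 0 \<le> (\<Sum>x\<in>S. \<Sum>y\<in>S. f x * f y * M x y)"
  by (auto simp: psd_on_def)

lemma psd_on_insert_form:
  assumes "finite S" "a \<notin> S" and sym: "\<And>x y. x \<in> insert a S \<Longrightarrow> y \<in> insert a S \<Longrightarrow> M x y = M y x"
  shows "(\<Sum>x\<in>insert a S. \<Sum>y\<in>insert a S. f x * f y * M x y) =
    (f a)\<^sup>2 * M a a + 2 * f a * (\<Sum>y\<in>S. f y * M a y) + (\<Sum>x\<in>S. \<Sum>y\<in>S. f x * f y * (M x y :: real))"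
proof -
  have "(\<Sum>x\<in>S. f x * f a * M x a) = f a * (\<Sum>y\<in>S. f y * M a y)"
    unfolding sum_distrib_left
  proof (rule sum.cong)
    fix x assume "x \<in> S"
    then have "M x a = M a x" using sym by blast
    then show "f x * f a * M x a = f a * (f x * M a x)" by simp
  qed simp
  moreover have "(\<Sum>y\<in>S. f a * f y * M a y) = f a * (\<Sum>y\<in>S. f y * M a y)"
    unfolding sum_distrib_left by (rule sum.cong) (auto simp: mult_ac)
  ultimately show ?thesis
    using assms(1,2) by (simp add: sum.distrib power2_eq_square algebra_simps)
qed

text \<open>Without a quadratic term the form is affine in the coordinate at \<open>a\<close>, so
  nonnegativity forces the slope to vanish.\<close>

lemma psd_on_diag_zero:
  assumes fin: "finite S" "a \<notin> S"
    and sym: "\<And>x y. x \<in> insert a S \<Longrightarrow> y \<in> insert a S \<Longrightarrow> M x y = M y x"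
    and psd: "psd_on (insert a S) M" and zero: "M a a = 0" and y: "y \<in> S"
  shows "M a y = 0"
proof (rule ccontr)
  assume ne: "M a y \<noteq> 0"
  \<comment> \<open>With value 1 at \<open>y\<close> and 0 elsewhere, this value at \<open>a\<close>
    gives the form the value -1.\<close>
  define t where "t = - (M y y + 1) / (2 * M a y)"
  define f where "f = (\<lambda>x. if x = a then t else if x = y then 1 else (0::real))"
  have ay: "a \<noteq> y" using fin y by auto
  have 1: "(\<Sum>z\<in>S. f z * M a z) = M a y"
  proof -
    have "(\<Sum>z\<in>S. f z * M a z) = (\<Sum>z\<in>S. if z = y then M a y else 0)"
      by (rule sum.cong) (use fin in \<open>auto simp: f_def\<close>)
    then show ?thesis using fin y by simp
  qed
  have 2: "(\<Sum>x\<in>S. \<Sum>z\<in>S. f x * f z * M x z) = M y y"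
  proof -
    have "(\<Sum>x\<in>S. \<Sum>z\<in>S. f x * f z * M x z) = (\<Sum>x\<in>S. \<Sum>z\<in>S. if z = y then (if x = y then M y y else 0) else 0)"
      by (intro sum.cong refl) (use fin in \<open>auto simp: f_def\<close>)
    then show ?thesis using fin y by simp
  qed
  have "0 \<le> (f a)\<^sup>2 * M a a + 2 * f a * (\<Sum>y\<in>S. f y * M a y) + (\<Sum>x\<in>S. \<Sum>y\<in>S. f x * f y * M x y)"
    using psd_onD[OF psd, of f] psd_on_insert_form[OF fin sym, where f = f] by simp
  then have "0 \<le> 2 * t * M a y + M y y"
    unfolding 1 2 zero by (simp add: f_def)
  moreover have "2 * t * M a y = - (M y y + 1)" using ne by (simp add: t_def)
  ultimately show False by simp
qed

text \<open>Cholesky elimination, one index at a time. It is used to write the coupling across a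
  reflection plane as an inner product of vectors attached to the two halves.\<close>

lemma psd_on_decomp:
  assumes "finite S" and "\<And>x y. x \<in> S \<Longrightarrow> y \<in> S \<Longrightarrow> M x y = M y x" and "psd_on S M"
  shows "\<exists>(v :: nat \<Rightarrow> 'a \<Rightarrow> real) n. \<forall>x\<in>S. \<forall>y\<in>S. M x y = (\<Sum>l<n. v l x * v l y)"
  using assms
proof (induction S arbitrary: M rule: finite_induct)
  case empty
  then show ?case by auto
next
  case (insert a S)
  have sym: "\<And>x y. x \<in> insert a S \<Longrightarrow> y \<in> insert a S \<Longrightarrow> M x y = M y x" by (fact insert.prems(1))
  note form = psd_on_insert_form[OF insert.hyps sym]
  show ?case
  proof (cases "M a a = 0")
    case True
    have zero: "M a y = 0" if "y \<in> S" for y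
      using psd_on_diag_zero[OF insert.hyps sym insert.prems(2) True that] .
    have "psd_on S M"
      unfolding psd_on_def
    proof
      fix f
      show "0 \<le> (\<Sum>x\<in>S. \<Sum>y\<in>S. f x * f y * M x y)"
        using psd_onD[OF insert.prems(2), of "f"] form[where f = f] zero True by simp
    qed
    then obtain v :: "nat \<Rightarrow> 'a \<Rightarrow> real" and n where
      v: "\<forall>x\<in>S. \<forall>y\<in>S. M x y = (\<Sum>l<n. v l x * v l y)"
      using insert.IH[of M] sym by blast
    define u where "u = (\<lambda>l x. if x = a then 0 else v l x)"
    have "M x y = (\<Sum>l<n. u l x * u l y)" if "x \<in> insert a S" "y \<in> insert a S" for x y
    proof (cases "x = a \<or> y = a")
      case t: True
      then have "M x y = 0" using that zero sym True by (metis insert_iff)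
      then show ?thesis using t by (auto simp: u_def)
    next
      case False
      then show ?thesis using that v by (auto simp: u_def)
    qed
    then show ?thesis by blast
  next
    case False
    have pos: "M a a > 0"
    proof -
      have "0 \<le> M a a"
        using psd_onD[OF insert.prems(2), of "\<lambda>x. if x = a then 1 else 0"]
          form[where f = "\<lambda>x. if x = a then 1 else 0"] insert.hyps(2)
        by (simp add: sum.neutral)
      then show ?thesis using False by simp
    qed
    \<comment> \<open>Schur complement of the pivot \<open>M a a\<close>.\<close>
    define M' where "M' = (\<lambda>x y. M x y - M a x * M a y / M a a)"
    have "psd_on S M'"
      unfolding psd_on_def
    proof
      fix f
      define s where "s = (\<Sum>y\<in>S. f y * M a y)"
      \<comment> \<open>The value at \<open>a\<close> minimises the form of \<open>M\<close> for
        given values on \<open>S\<close>; the minimum is the form of \<open>M'\<close>.\<close>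
      define g where "g = (\<lambda>x. if x = a then - s / M a a else f x)"
      have g: "(\<Sum>y\<in>S. g y * M a y) = s" "(\<Sum>x\<in>S. \<Sum>y\<in>S. g x * g y * M x y) = (\<Sum>x\<in>S. \<Sum>y\<in>S. f x * f y * M x y)"
        unfolding s_def by (intro sum.cong refl, use insert.hyps in \<open>auto simp: g_def\<close>)+
      have "0 \<le> (g a)\<^sup>2 * M a a + 2 * g a * s + (\<Sum>x\<in>S. \<Sum>y\<in>S. f x * f y * M x y)"
        using psd_onD[OF insert.prems(2), of g] form[where f = g] g by simp
      also have "(g a)\<^sup>2 * M a a + 2 * g a * s = - (s * s / M a a)"
        using pos by (simp add: g_def field_simps power2_eq_square)
      also have "s * s / M a a = (\<Sum>x\<in>S. \<Sum>y\<in>S. f x * f y * (M a x * M a y / M a a))"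
        unfolding s_def sum_product sum_divide_distrib by (intro sum.cong refl) (simp add: mult_ac)
      finally show "0 \<le> (\<Sum>x\<in>S. \<Sum>y\<in>S. f x * f y * M' x y)"
        by (simp add: M'_def right_diff_distrib sum_subtractf)
    qed
    moreover have "M' x y = M' y x" if "x \<in> S" "y \<in> S" for x y
      using sym that by (auto simp: M'_def mult_ac)
    ultimately obtain v :: "nat \<Rightarrow> 'a \<Rightarrow> real" and n where
      v: "\<forall>x\<in>S. \<forall>y\<in>S. M' x y = (\<Sum>l<n. v l x * v l y)"
      using insert.IH[of M'] by blast
    define u where "u = (\<lambda>l x. if l = n then M a x / sqrt (M a a) else if x = a then 0 else v l x)"
    have "M x y = (\<Sum>l<Suc n. u l x * u l y)" if "x \<in> insert a S" "y \<in> insert a S" for x y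
    proof -
      have sum: "(\<Sum>l<Suc n. u l x * u l y) =
        (\<Sum>l<n. (if x = a then 0 else v l x) * (if y = a then 0 else v l y)) + M a x * M a y / M a a"
        using pos by (simp add: u_def field_simps)
      show ?thesis
      proof (cases "x = a \<or> y = a")
        case True
        then show ?thesis unfolding sum using that sym pos by auto
      next
        case False
        then have "x \<in> S" "y \<in> S" using that by auto
        then have "M' x y = (\<Sum>l<n. v l x * v l y)" using v by auto
        then show ?thesis unfolding sum using False by (simp add: M'_def)
      qed
    qed
    then show ?thesis by blast
  qed
qed

text \<open>Schur product: each rank-one term of the Gram factor is absorbed into the test function.
  Iteration gives all entrywise powers of a Gram kernel.\<close>

lemma psd_on_mult_gram:
  assumes "psd_on S A"
  shows "psd_on S (\<lambda>i j. A i j * (\<Sum>l\<in>T. Y l i * Y l j))"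
  unfolding psd_on_def
proof
  fix f
  have "(\<Sum>x\<in>S. \<Sum>y\<in>S. f x * f y * (A x y * (\<Sum>l\<in>T. Y l x * Y l y))) =
    (\<Sum>x\<in>S. \<Sum>y\<in>S. \<Sum>l\<in>T. (f x * Y l x) * (f y * Y l y) * A x y)"
    by (simp add: sum_distrib_left mult_ac)
  also have "\<dots> = (\<Sum>x\<in>S. \<Sum>l\<in>T. \<Sum>y\<in>S. (f x * Y l x) * (f y * Y l y) * A x y)"
    by (intro sum.cong refl sum.swap)
  also have "\<dots> = (\<Sum>l\<in>T. \<Sum>x\<in>S. \<Sum>y\<in>S. (f x * Y l x) * (f y * Y l y) * A x y)"
    by (rule sum.swap)
  also have "0 \<le> \<dots>" by (intro sum_nonneg psd_onD[OF assms])
  finally show "0 \<le> (\<Sum>x\<in>S. \<Sum>y\<in>S. f x * f y * (A x y * (\<Sum>l\<in>T. Y l x * Y l y)))" .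
qed

text \<open>The exponential series has nonnegative coefficients, and entrywise powers of a Gram
  kernel are positive semidefinite.\<close>

lemma psd_on_exp_gram:
  assumes "finite S"
  shows "psd_on S (\<lambda>i j. exp (\<Sum>l\<in>T. Y l i * Y l j))"
proof -
  define M where "M = (\<lambda>i j. \<Sum>l\<in>T. Y l i * Y l j)"
  have pow: "psd_on S (\<lambda>i j. M i j ^ n)" for n
  proof (induction n)
    case 0
    show ?case
      unfolding psd_on_def by (simp flip: sum_product)
  next
    case (Suc n)
    then show ?case using psd_on_mult_gram[OF Suc, of Y T] by (simp add: M_def mult_ac)
  qed
  show ?thesis
    unfolding psd_on_def
  proof
    fix f
    have conv: "(\<lambda>n. \<Sum>x\<in>S. \<Sum>y\<in>S. f x * f y * (M x y ^ n /\<^sub>R fact n)) sums (\<Sum>x\<in>S. \<Sum>y\<in>S. f x * f y * exp (M x y))"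
      by (intro sums_sum sums_mult exp_converges)
    have nn: "0 \<le> (\<Sum>x\<in>S. \<Sum>y\<in>S. f x * f y * (M x y ^ n /\<^sub>R fact n))" for n
    proof -
      have "(\<Sum>x\<in>S. \<Sum>y\<in>S. f x * f y * (M x y ^ n /\<^sub>R fact n)) = (\<Sum>x\<in>S. \<Sum>y\<in>S. f x * f y * (M x y ^ n)) / fact n"
        by (simp add: sum_divide_distrib field_simps)
      then show ?thesis using psd_onD[OF pow, of f n] by simp
    qed
    show "0 \<le> (\<Sum>x\<in>S. \<Sum>y\<in>S. f x * f y * exp (\<Sum>l\<in>T. Y l x * Y l y))"
      using sums_le[OF nn sums_zero conv] unfolding M_def .
  qed
qed

lemma quadratic_discriminant:
  fixes A B C :: real
  assumes "\<And>s t. 0 \<le> s\<^sup>2 * A + 2 * s * t * B + t\<^sup>2 * C"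
  shows "B\<^sup>2 \<le> A * C"
proof -
  have C: "0 \<le> C" and A: "0 \<le> A" using assms[of 0 1] assms[of 1 0] by auto
  show ?thesis
  proof (cases "A = 0")
    case True
    show ?thesis
    proof (rule ccontr)
      assume "\<not> ?thesis"
      then have B: "B \<noteq> 0" using True by auto
      have "0 \<le> 2 * (- (C + 1) / (2 * B)) * B + C" using assms[of "- (C + 1) / (2 * B)" 1] True by simp
      moreover have "2 * (- (C + 1) / (2 * B)) * B = - (C + 1)" using B by simp
      ultimately show False by linarith
    qed
  next
    case False
    then have pos: "A > 0" using A by simp
    have "0 \<le> (- B / A)\<^sup>2 * A + 2 * (- B / A) * B + C" using assms[of "- B / A" 1] by simp
    also have "(- B / A)\<^sup>2 * A + 2 * (- B / A) * B = - (B\<^sup>2 / A)"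
      using pos by (simp add: power2_eq_square field_simps)
    finally show ?thesis using pos by (simp add: field_simps)
  qed
qed

text \<open>Cauchy--Schwarz for two families of points, obtained by applying positivity of the kernel to
  all linear combinations of both families.\<close>

lemma gram_exp_cauchy_schwarz:
  fixes f1 f2 :: "'a \<Rightarrow> real" and Y1 Y2 :: "'l \<Rightarrow> 'a \<Rightarrow> real" and T :: "'l set"
  assumes "finite S"
  defines "B \<equiv> \<lambda>f Y g Z. \<Sum>x\<in>S. \<Sum>y\<in>S. f x * g y * exp (\<Sum>l\<in>T. Y l x * Z l y)"
  shows "(B f1 Y1 f2 Y2)\<^sup>2 \<le> B f1 Y1 f1 Y1 * B f2 Y2 f2 Y2" "0 \<le> B f1 Y1 f1 Y1"
proof -
  have sym: "B f Y g Z = B g Z f Y" for f Y g Z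
    unfolding B_def by (subst sum.swap) (simp add: mult_ac)
  show "0 \<le> B f1 Y1 f1 Y1"
    unfolding B_def by (rule psd_onD[OF psd_on_exp_gram[OF assms(1)]])
  show "(B f1 Y1 f2 Y2)\<^sup>2 \<le> B f1 Y1 f1 Y1 * B f2 Y2 f2 Y2"
  proof (rule quadratic_discriminant)
    fix s t :: real
    \<comment> \<open>Both families are put on one index set, the Boolean naming the family, so that
      a single positive form contains both diagonal values and the mixed one.\<close>
    define Y where "Y = (\<lambda>l (b, x). if b then Y1 l x else Y2 l x)"
    define f where "f = (\<lambda>(b, x). if b then s * f1 x else t * f2 x)"
    have "0 \<le> (\<Sum>p\<in>UNIV \<times> S. \<Sum>q\<in>UNIV \<times> S. f p * f q * exp (\<Sum>l\<in>T. Y l p * Y l q))"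
      by (rule psd_onD[OF psd_on_exp_gram]) (simp add: assms(1))
    also have "\<dots> = s\<^sup>2 * B f1 Y1 f1 Y1 + s * t * B f1 Y1 f2 Y2 + s * t * B f2 Y2 f1 Y1 + t\<^sup>2 * B f2 Y2 f2 Y2"
    proof -
      have split: "(\<Sum>p\<in>UNIV \<times> S. g p) = (\<Sum>x\<in>S. g (True, x)) + (\<Sum>x\<in>S. g (False, x))" for g :: "bool \<times> 'a \<Rightarrow> real"
        using sum.cartesian_product[of "\<lambda>b x. g (b, x)" S UNIV] by (simp add: UNIV_bool)
      show ?thesis
        unfolding split
        by (simp add: f_def Y_def B_def sum.distrib sum_distrib_left power2_eq_square mult_ac)
    qed
    finally show "0 \<le> s\<^sup>2 * B f1 Y1 f1 Y1 + 2 * s * t * B f1 Y1 f2 Y2 + t\<^sup>2 * B f2 Y2 f2 Y2"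
      using sym[of f2 Y2 f1 Y1] by simp
  qed
qed

section \<open>Reflection positivity of signed spin systems\<close>

text \<open>A field with two real components per site. \<open>J\<close> decides which components
  interact: the identity couples each component to itself (dimers), \<open>Not\<close> couples the
  first to the second (permutations). Ordered pairs are summed, hence the factor 1/2.\<close>

definition spin_energy :: "'v set \<Rightarrow> ('v \<Rightarrow> 'v \<Rightarrow> real) \<Rightarrow> (bool \<Rightarrow> bool) \<Rightarrow> ('v \<Rightarrow> bool \<Rightarrow> real) \<Rightarrow> real" where
  "spin_energy V W J z = (\<Sum>x\<in>V. \<Sum>y\<in>V. W x y * (\<Sum>k\<in>UNIV. z x k * z y (J k))) / 2"

text \<open>Site \<open>x\<close> carries the signed measure giving mass \<open>c x i\<close> to the point \<open>p x i\<close>.\<close>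

definition spin_sum ::
    "'v set \<Rightarrow> ('v \<Rightarrow> 'v \<Rightarrow> real) \<Rightarrow> (bool \<Rightarrow> bool) \<Rightarrow> ('v \<Rightarrow> 'i::finite \<Rightarrow> real) \<Rightarrow> ('v \<Rightarrow> 'i \<Rightarrow> bool \<Rightarrow> real) \<Rightarrow> real" where
  "spin_sum V W J c p =
     (\<Sum>\<omega>\<in>V \<rightarrow>\<^sub>E UNIV. (\<Prod>x\<in>V. c x (\<omega> x)) * exp (spin_energy V W J (\<lambda>x. p x (\<omega> x))))"

lemma spin_sum_cong:
  assumes "\<And>x i. x \<in> V \<Longrightarrow> c x i = c' x i" "\<And>x i k. x \<in> V \<Longrightarrow> p x i k = p' x i k"
  shows "spin_sum V W J c p = spin_sum V W J c' p'"
  unfolding spin_sum_def spin_energy_def using assms by (intro sum.cong arg_cong2[where f = "(*)"]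
    prod.cong arg_cong[where f = exp] arg_cong2[where f = "(/)"] refl) auto

lemma sum_involution:
  assumes "\<And>k. J (J k) = k"
  shows "(\<Sum>k\<in>UNIV. f (J k)) = (\<Sum>k\<in>UNIV. f k)"
  by (rule sum.reindex_bij_witness[of _ J J]) (auto simp: assms)

text \<open>Besides moving sites by \<theta>, a reflection relabels local states by \<open>j\<close>
  and permutes components by \<open>J\<close>. With this twist, the coupling of a site of
  \<open>P\<close> to a mirrored site becomes the ordinary inner product of two fields on
  \<open>P\<close>, which is where \<open>W_psd\<close> applies.\<close>

locale reflection =
  fixes V :: "'v set" and W :: "'v \<Rightarrow> 'v \<Rightarrow> real" and P :: "'v set" and \<theta> :: "'v \<Rightarrow> 'v"
    and J :: "bool \<Rightarrow> bool" and j :: "'i::finite \<Rightarrow> 'i"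
  assumes finite: "finite V" and half: "P \<subseteq> V"
    and refl_in: "x \<in> V \<Longrightarrow> \<theta> x \<in> V" and refl_refl: "x \<in> V \<Longrightarrow> \<theta> (\<theta> x) = x"
    and refl_half: "x \<in> V \<Longrightarrow> \<theta> x \<in> P \<longleftrightarrow> x \<notin> P"
    and W_sym: "x \<in> V \<Longrightarrow> y \<in> V \<Longrightarrow> W x y = W y x"
    and W_refl: "x \<in> V \<Longrightarrow> y \<in> V \<Longrightarrow> W (\<theta> x) (\<theta> y) = W x y"
    and W_psd: "psd_on P (\<lambda>x y. W x (\<theta> y))"
    and JJ: "J (J k) = k" and jj: "j (j i) = i"
begin

definition half_weight where
  "half_weight c p u = (\<Prod>x\<in>P. c x (u x)) * exp (spin_energy P W J (\<lambda>x. p x (u x :: 'i)))"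

text \<open>A pairing of two systems on \<open>P\<close>, the second being the other half already
  reflected into \<open>P\<close>; the last exponential is the coupling across the plane.\<close>

definition half_form where
  "half_form c1 p1 c2 p2 = (\<Sum>u\<in>P \<rightarrow>\<^sub>E UNIV. \<Sum>v\<in>P \<rightarrow>\<^sub>E UNIV. half_weight c1 p1 u * half_weight c2 p2 v *
     exp (\<Sum>x\<in>P. \<Sum>y\<in>P. W x (\<theta> y) * (\<Sum>k\<in>UNIV. p1 x (u x) k * p2 y (v y) k)))"

lemma finite_half: "finite P" using finite half finite_subset by blast

lemma half_in: "x \<in> P \<Longrightarrow> x \<in> V" using half by auto

lemma half_form_cong:
  assumes "\<And>x i. x \<in> P \<Longrightarrow> c1 x i = c1' x i" "\<And>x i k. x \<in> P \<Longrightarrow> p1 x i k = p1' x i k"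
    "\<And>x i. x \<in> P \<Longrightarrow> c2 x i = c2' x i" "\<And>x i k. x \<in> P \<Longrightarrow> p2 x i k = p2' x i k"
  shows "half_form c1 p1 c2 p2 = half_form c1' p1' c2' p2'"
  unfolding half_form_def half_weight_def spin_energy_def using assms
  by (intro sum.cong arg_cong2[where f = "(*)"]
    prod.cong arg_cong[where f = exp] arg_cong2[where f = "(/)"] refl) auto

text \<open>Once \<open>W x (\<theta> y)\<close> is factorised, the coupling of the halves is the
  inner product of the vectors \<open>Y\<close>, indexed by a factor of the decomposition and a spin
  component.\<close>

lemma half_form_cauchy_schwarz:
  "(half_form c1 p1 c2 p2)\<^sup>2 \<le> half_form c1 p1 c1 p1 * half_form c2 p2 c2 p2"
  "0 \<le> half_form c1 p1 c1 p1"
proof -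
  have "W x (\<theta> y) = W y (\<theta> x)" if "x \<in> P" "y \<in> P" for x y
    using that half W_sym W_refl refl_refl refl_in by (metis subsetD)
  then obtain v :: "nat \<Rightarrow> 'v \<Rightarrow> real" and n where
    v: "\<forall>x\<in>P. \<forall>y\<in>P. W x (\<theta> y) = (\<Sum>l<n. v l x * v l y)"
    using psd_on_decomp[OF finite_half _ W_psd] by blast
  define Y where "Y = (\<lambda>p :: 'v \<Rightarrow> 'i \<Rightarrow> bool \<Rightarrow> real. \<lambda>(l, k) u. \<Sum>x\<in>P. v l x * p x (u x) k)"
  have eq: "(\<Sum>x\<in>P. \<Sum>y\<in>P. W x (\<theta> y) * (\<Sum>k\<in>UNIV. p x (u x) k * q y (t y) k)) =
    (\<Sum>l\<in>{..<n} \<times> UNIV. Y p l u * Y q l t)" for p q u t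
  proof -
    have "(\<Sum>l\<in>{..<n} \<times> UNIV. Y p l u * Y q l t) =
      (\<Sum>l<n. \<Sum>k\<in>UNIV. \<Sum>x\<in>P. \<Sum>y\<in>P. (v l x * p x (u x) k) * (v l y * q y (t y) k))"
      unfolding Y_def sum.cartesian_product' by (simp add: sum_product)
    also have "\<dots> = (\<Sum>l<n. \<Sum>x\<in>P. \<Sum>k\<in>UNIV. \<Sum>y\<in>P. (v l x * p x (u x) k) * (v l y * q y (t y) k))"
      by (intro sum.cong refl sum.swap)
    also have "\<dots> = (\<Sum>l<n. \<Sum>x\<in>P. \<Sum>y\<in>P. \<Sum>k\<in>UNIV. (v l x * p x (u x) k) * (v l y * q y (t y) k))"
      by (intro sum.cong refl sum.swap)
    also have "\<dots> = (\<Sum>x\<in>P. \<Sum>l<n. \<Sum>y\<in>P. \<Sum>k\<in>UNIV. (v l x * p x (u x) k) * (v l y * q y (t y) k))"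
      by (rule sum.swap)
    also have "\<dots> = (\<Sum>x\<in>P. \<Sum>y\<in>P. \<Sum>l<n. \<Sum>k\<in>UNIV. (v l x * p x (u x) k) * (v l y * q y (t y) k))"
      by (intro sum.cong refl sum.swap)
    also have "\<dots> = (\<Sum>x\<in>P. \<Sum>y\<in>P. W x (\<theta> y) * (\<Sum>k\<in>UNIV. p x (u x) k * q y (t y) k))"
      using v by (intro sum.cong refl) (simp add: sum_product mult_ac)
    finally show ?thesis by simp
  qed
  have fin: "finite (P \<rightarrow>\<^sub>E (UNIV :: 'i set))" by (intro finite_PiE finite_half) simp
  show "(half_form c1 p1 c2 p2)\<^sup>2 \<le> half_form c1 p1 c1 p1 * half_form c2 p2 c2 p2"
    "0 \<le> half_form c1 p1 c1 p1"
    unfolding half_form_def eq by (rule gram_exp_cauchy_schwarz[OF fin])+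
qed

lemma half_image: "\<theta> ` P = V - P"
proof
  show "\<theta> ` P \<subseteq> V - P" using half refl_in refl_half refl_refl by (auto)
  show "V - P \<subseteq> \<theta> ` P"
    using refl_in refl_half refl_refl by (metis DiffE image_eqI subsetI)
qed

lemma inj_refl: "inj_on \<theta> P"
  using refl_refl half by (metis inj_onI subsetD)

lemma sum_split: "(\<Sum>x\<in>V. g x) = (\<Sum>x\<in>P. g x) + (\<Sum>x\<in>P. g (\<theta> x :: 'v) :: real)"
  using sum.subset_diff[OF half finite, of g] sum.reindex[OF inj_refl, of g] half_image by simp

lemma prod_split: "(\<Prod>x\<in>V. g x) = (\<Prod>x\<in>P. g x) * (\<Prod>x\<in>P. g (\<theta> x :: 'v) :: real)"
  using prod.subset_diff[OF half finite, of g] prod.reindex[OF inj_refl, of g] half_image by simp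

text \<open>The two mixed terms agree by symmetry of \<open>W\<close> and because \<open>J\<close>
  is an involution. They cancel the factor 1/2, so the coupling across the plane has coefficient
  1.\<close>

lemma spin_energy_split:
  "spin_energy V W J z = spin_energy P W J z + spin_energy P W J (\<lambda>x k. z (\<theta> x) (J k)) +
     (\<Sum>x\<in>P. \<Sum>y\<in>P. W x (\<theta> y) * (\<Sum>k\<in>UNIV. z x k * z (\<theta> y) (J k)))"
proof -
  have J: "(\<Sum>k\<in>UNIV. f (J k)) = (\<Sum>k\<in>UNIV. f k)" for f :: "bool \<Rightarrow> real"
    by (rule sum_involution) (rule JJ)
  have 1: "(\<Sum>x\<in>P. \<Sum>y\<in>P. W (\<theta> x) (\<theta> y) * (\<Sum>k\<in>UNIV. z (\<theta> x) k * z (\<theta> y) (J k))) =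
    (\<Sum>x\<in>P. \<Sum>y\<in>P. W x y * (\<Sum>k\<in>UNIV. z (\<theta> x) (J k) * z (\<theta> y) (J (J k))))"
    using J[of "\<lambda>k. z (\<theta> _) k * z (\<theta> _) (J k)"]
    by (intro sum.cong refl) (simp add: half_in W_refl)
  have 2: "(\<Sum>x\<in>P. \<Sum>y\<in>P. W (\<theta> x) y * (\<Sum>k\<in>UNIV. z (\<theta> x) k * z y (J k))) =
    (\<Sum>x\<in>P. \<Sum>y\<in>P. W x (\<theta> y) * (\<Sum>k\<in>UNIV. z x k * z (\<theta> y) (J k)))"
  proof -
    have "(\<Sum>x\<in>P. \<Sum>y\<in>P. W (\<theta> x) y * (\<Sum>k\<in>UNIV. z (\<theta> x) k * z y (J k))) =
      (\<Sum>x\<in>P. \<Sum>y\<in>P. W y (\<theta> x) * (\<Sum>k\<in>UNIV. z y k * z (\<theta> x) (J k)))"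
    proof (intro sum.cong refl)
      fix x y assume "x \<in> P" "y \<in> P"
      then have "W (\<theta> x) y = W y (\<theta> x)" by (intro W_sym refl_in half_in)
      moreover have "(\<Sum>k\<in>UNIV. z (\<theta> x) k * z y (J k)) = (\<Sum>k\<in>UNIV. z y k * z (\<theta> x) (J k))"
        using J[of "\<lambda>k. z (\<theta> x) k * z y (J k)"] by (simp add: JJ mult.commute)
      ultimately show "W (\<theta> x) y * (\<Sum>k\<in>UNIV. z (\<theta> x) k * z y (J k)) =
        W y (\<theta> x) * (\<Sum>k\<in>UNIV. z y k * z (\<theta> x) (J k))" by simp
    qed
    also have "\<dots> = (\<Sum>y\<in>P. \<Sum>x\<in>P. W y (\<theta> x) * (\<Sum>k\<in>UNIV. z y k * z (\<theta> x) (J k)))"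
      by (rule sum.swap)
    finally show ?thesis .
  qed
  show ?thesis
    unfolding spin_energy_def sum_split sum.distrib 1 2 by (simp add: field_simps)
qed

lemma spin_sum_eq_half_form:
  "spin_sum V W J c p = half_form c p (\<lambda>x i. c (\<theta> x) (j i)) (\<lambda>x i k. p (\<theta> x) (j i) (J k))"
proof -
  \<comment> \<open>A configuration of \<open>V\<close> is a pair of configurations of
    \<open>P\<close>; the second is moved by \<theta> and relabelled by \<open>j\<close>, to match
    the reflected data.\<close>
  define glue where "glue = (\<lambda>(u :: 'v \<Rightarrow> 'i, v). \<lambda>x\<in>V. if x \<in> P then u x else j (v (\<theta> x)))"
  define cut where "cut = (\<lambda>\<omega> :: 'v \<Rightarrow> 'i. (\<lambda>x\<in>P. \<omega> x, \<lambda>x\<in>P. j (\<omega> (\<theta> x))))"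
  have nin: "\<theta> x \<notin> P" if "x \<in> P" for x using that refl_half half_in by blast
  have "half_form c p (\<lambda>x i. c (\<theta> x) (j i)) (\<lambda>x i k. p (\<theta> x) (j i) (J k)) =
    (\<Sum>(u, v)\<in>(P \<rightarrow>\<^sub>E UNIV) \<times> (P \<rightarrow>\<^sub>E UNIV). half_weight c p u *
      half_weight (\<lambda>x i. c (\<theta> x) (j i)) (\<lambda>x i k. p (\<theta> x) (j i) (J k)) v *
      exp (\<Sum>x\<in>P. \<Sum>y\<in>P. W x (\<theta> y) * (\<Sum>k\<in>UNIV. p x (u x) k * p (\<theta> y) (j (v y)) (J k))))"
    unfolding half_form_def sum.cartesian_product ..
  also have "\<dots> = spin_sum V W J c p"
    unfolding spin_sum_def
  proof (rule sum.reindex_bij_witness[of _ cut glue])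
    fix q :: "('v \<Rightarrow> 'i) \<times> ('v \<Rightarrow> 'i)" assume q: "q \<in> (P \<rightarrow>\<^sub>E UNIV) \<times> (P \<rightarrow>\<^sub>E UNIV)"
    obtain u v where uv: "q = (u, v)" by force
    with q have u: "u \<in> P \<rightarrow>\<^sub>E UNIV" and v: "v \<in> P \<rightarrow>\<^sub>E UNIV" by auto
    have g1: "glue q x = u x" if "x \<in> P" for x using that half_in by (auto simp: glue_def uv)
    have g2: "glue q (\<theta> x) = j (v x)" if "x \<in> P" for x
      using that half_in nin refl_in refl_refl by (auto simp: glue_def uv)
    have "cut (glue q) = (\<lambda>x\<in>P. u x, \<lambda>x\<in>P. v x)"
      unfolding cut_def by (auto simp: g1 g2 jj)
    then show "cut (glue q) = q" using u v uv by (auto simp: PiE_restrict)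
    show "glue q \<in> V \<rightarrow>\<^sub>E UNIV" by (auto simp: glue_def uv)
    show "(\<Prod>x\<in>V. c x (glue q x)) * exp (spin_energy V W J (\<lambda>x. p x (glue q x))) =
      (case q of (u, v) \<Rightarrow> half_weight c p u * half_weight (\<lambda>x i. c (\<theta> x) (j i)) (\<lambda>x i k. p (\<theta> x) (j i) (J k)) v *
      exp (\<Sum>x\<in>P. \<Sum>y\<in>P. W x (\<theta> y) * (\<Sum>k\<in>UNIV. p x (u x) k * p (\<theta> y) (j (v y)) (J k))))"
      unfolding uv prod.case half_weight_def spin_energy_split prod_split exp_add
      by (simp add: spin_energy_def g1[unfolded uv] g2[unfolded uv] cong: sum.cong prod.cong)
  next
    fix \<omega> :: "'v \<Rightarrow> 'i" assume \<omega>: "\<omega> \<in> V \<rightarrow>\<^sub>E UNIV"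
    show "cut \<omega> \<in> (P \<rightarrow>\<^sub>E UNIV) \<times> (P \<rightarrow>\<^sub>E UNIV)" by (auto simp: cut_def)
    show "glue (cut \<omega>) = \<omega>"
    proof
      fix x show "glue (cut \<omega>) x = \<omega> x"
        using \<omega> refl_half[of x] refl_in refl_refl half_in
        by (cases "x \<in> V") (auto simp: glue_def cut_def jj PiE_def extensional_def)
    qed
  qed
  finally show ?thesis ..
qed

text \<open>\<open>fc Q\<close> and \<open>fp Q\<close> keep the data on \<open>Q\<close> and write
  their mirror image on the other half. Both symmetrised systems are diagonal values of
  \<open>half_form\<close>, so Cauchy--Schwarz for that form applies.\<close>

theorem reflection_positivity:
  defines "fc \<equiv> \<lambda>Q (c :: 'v \<Rightarrow> 'i \<Rightarrow> real) x i. if x \<in> Q then c x i else c (\<theta> x) (j i)"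
  defines "fp \<equiv> \<lambda>Q (p :: 'v \<Rightarrow> 'i \<Rightarrow> bool \<Rightarrow> real) x i k. if x \<in> Q then p x i k else p (\<theta> x) (j i) (J k)"
  shows "(spin_sum V W J c p)\<^sup>2 \<le>
      spin_sum V W J (fc P c) (fp P p) * spin_sum V W J (fc (V - P) c) (fp (V - P) p)"
    "0 \<le> spin_sum V W J (fc P c) (fp P p)" "0 \<le> spin_sum V W J (fc (V - P) c) (fp (V - P) p)"
proof -
  define c' where "c' = (\<lambda>x i. c (\<theta> x) (j i))"
  define p' where "p' = (\<lambda>x i k. p (\<theta> x) (j i) (J k))"
  have nin: "\<theta> x \<notin> P" if "x \<in> P" for x using that refl_half half_in by blast
  have 0: "spin_sum V W J c p = half_form c p c' p'"
    unfolding spin_sum_eq_half_form c'_def p'_def ..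
  have 1: "spin_sum V W J (fc P c) (fp P p) = half_form c p c p"
    unfolding spin_sum_eq_half_form
    by (rule half_form_cong) (auto simp: fc_def fp_def nin refl_refl half_in jj JJ)
  have 2: "spin_sum V W J (fc (V - P) c) (fp (V - P) p) = half_form c' p' c' p'"
    unfolding spin_sum_eq_half_form
    by (rule half_form_cong) (auto simp: fc_def fp_def c'_def p'_def nin refl_in half_in)
  show "(spin_sum V W J c p)\<^sup>2 \<le>
      spin_sum V W J (fc P c) (fp P p) * spin_sum V W J (fc (V - P) c) (fp (V - P) p)"
    "0 \<le> spin_sum V W J (fc P c) (fp P p)" "0 \<le> spin_sum V W J (fc (V - P) c) (fp (V - P) p)"
    unfolding 0 1 2 by (rule half_form_cauchy_schwarz)+
qed

end

section \<open>Chessboard estimate\<close>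

text \<open>The bonds \<open>B\<close> are not the couplings, as \<open>W\<close> may have any
  range; they measure how far a configuration is from being constant. A bond that crosses a plane
  joins mirror images, and every bond is crossed by some plane. Connectedness is phrased through
  real functions because a locale assumption cannot quantify over types.\<close>

locale reflection_system =
  fixes V :: "'v set" and B :: "('v \<times> 'v) set" and R :: "('v set \<times> ('v \<Rightarrow> 'v)) set"
    and W :: "'v \<Rightarrow> 'v \<Rightarrow> real"
  assumes fin: "finite V" and nonempty: "V \<noteq> {}"
    and half: "(P, \<theta>) \<in> R \<Longrightarrow> P \<subseteq> V"
    and refl_in: "(P, \<theta>) \<in> R \<Longrightarrow> x \<in> V \<Longrightarrow> \<theta> x \<in> V"
    and refl_refl: "(P, \<theta>) \<in> R \<Longrightarrow> x \<in> V \<Longrightarrow> \<theta> (\<theta> x) = x"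
    and refl_half: "(P, \<theta>) \<in> R \<Longrightarrow> x \<in> V \<Longrightarrow> \<theta> x \<in> P \<longleftrightarrow> x \<notin> P"
    and bonds: "B \<subseteq> V \<times> V"
    and bond_refl: "(P, \<theta>) \<in> R \<Longrightarrow> (x, y) \<in> B \<Longrightarrow> (\<theta> x, \<theta> y) \<in> B"
    and bond_cross: "(P, \<theta>) \<in> R \<Longrightarrow> (x, y) \<in> B \<Longrightarrow> x \<in> P \<longleftrightarrow> y \<notin> P \<Longrightarrow> y = \<theta> x"
    and bond_exists: "(x, y) \<in> B \<Longrightarrow> \<exists>(P, \<theta>)\<in>R. x \<in> P \<longleftrightarrow> y \<notin> P"
    and bond_connected: "(\<And>x y. (x, y) \<in> B \<Longrightarrow> s x = s y) \<Longrightarrow> x \<in> V \<Longrightarrow> y \<in> V \<Longrightarrow> (s x :: real) = s y"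
    and W_sym: "x \<in> V \<Longrightarrow> y \<in> V \<Longrightarrow> W x y = W y x"
    and W_refl: "(P, \<theta>) \<in> R \<Longrightarrow> x \<in> V \<Longrightarrow> y \<in> V \<Longrightarrow> W (\<theta> x) (\<theta> y) = W x y"
    and W_psd: "(P, \<theta>) \<in> R \<Longrightarrow> psd_on P (\<lambda>x y. W x (\<theta> y))"
begin

definition fold_at :: "('v \<Rightarrow> 'v) \<Rightarrow> 'v set \<Rightarrow> ('v \<Rightarrow> 's) \<Rightarrow> 'v \<Rightarrow> 's" where
  "fold_at \<theta> Q s = (\<lambda>x\<in>V. if x \<in> Q then s x else s (\<theta> x))"

definition defects :: "('v \<Rightarrow> 's) \<Rightarrow> ('v \<times> 'v) set" where
  "defects s = {(x, y) \<in> B. s x \<noteq> s y}"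

lemma finite_defects: "finite (defects s)"
  by (rule finite_subset[of _ "V \<times> V"]) (use fin bonds in \<open>auto simp: defects_def\<close>)

lemma constant_of_no_defects:
  assumes "defects s = {}" "x \<in> V" "y \<in> V"
  shows "s x = s y"
proof -
  \<comment> \<open>The indicator of agreement with \<open>s x\<close> transfers connectedness from
    real functions to an arbitrary value type.\<close>
  have "(if s x = s z then 1 else 0 :: real) = (if s x = s z' then 1 else 0)" if "(z, z') \<in> B" for z z'
    using that assms(1) by (auto simp: defects_def)
  from bond_connected[of "\<lambda>z. if s x = s z then 1 else 0", OF this assms(2,3)]
  show ?thesis by (auto split: if_splits)
qed

text \<open>After folding, a crossing bond joins a site to its mirror image and carries equal
  values. The remaining defects lie inside \<open>Q\<close> or are disjoint mirror images of
  those.\<close>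

lemma card_defects_fold:
  assumes R: "(P, \<theta>) \<in> R" and Q: "Q = P \<or> Q = V - P"
  shows "card (defects (fold_at \<theta> Q s)) = 2 * card (defects s \<inter> Q \<times> Q)"
proof -
  note half = half[OF R] and refl_in = refl_in[OF R] and refl_refl = refl_refl[OF R]
    and refl_half = refl_half[OF R]
  have QV: "Q \<subseteq> V" using Q half by auto
  have rq: "\<theta> x \<in> Q \<longleftrightarrow> x \<notin> Q" if "x \<in> V" for x
    using Q refl_half[OF that] refl_in[OF that] that by auto
  have inV: "x \<in> V" "y \<in> V" if "(x, y) \<in> B" for x y using bonds that by auto
  let ?A = "defects s \<inter> Q \<times> Q"
  let ?f = "\<lambda>(x, y). (\<theta> x, \<theta> y)"
  have eq: "defects (fold_at \<theta> Q s) = ?A \<union> ?f ` ?A"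
  proof (intro equalityI subsetI)
    fix z assume z: "z \<in> defects (fold_at \<theta> Q s)"
    obtain x y where xy: "z = (x, y)" by force
    have b: "(x, y) \<in> B" and ne: "fold_at \<theta> Q s x \<noteq> fold_at \<theta> Q s y" using z xy by (auto simp: defects_def)
    note v = inV[OF b]
    have same: "x \<in> Q \<longleftrightarrow> y \<in> Q"
    proof (rule ccontr)
      assume c: "\<not> ?thesis"
      then have "x \<in> P \<longleftrightarrow> y \<notin> P" using Q v by auto
      then have "y = \<theta> x" using bond_cross[OF R b] by blast
      then show False using ne v c refl_refl[OF v(1)] by (auto simp: fold_at_def)
    qed
    show "z \<in> ?A \<union> ?f ` ?A"
    proof (cases "x \<in> Q")
      case True
      then show ?thesis using b ne v same xy by (auto simp: defects_def fold_at_def)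
    next
      case False
      then have "(\<theta> x, \<theta> y) \<in> ?A" using b ne v same rq bond_refl[OF R b]
        by (auto simp: defects_def fold_at_def)
      then show ?thesis using xy refl_refl v by (auto simp: image_iff intro!: bexI[of _ "(\<theta> x, \<theta> y)"])
    qed
  next
    fix z assume "z \<in> ?A \<union> ?f ` ?A"
    then show "z \<in> defects (fold_at \<theta> Q s)"
    proof
      assume "z \<in> ?A"
      then show ?thesis using QV by (auto simp: defects_def fold_at_def)
    next
      assume "z \<in> ?f ` ?A"
      then obtain x y where xy: "(x, y) \<in> B" "s x \<noteq> s y" "x \<in> Q" "y \<in> Q" "z = (\<theta> x, \<theta> y)"
        by (auto simp: defects_def)
      then show ?thesis using bond_refl[OF R xy(1)] rq[OF inV(1)[OF xy(1)]] rq[OF inV(2)[OF xy(1)]] 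
          refl_refl inV[OF xy(1)] refl_in
        by (auto simp: defects_def fold_at_def)
    qed
  qed
  have "inj_on ?f ?A"
    by (rule inj_on_inverseI[of _ ?f]) (use QV refl_refl in auto)
  then have "card (?f ` ?A) = card ?A" by (rule card_image)
  moreover have "?A \<inter> ?f ` ?A = {}" using QV rq by auto
  ultimately show ?thesis
    unfolding eq by (subst card_Un_disjoint) (auto simp: finite_defects)
qed

text \<open>A maximiser with the fewest defects has none: folding along a plane through a defect gives two
  maximisers, one of which has fewer defects.\<close>

lemma chessboard_normalised:
  fixes \<psi> :: "('v \<Rightarrow> 's) \<Rightarrow> real"
  assumes S: "finite S"
    and rp: "\<And>s P \<theta>. s \<in> V \<rightarrow>\<^sub>E S \<Longrightarrow> (P, \<theta>) \<in> R \<Longrightarrow>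
      (\<psi> s)\<^sup>2 \<le> \<psi> (fold_at \<theta> P s) * \<psi> (fold_at \<theta> (V - P) s) \<and> 0 \<le> \<psi> (fold_at \<theta> P s) \<and> 0 \<le> \<psi> (fold_at \<theta> (V - P) s)"
    and const: "\<And>v. v \<in> S \<Longrightarrow> \<psi> (\<lambda>x\<in>V. v) \<le> 1"
    and s: "s \<in> V \<rightarrow>\<^sub>E S"
  shows "\<psi> s \<le> 1"
proof -
  let ?F = "V \<rightarrow>\<^sub>E S"
  have finF: "finite ?F" using fin S by (intro finite_PiE) auto
  define m where "m = Max (\<psi> ` ?F)"
  have le: "\<psi> t \<le> m" if "t \<in> ?F" for t
    unfolding m_def using that finF by (intro Max_ge) auto
  have "m \<in> \<psi> ` ?F" unfolding m_def using finF s by (intro Max_in) auto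
  then obtain t0 where t0: "t0 \<in> ?F" "\<psi> t0 = m" by auto
  define t where "t = arg_min (\<lambda>t. card (defects t)) (\<lambda>t. t \<in> ?F \<and> \<psi> t = m)"
  have t: "t \<in> ?F" "\<psi> t = m" and min: "\<And>u. u \<in> ?F \<Longrightarrow> \<psi> u = m \<Longrightarrow> card (defects t) \<le> card (defects u)"
    using arg_min_nat_lemma[of "\<lambda>t. t \<in> ?F \<and> \<psi> t = m" t0 "\<lambda>t. card (defects t)"] t0
    by (auto simp: t_def)
  show ?thesis
  proof (rule ccontr)
    assume "\<not> ?thesis"
    then have m1: "m > 1" using le[OF s] by simp
    have "defects t = {}"
    proof (rule ccontr)
      assume "defects t \<noteq> {}"
      then obtain x y where xy: "(x, y) \<in> defects t" by auto
      then have b: "(x, y) \<in> B" by (auto simp: defects_def)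
      then obtain P \<theta> where R: "(P, \<theta>) \<in> R" and cross: "x \<in> P \<longleftrightarrow> y \<notin> P" using bond_exists by blast
      let ?Q = "V - P"
      have in1: "fold_at \<theta> P t \<in> ?F" "fold_at \<theta> ?Q t \<in> ?F"
        using PiE_mem[OF t(1)] refl_in[OF R] by (auto simp: fold_at_def)
      have sq: "m * m \<le> \<psi> (fold_at \<theta> P t) * \<psi> (fold_at \<theta> ?Q t)" and nn: "0 \<le> \<psi> (fold_at \<theta> P t)" "0 \<le> \<psi> (fold_at \<theta> ?Q t)"
        using rp[OF t(1) R] t(2) by (auto simp: power2_eq_square)
      \<comment> \<open>Both factors lie between 0 and \<open>m\<close>, and their product is at
        least \<open>m * m\<close> with m > 1, so both folds are maximisers.\<close>
      have "\<psi> (fold_at \<theta> P t) * \<psi> (fold_at \<theta> ?Q t) \<le> \<psi> (fold_at \<theta> P t) * m"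
        using nn le in1 by (intro mult_left_mono) auto
      then have "m * m \<le> \<psi> (fold_at \<theta> P t) * m" using sq by linarith
      then have a: "\<psi> (fold_at \<theta> P t) = m" using m1 le[OF in1(1)] by simp
      have "m * m \<le> m * \<psi> (fold_at \<theta> ?Q t)" using sq a by simp
      then have a': "\<psi> (fold_at \<theta> ?Q t) = m" using m1 le[OF in1(2)] by simp
      have "card (defects t) \<le> 2 * card (defects t \<inter> P \<times> P)" "card (defects t) \<le> 2 * card (defects t \<inter> ?Q \<times> ?Q)"
        using min[OF in1(1) a] min[OF in1(2) a']
        unfolding card_defects_fold[OF R disjI1[OF refl]] card_defects_fold[OF R disjI2[OF refl]] .
      \<comment> \<open>The chosen defect crosses the plane and lies in neither half, so the
        inequality is strict, whereas the two bounds above add up to the opposite one.\<close>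
      moreover have "card (defects t \<inter> P \<times> P) + card (defects t \<inter> ?Q \<times> ?Q) < card (defects t)"
      proof -
        have "card (defects t \<inter> P \<times> P) + card (defects t \<inter> ?Q \<times> ?Q) = card ((defects t \<inter> P \<times> P) \<union> (defects t \<inter> ?Q \<times> ?Q))"
          by (rule card_Un_disjoint[symmetric]) (auto simp: finite_defects)
        also have "\<dots> < card (defects t)"
          by (rule psubset_card_mono) (use xy cross finite_defects in auto)
        finally show ?thesis .
      qed
      ultimately show False by linarith
    qed
    note const_t = constant_of_no_defects[OF this]
    obtain x0 where x0: "x0 \<in> V" using nonempty by auto
    have "t = (\<lambda>x\<in>V. t x0)"
    proof
      fix x show "t x = (\<lambda>x\<in>V. t x0) x"
        using const_t[of x x0] PiE_arb[OF t(1), of x] x0 by (cases "x \<in> V") auto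
    qed
    moreover have "t x0 \<in> S" using t(1) x0 by auto
    ultimately have "\<psi> t \<le> 1" using const by metis
    then show False using t m1 by simp
  qed
qed

lemma reflection:
  assumes "(P, \<theta>) \<in> R" "\<And>k. J (J k) = k" "\<And>i. j (j i) = (i :: 'i :: finite)"
  shows "reflection V W P \<theta> J j"
  by unfold_locales (use assms fin half refl_in refl_refl refl_half W_sym W_refl W_psd in auto)

text \<open>Dividing by the N-th roots of the constant partition functions normalises the value on
  constants to 1. These normalisers multiply correctly under folding, so the reflection inequality
  survives. As site weights may be signed, positivity of the constant partition functions is a
  hypothesis.\<close>

theorem chessboard_estimate:
  fixes c :: "'s \<Rightarrow> 'i :: finite \<Rightarrow> real" and p :: "'s \<Rightarrow> 'i \<Rightarrow> bool \<Rightarrow> real" and s :: "'v \<Rightarrow> 's"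
  assumes JJ: "\<And>k. J (J k) = k" and jj: "\<And>i. j (j i) = i"
    and c: "\<And>v i. v \<in> s ` V \<Longrightarrow> c v (j i) = c v i"
    and p: "\<And>v i k. v \<in> s ` V \<Longrightarrow> p v (j i) (J k) = p v i k"
    and pos: "\<And>v. v \<in> s ` V \<Longrightarrow> 0 < spin_sum V W J (\<lambda>_. c v) (\<lambda>_. p v)"
  shows "spin_sum V W J (\<lambda>x. c (s x)) (\<lambda>x. p (s x)) \<le>
    (\<Prod>x\<in>V. root (card V) (spin_sum V W J (\<lambda>_. c (s x)) (\<lambda>_. p (s x))))"
proof -
  define Z where "Z = (\<lambda>t. spin_sum V W J (\<lambda>x. c (t x)) (\<lambda>x. p (t x)))"
  define r where "r = (\<lambda>v. root (card V) (spin_sum V W J (\<lambda>_. c v) (\<lambda>_. p v)))"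
  define S where "S = s ` V"
  have card: "card V > 0" using fin nonempty by (simp add: card_gt_0_iff)
  have r: "r v > 0" if "v \<in> S" for v
    using that card pos by (auto simp: r_def S_def)
  define \<psi> where "\<psi> = (\<lambda>t. Z t / (\<Prod>x\<in>V. r (t x)))"
  have prpos: "(\<Prod>x\<in>V. r (t x)) > 0" if "t \<in> V \<rightarrow>\<^sub>E S" for t
    using that r by (intro prod_pos) auto
  have rp: "(\<psi> t)\<^sup>2 \<le> \<psi> (fold_at \<theta> P t) * \<psi> (fold_at \<theta> (V - P) t) \<and> 0 \<le> \<psi> (fold_at \<theta> P t) \<and> 0 \<le> \<psi> (fold_at \<theta> (V - P) t)"
    if t: "t \<in> V \<rightarrow>\<^sub>E S" and R: "(P, \<theta>) \<in> R" for t P \<theta>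
  proof -
    interpret rf: reflection V W P \<theta> J j by (rule reflection[OF R]) (auto simp: JJ jj)
    have inS: "t x \<in> s ` V" if "x \<in> V" for x using t that by (auto simp: S_def)
    \<comment> \<open>Local data invariant under \<open>j\<close> and \<open>J\<close> look the same
      after reflection, so symmetrising the data is the same as folding \<open>t\<close>.\<close>
    have fold: "spin_sum V W J (\<lambda>x i. if x \<in> Q then c (t x) i else c (t (\<theta> x)) (j i))
        (\<lambda>x i k. if x \<in> Q then p (t x) i k else p (t (\<theta> x)) (j i) (J k)) = Z (fold_at \<theta> Q t)" for Q
      unfolding Z_def by (rule spin_sum_cong) (auto simp: fold_at_def c p inS refl_in[OF R])
    have z: "(Z t)\<^sup>2 \<le> Z (fold_at \<theta> P t) * Z (fold_at \<theta> (V - P) t)"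
      "0 \<le> Z (fold_at \<theta> P t)" "0 \<le> Z (fold_at \<theta> (V - P) t)"
      using rf.reflection_positivity[of "\<lambda>x. c (t x)" "\<lambda>x. p (t x)", unfolded fold] by (auto simp: Z_def)
    have inF: "fold_at \<theta> Q t \<in> V \<rightarrow>\<^sub>E S" for Q
      using PiE_mem[OF t] refl_in[OF R] by (auto simp: fold_at_def)
    have "(\<Prod>x\<in>V. r (fold_at \<theta> P t x)) = (\<Prod>x\<in>P. r (t x)) * (\<Prod>x\<in>P. r (t x))"
      unfolding rf.prod_split using rf.half_in refl_half[OF R] refl_in[OF R] refl_refl[OF R]
      by (intro arg_cong2[where f = "(*)"] prod.cong) (auto simp: fold_at_def)
    moreover have "(\<Prod>x\<in>V. r (fold_at \<theta> (V - P) t x)) = (\<Prod>x\<in>P. r (t (\<theta> x))) * (\<Prod>x\<in>P. r (t (\<theta> x)))"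
      unfolding rf.prod_split using rf.half_in refl_half[OF R] refl_in[OF R] refl_refl[OF R]
      by (intro arg_cong2[where f = "(*)"] prod.cong) (auto simp: fold_at_def)
    ultimately have "(\<Prod>x\<in>V. r (fold_at \<theta> P t x)) * (\<Prod>x\<in>V. r (fold_at \<theta> (V - P) t x)) = (\<Prod>x\<in>V. r (t x))\<^sup>2"
      unfolding rf.prod_split by (simp add: power2_eq_square)
    then show ?thesis
      unfolding \<psi>_def using z prpos[OF t] prpos[OF inF]
      by (simp add: power_divide divide_right_mono less_imp_le)
  qed
  have const: "\<psi> (\<lambda>x\<in>V. v) \<le> 1" if v: "v \<in> S" for v
  proof -
    have "Z (\<lambda>x\<in>V. v) = spin_sum V W J (\<lambda>_. c v) (\<lambda>_. p v)"
      unfolding Z_def by (rule spin_sum_cong) auto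
    moreover have "(\<Prod>x\<in>V. r ((\<lambda>x\<in>V. v) x)) = r v ^ card V"
      by simp
    moreover have "r v ^ card V = spin_sum V W J (\<lambda>_. c v) (\<lambda>_. p v)"
      unfolding r_def using card pos v by (simp add: S_def less_imp_le)
    moreover have "spin_sum V W J (\<lambda>_. c v) (\<lambda>_. p v) > 0" using pos v by (simp add: S_def)
    ultimately show ?thesis by (simp add: \<psi>_def)
  qed
  have s': "restrict s V \<in> V \<rightarrow>\<^sub>E S" by (auto simp: S_def)
  have "\<psi> (restrict s V) \<le> 1"
    by (rule chessboard_normalised[OF _ rp const s']) (simp add: S_def fin)
  moreover have "Z (restrict s V) = Z s" unfolding Z_def by (rule spin_sum_cong) auto
  ultimately have "Z s \<le> (\<Prod>x\<in>V. r (s x))" using prpos[OF s'] by (simp add: \<psi>_def)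
  then show ?thesis by (simp add: Z_def r_def)
qed

end

section \<open>Infrared bound\<close>

definition spin :: "bool \<times> bool \<Rightarrow> bool \<Rightarrow> real" where
  "spin i k = (if (if k then fst i else snd i) then 1 else - 1)"

definition spin_avg :: "'v set \<Rightarrow> ('v \<Rightarrow> 'v \<Rightarrow> real) \<Rightarrow> (bool \<Rightarrow> bool) \<Rightarrow> real \<Rightarrow> (bool \<times> bool \<Rightarrow> real) \<Rightarrow>
    (('v \<Rightarrow> bool \<times> bool) \<Rightarrow> real) \<Rightarrow> real" where
  "spin_avg V W J \<epsilon> f F = (\<Sum>\<omega>\<in>V \<rightarrow>\<^sub>E UNIV. (\<Prod>x\<in>V. f (\<omega> x)) *
     exp (spin_energy V W J (\<lambda>x k. \<epsilon> * spin (\<omega> x) k)) * F \<omega>)"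

lemma spin_avg_sum: "spin_avg V W J \<epsilon> f (\<lambda>\<omega>. \<Sum>a\<in>A. F a \<omega>) = (\<Sum>a\<in>A. spin_avg V W J \<epsilon> f (F a))"
  unfolding spin_avg_def by (simp add: sum_distrib_left) (rule sum.swap)

lemma spin_avg_scale: "spin_avg V W J \<epsilon> f (\<lambda>\<omega>. a * F \<omega>) = a * spin_avg V W J \<epsilon> f F"
  unfolding spin_avg_def by (simp add: sum_distrib_left mult_ac)

text \<open>An observable at one or two sites is a change of their single-site weights. Correlations
  are thus spin sums themselves, so reflection positivity and the limit theorem for spin sums apply
  to them.\<close>

lemma spin_sum_insert_eq_spin_avg:
  assumes "finite V" "x \<in> V" "y \<in> V"
  shows "spin_sum V W J (\<lambda>z i. f i * ((if z = x then a i else 1) * (if z = y then b i else 1))) (\<lambda>_ i k. \<epsilon> * spin i k) =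
    spin_avg V W J \<epsilon> f (\<lambda>\<omega>. a (\<omega> x) * b (\<omega> y))"
proof -
  have "(\<Prod>z\<in>V. (if z = x then a (\<omega> z) else 1) * (if z = y then b (\<omega> z) else 1)) = a (\<omega> x) * b (\<omega> y)" for \<omega>
  proof -
    have "(\<Prod>z\<in>V. if z = x then a (\<omega> z) else 1) = a (\<omega> x)" "(\<Prod>z\<in>V. if z = y then b (\<omega> z) else 1) = b (\<omega> y)"
      using assms by (simp_all add: prod.delta)
    then show ?thesis by (simp add: prod.distrib)
  qed
  then show ?thesis
    unfolding spin_sum_def spin_avg_def by (simp add: prod.distrib[of f "\<lambda>z. _ z * _ z"] prod.distrib mult_ac)
qed

lemma spin_avg_one:
  "spin_avg V W J \<epsilon> f (\<lambda>_. 1) = spin_sum V W J (\<lambda>_. f) (\<lambda>_ i k. \<epsilon> * spin i k)"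
  by (simp add: spin_avg_def spin_sum_def)

lemma spin_avg_flip:
  assumes JJ: "\<And>k. J (J k) = k" and jj: "\<And>i. j (j i) = i" and spin_j: "\<And>i k. spin (j i) (J k) = spin i k"
    and f: "\<And>i. f (j i) = f i"
  shows "spin_avg V W J \<epsilon> f F = spin_avg V W J \<epsilon> f (\<lambda>\<omega>. F (\<lambda>z\<in>V. j (\<omega> z)))"
proof -
  define flip where "flip = (\<lambda>\<omega>. \<lambda>z\<in>V. j (\<omega> z))"
  have spin_j': "spin (j i) k = spin i (J k)" for i k using spin_j[of i "J k"] by (simp add: JJ)
  have J: "(\<Sum>k\<in>UNIV. q (J k)) = (\<Sum>k\<in>UNIV. q k)" for q :: "bool \<Rightarrow> real"
    by (rule sum_involution) (rule JJ)
  have en: "spin_energy V W J (\<lambda>x k. \<epsilon> * spin (flip \<omega> x) k) = spin_energy V W J (\<lambda>x k. \<epsilon> * spin (\<omega> x) k)" for \<omega>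
  proof -
    have "(\<Sum>k\<in>UNIV. \<epsilon> * spin (flip \<omega> x) k * (\<epsilon> * spin (flip \<omega> y) (J k))) =
      (\<Sum>k\<in>UNIV. \<epsilon> * spin (\<omega> x) k * (\<epsilon> * spin (\<omega> y) (J k)))" if "x \<in> V" "y \<in> V" for x y
      using J[of "\<lambda>k. \<epsilon> * spin (\<omega> x) k * (\<epsilon> * spin (\<omega> y) (J k))"] that by (simp add: flip_def spin_j')
    then show ?thesis unfolding spin_energy_def by simp
  qed
  have pr: "(\<Prod>x\<in>V. f (flip \<omega> x)) = (\<Prod>x\<in>V. f (\<omega> x))" for \<omega> by (simp add: flip_def f)
  have inv: "flip (flip \<omega>) = \<omega>" if "\<omega> \<in> V \<rightarrow>\<^sub>E UNIV" for \<omega>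
    using that by (auto simp: flip_def jj PiE_def extensional_def)
  have flip: "(\<lambda>z\<in>V. j (\<omega> z)) = flip \<omega>" for \<omega> by (simp add: flip_def)
  show ?thesis
    unfolding spin_avg_def flip
  proof (rule sum.reindex_bij_witness[of _ flip flip])
    fix \<omega> :: "'a \<Rightarrow> bool \<times> bool" assume \<omega>: "\<omega> \<in> V \<rightarrow>\<^sub>E UNIV"
    show "flip (flip \<omega>) = \<omega>" by (rule inv[OF \<omega>])
    show "flip (flip \<omega>) = \<omega>" by (rule inv[OF \<omega>])
    show "flip \<omega> \<in> V \<rightarrow>\<^sub>E UNIV" by (simp add: flip_def)
    show "flip \<omega> \<in> V \<rightarrow>\<^sub>E UNIV" by (simp add: flip_def)
    show "(\<Prod>x\<in>V. f (flip \<omega> x)) * exp (spin_energy V W J (\<lambda>x k. \<epsilon> * spin (flip \<omega> x) k)) * F (flip (flip \<omega>)) =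
      (\<Prod>x\<in>V. f (\<omega> x)) * exp (spin_energy V W J (\<lambda>x k. \<epsilon> * spin (\<omega> x) k)) * F \<omega>"
      unfolding en pr inv[OF \<omega>] ..
  qed
qed

lemma tendsto_diff_quotient_0:
  assumes "(f has_field_derivative D) (at 0)"
  shows "((\<lambda>t. (f t - f 0) / t) \<longlongrightarrow> (D :: real)) (at_right 0)"
proof -
  have "((\<lambda>t. (f t - f 0) / (t - 0)) \<longlongrightarrow> D) (at 0)"
    using assms unfolding has_field_derivative_iff .
  then have "((\<lambda>t. (f t - f 0) / (t - 0)) \<longlongrightarrow> D) (at_right 0)"
    by (rule filterlim_mono) (simp_all add: at_le)
  then show ?thesis by simp
qed

lemma filterlim_sq_at_right: "filterlim (\<lambda>t :: real. t\<^sup>2) (at_right 0) (at_right 0)"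
proof -
  have "((\<lambda>t :: real. t\<^sup>2) \<longlongrightarrow> 0\<^sup>2) (at_right 0)" by (intro tendsto_intros)
  then show ?thesis
    unfolding filterlim_at by (auto simp: eventually_at_right_less intro: eventually_mono[OF eventually_at_right_less])
qed

lemma second_difference_limit:
  "((\<lambda>t :: real. (exp (- (t * x)) + exp (t * x) - 2) / t\<^sup>2) \<longlongrightarrow> x\<^sup>2) (at_right 0)"
proof -
  \<comment> \<open>The second difference is the square of this odd difference.\<close>
  have "((\<lambda>t :: real. (exp (t * x / 2) - exp (- (t * x / 2)))) has_field_derivative x) (at 0)"
    by (auto intro!: derivative_eq_intros)
  from tendsto_power[OF tendsto_diff_quotient_0[OF this], of 2]
  show ?thesis
    by (simp add: power_divide power2_diff exp_double[symmetric] power2_eq_square exp_add[symmetric]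
        add.commute algebra_simps flip: exp_minus)
qed

context reflection_system
begin

text \<open>Shift the spin at \<open>x\<close> by \<open>h x\<close> in the direction
  \<open>d\<close>. The chessboard estimate bounds the shifted partition function by those with
  constant shift, which do not depend on the shift; to second order in its size this bounds a second
  moment.\<close>

lemma gaussian_domination:
  fixes f :: "bool \<times> bool \<Rightarrow> real" and d :: "bool \<Rightarrow> real" and h :: "'v \<Rightarrow> real" and \<epsilon> :: real
  assumes JJ: "\<And>k. J (J k) = k" and jj: "\<And>i. j (j i) = i" and spin_j: "\<And>i k. spin (j i) (J k) = spin i k"
    and f: "\<And>i. f (j i) = f i" and d: "\<And>k. d (J k) = d k"
    and rows: "\<And>x. x \<in> V \<Longrightarrow> (\<Sum>y\<in>V. W x y) = 1"
    and pos: "0 < spin_avg V W J \<epsilon> f (\<lambda>_. 1)"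
  defines "g \<equiv> \<lambda>x. h x - (\<Sum>y\<in>V. W x y * h y)"
  defines "X \<equiv> \<lambda>\<omega>. \<Sum>x\<in>V. g x * (\<Sum>k\<in>UNIV. d k * (\<epsilon> * spin (\<omega> x) k))"
  shows "spin_avg V W J \<epsilon> f (\<lambda>\<omega>. (X \<omega>)\<^sup>2) \<le>
    (\<Sum>k\<in>UNIV. (d k)\<^sup>2) * (\<Sum>x\<in>V. h x * g x) * spin_avg V W J \<epsilon> f (\<lambda>_. 1)"
proof -
  define D where "D = (\<Sum>k\<in>UNIV. (d k)\<^sup>2)"
  define self where "self = (\<lambda>q :: bool \<Rightarrow> real. \<Sum>k\<in>UNIV. q k * q (J k))"
  define p where "p = (\<lambda>v i k. v * d k + \<epsilon> * spin i k)"
  \<comment> \<open>Trading the self-energy of the shifted spin for that of the unshifted one makes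
    the shift enter only through differences between sites, because rows of \<open>W\<close> sum to
    1; a constant shift then has no effect.\<close>
  define c where "c = (\<lambda>v i. f i * exp ((self (\<lambda>k. \<epsilon> * spin i k) - self (p v i)) / 2))"
  have J: "(\<Sum>k\<in>UNIV. q (J k)) = (\<Sum>k\<in>UNIV. q k)" for q :: "bool \<Rightarrow> real"
    by (rule sum_involution) (rule JJ)
  \<comment> \<open>Expanding the shifted energy leaves a Gaussian prefactor and an exponential
    moment of a linear functional of the spins.\<close>
  have Z: "spin_sum V W J (\<lambda>x. c (u x)) (\<lambda>x. p (u x)) =
      exp (- (D / 2 * (\<Sum>x\<in>V. u x * (u x - (\<Sum>y\<in>V. W x y * u y))))) *
      spin_avg V W J \<epsilon> f (\<lambda>\<omega>. exp (- (\<Sum>x\<in>V. (u x - (\<Sum>y\<in>V. W x y * u y)) * (\<Sum>k\<in>UNIV. d k * (\<epsilon> * spin (\<omega> x) k)))))"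
    for u :: "'v \<Rightarrow> real"
  proof -
    have expo: "(\<Sum>x\<in>V. (self (\<lambda>k. \<epsilon> * spin (\<omega> x) k) - self (p (u x) (\<omega> x))) / 2) + spin_energy V W J (\<lambda>x. p (u x) (\<omega> x)) =
      spin_energy V W J (\<lambda>x k. \<epsilon> * spin (\<omega> x) k) - D / 2 * (\<Sum>x\<in>V. u x * (u x - (\<Sum>y\<in>V. W x y * u y))) -
      (\<Sum>x\<in>V. (u x - (\<Sum>y\<in>V. W x y * u y)) * (\<Sum>k\<in>UNIV. d k * (\<epsilon> * spin (\<omega> x) k)))" for \<omega>
    proof -
      define s where "s = (\<lambda>x k. \<epsilon> * spin (\<omega> x) k)"
      define m where "m = (\<lambda>x. \<Sum>k\<in>UNIV. d k * s x k)"
      have prod: "(\<Sum>k\<in>UNIV. p (u x) (\<omega> x) k * p (u y) (\<omega> y) (J k)) =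
        u x * u y * D + u x * m y + u y * m x + (\<Sum>k\<in>UNIV. s x k * s y (J k))" for x y
      proof -
        have "m y = (\<Sum>k\<in>UNIV. d k * s y (J k))" using J[of "\<lambda>k. d k * s y k"] by (simp add: m_def d)
        moreover have "(\<Sum>k\<in>UNIV. p (u x) (\<omega> x) k * p (u y) (\<omega> y) (J k)) =
          u x * u y * D + u x * (\<Sum>k\<in>UNIV. d k * s y (J k)) + u y * m x + (\<Sum>k\<in>UNIV. s x k * s y (J k))"
        proof -
          have "p (u z) (\<omega> z) k = u z * d k + s z k" for z k by (simp add: p_def s_def)
          then show ?thesis
            by (simp add: m_def D_def d sum_distrib_left sum.distrib[symmetric] algebra_simps power2_eq_square)
        qed
        ultimately show ?thesis by simp
      qed
      have swap: "(\<Sum>x\<in>V. \<Sum>y\<in>V. W x y * (u y * m x)) = (\<Sum>x\<in>V. (\<Sum>y\<in>V. W x y * u y) * m x)"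
        by (simp add: sum_distrib_left sum_distrib_right mult_ac)
      have swap2: "(\<Sum>x\<in>V. \<Sum>y\<in>V. W x y * (u x * m y)) = (\<Sum>x\<in>V. (\<Sum>y\<in>V. W x y * u y) * m x)"
        unfolding swap[symmetric] by (subst sum.swap) (intro sum.cong refl, simp add: W_sym)
      have e1: "2 * spin_energy V W J (\<lambda>x. p (u x) (\<omega> x)) = D * (\<Sum>x\<in>V. u x * (\<Sum>y\<in>V. W x y * u y)) +
        2 * (\<Sum>x\<in>V. (\<Sum>y\<in>V. W x y * u y) * m x) + 2 * spin_energy V W J s"
      proof -
        have "2 * spin_energy V W J (\<lambda>x. p (u x) (\<omega> x)) = (\<Sum>x\<in>V. \<Sum>y\<in>V. W x y * (u x * u y * D)) +
          (\<Sum>x\<in>V. \<Sum>y\<in>V. W x y * (u x * m y)) + (\<Sum>x\<in>V. \<Sum>y\<in>V. W x y * (u y * m x)) + 2 * spin_energy V W J s"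
          unfolding spin_energy_def prod by (simp add: distrib_left sum.distrib)
        also have "(\<Sum>x\<in>V. \<Sum>y\<in>V. W x y * (u x * u y * D)) = D * (\<Sum>x\<in>V. u x * (\<Sum>y\<in>V. W x y * u y))"
          by (simp add: sum_distrib_left mult_ac)
        finally show ?thesis unfolding swap swap2 by simp
      qed
      have e2: "self (p (u x) (\<omega> x)) = D * (u x * u x) + 2 * (u x * m x) + self (s x)" for x
        unfolding self_def prod by simp
      have arith: "S + E = E0 - XH - gm" if "S = - X - m1" "XH = X - Y" "gm = m1 - m2" "DB = 2 * Y" "2 * E = DB + 2 * m2 + 2 * E0"
        for S E E0 XH gm X Y m1 m2 DB :: real using that by linarith
      have f1: "(\<Sum>x\<in>V. (self (s x) - self (p (u x) (\<omega> x))) / 2) = - (D / 2 * (\<Sum>x\<in>V. u x * u x)) - (\<Sum>x\<in>V. u x * m x)"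
        unfolding e2 sum_distrib_left by (simp add: sum_negf[symmetric] sum_subtractf[symmetric] field_simps)
      have f2: "D / 2 * (\<Sum>x\<in>V. u x * (u x - (\<Sum>y\<in>V. W x y * u y))) = D / 2 * (\<Sum>x\<in>V. u x * u x) - D / 2 * (\<Sum>x\<in>V. u x * (\<Sum>y\<in>V. W x y * u y))"
        by (simp add: right_diff_distrib sum_subtractf)
      have f3: "(\<Sum>x\<in>V. (u x - (\<Sum>y\<in>V. W x y * u y)) * m x) = (\<Sum>x\<in>V. u x * m x) - (\<Sum>x\<in>V. (\<Sum>y\<in>V. W x y * u y) * m x)"
        by (simp add: left_diff_distrib sum_subtractf)
      have f4: "D * (\<Sum>x\<in>V. u x * (\<Sum>y\<in>V. W x y * u y)) = 2 * (D / 2 * (\<Sum>x\<in>V. u x * (\<Sum>y\<in>V. W x y * u y)))"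
        by simp
      have "(\<Sum>x\<in>V. (self (s x) - self (p (u x) (\<omega> x))) / 2) + spin_energy V W J (\<lambda>x. p (u x) (\<omega> x)) =
        spin_energy V W J s - D / 2 * (\<Sum>x\<in>V. u x * (u x - (\<Sum>y\<in>V. W x y * u y))) -
        (\<Sum>x\<in>V. (u x - (\<Sum>y\<in>V. W x y * u y)) * m x)"
        by (rule arith[OF f1 f2 f3 f4 e1])
      then show ?thesis unfolding s_def m_def .
    qed
    have pt: "(\<Prod>x\<in>V. c (u x) (\<omega> x)) * exp (spin_energy V W J (\<lambda>x. p (u x) (\<omega> x))) =
      exp (- (D / 2 * (\<Sum>x\<in>V. u x * (u x - (\<Sum>y\<in>V. W x y * u y))))) *
      ((\<Prod>x\<in>V. f (\<omega> x)) * exp (spin_energy V W J (\<lambda>x k. \<epsilon> * spin (\<omega> x) k)) *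
       exp (- (\<Sum>x\<in>V. (u x - (\<Sum>y\<in>V. W x y * u y)) * (\<Sum>k\<in>UNIV. d k * (\<epsilon> * spin (\<omega> x) k)))))" for \<omega>
    proof -
      have "(\<Prod>x\<in>V. c (u x) (\<omega> x)) = (\<Prod>x\<in>V. f (\<omega> x)) *
          exp (\<Sum>x\<in>V. (self (\<lambda>k. \<epsilon> * spin (\<omega> x) k) - self (p (u x) (\<omega> x))) / 2)"
        unfolding c_def using fin by (simp add: prod.distrib exp_sum)
      then have "(\<Prod>x\<in>V. c (u x) (\<omega> x)) * exp (spin_energy V W J (\<lambda>x. p (u x) (\<omega> x))) =
        (\<Prod>x\<in>V. f (\<omega> x)) * exp ((\<Sum>x\<in>V. (self (\<lambda>k. \<epsilon> * spin (\<omega> x) k) - self (p (u x) (\<omega> x))) / 2) +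
          spin_energy V W J (\<lambda>x. p (u x) (\<omega> x)))"
        by (simp only: mult.assoc exp_add)
      then show ?thesis unfolding expo by (simp only: diff_conv_add_uminus exp_add mult_ac)
    qed
    show ?thesis
      unfolding spin_sum_def spin_avg_def sum_distrib_left pt ..
  qed
  have const: "spin_sum V W J (\<lambda>_. c v) (\<lambda>_. p v) = spin_avg V W J \<epsilon> f (\<lambda>_. 1)" for v
  proof -
    have "v - (\<Sum>y\<in>V. W x y * v) = 0" if "x \<in> V" for x
      using rows[OF that] by (simp flip: sum_distrib_right)
    then show ?thesis using Z[of "\<lambda>_. v"] by simp
  qed
  have le: "spin_sum V W J (\<lambda>x. c (u x)) (\<lambda>x. p (u x)) \<le> spin_avg V W J \<epsilon> f (\<lambda>_. 1)" for u :: "'v \<Rightarrow> real"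
  proof -
    have pj: "p v (j i) (J k) = p v i k" for v i k by (simp add: p_def d spin_j)
    have selfj: "self (q \<circ> J) = self q" for q using J[of "\<lambda>k. q k * q (J k)"] by (simp add: self_def)
    have "p v (j i) \<circ> J = p v i" "(\<lambda>k. \<epsilon> * spin (j i) k) \<circ> J = (\<lambda>k. \<epsilon> * spin i k)" for v i
      by (rule ext, simp add: pj spin_j)+
    then have cj: "c v (j i) = c v i" for v i unfolding c_def f by (metis selfj)
    have "spin_sum V W J (\<lambda>x. c (u x)) (\<lambda>x. p (u x)) \<le>
      (\<Prod>x\<in>V. root (card V) (spin_sum V W J (\<lambda>_. c (u x)) (\<lambda>_. p (u x))))"
      by (rule chessboard_estimate[OF JJ jj]) (use pj cj const pos in auto)
    also have "\<dots> = spin_avg V W J \<epsilon> f (\<lambda>_. 1)"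
      unfolding const using pos fin nonempty by (simp add: card_gt_0_iff)
    finally show ?thesis .
  qed
  define A where "A = D * (\<Sum>x\<in>V. h x * g x)"
  define S where "S = spin_avg V W J \<epsilon> f"
  have bound: "S (\<lambda>\<omega>. exp (- (t * X \<omega>))) \<le> S (\<lambda>_. 1) * exp (t\<^sup>2 * A / 2)" for t
  proof -
    have 1: "t * h x - (\<Sum>y\<in>V. W x y * (t * h y)) = t * g x" for x
      by (simp add: g_def right_diff_distrib sum_distrib_left mult_ac)
    have 2: "(\<Sum>x\<in>V. t * h x * (t * g x)) = t\<^sup>2 * (\<Sum>x\<in>V. h x * g x)"
      by (simp add: sum_distrib_left power2_eq_square mult_ac)
    have 3: "(\<Sum>x\<in>V. t * g x * (\<Sum>k\<in>UNIV. d k * (\<epsilon> * spin (\<omega> x) k))) = t * X \<omega>" for \<omega>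
      unfolding X_def sum_distrib_left[of t] by (simp add: mult.assoc)
    have "exp (- (t\<^sup>2 * A / 2)) * S (\<lambda>\<omega>. exp (- (t * X \<omega>))) \<le> S (\<lambda>_. 1)"
      using le[of "\<lambda>x. t * h x"] unfolding Z 1 2 3 S_def A_def by (simp add: mult_ac)
    then show ?thesis by (simp add: exp_minus field_simps)
  qed
  \<comment> \<open>The bounds for shifts t and -t are added, so the first-order terms cancel and
    the second moment remains.\<close>
  have lim1: "((\<lambda>t. S (\<lambda>\<omega>. (exp (- (t * X \<omega>)) + exp (t * X \<omega>) - 2) / t\<^sup>2)) \<longlongrightarrow> S (\<lambda>\<omega>. (X \<omega>)\<^sup>2)) (at_right 0)"
    unfolding S_def spin_avg_def by (intro tendsto_sum tendsto_mult tendsto_const second_difference_limit)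
  have lim2: "((\<lambda>t. S (\<lambda>_. 1) * (2 * (exp (t\<^sup>2 * A / 2) - 1) / t\<^sup>2)) \<longlongrightarrow> S (\<lambda>_. 1) * A) (at_right 0)"
  proof -
    have "((\<lambda>t. (2 * (exp (t\<^sup>2 * A / 2) - 1) / t\<^sup>2)) \<longlongrightarrow> A) (at_right 0)"
    proof -
      have "((\<lambda>s. 2 * exp (s * A / 2)) has_field_derivative A) (at 0)"
        by (auto intro!: derivative_eq_intros)
      from filterlim_compose[OF tendsto_diff_quotient_0[OF this] filterlim_sq_at_right]
      show ?thesis by (simp add: algebra_simps)
    qed
    then show ?thesis by (intro tendsto_intros)
  qed
  have "S (\<lambda>\<omega>. (X \<omega>)\<^sup>2) \<le> S (\<lambda>_. 1) * A"
  proof (rule tendsto_le[OF _ lim2 lim1])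
    show "\<forall>\<^sub>F t in at_right 0. S (\<lambda>\<omega>. (exp (- (t * X \<omega>)) + exp (t * X \<omega>) - 2) / t\<^sup>2) \<le> S (\<lambda>_. 1) * (2 * (exp (t\<^sup>2 * A / 2) - 1) / t\<^sup>2)"
    proof (rule eventually_mono[OF eventually_at_right_less])
      fix t :: real assume t: "0 < t"
      have "S (\<lambda>\<omega>. (exp (- (t * X \<omega>)) + exp (t * X \<omega>) - 2) / t\<^sup>2) =
        (S (\<lambda>\<omega>. exp (- (t * X \<omega>))) + S (\<lambda>\<omega>. exp (t * X \<omega>)) - 2 * S (\<lambda>_. 1)) / t\<^sup>2"
        unfolding S_def spin_avg_def
        by (simp add: sum_divide_distrib sum.distrib sum_subtractf algebra_simps diff_divide_distrib add_divide_distrib sum_distrib_left)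
      also have "\<dots> \<le> (2 * S (\<lambda>_. 1) * exp (t\<^sup>2 * A / 2) - 2 * S (\<lambda>_. 1)) / t\<^sup>2"
        using bound[of t] bound[of "- t"] by (intro divide_right_mono) auto
      finally show "S (\<lambda>\<omega>. (exp (- (t * X \<omega>)) + exp (t * X \<omega>) - 2) / t\<^sup>2) \<le> S (\<lambda>_. 1) * (2 * (exp (t\<^sup>2 * A / 2) - 1) / t\<^sup>2)"
        by (simp add: algebra_simps)
    qed
  qed simp
  then show ?thesis by (simp add: S_def A_def D_def mult_ac)
qed

text \<open>Component \<open>True\<close> is inserted at a site of \<open>P\<close> and component
  \<open>J True\<close> at a mirrored site. Reflection maps one kind of insertion to the other, so
  symmetrising yields the correlation of each site with its own mirror image.\<close>

lemma two_point_cauchy_schwarz: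
  fixes f :: "bool \<times> bool \<Rightarrow> real" and \<epsilon> :: real
  assumes JJ: "\<And>k. J (J k) = k" and jj: "\<And>i. j (j i) = i" and spin_j: "\<And>i k. spin (j i) (J k) = spin i k"
    and f: "\<And>i. f (j i) = f i" and R: "(P, \<theta>) \<in> R" and xy: "x \<in> P" "y \<in> P"
  defines "T \<equiv> \<lambda>a b. spin_avg V W J \<epsilon> f (\<lambda>\<omega>. spin (\<omega> a) True * spin (\<omega> b) (J True))"
  shows "(T x (\<theta> y))\<^sup>2 \<le> T x (\<theta> x) * T y (\<theta> y)"
proof -
  interpret rf: reflection V W P \<theta> J j by (rule reflection[OF R]) (auto simp: JJ jj)
  define c where "c = (\<lambda>(a :: 'v) b z i. f i * ((if z = a then spin i True else 1) * (if z = b then spin i (J True) else 1)))"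
  have c: "spin_sum V W J (c a b) (\<lambda>_ i k. \<epsilon> * spin i k) = T a b" if "a \<in> V" "b \<in> V" for a b
    unfolding c_def T_def by (rule spin_sum_insert_eq_spin_avg[OF fin that])
  have V: "x \<in> V" "y \<in> V" "\<theta> x \<in> V" "\<theta> y \<in> V" using xy half[OF R] refl_in[OF R] by auto
  have nin: "\<theta> x \<notin> P" "\<theta> y \<notin> P" using xy V refl_half[OF R] by auto
  have inj: "\<theta> z = x \<longleftrightarrow> z = \<theta> x" "\<theta> z = y \<longleftrightarrow> z = \<theta> y" "\<theta> z = \<theta> y \<longleftrightarrow> z = y" "\<theta> z = \<theta> x \<longleftrightarrow> z = x" if "z \<in> V" for z
    using V that refl_refl[OF R] by metis+
  have spin_j': "spin (j i) True = spin i (J True)" for i using spin_j[of i "J True"] by (simp add: JJ)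
  have 1: "spin_sum V W J (\<lambda>z i. if z \<in> P then c x (\<theta> y) z i else c x (\<theta> y) (\<theta> z) (j i))
      (\<lambda>z i k. if z \<in> P then \<epsilon> * spin i k else \<epsilon> * spin (j i) (J k)) = T x (\<theta> x)"
    unfolding c[OF V(1,3), symmetric] using nin xy
    by (intro spin_sum_cong) (auto simp: spin_j spin_j' c_def f inj)
  have 2: "spin_sum V W J (\<lambda>z i. if z \<in> V - P then c x (\<theta> y) z i else c x (\<theta> y) (\<theta> z) (j i))
      (\<lambda>z i k. if z \<in> V - P then \<epsilon> * spin i k else \<epsilon> * spin (j i) (J k)) = T y (\<theta> y)"
    unfolding c[OF V(2,4), symmetric] using nin xy
    by (intro spin_sum_cong) (auto simp: spin_j spin_j' c_def f inj)
  show ?thesis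
    using rf.reflection_positivity(1)[of "c x (\<theta> y)" "\<lambda>_ i k. \<epsilon> * spin i k"] unfolding 1 2 c[OF V(1,4)] .
qed

end

text \<open>The monomer double-dimer model and the permutation model are \<open>\<epsilon> \<rightarrow> 0\<close> limits of signed spin
  systems; \<open>Z\<close> and \<open>G\<close> are the partition and two-point functions of the limit.\<close>

locale rp_model = reflection_system V B R W
  for V :: "'v set" and B R and W :: "'v \<Rightarrow> 'v \<Rightarrow> real" +
  fixes J :: "bool \<Rightarrow> bool" and j :: "bool \<times> bool \<Rightarrow> bool \<times> bool" and f :: "real \<Rightarrow> bool \<times> bool \<Rightarrow> real"
    and d :: "bool \<Rightarrow> real" and Z :: real and G :: "'v \<Rightarrow> 'v \<Rightarrow> real"
  assumes JJ: "J (J k) = k" and jj: "j (j i) = i" and spin_j: "spin (j i) (J k) = spin i k"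
    and f_j: "f \<epsilon> (j i) = f \<epsilon> i" and d_J: "d (J k) = d k" and d_pos: "0 < (\<Sum>k\<in>UNIV. (d k)\<^sup>2)"
    and rows: "x \<in> V \<Longrightarrow> (\<Sum>y\<in>V. W x y) = 1"
    and Z_pos: "0 < Z"
    and Z_lim: "((\<lambda>\<epsilon>. spin_avg V W J \<epsilon> (f \<epsilon>) (\<lambda>_. 1)) \<longlongrightarrow> Z) (at_right 0)"
    and G_lim: "x \<in> V \<Longrightarrow> y \<in> V \<Longrightarrow>
      ((\<lambda>\<epsilon>. \<epsilon>\<^sup>2 * spin_avg V W J \<epsilon> (f \<epsilon>) (\<lambda>\<omega>. spin (\<omega> x) True * spin (\<omega> y) (J True))) \<longlongrightarrow> Z * G x y) (at_right 0)"
    and quad_lim: "x \<in> V \<Longrightarrow> y \<in> V \<Longrightarrow>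
      ((\<lambda>\<epsilon>. \<epsilon>\<^sup>2 * (\<Sum>k\<in>UNIV. \<Sum>l\<in>UNIV. d k * d l * spin_avg V W J \<epsilon> (f \<epsilon>) (\<lambda>\<omega>. spin (\<omega> x) k * spin (\<omega> y) l)))
        \<longlongrightarrow> (\<Sum>k\<in>UNIV. (d k)\<^sup>2) * (Z * G x y)) (at_right 0)"
begin

section \<open>Symmetries, reflection inequality and infrared bound for the limiting two-point
  function\<close>

lemma two_point_sym:
  assumes "x \<in> V" "y \<in> V"
  shows "G x y = G y x"
proof -
  have spin_j': "spin (j i) k = spin i (J k)" for i k using spin_j[of i "J k"] by (simp add: JJ)
  have eq: "spin_avg V W J \<epsilon> (f \<epsilon>) (\<lambda>\<omega>. spin (\<omega> x) True * spin (\<omega> y) (J True)) =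
    spin_avg V W J \<epsilon> (f \<epsilon>) (\<lambda>\<omega>. spin (\<omega> y) True * spin (\<omega> x) (J True))" for \<epsilon>
    by (subst spin_avg_flip[where J = J and j = j and f = "f \<epsilon>", OF JJ jj spin_j f_j])
      (use assms in \<open>simp add: spin_j' JJ mult.commute\<close>)
  have "Z * G x y = Z * G y x"
    using G_lim[OF assms] G_lim[OF assms(2,1)] unfolding eq by (intro tendsto_unique) auto
  then show ?thesis using Z_pos by simp
qed

lemma two_point_invariant:
  assumes t: "bij_betw t V V" and W: "\<And>x y. x \<in> V \<Longrightarrow> y \<in> V \<Longrightarrow> W (t x) (t y) = W x y" and xy: "x \<in> V" "y \<in> V"
  shows "G (t x) (t y) = G x y"
proof -
  define t' where "t' = the_inv_into V t"
  have t': "t' (t z) = z" "t (t' z) = z" "t z \<in> V" "t' z \<in> V" if "z \<in> V" for z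
    using that t bij_betw_the_inv_into[OF t] unfolding t'_def
    by (auto simp: bij_betw_def the_inv_into_f_f f_the_inv_into_f)
  have eq: "spin_avg V W J \<epsilon> (f \<epsilon>) (\<lambda>\<omega>. spin (\<omega> (t x)) True * spin (\<omega> (t y)) (J True)) =
    spin_avg V W J \<epsilon> (f \<epsilon>) (\<lambda>\<omega>. spin (\<omega> x) True * spin (\<omega> y) (J True))" for \<epsilon>
  proof -
    define m where "m = (\<lambda>\<omega> :: 'v \<Rightarrow> bool \<times> bool. \<lambda>z\<in>V. \<omega> (t z))"
    define m' where "m' = (\<lambda>\<omega> :: 'v \<Rightarrow> bool \<times> bool. \<lambda>z\<in>V. \<omega> (t' z))"
    have en: "spin_energy V W J (\<lambda>x k. \<epsilon> * spin (m \<omega> x) k) = spin_energy V W J (\<lambda>x k. \<epsilon> * spin (\<omega> x) k)" for \<omega>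
    proof -
      define e where "e = (\<lambda>x y. W x y * (\<Sum>k\<in>UNIV. \<epsilon> * spin (\<omega> x) k * (\<epsilon> * spin (\<omega> y) (J k))))"
      have "(\<Sum>x\<in>V. \<Sum>y\<in>V. e (t x) (t y)) = (\<Sum>x\<in>V. \<Sum>y\<in>V. e x y)"
        by (simp add: sum.reindex_bij_betw[OF t] sum.reindex_bij_betw[OF t, of "\<lambda>x. \<Sum>y\<in>V. e x y"])
      then show ?thesis unfolding spin_energy_def by (simp add: m_def e_def W)
    qed
    have pr: "(\<Prod>z\<in>V. f \<epsilon> (m \<omega> z)) = (\<Prod>z\<in>V. f \<epsilon> (\<omega> z))" for \<omega>
      using prod.reindex_bij_betw[OF t, of "\<lambda>z. f \<epsilon> (\<omega> z)"] by (simp add: m_def)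
    show ?thesis
      unfolding spin_avg_def
    proof (rule sum.reindex_bij_witness[of _ m' m])
      fix \<omega> :: "'v \<Rightarrow> bool \<times> bool" assume \<omega>: "\<omega> \<in> V \<rightarrow>\<^sub>E UNIV"
      show "m' (m \<omega>) = \<omega>" "m (m' \<omega>) = \<omega>"
        using \<omega> t' by (auto simp: m_def m'_def PiE_def extensional_def fun_eq_iff)
      show "m \<omega> \<in> V \<rightarrow>\<^sub>E UNIV" "m' \<omega> \<in> V \<rightarrow>\<^sub>E UNIV" by (auto simp: m_def m'_def)
      show "(\<Prod>x\<in>V. f \<epsilon> (m \<omega> x)) * exp (spin_energy V W J (\<lambda>x k. \<epsilon> * spin (m \<omega> x) k)) *
          (spin (m \<omega> x) True * spin (m \<omega> y) (J True)) =
        (\<Prod>x\<in>V. f \<epsilon> (\<omega> x)) * exp (spin_energy V W J (\<lambda>x k. \<epsilon> * spin (\<omega> x) k)) *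
          (spin (\<omega> (t x)) True * spin (\<omega> (t y)) (J True))"
        unfolding en pr using xy by (simp add: m_def)
    qed
  qed
  have "t x \<in> V" "t y \<in> V" using t' xy by auto
  then have "Z * G (t x) (t y) = Z * G x y"
    using G_lim[of "t x" "t y"] G_lim[OF xy] unfolding eq by (intro tendsto_unique) auto
  then show ?thesis using Z_pos by simp
qed

lemma two_point_reflection:
  assumes R: "(P, \<theta>) \<in> R" and xy: "x \<in> P" "y \<in> P"
  shows "(G x (\<theta> y))\<^sup>2 \<le> G x (\<theta> x) * G y (\<theta> y)"
proof -
  let ?T = "\<lambda>\<epsilon> a b. \<epsilon>\<^sup>2 * spin_avg V W J \<epsilon> (f \<epsilon>) (\<lambda>\<omega>. spin (\<omega> a) True * spin (\<omega> b) (J True))"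
  have V: "x \<in> V" "y \<in> V" "\<theta> x \<in> V" "\<theta> y \<in> V" using xy half[OF R] refl_in[OF R] by auto
  have "(?T \<epsilon> x (\<theta> y))\<^sup>2 \<le> ?T \<epsilon> x (\<theta> x) * ?T \<epsilon> y (\<theta> y)" for \<epsilon>
    using mult_left_mono[OF two_point_cauchy_schwarz[where f = "f \<epsilon>" and \<epsilon> = \<epsilon> and J = J and j = j, OF JJ jj spin_j f_j R xy] zero_le_power2, of "\<epsilon>\<^sup>2"]
    by (simp add: power_mult_distrib power2_eq_square mult_ac)
  then have "(Z * G x (\<theta> y))\<^sup>2 \<le> Z * G x (\<theta> x) * (Z * G y (\<theta> y))"
    by (intro tendsto_le[OF trivial_limit_at_right_real tendsto_mult[OF G_lim[OF V(1,3)] G_lim[OF V(2,4)]]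
      tendsto_power[OF G_lim[OF V(1,4)]]] always_eventually allI)
  then have "Z\<^sup>2 * (G x (\<theta> y))\<^sup>2 \<le> Z\<^sup>2 * (G x (\<theta> x) * G y (\<theta> y))"
    by (simp add: power_mult_distrib power2_eq_square mult_ac)
  then show ?thesis using Z_pos by simp
qed

text \<open>The square of the linear functional is expanded into two-point sums before \<epsilon>
  tends to 0. The squared norm of \<open>d\<close> and the factor \<open>Z\<close> then occur on
  both sides and cancel.\<close>

theorem infrared_bound:
  fixes h :: "'v \<Rightarrow> real"
  defines "g \<equiv> \<lambda>x. h x - (\<Sum>y\<in>V. W x y * h y)"
  shows "(\<Sum>x\<in>V. \<Sum>y\<in>V. g x * g y * G x y) \<le> (\<Sum>x\<in>V. h x * g x)"
proof -
  define D where "D = (\<Sum>k\<in>UNIV. (d k)\<^sup>2)"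
  let ?S = "\<lambda>\<epsilon>. spin_avg V W J \<epsilon> (f \<epsilon>)"
  let ?U = "\<lambda>\<epsilon> x y. \<epsilon>\<^sup>2 * (\<Sum>k\<in>UNIV. \<Sum>l\<in>UNIV. d k * d l * ?S \<epsilon> (\<lambda>\<omega>. spin (\<omega> x) k * spin (\<omega> y) l))"
  have sq: "?S \<epsilon> (\<lambda>\<omega>. (\<Sum>x\<in>V. g x * (\<Sum>k\<in>UNIV. d k * (\<epsilon> * spin (\<omega> x) k)))\<^sup>2) =
    (\<Sum>x\<in>V. \<Sum>y\<in>V. g x * g y * ?U \<epsilon> x y)" for \<epsilon>
  proof -
    have pt: "(\<Sum>x\<in>V. g x * (\<Sum>k\<in>UNIV. d k * (\<epsilon> * spin (\<omega> x) k)))\<^sup>2 =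
      (\<Sum>x\<in>V. \<Sum>y\<in>V. \<Sum>k\<in>UNIV. \<Sum>l\<in>UNIV. (g x * g y * \<epsilon>\<^sup>2 * d k * d l) * (spin (\<omega> x) k * spin (\<omega> y) l))" for \<omega> :: "'v \<Rightarrow> bool \<times> bool"
    proof -
      have "(\<Sum>x\<in>V. g x * (\<Sum>k\<in>UNIV. d k * (\<epsilon> * spin (\<omega> x) k)))\<^sup>2 =
        (\<Sum>x\<in>V. \<Sum>y\<in>V. (g x * g y) * ((\<Sum>k\<in>UNIV. d k * (\<epsilon> * spin (\<omega> x) k)) * (\<Sum>k\<in>UNIV. d k * (\<epsilon> * spin (\<omega> y) k))))"
        by (simp add: power2_eq_square sum_product mult_ac)
      also have "\<dots> = (\<Sum>x\<in>V. \<Sum>y\<in>V. \<Sum>k\<in>UNIV. \<Sum>l\<in>UNIV. (g x * g y * \<epsilon>\<^sup>2 * d k * d l) * (spin (\<omega> x) k * spin (\<omega> y) l))"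
        unfolding sum_product by (simp add: sum_distrib_left power2_eq_square mult_ac)
      finally show ?thesis .
    qed
    show ?thesis
      unfolding pt spin_avg_sum spin_avg_scale by (simp add: sum_distrib_left mult_ac)
  qed
  have lim1: "((\<lambda>\<epsilon>. \<Sum>x\<in>V. \<Sum>y\<in>V. g x * g y * ?U \<epsilon> x y) \<longlongrightarrow> (\<Sum>x\<in>V. \<Sum>y\<in>V. g x * g y * (D * (Z * G x y)))) (at_right 0)"
    unfolding D_def by (intro tendsto_sum tendsto_mult tendsto_const quad_lim)
  have lim2: "((\<lambda>\<epsilon>. D * (\<Sum>x\<in>V. h x * g x) * ?S \<epsilon> (\<lambda>_. 1)) \<longlongrightarrow> D * (\<Sum>x\<in>V. h x * g x) * Z) (at_right 0)"
    by (intro tendsto_intros Z_lim)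
  \<comment> \<open>Domination asks for a positive partition function, which the positive limit
    provides for small \<epsilon>.\<close>
  have "\<forall>\<^sub>F \<epsilon> in at_right 0. 0 < ?S \<epsilon> (\<lambda>_. 1)" using Z_lim Z_pos by (rule order_tendstoD)
  then have "\<forall>\<^sub>F \<epsilon> in at_right 0. (\<Sum>x\<in>V. \<Sum>y\<in>V. g x * g y * ?U \<epsilon> x y) \<le> D * (\<Sum>x\<in>V. h x * g x) * ?S \<epsilon> (\<lambda>_. 1)"
  proof eventually_elim
    case (elim \<epsilon>)
    have "?S \<epsilon> (\<lambda>\<omega>. (\<Sum>x\<in>V. g x * (\<Sum>k\<in>UNIV. d k * (\<epsilon> * spin (\<omega> x) k)))\<^sup>2) \<le>
        D * (\<Sum>x\<in>V. h x * g x) * ?S \<epsilon> (\<lambda>_. 1)"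
      unfolding D_def g_def
      by (rule gaussian_domination[where J = J and j = j and f = "f \<epsilon>" and d = d and h = h and \<epsilon> = \<epsilon>, OF JJ jj spin_j f_j d_J rows elim])
    then show ?case unfolding sq .
  qed
  then have "(\<Sum>x\<in>V. \<Sum>y\<in>V. g x * g y * (D * (Z * G x y))) \<le> D * (\<Sum>x\<in>V. h x * g x) * Z"
    by (rule tendsto_le[OF trivial_limit_at_right_real lim2 lim1])
  then have "(D * Z) * (\<Sum>x\<in>V. \<Sum>y\<in>V. g x * g y * G x y) \<le> (D * Z) * (\<Sum>x\<in>V. h x * g x)"
    by (simp add: sum_distrib_left mult_ac)
  then show ?thesis using d_pos Z_pos by (simp add: D_def)
qed

end

section \<open>The permutation model as a limit of spin systems\<close>

definition pm :: "bool \<Rightarrow> real" where "pm b = (if b then 1 else - 1)"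

lemma pm_sq [simp]: "pm b * pm b = 1" "pm b * (pm b * c) = c" "pm b \<noteq> 0"
  by (auto simp: pm_def)

lemma spin_pm: "spin i True = pm (fst i)" "spin i False = pm (snd i)"
  by (auto simp: spin_def pm_def)

lemma sum_PiE_pair:
  "(\<Sum>\<omega>\<in>V \<rightarrow>\<^sub>E UNIV. F \<omega>) = (\<Sum>\<sigma>\<in>V \<rightarrow>\<^sub>E UNIV. \<Sum>\<tau>\<in>V \<rightarrow>\<^sub>E UNIV. F (\<lambda>x\<in>V. (\<sigma> x, \<tau> x)))"
proof -
  have "(\<Sum>\<sigma>\<in>V \<rightarrow>\<^sub>E UNIV. \<Sum>\<tau>\<in>V \<rightarrow>\<^sub>E UNIV. F (\<lambda>x\<in>V. (\<sigma> x, \<tau> x))) =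
    (\<Sum>(\<sigma>, \<tau>)\<in>(V \<rightarrow>\<^sub>E UNIV) \<times> (V \<rightarrow>\<^sub>E UNIV). F (\<lambda>x\<in>V. (\<sigma> x, \<tau> x)))"
    by (rule sum.cartesian_product)
  also have "\<dots> = (\<Sum>\<omega>\<in>V \<rightarrow>\<^sub>E UNIV. F \<omega>)"
    by (rule sum.reindex_bij_witness[of _ "\<lambda>\<omega>. (\<lambda>x\<in>V. fst (\<omega> x), \<lambda>x\<in>V. snd (\<omega> x))" "\<lambda>(\<sigma>, \<tau>). \<lambda>x\<in>V. (\<sigma> x, \<tau> x)"])
      (auto simp: PiE_def extensional_def fun_eq_iff)
  finally show ?thesis ..
qed

lemma sum_sign_prod_power:
  assumes "finite V"
  shows "(\<Sum>\<tau>\<in>V \<rightarrow>\<^sub>E UNIV. \<Prod>y\<in>V. pm (\<tau> y) ^ n y) = (if \<forall>y\<in>V. even (n y) then 2 ^ card V else 0)"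
proof -
  have "(\<Sum>\<tau>\<in>V \<rightarrow>\<^sub>E UNIV. \<Prod>y\<in>V. pm (\<tau> y) ^ n y) = (\<Prod>y\<in>V. \<Sum>b\<in>UNIV. pm b ^ n y)"
    using assms by (subst prod_sum_PiE) auto
  also have "\<dots> = (\<Prod>y\<in>V. if even (n y) then 2 else 0)"
    by (intro prod.cong) (auto simp: UNIV_bool pm_def)
  finally show ?thesis using assms by auto
qed

lemma prod_fibres:
  assumes "finite V" "finite A" "\<And>x. x \<in> A \<Longrightarrow> g x \<in> V"
  shows "(\<Prod>x\<in>A. h (g x)) = (\<Prod>y\<in>V. h y ^ card {x \<in> A. g x = y} :: real)"
proof -
  have "(\<Prod>y\<in>V. h y ^ card {x \<in> A. g x = y}) = (\<Prod>y\<in>V. \<Prod>x | x \<in> A \<and> g x = y. h (g x))"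
    by (intro prod.cong refl) simp
  also have "\<dots> = (\<Prod>x\<in>A. h (g x))" using assms by (intro prod.group) auto
  finally show ?thesis ..
qed

text \<open>The permanent of the block of \<open>W\<close> with rows \<open>A\<close> and columns
  \<open>B\<close>.\<close>

definition bij_weight :: "('v \<Rightarrow> 'v \<Rightarrow> real) \<Rightarrow> 'v set \<Rightarrow> 'v set \<Rightarrow> real" where
  "bij_weight W A B = (\<Sum>g | g \<in> A \<rightarrow>\<^sub>E B \<and> bij_betw g A B. \<Prod>x\<in>A. W x (g x))"

text \<open>Two fields of fair signs that are coupled to each other but not within themselves; only
  the counting measure is normalised, not the exponential weight.\<close>

definition sign_corr :: "'v set \<Rightarrow> ('v \<Rightarrow> 'v \<Rightarrow> real) \<Rightarrow> real \<Rightarrow> 'v set \<Rightarrow> 'v set \<Rightarrow> real" where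
  "sign_corr V W \<epsilon> A B = (\<Sum>\<sigma>\<in>V \<rightarrow>\<^sub>E UNIV. \<Sum>\<tau>\<in>V \<rightarrow>\<^sub>E UNIV. (\<Prod>x\<in>A. pm (\<sigma> x)) * (\<Prod>x\<in>B. pm (\<tau> x)) *
     exp (\<epsilon>\<^sup>2 * (\<Sum>x\<in>V. \<Sum>y\<in>V. W x y * pm (\<sigma> x) * pm (\<tau> y)))) / 4 ^ card V"

text \<open>Summing out \<sigma> factorises over sites: a site with an inserted sign gives a
  \<open>sinh\<close>, any other a \<open>cosh\<close>.\<close>

lemma sign_corr_eq:
  assumes "finite V" "A \<subseteq> V"
  shows "sign_corr V W \<epsilon> A B = (\<Sum>\<tau>\<in>V \<rightarrow>\<^sub>E UNIV. (\<Prod>x\<in>B. pm (\<tau> x)) *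
    ((\<Prod>x\<in>A. sinh (\<epsilon>\<^sup>2 * (\<Sum>y\<in>V. W x y * pm (\<tau> y)))) *
     (\<Prod>x\<in>V - A. cosh (\<epsilon>\<^sup>2 * (\<Sum>y\<in>V. W x y * pm (\<tau> y)))))) / 2 ^ card V"
proof -
  have "(\<Sum>\<sigma>\<in>V \<rightarrow>\<^sub>E UNIV. (\<Prod>x\<in>A. pm (\<sigma> x)) * exp (\<epsilon>\<^sup>2 * (\<Sum>x\<in>V. \<Sum>y\<in>V. W x y * pm (\<sigma> x) * pm (\<tau> y)))) =
    2 ^ card V * ((\<Prod>x\<in>A. sinh (\<epsilon>\<^sup>2 * (\<Sum>y\<in>V. W x y * pm (\<tau> y)))) *
     (\<Prod>x\<in>V - A. cosh (\<epsilon>\<^sup>2 * (\<Sum>y\<in>V. W x y * pm (\<tau> y)))))" for \<tau>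
  proof -
    define c where "c = (\<lambda>x. \<epsilon>\<^sup>2 * (\<Sum>y\<in>V. W x y * pm (\<tau> y)))"
    have A: "(\<Prod>x\<in>A. pm (\<sigma> x)) = (\<Prod>x\<in>V. if x \<in> A then pm (\<sigma> x) else 1)" for \<sigma>
      using assms prod.inter_restrict[of V "\<lambda>x. pm (\<sigma> x)" A] by (simp add: Int_absorb1)
    have B: "\<epsilon>\<^sup>2 * (\<Sum>x\<in>V. \<Sum>y\<in>V. W x y * pm (\<sigma> x) * pm (\<tau> y)) = (\<Sum>x\<in>V. pm (\<sigma> x) * c x)" for \<sigma>
      by (simp add: c_def sum_distrib_left mult_ac)
    have "(\<Sum>\<sigma>\<in>V \<rightarrow>\<^sub>E UNIV. (\<Prod>x\<in>A. pm (\<sigma> x)) * exp (\<epsilon>\<^sup>2 * (\<Sum>x\<in>V. \<Sum>y\<in>V. W x y * pm (\<sigma> x) * pm (\<tau> y)))) =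
      (\<Sum>\<sigma>\<in>V \<rightarrow>\<^sub>E UNIV. \<Prod>x\<in>V. (if x \<in> A then pm (\<sigma> x) else 1) * exp (pm (\<sigma> x) * c x))"
      unfolding A B using assms(1) by (simp add: exp_sum prod.distrib)
    also have "\<dots> = (\<Prod>x\<in>V. \<Sum>b\<in>UNIV. (if x \<in> A then pm b else 1) * exp (pm b * c x))"
      using assms(1) by (subst prod_sum_PiE) auto
    also have "\<dots> = (\<Prod>x\<in>V. 2 * (if x \<in> A then sinh (c x) else cosh (c x)))"
      by (intro prod.cong) (auto simp: UNIV_bool pm_def sinh_def cosh_def)
    also have "\<dots> = 2 ^ card V * (\<Prod>x\<in>V. if x \<in> A then sinh (c x) else cosh (c x))"
      by (simp add: prod.distrib)
    also have "(\<Prod>x\<in>V. if x \<in> A then sinh (c x) else cosh (c x)) = (\<Prod>x\<in>A. sinh (c x)) * (\<Prod>x\<in>V - A. cosh (c x))"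
      using assms by (subst prod.If_cases) (auto simp: Int_absorb1 Diff_eq)
    finally show ?thesis unfolding c_def .
  qed
  note eq = this
  have "(\<Sum>\<sigma>\<in>V \<rightarrow>\<^sub>E UNIV. \<Sum>\<tau>\<in>V \<rightarrow>\<^sub>E UNIV. (\<Prod>x\<in>A. pm (\<sigma> x)) * (\<Prod>x\<in>B. pm (\<tau> x)) *
     exp (\<epsilon>\<^sup>2 * (\<Sum>x\<in>V. \<Sum>y\<in>V. W x y * pm (\<sigma> x) * pm (\<tau> y)))) =
    (\<Sum>\<tau>\<in>V \<rightarrow>\<^sub>E UNIV. (\<Prod>x\<in>B. pm (\<tau> x)) * (\<Sum>\<sigma>\<in>V \<rightarrow>\<^sub>E UNIV. (\<Prod>x\<in>A. pm (\<sigma> x)) *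
     exp (\<epsilon>\<^sup>2 * (\<Sum>x\<in>V. \<Sum>y\<in>V. W x y * pm (\<sigma> x) * pm (\<tau> y)))))"
    by (subst sum.swap) (simp add: sum_distrib_left mult_ac)
  moreover have four: "(4 :: real) ^ card V = 2 ^ card V * 2 ^ card V" by (simp flip: power_mult_distrib)
  ultimately show ?thesis
    unfolding sign_corr_def eq
    by (simp add: sum_divide_distrib four sum_distrib_left mult_ac)
qed

lemma sign_corr_tendsto:
  assumes fin: "finite V" and A: "A \<subseteq> V"
  shows "((\<lambda>\<epsilon>. sign_corr V W \<epsilon> A B / (\<epsilon>\<^sup>2) ^ card A) \<longlongrightarrow>
      (\<Sum>\<tau>\<in>V \<rightarrow>\<^sub>E UNIV. (\<Prod>x\<in>B. pm (\<tau> x)) * ((\<Prod>x\<in>A. \<Sum>y\<in>V. W x y * pm (\<tau> y)) * (\<Prod>x\<in>V - A. 1))) / 2 ^ card V) (at_right 0)"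
proof -
  let ?c = "\<lambda>\<tau> x. (\<Sum>y\<in>V. W x y * pm (\<tau> y))"
  have sinh_lim: "((\<lambda>\<epsilon>. sinh (\<epsilon>\<^sup>2 * c) / \<epsilon>\<^sup>2) \<longlongrightarrow> c) (at_right 0)" for c :: real
  proof -
    have "((\<lambda>s. sinh (s * c)) has_field_derivative c) (at 0)" by (auto intro!: derivative_eq_intros)
    from filterlim_compose[OF tendsto_diff_quotient_0[OF this] filterlim_sq_at_right] show ?thesis by simp
  qed
  have cosh_lim: "((\<lambda>\<epsilon>. cosh (\<epsilon>\<^sup>2 * c)) \<longlongrightarrow> 1) (at_right 0)" for c :: real
  proof -
    have "((\<lambda>\<epsilon>. cosh (\<epsilon>\<^sup>2 * c)) \<longlongrightarrow> cosh (0\<^sup>2 * c)) (at_right 0)" by (intro tendsto_intros)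
    then show ?thesis by simp
  qed
  have eq: "sign_corr V W \<epsilon> A B / (\<epsilon>\<^sup>2) ^ card A = (\<Sum>\<tau>\<in>V \<rightarrow>\<^sub>E UNIV. (\<Prod>x\<in>B. pm (\<tau> x)) *
    ((\<Prod>x\<in>A. sinh (\<epsilon>\<^sup>2 * ?c \<tau> x) / \<epsilon>\<^sup>2) * (\<Prod>x\<in>V - A. cosh (\<epsilon>\<^sup>2 * ?c \<tau> x)))) / 2 ^ card V" for \<epsilon>
    unfolding sign_corr_eq[OF fin A] by (simp add: prod_dividef sum_divide_distrib mult_ac)
  show ?thesis
    unfolding eq by (intro tendsto_divide tendsto_sum tendsto_mult tendsto_const tendsto_prod sinh_lim cosh_lim) simp
qed

text \<open>The leading coefficient is a sum over maps from \<open>A\<close> to \<open>V\<close>.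
  Averaging over \<tau> keeps the maps that hit each point of \<open>B\<close> an odd and every
  other point an even number of times; with \<open>card A \<le> card B\<close> only bijections onto
  \<open>B\<close> do that.\<close>

lemma sign_corr_limit:
  assumes fin: "finite V" and A: "A \<subseteq> V" and B: "B \<subseteq> V" and card: "card A \<le> card B"
  shows "((\<lambda>\<epsilon>. sign_corr V W \<epsilon> A B / (\<epsilon>\<^sup>2) ^ card A) \<longlongrightarrow> (if card A = card B then bij_weight W A B else 0)) (at_right 0)"
proof -
  note finA = finite_subset[OF A fin] and finB = finite_subset[OF B fin]
  let ?c = "\<lambda>\<tau> x. (\<Sum>y\<in>V. W x y * pm (\<tau> y))"
  note sign_corr_tendsto[OF fin A, of W B]
  moreover have "(\<Sum>\<tau>\<in>V \<rightarrow>\<^sub>E UNIV. (\<Prod>x\<in>B. pm (\<tau> x)) * ((\<Prod>x\<in>A. ?c \<tau> x) * (\<Prod>x\<in>V - A. 1))) / 2 ^ card V =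
    (if card A = card B then bij_weight W A B else 0)"
  proof -
    define n where "n = (\<lambda>g y. (if y \<in> B then 1 else 0) + card {x \<in> A. g x = y})"
    have "(\<Sum>\<tau>\<in>V \<rightarrow>\<^sub>E UNIV. (\<Prod>x\<in>B. pm (\<tau> x)) * ((\<Prod>x\<in>A. ?c \<tau> x) * (\<Prod>x\<in>V - A. 1))) =
      (\<Sum>\<tau>\<in>V \<rightarrow>\<^sub>E UNIV. \<Sum>g\<in>A \<rightarrow>\<^sub>E V. (\<Prod>x\<in>A. W x (g x)) * (\<Prod>y\<in>V. pm (\<tau> y) ^ n g y))"
    proof (intro sum.cong refl)
      fix \<tau> :: "'a \<Rightarrow> bool"
      have b: "(\<Prod>x\<in>B. pm (\<tau> x)) = (\<Prod>y\<in>V. pm (\<tau> y) ^ (if y \<in> B then 1 else 0))"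
        using prod.inter_restrict[OF fin, of "\<lambda>x. pm (\<tau> x)" B] B
        by (simp add: Int_absorb1 if_distrib[of "\<lambda>k. _ ^ k"] cong: if_cong)
      have a: "(\<Prod>x\<in>A. ?c \<tau> x) = (\<Sum>g\<in>A \<rightarrow>\<^sub>E V. (\<Prod>x\<in>A. W x (g x)) * (\<Prod>x\<in>A. pm (\<tau> (g x))))"
        using finA fin by (subst prod_sum_PiE) (auto simp: prod.distrib)
      show "(\<Prod>x\<in>B. pm (\<tau> x)) * ((\<Prod>x\<in>A. ?c \<tau> x) * (\<Prod>x\<in>V - A. 1)) =
        (\<Sum>g\<in>A \<rightarrow>\<^sub>E V. (\<Prod>x\<in>A. W x (g x)) * (\<Prod>y\<in>V. pm (\<tau> y) ^ n g y))"
        unfolding a b sum_distrib_left sum_distrib_right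
      proof (rule sum.cong)
        fix g assume "g \<in> A \<rightarrow>\<^sub>E V"
        then have "(\<Prod>x\<in>A. pm (\<tau> (g x))) = (\<Prod>y\<in>V. pm (\<tau> y) ^ card {x \<in> A. g x = y})"
          by (intro prod_fibres[OF fin finA]) auto
        then show "(\<Prod>y\<in>V. pm (\<tau> y) ^ (if y \<in> B then 1 else 0)) * ((\<Prod>x\<in>A. W x (g x)) * (\<Prod>x\<in>A. pm (\<tau> (g x))) * (\<Prod>x\<in>V - A. 1)) =
          (\<Prod>x\<in>A. W x (g x)) * (\<Prod>y\<in>V. pm (\<tau> y) ^ n g y)"
          by (simp add: n_def power_add prod.distrib)
      qed simp
    qed
    also have "\<dots> = (\<Sum>g\<in>A \<rightarrow>\<^sub>E V. (\<Prod>x\<in>A. W x (g x)) * (\<Sum>\<tau>\<in>V \<rightarrow>\<^sub>E UNIV. \<Prod>y\<in>V. pm (\<tau> y) ^ n g y))"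
      by (subst sum.swap) (simp add: sum_distrib_left)
    also have "\<dots> = (\<Sum>g\<in>A \<rightarrow>\<^sub>E V. if \<forall>y\<in>V. even (n g y) then (\<Prod>x\<in>A. W x (g x)) * 2 ^ card V else 0)"
      by (simp add: sum_sign_prod_power[OF fin] if_distrib cong: if_cong)
    also have "\<dots> = (\<Sum>g | g \<in> A \<rightarrow>\<^sub>E V \<and> (\<forall>y\<in>V. even (n g y)). (\<Prod>x\<in>A. W x (g x)) * 2 ^ card V)"
      using fin finA by (subst sum.inter_filter[symmetric]) (auto intro!: finite_PiE)
    also have "{g. g \<in> A \<rightarrow>\<^sub>E V \<and> (\<forall>y\<in>V. even (n g y))} = (if card A = card B then {g. g \<in> A \<rightarrow>\<^sub>E B \<and> bij_betw g A B} else {})"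
    proof -
      have bij: "bij_betw g A B \<and> card A = card B" if g: "g \<in> A \<rightarrow>\<^sub>E V" and ev: "\<forall>y\<in>V. even (n g y)" for g
      proof -
        have "B \<subseteq> g ` A"
        proof
          fix y assume y: "y \<in> B"
          then have "even (n g y)" using ev B by blast
          then have "odd (card {x \<in> A. g x = y})" using y by (simp add: n_def)
          then have "{x \<in> A. g x = y} \<noteq> {}" by (metis card.empty even_zero)
          then show "y \<in> g ` A" by auto
        qed
        moreover have "card (g ` A) \<le> card A" by (rule card_image_le[OF finA])
        moreover have "card B \<le> card (g ` A)" using \<open>B \<subseteq> g ` A\<close> finA by (intro card_mono) auto
        ultimately have c: "card B = card (g ` A)" "card (g ` A) = card A" using card by linarith+
        then have "B = g ` A" using \<open>B \<subseteq> g ` A\<close> finA by (intro card_subset_eq) auto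
        then show ?thesis using eq_card_imp_inj_on[OF finA c(2)] c by (auto simp: bij_betw_def)
      qed
      have conv: "\<forall>y\<in>V. even (n g y)" if g: "bij_betw g A B" for g
      proof
        fix y assume "y \<in> V"
        show "even (n g y)"
        proof (cases "y \<in> B")
          case True
          then obtain x where x: "x \<in> A" "g x = y" using g by (auto simp: bij_betw_def)
          then have "{x \<in> A. g x = y} = {x}" using g by (auto simp: bij_betw_def inj_on_def)
          then show ?thesis using True by (simp add: n_def)
        next
          case False
          then have "{x \<in> A. g x = y} = {}" using g by (auto simp: bij_betw_def)
          then have "n g y = 0" using False by (simp only: n_def card.empty if_False)
          then show ?thesis by simp
        qed
      qed
      have s1: "g \<in> A \<rightarrow>\<^sub>E B" if "g \<in> A \<rightarrow>\<^sub>E V" "bij_betw g A B" for g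
        using that by (auto simp: bij_betw_def PiE_def)
      have s2: "g \<in> A \<rightarrow>\<^sub>E V" if "g \<in> A \<rightarrow>\<^sub>E B" for g
        using that B by (auto simp: PiE_def)
      have "(g \<in> A \<rightarrow>\<^sub>E V \<and> (\<forall>y\<in>V. even (n g y))) = (card A = card B \<and> g \<in> A \<rightarrow>\<^sub>E B \<and> bij_betw g A B)" for g
        using bij[of g] conv[of g] s1[of g] s2[of g] by argo
      then show ?thesis by auto
    qed
    finally show ?thesis by (auto simp: bij_weight_def sum_distrib_right[symmetric])
  qed
  ultimately show ?thesis by (simp only:)
qed

text \<open>A signed weight. Its two signs let a site contribute only if both components are met an
  odd number of times, to leading order by one outgoing and one incoming arrow; the division cancels
  the coupling \<epsilon>^2 of one arrow per site.\<close>

definition per_site :: "real \<Rightarrow> bool \<times> bool \<Rightarrow> real" where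
  "per_site \<epsilon> i = spin i True * spin i False / (4 * \<epsilon>\<^sup>2)"

text \<open>An inserted sign cancels the one in \<open>per_site\<close>, as signs square to 1. It
  thus removes the outgoing arrow at a point of \<open>A\<close> or the incoming arrow at a point of
  \<open>B\<close>, whence the complements.\<close>

lemma spin_avg_per:
  assumes fin: "finite V" and W: "\<And>x y. x \<in> V \<Longrightarrow> y \<in> V \<Longrightarrow> W x y = W y x" and A: "A \<subseteq> V" and B: "B \<subseteq> V"
  shows "spin_avg V W Not \<epsilon> (per_site \<epsilon>) (\<lambda>\<omega>. (\<Prod>x\<in>A. spin (\<omega> x) True) * (\<Prod>x\<in>B. spin (\<omega> x) False)) =
    sign_corr V W \<epsilon> (V - A) (V - B) / (\<epsilon>\<^sup>2) ^ card V"
proof -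
  have en: "spin_energy V W Not (\<lambda>x k. \<epsilon> * spin ((\<lambda>x\<in>V. (\<sigma> x, \<tau> x)) x) k) =
    \<epsilon>\<^sup>2 * (\<Sum>x\<in>V. \<Sum>y\<in>V. W x y * pm (\<sigma> x) * pm (\<tau> y))" for \<sigma> \<tau>
  proof -
    have "spin_energy V W Not (\<lambda>x k. \<epsilon> * spin ((\<lambda>x\<in>V. (\<sigma> x, \<tau> x)) x) k) =
      \<epsilon>\<^sup>2 * ((\<Sum>x\<in>V. \<Sum>y\<in>V. W x y * pm (\<sigma> x) * pm (\<tau> y)) + (\<Sum>x\<in>V. \<Sum>y\<in>V. W x y * pm (\<tau> x) * pm (\<sigma> y))) / 2"
      unfolding spin_energy_def sum.distrib[symmetric] sum_distrib_left
      by (simp add: UNIV_bool spin_pm power2_eq_square algebra_simps)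
    also have "(\<Sum>x\<in>V. \<Sum>y\<in>V. W x y * pm (\<tau> x) * pm (\<sigma> y)) = (\<Sum>x\<in>V. \<Sum>y\<in>V. W x y * pm (\<sigma> x) * pm (\<tau> y))"
      by (subst sum.swap) (simp add: W mult_ac)
    finally show ?thesis by simp
  qed
  have pr: "(\<Prod>x\<in>V. pm (\<sigma> x)) * (\<Prod>x\<in>A. pm (\<sigma> x)) = (\<Prod>x\<in>V - A. pm (\<sigma> x))" if "A \<subseteq> V" for A \<sigma>
  proof -
    have "(\<Prod>x\<in>V. pm (\<sigma> x)) = (\<Prod>x\<in>V - A. pm (\<sigma> x)) * (\<Prod>x\<in>A. pm (\<sigma> x))"
      by (rule prod.subset_diff[OF that fin])
    then show ?thesis by (simp add: mult.assoc prod.distrib[symmetric])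
  qed
  have site: "(\<Prod>x\<in>V. per_site \<epsilon> ((\<lambda>x\<in>V. (\<sigma> x, \<tau> x)) x)) =
    (\<Prod>x\<in>V. pm (\<sigma> x)) * (\<Prod>x\<in>V. pm (\<tau> x)) / (4 ^ card V * (\<epsilon>\<^sup>2) ^ card V)" for \<sigma> \<tau>
    by (simp add: per_site_def spin_pm prod_dividef prod.distrib power_mult_distrib)
  have ins: "(\<Prod>x\<in>A. spin ((\<lambda>x\<in>V. (\<sigma> x, \<tau> x)) x) True) = (\<Prod>x\<in>A. pm (\<sigma> x))"
      "(\<Prod>x\<in>B. spin ((\<lambda>x\<in>V. (\<sigma> x, \<tau> x)) x) False) = (\<Prod>x\<in>B. pm (\<tau> x))" for \<sigma> \<tau>
    by (intro prod.cong refl; use A B in \<open>auto simp: spin_pm\<close>)+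
  have regroup: "a * b / (p * q) * e * (c * d) = (a * c) * (b * d) * e / p / q" for a b p q e c d :: real
    by simp
  show ?thesis
    unfolding spin_avg_def sum_PiE_pair en site ins regroup pr[OF A] pr[OF B] sign_corr_def sum_divide_distrib ..
qed

text \<open>Laplace expansion of a permanent along the column \<open>x\<close>: permutations are
  classified by the preimage of \<open>x\<close>. Divided by the partition function, it is the sum
  rule with p = 0.\<close>

lemma bij_weight_expand:
  assumes fin: "finite V" and x: "x \<in> V"
  shows "bij_weight W V V = (\<Sum>y\<in>V. W y x * bij_weight W (V - {y}) (V - {x}))"
proof -
  let ?S = "\<lambda>A B. {g. g \<in> A \<rightarrow>\<^sub>E B \<and> bij_betw g A B}"
  have finS: "finite (?S (V - {y}) (V - {x}))" for y
    using fin by (intro finite_subset[OF _ finite_PiE[of "V - {y}" "\<lambda>_. V - {x}"]]) auto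
  have "(\<Sum>y\<in>V. W y x * bij_weight W (V - {y}) (V - {x})) =
    (\<Sum>(y, g)\<in>Sigma V (\<lambda>y. ?S (V - {y}) (V - {x})). W y x * (\<Prod>z\<in>V - {y}. W z (g z)))"
    unfolding bij_weight_def sum_distrib_left using fin finS by (subst sum.Sigma) auto
  also have "\<dots> = (\<Sum>g\<in>?S V V. \<Prod>z\<in>V. W z (g z))"
  proof (rule sum.reindex_bij_witness[of _ "\<lambda>f. (inv_into V f x, f(inv_into V f x := undefined))" "\<lambda>(y, g). g(y := x)"])
    fix a assume a: "a \<in> Sigma V (\<lambda>y. ?S (V - {y}) (V - {x}))"
    obtain y g where yg: "a = (y, g)" by force
    have y: "y \<in> V" and g: "g \<in> (V - {y}) \<rightarrow>\<^sub>E (V - {x})" "bij_betw g (V - {y}) (V - {x})"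
      using a yg by auto
    have bij: "bij_betw (g(y := x)) V V"
    proof -
      have "bij_betw (g(y := x)) (V - {y}) (V - {x})"
        using g(2) by (rule bij_betw_cong[THEN iffD1, rotated]) auto
      then have "bij_betw (g(y := x)) ((V - {y}) \<union> {y}) ((V - {x}) \<union> {(g(y := x)) y})"
        by (intro notIn_Un_bij_betw) auto
      then show ?thesis using x y by (simp add: insert_absorb)
    qed
    have inv: "inv_into V (g(y := x)) x = y"
      using bij y by (metis bij_betw_inv_into_left fun_upd_same)
    show "(\<lambda>f. (inv_into V f x, f(inv_into V f x := undefined))) (case a of (y, g) \<Rightarrow> g(y := x)) = a"
      using g(1) yg inv by (auto simp: PiE_def extensional_def fun_eq_iff)
    show "(case a of (y, g) \<Rightarrow> g(y := x)) \<in> ?S V V"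
      using bij g(1) yg x y by (auto simp: PiE_def extensional_def)
    show "(\<Prod>z\<in>V. W z ((case a of (y, g) \<Rightarrow> g(y := x)) z)) = (case a of (y, g) \<Rightarrow> W y x * (\<Prod>z\<in>V - {y}. W z (g z)))"
      using prod.remove[OF fin y, of "\<lambda>z. W z ((g(y := x)) z)"] yg by simp
  next
    fix f assume f: "f \<in> ?S V V"
    define y where "y = inv_into V f x"
    have y: "y \<in> V" "f y = x" using f x unfolding y_def
      by (auto simp: bij_betw_def inv_into_into f_inv_into_f)
    have "bij_betw f (V - {y}) (V - {x})"
      using f y by (intro bij_betw_DiffI[of f V V "{y}" "{x}", simplified]) auto
    then have "bij_betw (f(y := undefined)) (V - {y}) (V - {x})"
      by (rule bij_betw_cong[THEN iffD1, rotated]) auto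
    then show "(\<lambda>f. (inv_into V f x, f(inv_into V f x := undefined))) f \<in> Sigma V (\<lambda>y. ?S (V - {y}) (V - {x}))"
      using f y unfolding y_def[symmetric] by (auto simp: PiE_def extensional_def bij_betw_def)
    show "(case (inv_into V f x, f(inv_into V f x := undefined)) of (y, g) \<Rightarrow> g(y := x)) = f"
      using y unfolding y_def[symmetric] by auto
  qed
  finally show ?thesis by (simp add: bij_weight_def)
qed

lemma Z_per_eq: "Z_per V W = bij_weight W V V"
  unfolding Z_per_def bij_weight_def
proof (rule sum.reindex_bij_witness[of _ "\<lambda>g x. if x \<in> V then g x else x" "\<lambda>\<pi>. restrict \<pi> V"])
  fix \<pi> assume \<pi>: "\<pi> \<in> {\<pi>. \<pi> permutes V}"
  then show "(\<lambda>x. if x \<in> V then restrict \<pi> V x else x) = \<pi>"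
    by (auto simp: permutes_def)
  show "restrict \<pi> V \<in> {g. g \<in> V \<rightarrow>\<^sub>E V \<and> bij_betw g V V}"
    using \<pi> permutes_imp_bij[of \<pi> V] by (auto simp: permutes_in_image cong: bij_betw_cong)
  show "(\<Prod>x\<in>V. W x (restrict \<pi> V x)) = (\<Prod>x\<in>V. W x (\<pi> x))" by simp
next
  fix g assume g: "g \<in> {g. g \<in> V \<rightarrow>\<^sub>E V \<and> bij_betw g V V}"
  then show "restrict (\<lambda>x. if x \<in> V then g x else x) V = g"
    by (auto simp: PiE_def extensional_def fun_eq_iff)
  have "bij_betw (\<lambda>x. if x \<in> V then g x else x) V V"
    using g by (subst bij_betw_cong[of V _ g]) auto
  then show "(\<lambda>x. if x \<in> V then g x else x) \<in> {\<pi>. \<pi> permutes V}"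
    by (auto intro!: bij_imp_permutes)
qed

lemma G_per_eq: "G_per V W x y = bij_weight W (V - {y}) (V - {x}) / Z_per V W"
  by (simp add: G_per_def bij_weight_def)

lemma sum_G_per:
  assumes "finite V" "x \<in> V" "Z_per V W > 0"
  shows "(\<Sum>y\<in>V. W y x * G_per V W x y) = 1"
  using assms bij_weight_expand[OF assms(1,2), of W]
  by (simp add: G_per_eq sum_divide_distrib[symmetric] Z_per_eq)

text \<open>The arguments of \<open>G_per\<close> are interchanged because inserting component
  \<open>True\<close> at \<open>x\<close> deletes \<open>x\<close> from the domain of the bijection,
  and the domain belongs to the second argument of \<open>G_per\<close>. Symmetry of
  \<open>G_per\<close> is a consequence of the model, through \<open>two_point_sym\<close>.\<close>

lemma (in reflection_system) rp_model_per:
  assumes rows: "\<And>x. x \<in> V \<Longrightarrow> (\<Sum>y\<in>V. W x y) = 1" and pos: "Z_per V W > 0"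
  shows "rp_model V B R W Not prod.swap per_site (\<lambda>_. 1) (Z_per V W) (\<lambda>x y. G_per V W y x)"
proof -
  let ?S = "\<lambda>\<epsilon>. spin_avg V W Not \<epsilon> (per_site \<epsilon>)"
  have spin_swap: "spin (prod.swap i) k = spin i (\<not> k)" for i k by (auto simp: spin_def)
  have site_swap: "per_site \<epsilon> (prod.swap i) = per_site \<epsilon> i" for \<epsilon> i by (simp add: per_site_def spin_swap)
  note avg = spin_avg_per[OF fin W_sym]
  have ab: "?S \<epsilon> (\<lambda>\<omega>. spin (\<omega> x) True * spin (\<omega> y) False) = sign_corr V W \<epsilon> (V - {x}) (V - {y}) / (\<epsilon>\<^sup>2) ^ card V"
    if "x \<in> V" "y \<in> V" for x y \<epsilon>
    using avg[where A = "{x}" and B = "{y}" and \<epsilon> = \<epsilon>] that by simp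
  have flip: "?S \<epsilon> (\<lambda>\<omega>. spin (\<omega> x) k * spin (\<omega> y) l) = ?S \<epsilon> (\<lambda>\<omega>. spin (\<omega> x) (\<not> k) * spin (\<omega> y) (\<not> l))"
    if "x \<in> V" "y \<in> V" for x y k l \<epsilon>
    using spin_avg_flip[of Not prod.swap "per_site \<epsilon>" V W \<epsilon> "\<lambda>\<omega>. spin (\<omega> x) k * spin (\<omega> y) l"] that
    by (simp add: spin_swap site_swap)
  have cardV: "card V > 0" using fin nonempty by (simp add: card_gt_0_iff)
  have pos_eps: "\<forall>\<^sub>F \<epsilon> in at_right (0::real). 0 < \<epsilon>" by (rule eventually_at_right_less)
  have Zlim: "((\<lambda>\<epsilon>. ?S \<epsilon> (\<lambda>_. 1)) \<longlongrightarrow> Z_per V W) (at_right 0)"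
    using sign_corr_limit[OF fin subset_refl subset_refl, of W] avg[where A = "{}" and B = "{}"] by (simp add: Z_per_eq)
  have eps2: "((\<lambda>\<epsilon> :: real. \<epsilon>\<^sup>2) \<longlongrightarrow> 0) (at_right 0)"
  proof -
    have "((\<lambda>\<epsilon> :: real. \<epsilon>\<^sup>2) \<longlongrightarrow> 0\<^sup>2) (at_right 0)" by (intro tendsto_intros)
    then show ?thesis by simp
  qed
  have ablim: "((\<lambda>\<epsilon>. \<epsilon>\<^sup>2 * ?S \<epsilon> (\<lambda>\<omega>. spin (\<omega> x) True * spin (\<omega> y) False)) \<longlongrightarrow> Z_per V W * G_per V W y x) (at_right 0)"
    if xy: "x \<in> V" "y \<in> V" for x y
  proof -
    have c: "card (V - {x}) = card V - 1" "card (V - {y}) = card V - 1" using xy fin by auto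
    have "((\<lambda>\<epsilon>. sign_corr V W \<epsilon> (V - {x}) (V - {y}) / (\<epsilon>\<^sup>2) ^ card (V - {x})) \<longlongrightarrow> Z_per V W * G_per V W y x) (at_right 0)"
      using sign_corr_limit[OF fin, of "V - {x}" "V - {y}" W] c pos by (simp add: G_per_eq)
    then show ?thesis
    proof (rule Lim_transform_eventually)
      show "\<forall>\<^sub>F \<epsilon> in at_right 0. sign_corr V W \<epsilon> (V - {x}) (V - {y}) / (\<epsilon>\<^sup>2) ^ card (V - {x}) =
        \<epsilon>\<^sup>2 * ?S \<epsilon> (\<lambda>\<omega>. spin (\<omega> x) True * spin (\<omega> y) False)"
        using pos_eps
      proof eventually_elim
        case (elim \<epsilon>)
        have "(\<epsilon>\<^sup>2) ^ card V = \<epsilon>\<^sup>2 * (\<epsilon>\<^sup>2) ^ card (V - {x})"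
          using c(1) cardV by (metis Suc_diff_1 power_Suc)
        then show ?case unfolding ab[OF xy] using elim by simp
      qed
    qed
  qed
  \<comment> \<open>With equal components the other field still carries a sign at every site, so the
    correlation stays bounded after rescaling and the extra factor \<epsilon>^2 kills it.\<close>
  have bblim: "((\<lambda>\<epsilon>. \<epsilon>\<^sup>2 * ?S \<epsilon> (\<lambda>\<omega>. spin (\<omega> x) False * spin (\<omega> y) False)) \<longlongrightarrow> 0) (at_right 0)"
    if xy: "x \<in> V" "y \<in> V" for x y
  proof -
    obtain B where B: "B \<subseteq> V" and eq: "\<And>\<omega>. spin (\<omega> x) False * spin (\<omega> y) False = (\<Prod>x\<in>B. spin (\<omega> x) False)"
    proof (cases "x = y")
      case True
      then show ?thesis using that[of "{}"] by (simp add: spin_pm)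
    next
      case False
      then show ?thesis using that[of "{x, y}"] xy by simp
    qed
    show ?thesis
      unfolding eq using tendsto_mult[OF eps2 sign_corr_tendsto[OF fin subset_refl, of W "V - B"]] avg[where A = "{}" and B = B] B
      by simp
  qed
  \<comment> \<open>Only the two mixed pairs of components survive, matching the squared norm 2 of
    the direction (1, 1).\<close>
  have quad: "((\<lambda>\<epsilon>. \<epsilon>\<^sup>2 * (\<Sum>k\<in>UNIV. \<Sum>l\<in>UNIV. 1 * 1 * ?S \<epsilon> (\<lambda>\<omega>. spin (\<omega> x) k * spin (\<omega> y) l)))
        \<longlongrightarrow> (\<Sum>k :: bool\<in>UNIV. 1\<^sup>2) * (Z_per V W * G_per V W y x)) (at_right 0)" if xy: "x \<in> V" "y \<in> V" for x y
  proof -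
    have eq: "\<epsilon>\<^sup>2 * (\<Sum>k\<in>UNIV. \<Sum>l\<in>UNIV. 1 * 1 * ?S \<epsilon> (\<lambda>\<omega>. spin (\<omega> x) k * spin (\<omega> y) l)) =
      2 * (\<epsilon>\<^sup>2 * ?S \<epsilon> (\<lambda>\<omega>. spin (\<omega> x) True * spin (\<omega> y) False)) +
      2 * (\<epsilon>\<^sup>2 * ?S \<epsilon> (\<lambda>\<omega>. spin (\<omega> x) False * spin (\<omega> y) False))" for \<epsilon>
      using flip[OF xy, of \<epsilon> True False] flip[OF xy, of \<epsilon> True True] by (simp add: UNIV_bool algebra_simps)
    have "((\<lambda>\<epsilon>. \<epsilon>\<^sup>2 * (\<Sum>k\<in>UNIV. \<Sum>l\<in>UNIV. 1 * 1 * ?S \<epsilon> (\<lambda>\<omega>. spin (\<omega> x) k * spin (\<omega> y) l)))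
        \<longlongrightarrow> 2 * (Z_per V W * G_per V W y x) + 2 * 0) (at_right 0)"
      unfolding eq by (intro tendsto_intros ablim bblim xy)
    then show ?thesis by (simp add: UNIV_bool)
  qed
  show ?thesis
    by unfold_locales (use rows pos Zlim ablim quad in \<open>simp_all add: spin_swap site_swap UNIV_bool\<close>)
qed

section \<open>High-temperature expansion\<close>

definition pairs :: "'v set \<Rightarrow> 'v set set" where
  "pairs V = {{x, y} | x y. x \<in> V \<and> y \<in> V \<and> x \<noteq> y}"

definition degree_in :: "'v set set \<Rightarrow> 'v \<Rightarrow> nat" where
  "degree_in M x = card {e \<in> M. x \<in> e}"

definition matching_sum :: "'v set \<Rightarrow> ('v \<Rightarrow> 'v \<Rightarrow> real) \<Rightarrow> ('v \<Rightarrow> nat \<Rightarrow> nat \<Rightarrow> real) \<Rightarrow> real" where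
  "matching_sum V W \<kappa> = (\<Sum>M1\<in>Pow (pairs V). \<Sum>M2\<in>Pow (pairs V).
     (\<Prod>e\<in>M1. edge_weight W e) * (\<Prod>e\<in>M2. edge_weight W e) *
     (\<Prod>x\<in>V. \<kappa> x (degree_in M1 x) (degree_in M2 x)))"

lemma finite_pairs: "finite V \<Longrightarrow> finite (pairs V)"
  by (rule finite_subset[of _ "Pow V"]) (auto simp: pairs_def)

lemma edge_weight_doubleton: "W x y = W y x \<Longrightarrow> edge_weight W {x, y} = W x y"
  unfolding edge_weight_def by (rule the_equality) (auto simp: doubleton_eq_iff)

lemma pairsE:
  assumes "e \<in> pairs V"
  obtains x y where "e = {x, y}" "x \<in> V" "y \<in> V" "x \<noteq> y"
  using assms by (auto simp: pairs_def)

lemma sum_ordered_pairs: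
  fixes h :: "'v \<Rightarrow> 'v \<Rightarrow> real"
  assumes fin: "finite V" and h: "\<And>x y. x \<in> V \<Longrightarrow> y \<in> V \<Longrightarrow> x \<noteq> y \<Longrightarrow> h x y = k {x, y}"
  shows "(\<Sum>x\<in>V. \<Sum>y\<in>V. h x y) = (\<Sum>x\<in>V. h x x) + 2 * (\<Sum>e\<in>pairs V. k e)"
proof -
  let ?D = "{p \<in> V \<times> V. fst p \<noteq> snd p}"
  have finD: "finite ?D" using fin by simp
  have "(\<Sum>x\<in>V. \<Sum>y\<in>V. h x y) = (\<Sum>x\<in>V. h x x + (\<Sum>y\<in>V. if x \<noteq> y then k {x, y} else 0))"
  proof (rule sum.cong)
    fix x assume x: "x \<in> V"
    have "(\<Sum>y\<in>V. if x \<noteq> y then k {x, y} else 0) = (\<Sum>y\<in>V - {x}. h x y)"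
    proof -
      have "(\<Sum>y\<in>V. if x \<noteq> y then k {x, y} else 0) = (\<Sum>y\<in>V - {x}. if x \<noteq> y then k {x, y} else 0)"
        using sum.remove[OF fin x, of "\<lambda>y. if x \<noteq> y then k {x, y} else 0"] by simp
      also have "\<dots> = (\<Sum>y\<in>V - {x}. h x y)" using x by (intro sum.cong) (auto simp: h)
      finally show ?thesis .
    qed
    then show "(\<Sum>y\<in>V. h x y) = h x x + (\<Sum>y\<in>V. if x \<noteq> y then k {x, y} else 0)"
      using sum.remove[OF fin x, of "h x"] by simp
  qed simp
  also have "(\<Sum>x\<in>V. h x x + (\<Sum>y\<in>V. if x \<noteq> y then k {x, y} else 0)) =
    (\<Sum>x\<in>V. h x x) + (\<Sum>p\<in>V \<times> V. if fst p \<noteq> snd p then k {fst p, snd p} else 0)"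
    by (simp only: sum.distrib sum.cartesian_product' fst_conv snd_conv)
  also have "(\<Sum>p\<in>V \<times> V. if fst p \<noteq> snd p then k {fst p, snd p} else 0) = (\<Sum>p\<in>?D. k {fst p, snd p})"
    using fin by (simp add: sum.inter_filter)
  also have "\<dots> = (\<Sum>e\<in>pairs V. \<Sum>p | p \<in> ?D \<and> {fst p, snd p} = e. k {fst p, snd p})"
  proof (rule sum.group[symmetric])
    show "(\<lambda>p. {fst p, snd p}) ` ?D \<subseteq> pairs V" by (force simp: pairs_def)
  qed (use finD finite_pairs[OF fin] in auto)
  also have "\<dots> = (\<Sum>e\<in>pairs V. 2 * k e)"
  proof (rule sum.cong)
    fix e assume "e \<in> pairs V"
    then obtain x y where e: "e = {x, y}" "x \<in> V" "y \<in> V" "x \<noteq> y" by (rule pairsE)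
    have "{p. p \<in> ?D \<and> {fst p, snd p} = e} = {(x, y), (y, x)}"
      using e by (auto simp: doubleton_eq_iff)
    then show "(\<Sum>p | p \<in> ?D \<and> {fst p, snd p} = e. k {fst p, snd p}) = 2 * k e"
      using e by (simp add: insert_commute)
  qed simp
  finally show ?thesis by (simp add: sum_distrib_left)
qed

lemma prod_edges_eq_prod_degree:
  assumes fin: "finite V" and M: "M \<subseteq> pairs V"
  shows "(\<Prod>e\<in>M. \<Prod>x\<in>e. s x) = (\<Prod>x\<in>V. s x ^ degree_in M x :: real)"
proof -
  have finM: "finite M" using finite_subset[OF M finite_pairs[OF fin]] .
  have "(\<Prod>e\<in>M. \<Prod>x\<in>e. s x) = (\<Prod>e\<in>M. \<Prod>x\<in>V. if x \<in> e then s x else 1)"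
  proof (rule prod.cong)
    fix e assume "e \<in> M"
    then have "e \<subseteq> V" using M by (auto simp: pairs_def)
    then show "(\<Prod>x\<in>e. s x) = (\<Prod>x\<in>V. if x \<in> e then s x else 1)"
      using prod.inter_restrict[OF fin, of s e] by (simp add: Int_absorb1)
  qed simp
  also have "\<dots> = (\<Prod>x\<in>V. \<Prod>e\<in>M. if x \<in> e then s x else 1)" by (rule prod.swap)
  also have "\<dots> = (\<Prod>x\<in>V. s x ^ degree_in M x)"
  proof (rule prod.cong)
    fix x
    have "(\<Prod>e\<in>M. if x \<in> e then s x else 1) = (\<Prod>e | e \<in> M \<and> x \<in> e. s x)"
      by (rule prod.inter_filter[OF finM, symmetric])
    then show "(\<Prod>e\<in>M. if x \<in> e then s x else 1) = s x ^ degree_in M x" by (simp add: degree_in_def)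
  qed simp
  finally show ?thesis .
qed

text \<open>Handshake identity; it moves powers of \<epsilon> from the edges to their end
  points.\<close>

lemma power_sum_degree:
  assumes fin: "finite V" and M: "M \<subseteq> pairs V"
  shows "(a\<^sup>2) ^ card M = (\<Prod>x\<in>V. a ^ degree_in M x :: real)"
proof -
  have "(\<Prod>e\<in>M. \<Prod>x\<in>e. a) = (\<Prod>e\<in>M. a\<^sup>2)"
  proof (rule prod.cong)
    fix e assume "e \<in> M"
    then obtain x y where "e = {x, y}" "x \<noteq> y" using M by (meson pairsE subsetD)
    then show "(\<Prod>x\<in>e. a) = a\<^sup>2" by (simp add: power2_eq_square)
  qed simp
  then show ?thesis using prod_edges_eq_prod_degree[OF fin M, of "\<lambda>_. a"] by simp
qed

text \<open>For a sign s, exp(b s) = cosh b (1 + s tanh b), and the product over edges expands into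
  a sum over edge sets. Diagonal terms are constant, as signs square to 1.\<close>

lemma high_temperature_expansion:
  fixes s :: "'v \<Rightarrow> real"
  assumes fin: "finite V" and W: "\<And>x y. x \<in> V \<Longrightarrow> y \<in> V \<Longrightarrow> W x y = W y x"
    and s: "\<And>x. x \<in> V \<Longrightarrow> s x = 1 \<or> s x = - 1"
  shows "exp (t * (\<Sum>x\<in>V. \<Sum>y\<in>V. W x y * (s x * s y)) / 2) =
    exp (t * (\<Sum>x\<in>V. W x x) / 2) * (\<Prod>e\<in>pairs V. cosh (t * edge_weight W e)) *
    (\<Sum>M\<in>Pow (pairs V). (\<Prod>e\<in>M. tanh (t * edge_weight W e)) * (\<Prod>x\<in>V. s x ^ degree_in M x))"
proof -
  define \<beta> where "\<beta> = (\<lambda>e. t * edge_weight W e)"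
  define sg where "sg = (\<lambda>e. \<Prod>x\<in>e. s x)"
  note finP = finite_pairs[OF fin]
  have chi: "sg e = 1 \<or> sg e = - 1" if eP: "e \<in> pairs V" for e
  proof -
    obtain x y where e: "e = {x, y}" "x \<in> V" "y \<in> V" "x \<noteq> y" using eP by (rule pairsE)
    then show ?thesis using s[OF e(2)] s[OF e(3)] by (auto simp: sg_def)
  qed
  have "(\<Sum>x\<in>V. \<Sum>y\<in>V. W x y * (s x * s y)) = (\<Sum>x\<in>V. W x x * (s x * s x)) + 2 * (\<Sum>e\<in>pairs V. edge_weight W e * sg e)"
    by (rule sum_ordered_pairs[OF fin]) (auto simp: sg_def edge_weight_doubleton W)
  also have "(\<Sum>x\<in>V. W x x * (s x * s x)) = (\<Sum>x\<in>V. W x x)"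
    using s by (intro sum.cong refl) (metis mult_1_right mult_minus1_right minus_minus)
  finally have "exp (t * (\<Sum>x\<in>V. \<Sum>y\<in>V. W x y * (s x * s y)) / 2) =
    exp (t * (\<Sum>x\<in>V. W x x) / 2 + (\<Sum>e\<in>pairs V. \<beta> e * sg e))"
    by (simp add: distrib_left add_divide_distrib sum_distrib_left \<beta>_def mult_ac)
  also have "\<dots> = exp (t * (\<Sum>x\<in>V. W x x) / 2) * (\<Prod>e\<in>pairs V. exp (\<beta> e * sg e))"
    by (simp add: exp_add exp_sum[OF finP])
  also have "(\<Prod>e\<in>pairs V. exp (\<beta> e * sg e)) = (\<Prod>e\<in>pairs V. cosh (\<beta> e) * (tanh (\<beta> e) * sg e + 1))"
  proof (rule prod.cong)
    fix e assume "e \<in> pairs V"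
    then have "sg e = 1 \<or> sg e = - 1" by (rule chi)
    moreover have "cosh (\<beta> e) * tanh (\<beta> e) = sinh (\<beta> e)" by (simp add: tanh_def)
    ultimately show "exp (\<beta> e * sg e) = cosh (\<beta> e) * (tanh (\<beta> e) * sg e + 1)"
      by (auto simp: distrib_left sinh_plus_cosh cosh_minus_sinh right_diff_distrib)
  qed simp
  also have "\<dots> = (\<Prod>e\<in>pairs V. cosh (\<beta> e)) * (\<Prod>e\<in>pairs V. tanh (\<beta> e) * sg e + 1)"
    by (rule prod.distrib)
  also have "(\<Prod>e\<in>pairs V. tanh (\<beta> e) * sg e + 1) = (\<Sum>M\<in>Pow (pairs V). (\<Prod>e\<in>M. tanh (\<beta> e) * sg e) * (\<Prod>e\<in>pairs V - M. 1))"
    by (rule prod_add[OF finP])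
  also have "\<dots> = (\<Sum>M\<in>Pow (pairs V). (\<Prod>e\<in>M. tanh (\<beta> e)) * (\<Prod>x\<in>V. s x ^ degree_in M x))"
    by (intro sum.cong refl) (simp add: prod.distrib sg_def prod_edges_eq_prod_degree[OF fin])
  finally show ?thesis by (simp add: \<beta>_def mult.assoc)
qed

text \<open>With \<open>J\<close> the identity the components decouple and each has its own edge
  set. An edge is of order \<epsilon>^2, shared as one \<epsilon> by each end point, so convergence
  reduces to that of the rescaled site moments.\<close>

lemma spin_sum_matching_limit:
  fixes c :: "real \<Rightarrow> 'v \<Rightarrow> bool \<times> bool \<Rightarrow> real"
  assumes fin: "finite V" and W: "\<And>x y. x \<in> V \<Longrightarrow> y \<in> V \<Longrightarrow> W x y = W y x"
    and lim: "\<And>x p q. x \<in> V \<Longrightarrow>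
      ((\<lambda>\<epsilon>. \<epsilon> ^ (p + q) * (\<Sum>i\<in>UNIV. c \<epsilon> x i * (spin i True ^ p * spin i False ^ q))) \<longlongrightarrow> \<kappa> x p q) (at_right 0)"
  shows "((\<lambda>\<epsilon>. spin_sum V W (\<lambda>k. k) (c \<epsilon>) (\<lambda>_ i k. \<epsilon> * spin i k)) \<longlongrightarrow> matching_sum V W \<kappa>) (at_right 0)"
proof -
  note finP = finite_pairs[OF fin]
  define C where "C = (\<lambda>\<epsilon> :: real. exp (\<epsilon>\<^sup>2 * (\<Sum>x\<in>V. W x x) / 2) * (\<Prod>e\<in>pairs V. cosh (\<epsilon>\<^sup>2 * edge_weight W e)))"
  define T where "T = (\<lambda>\<epsilon> M. \<Prod>e\<in>M. tanh (\<epsilon>\<^sup>2 * edge_weight W e))"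
  have eq: "spin_sum V W (\<lambda>k. k) (c \<epsilon>) (\<lambda>_ i k. \<epsilon> * spin i k) =
    C \<epsilon> * C \<epsilon> * (\<Sum>M1\<in>Pow (pairs V). \<Sum>M2\<in>Pow (pairs V). T \<epsilon> M1 * T \<epsilon> M2 *
      (\<Prod>x\<in>V. \<Sum>i\<in>UNIV. c \<epsilon> x i * (spin i True ^ degree_in M1 x * spin i False ^ degree_in M2 x)))" for \<epsilon>
  proof -
    have en: "exp (spin_energy V W (\<lambda>k. k) (\<lambda>x k. \<epsilon> * spin (\<omega> x) k)) =
      (C \<epsilon> * (\<Sum>M\<in>Pow (pairs V). T \<epsilon> M * (\<Prod>x\<in>V. spin (\<omega> x) True ^ degree_in M x))) *
      (C \<epsilon> * (\<Sum>M\<in>Pow (pairs V). T \<epsilon> M * (\<Prod>x\<in>V. spin (\<omega> x) False ^ degree_in M x)))" for \<omega> :: "'v \<Rightarrow> bool \<times> bool"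
    proof -
      have "spin_energy V W (\<lambda>k. k) (\<lambda>x k. \<epsilon> * spin (\<omega> x) k) =
        \<epsilon>\<^sup>2 * (\<Sum>x\<in>V. \<Sum>y\<in>V. W x y * (spin (\<omega> x) True * spin (\<omega> y) True)) / 2 +
        \<epsilon>\<^sup>2 * (\<Sum>x\<in>V. \<Sum>y\<in>V. W x y * (spin (\<omega> x) False * spin (\<omega> y) False)) / 2"
        unfolding spin_energy_def add_divide_distrib[symmetric] distrib_left[symmetric] sum.distrib[symmetric] sum_distrib_left
        by (simp add: UNIV_bool power2_eq_square algebra_simps)
      moreover have "exp (\<epsilon>\<^sup>2 * (\<Sum>x\<in>V. \<Sum>y\<in>V. W x y * (spin (\<omega> x) k * spin (\<omega> y) k)) / 2) =
        C \<epsilon> * (\<Sum>M\<in>Pow (pairs V). T \<epsilon> M * (\<Prod>x\<in>V. spin (\<omega> x) k ^ degree_in M x))" for k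
        unfolding C_def T_def by (rule high_temperature_expansion[OF fin W]) (auto simp: spin_def)
      ultimately show ?thesis by (simp only: exp_add)
    qed
    have "spin_sum V W (\<lambda>k. k) (c \<epsilon>) (\<lambda>_ i k. \<epsilon> * spin i k) =
      (\<Sum>\<omega>\<in>V \<rightarrow>\<^sub>E UNIV. \<Sum>M1\<in>Pow (pairs V). \<Sum>M2\<in>Pow (pairs V). C \<epsilon> * C \<epsilon> * (T \<epsilon> M1 * T \<epsilon> M2 *
      (\<Prod>x\<in>V. c \<epsilon> x (\<omega> x) * (spin (\<omega> x) True ^ degree_in M1 x * spin (\<omega> x) False ^ degree_in M2 x))))"
      unfolding spin_sum_def en
    proof (intro sum.cong refl)
      fix \<omega> :: "'v \<Rightarrow> bool \<times> bool"
      have r: "a * ((b * x) * (b * y)) = b * b * a * (x * y)" for a b x y :: real by simp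
      show "(\<Prod>x\<in>V. c \<epsilon> x (\<omega> x)) * ((C \<epsilon> * (\<Sum>M\<in>Pow (pairs V). T \<epsilon> M * (\<Prod>x\<in>V. spin (\<omega> x) True ^ degree_in M x))) *
        (C \<epsilon> * (\<Sum>M\<in>Pow (pairs V). T \<epsilon> M * (\<Prod>x\<in>V. spin (\<omega> x) False ^ degree_in M x)))) =
        (\<Sum>M1\<in>Pow (pairs V). \<Sum>M2\<in>Pow (pairs V). C \<epsilon> * C \<epsilon> * (T \<epsilon> M1 * T \<epsilon> M2 *
        (\<Prod>x\<in>V. c \<epsilon> x (\<omega> x) * (spin (\<omega> x) True ^ degree_in M1 x * spin (\<omega> x) False ^ degree_in M2 x))))"
        unfolding r sum_product unfolding sum_distrib_left prod.distrib
        by (intro sum.cong refl) (simp only: mult_ac)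
    qed
    also have "\<dots> = (\<Sum>M1\<in>Pow (pairs V). \<Sum>M2\<in>Pow (pairs V). \<Sum>\<omega>\<in>V \<rightarrow>\<^sub>E UNIV. C \<epsilon> * C \<epsilon> * (T \<epsilon> M1 * T \<epsilon> M2 *
      (\<Prod>x\<in>V. c \<epsilon> x (\<omega> x) * (spin (\<omega> x) True ^ degree_in M1 x * spin (\<omega> x) False ^ degree_in M2 x))))"
      by (subst sum.swap, intro sum.cong refl, subst sum.swap, rule refl)
    also have "\<dots> = (\<Sum>M1\<in>Pow (pairs V). \<Sum>M2\<in>Pow (pairs V). C \<epsilon> * C \<epsilon> * (T \<epsilon> M1 * T \<epsilon> M2 *
      (\<Prod>x\<in>V. \<Sum>i\<in>UNIV. c \<epsilon> x i * (spin i True ^ degree_in M1 x * spin i False ^ degree_in M2 x))))"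
      unfolding sum_distrib_left[symmetric] by (subst prod_sum_PiE) (use fin in auto)
    finally show ?thesis by (simp add: sum_distrib_left)
  qed
  define L where "L = (\<lambda>\<epsilon>. C \<epsilon> * C \<epsilon> * (\<Sum>M1\<in>Pow (pairs V). \<Sum>M2\<in>Pow (pairs V).
      (\<Prod>e\<in>M1. tanh (\<epsilon>\<^sup>2 * edge_weight W e) / \<epsilon>\<^sup>2) * (\<Prod>e\<in>M2. tanh (\<epsilon>\<^sup>2 * edge_weight W e) / \<epsilon>\<^sup>2) *
      (\<Prod>x\<in>V. \<epsilon> ^ (degree_in M1 x + degree_in M2 x) *
        (\<Sum>i\<in>UNIV. c \<epsilon> x i * (spin i True ^ degree_in M1 x * spin i False ^ degree_in M2 x)))))"
  have tanh_lim: "((\<lambda>\<epsilon>. tanh (\<epsilon>\<^sup>2 * a) / \<epsilon>\<^sup>2) \<longlongrightarrow> a) (at_right 0)" for a :: real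
  proof -
    have "((\<lambda>s. tanh (s * a)) has_field_derivative a) (at 0)" by (auto intro!: derivative_eq_intros)
    from filterlim_compose[OF tendsto_diff_quotient_0[OF this] filterlim_sq_at_right] show ?thesis by simp
  qed
  have C_lim: "(C \<longlongrightarrow> 1) (at_right 0)"
  proof -
    have "(C \<longlongrightarrow> exp (0\<^sup>2 * (\<Sum>x\<in>V. W x x) / 2) * (\<Prod>e\<in>pairs V. cosh (0\<^sup>2 * edge_weight W e))) (at_right 0)"
      unfolding C_def by (intro tendsto_intros) auto
    then show ?thesis by simp
  qed
  have "(L \<longlongrightarrow> 1 * 1 * matching_sum V W \<kappa>) (at_right 0)"
    unfolding L_def matching_sum_def by (intro tendsto_mult tendsto_sum tendsto_prod tanh_lim lim C_lim)
  moreover have "\<forall>\<^sub>F \<epsilon> in at_right 0. L \<epsilon> = spin_sum V W (\<lambda>k. k) (c \<epsilon>) (\<lambda>_ i k. \<epsilon> * spin i k)"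
  proof (rule eventually_mono[OF eventually_at_right_less])
    fix \<epsilon> :: real assume \<epsilon>: "0 < \<epsilon>"
    have r: "T \<epsilon> M1 * T \<epsilon> M2 * (\<Prod>x\<in>V. S x) = (\<Prod>e\<in>M1. tanh (\<epsilon>\<^sup>2 * edge_weight W e) / \<epsilon>\<^sup>2) * (\<Prod>e\<in>M2. tanh (\<epsilon>\<^sup>2 * edge_weight W e) / \<epsilon>\<^sup>2) *
      (\<Prod>x\<in>V. \<epsilon> ^ (degree_in M1 x + degree_in M2 x) * S x)"
      if M: "M1 \<in> Pow (pairs V)" "M2 \<in> Pow (pairs V)" for M1 M2 and S :: "'v \<Rightarrow> real"
    proof -
      have "(\<Prod>x\<in>V. \<epsilon> ^ (degree_in M1 x + degree_in M2 x)) = (\<epsilon>\<^sup>2) ^ card M1 * (\<epsilon>\<^sup>2) ^ card M2"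
        using M by (simp add: power_add prod.distrib power_sum_degree[OF fin])
      then show ?thesis using \<epsilon> by (simp add: prod.distrib prod_dividef T_def)
    qed
    show "L \<epsilon> = spin_sum V W (\<lambda>k. k) (c \<epsilon>) (\<lambda>_ i k. \<epsilon> * spin i k)"
      unfolding eq L_def
      by (rule arg_cong2[where f = "(*)", OF refl], rule sum.cong[OF refl], rule sum.cong[OF refl], rule r[symmetric])
  qed
  ultimately show ?thesis by (simp add: tendsto_cong)
qed

section \<open>The monomer double-dimer model as a limit of spin systems\<close>

lemma edges_subset_pairs: "edges V W \<subseteq> pairs V"
  by (auto simp: edges_def pairs_def)

lemma matching_sum_eq_dimers:
  assumes fin: "finite V" and W: "\<And>x y. x \<in> V \<Longrightarrow> y \<in> V \<Longrightarrow> W x y = W y x"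
    and nn: "\<And>x y. x \<in> V \<Longrightarrow> y \<in> V \<Longrightarrow> 0 \<le> W x y"
  shows "matching_sum V W \<kappa> = (\<Sum>m1\<in>dimer_configs V W. \<Sum>m2\<in>dimer_configs V W.
    (\<Prod>x\<in>V. \<kappa> x (occ V W m1 x) (occ V W m2 x)) * (\<Prod>e\<in>edges V W. edge_weight W e ^ (m1 e + m2 e)))"
proof -
  let ?E = "edges V W" and ?q = "edge_weight W"
  let ?supp = "\<lambda>m. {e \<in> ?E. m e = (1 :: nat)}"
  note finP = finite_pairs[OF fin] and EP = edges_subset_pairs[of V W]
  have finE: "finite ?E" using finite_subset[OF EP finP] .
  have reindex: "(\<Sum>m\<in>dimer_configs V W. F (?supp m)) = (\<Sum>M\<in>Pow ?E. F M)" for F :: "'a set set \<Rightarrow> real"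
  proof (rule sum.reindex_bij_witness[of _ "\<lambda>M. \<lambda>e\<in>?E. if e \<in> M then 1 else 0" ?supp])
    fix m assume m: "m \<in> dimer_configs V W"
    show "(\<lambda>e\<in>?E. if e \<in> ?supp m then 1 else 0) = m"
    proof
      fix e show "(\<lambda>e\<in>?E. if e \<in> ?supp m then 1 else 0) e = m e"
        using PiE_mem[OF m[unfolded dimer_configs_def], of e] PiE_arb[OF m[unfolded dimer_configs_def], of e] by auto
    qed
  qed (auto simp: dimer_configs_def)
  have occ: "occ V W m x = degree_in (?supp m) x" if m: "m \<in> dimer_configs V W" and x: "x \<in> V" for m x
  proof -
    have "occ V W m x = (\<Sum>e | e \<in> ?E \<and> x \<in> e. m e)"
      unfolding occ_def
    proof (rule sum.reindex_bij_betw[of "\<lambda>y. {x, y}"])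
      show "bij_betw (\<lambda>y. {x, y}) {y. {x, y} \<in> ?E} {e. e \<in> ?E \<and> x \<in> e}"
        by (auto simp: bij_betw_def inj_on_def doubleton_eq_iff edges_def image_iff)
    qed
    also have "\<dots> = (\<Sum>e | e \<in> ?E \<and> x \<in> e. if m e = 1 then 1 else 0)"
      using m by (intro sum.cong) (auto simp: dimer_configs_def dest!: PiE_mem)
    also have "\<dots> = degree_in (?supp m) x"
      using finE by (simp add: sum.inter_filter[symmetric] degree_in_def conj_ac)
    finally show ?thesis .
  qed
  have wt: "(\<Prod>e\<in>?E. ?q e ^ (m1 e + m2 e)) = (\<Prod>e\<in>?supp m1. ?q e) * (\<Prod>e\<in>?supp m2. ?q e)"
    if "m1 \<in> dimer_configs V W" "m2 \<in> dimer_configs V W" for m1 m2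
  proof -
    have one: "(\<Prod>e\<in>?E. ?q e ^ m e) = (\<Prod>e\<in>?supp m. ?q e)" if "m \<in> dimer_configs V W" for m
    proof -
      have "(\<Prod>e\<in>?E. ?q e ^ m e) = (\<Prod>e\<in>?E. if m e = 1 then ?q e else 1)"
        using that by (intro prod.cong) (auto simp: dimer_configs_def dest!: PiE_mem)
      then show ?thesis using finE by (simp add: prod.inter_filter)
    qed
    show ?thesis using that by (simp add: power_add prod.distrib one)
  qed
  have "(\<Sum>m1\<in>dimer_configs V W. \<Sum>m2\<in>dimer_configs V W.
    (\<Prod>x\<in>V. \<kappa> x (occ V W m1 x) (occ V W m2 x)) * (\<Prod>e\<in>?E. ?q e ^ (m1 e + m2 e))) =
    (\<Sum>m1\<in>dimer_configs V W. \<Sum>m2\<in>dimer_configs V W.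
    (\<Prod>e\<in>?supp m1. ?q e) * (\<Prod>e\<in>?supp m2. ?q e) *
    (\<Prod>x\<in>V. \<kappa> x (degree_in (?supp m1) x) (degree_in (?supp m2) x)))"
    by (intro sum.cong refl) (simp add: occ wt)
  also have "\<dots> = (\<Sum>m1\<in>dimer_configs V W. \<Sum>M2\<in>Pow ?E. (\<Prod>e\<in>?supp m1. ?q e) * (\<Prod>e\<in>M2. ?q e) *
    (\<Prod>x\<in>V. \<kappa> x (degree_in (?supp m1) x) (degree_in M2 x)))"
    by (rule sum.cong[OF refl], rule reindex)
  also have "\<dots> = (\<Sum>M1\<in>Pow ?E. \<Sum>M2\<in>Pow ?E. (\<Prod>e\<in>M1. ?q e) * (\<Prod>e\<in>M2. ?q e) *
    (\<Prod>x\<in>V. \<kappa> x (degree_in M1 x) (degree_in M2 x)))"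
    by (rule reindex)
  also have "\<dots> = matching_sum V W \<kappa>"
  proof -
    have zero: "(\<Prod>e\<in>M. ?q e) = 0" if M: "M \<in> Pow (pairs V) - Pow ?E" for M
    proof -
      obtain e where e: "e \<in> M" "e \<in> pairs V" "e \<notin> ?E" using M by auto
      obtain x y where xy: "e = {x, y}" "x \<in> V" "y \<in> V" "x \<noteq> y" using e(2) by (rule pairsE)
      then have "\<not> 0 < W x y" using e(3) by (auto simp: edges_def)
      then have "?q e = 0" using nn[OF xy(2,3)] W[OF xy(2,3)] by (simp add: xy(1) edge_weight_doubleton)
      moreover have "finite M" using M finP finite_subset by blast
      ultimately show ?thesis using e(1) by auto
    qed
    have sub: "Pow ?E \<subseteq> Pow (pairs V)" using EP by auto
    have fin2: "finite (Pow (pairs V))" using finP by simp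
    show ?thesis
      unfolding matching_sum_def
    proof (rule sum.mono_neutral_cong_left[OF fin2 sub])
      fix M1 assume "M1 \<in> Pow ?E"
      show "(\<Sum>M2\<in>Pow ?E. (\<Prod>e\<in>M1. ?q e) * (\<Prod>e\<in>M2. ?q e) * (\<Prod>x\<in>V. \<kappa> x (degree_in M1 x) (degree_in M2 x))) =
        (\<Sum>M2\<in>Pow (pairs V). (\<Prod>e\<in>M1. ?q e) * (\<Prod>e\<in>M2. ?q e) * (\<Prod>x\<in>V. \<kappa> x (degree_in M1 x) (degree_in M2 x)))"
        by (rule sum.mono_neutral_left[OF fin2 sub]) (simp add: zero)
    qed (simp add: zero)
  qed
  finally show ?thesis ..
qed

text \<open>The limit of the rescaled moments of \<open>mdd_weight\<close>.\<close>

definition mdd_site :: "real \<Rightarrow> nat \<Rightarrow> nat \<Rightarrow> real" where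
  "mdd_site a p q = (if p = 0 \<and> q = 0 then a else if p = 1 \<and> q = 1 then 1 else 0)"

text \<open>The same limit at a site with an inserted spin of the first component, which takes the
  place of the dimer of the first configuration.\<close>

definition source_site :: "nat \<Rightarrow> nat \<Rightarrow> real" where
  "source_site p q = (if p = 0 \<and> q = 1 then 1 else 0)"

lemma Z_mdd_eq:
  assumes fin: "finite V" and W: "\<And>x y. x \<in> V \<Longrightarrow> y \<in> V \<Longrightarrow> W x y = W y x"
    and nn: "\<And>x y. x \<in> V \<Longrightarrow> y \<in> V \<Longrightarrow> 0 \<le> W x y"
  shows "Z_mdd V W = matching_sum V W (\<lambda>x. mdd_site (W x x))"
proof -
  let ?D = "dimer_configs V W"
  have finD: "finite ?D" unfolding dimer_configs_def
    using finite_subset[OF edges_subset_pairs finite_pairs[OF fin]] by (intro finite_PiE) auto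
  define t where "t = (\<lambda>m1 m2. (\<Prod>x\<in>V. mdd_site (W x x) (occ V W m1 x) (occ V W m2 x)) * (\<Prod>e\<in>edges V W. edge_weight W e ^ (m1 e + m2 e)))"
  have "(\<Sum>m1\<in>?D. \<Sum>m2\<in>?D. t m1 m2) = (\<Sum>(m1, m2)\<in>?D \<times> ?D. t m1 m2)"
    by (rule sum.cartesian_product)
  also have "\<dots> = Z_mdd V W"
    unfolding Z_mdd_def
  proof (rule sum.mono_neutral_cong_right)
    show "mdd_configs V W \<subseteq> ?D \<times> ?D" by (auto simp: mdd_configs_def)
    show "\<forall>i\<in>?D \<times> ?D - mdd_configs V W. (case i of (m1, m2) \<Rightarrow> t m1 m2) = 0"
    proof
      fix i assume i: "i \<in> ?D \<times> ?D - mdd_configs V W"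
      obtain m1 m2 where m: "i = (m1, m2)" by force
      then obtain x where "x \<in> V" "\<not> (occ V W m1 x = occ V W m2 x \<and> occ V W m1 x \<in> {0, 1})"
        using i by (auto simp: mdd_configs_def)
      then have "\<exists>x\<in>V. mdd_site (W x x) (occ V W m1 x) (occ V W m2 x) = 0"
        by (intro bexI[of _ x]) (auto simp: mdd_site_def)
      then show "(case i of (m1, m2) \<Rightarrow> t m1 m2) = 0" using m fin by (auto simp: t_def)
    qed
    fix i assume i: "i \<in> mdd_configs V W"
    obtain m1 m2 where m: "i = (m1, m2)" by force
    have "(\<Prod>x\<in>V. mdd_site (W x x) (occ V W m1 x) (occ V W m2 x)) = (\<Prod>x\<in>V. W x x ^ (1 - occ V W m1 x))"
      using i m by (intro prod.cong) (auto simp: mdd_configs_def mdd_site_def)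
    then show "(case i of (m1, m2) \<Rightarrow> t m1 m2) = (case i of (m1, m2) \<Rightarrow> (\<Prod>x\<in>V. W x x ^ (1 - occ V W m1 x)) *
      (\<Prod>e\<in>edges V W. edge_weight W e ^ (m1 e + m2 e)))" using m by (simp add: t_def)
  qed (use finD in simp)
  finally show ?thesis
    using matching_sum_eq_dimers[OF fin W nn, where \<kappa> = "\<lambda>x. mdd_site (W x x)"] by (simp add: t_def)
qed

lemma G_mdd_eq:
  assumes fin: "finite V" and W: "\<And>x y. x \<in> V \<Longrightarrow> y \<in> V \<Longrightarrow> W x y = W y x"
    and nn: "\<And>x y. x \<in> V \<Longrightarrow> y \<in> V \<Longrightarrow> 0 \<le> W x y"
    and x: "x \<in> V" "y \<in> V" "x \<noteq> y"
  shows "G_mdd V W x y = matching_sum V W (\<lambda>z. if z = x \<or> z = y then source_site else mdd_site (W z z)) / Z_mdd V W"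
proof -
  let ?D = "dimer_configs V W" and ?k = "\<lambda>z. if z = x \<or> z = y then source_site else mdd_site (W z z)"
  have finD: "finite ?D" unfolding dimer_configs_def
    using finite_subset[OF edges_subset_pairs finite_pairs[OF fin]] by (intro finite_PiE) auto
  define t where "t = (\<lambda>m1 m2. (\<Prod>z\<in>V. ?k z (occ V W m1 z) (occ V W m2 z)) * (\<Prod>e\<in>edges V W. edge_weight W e ^ (m1 e + m2 e)))"
  have "(\<Sum>m1\<in>?D. \<Sum>m2\<in>?D. t m1 m2) = (\<Sum>(m1, m2)\<in>?D \<times> ?D. t m1 m2)"
    by (rule sum.cartesian_product)
  also have "\<dots> = (\<Sum>(m1, m2)\<in>mdd_configs_at V W x y. (\<Prod>z\<in>V - {x, y}. W z z ^ (1 - occ V W m1 z)) *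
        (\<Prod>e\<in>edges V W. edge_weight W e ^ (m1 e + m2 e)))"
  proof (rule sum.mono_neutral_cong_right)
    show "mdd_configs_at V W x y \<subseteq> ?D \<times> ?D" by (auto simp: mdd_configs_at_def)
    show "\<forall>i\<in>?D \<times> ?D - mdd_configs_at V W x y. (case i of (m1, m2) \<Rightarrow> t m1 m2) = 0"
    proof
      fix i assume i: "i \<in> ?D \<times> ?D - mdd_configs_at V W x y"
      obtain m1 m2 where m: "i = (m1, m2)" by force
      have "\<exists>z\<in>V. ?k z (occ V W m1 z) (occ V W m2 z) = 0"
      proof (rule ccontr)
        assume c: "\<not> ?thesis"
        then have nz: "?k z (occ V W m1 z) (occ V W m2 z) \<noteq> 0" if "z \<in> V" for z using that by blast
        have src: "p = 0 \<and> q = 1" if "source_site p q \<noteq> 0" for p q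
          using that by (auto simp: source_site_def split: if_splits)
        have reg: "p = q \<and> p \<in> {0, 1}" if "mdd_site a p q \<noteq> 0" for a p q
          using that by (auto simp: mdd_site_def split: if_splits)
        have "occ V W m1 z = occ V W m2 z \<and> occ V W m1 z \<in> {0, 1}" if "z \<in> V - {x, y}" for z
          using that nz[of z] by (intro reg[of "W z z"]) auto
        moreover have "occ V W m1 x = 0 \<and> occ V W m2 x = 1" using nz[OF x(1)] by (intro src) simp
        moreover have "occ V W m1 y = 0 \<and> occ V W m2 y = 1" using nz[OF x(2)] by (intro src) simp
        ultimately have "(m1, m2) \<in> mdd_configs_at V W x y"
          using i m unfolding mdd_configs_at_def by blast
        then show False using i m by auto
      qed
      then show "(case i of (m1, m2) \<Rightarrow> t m1 m2) = 0" using m fin by (auto simp: t_def)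
    qed
    fix i assume i: "i \<in> mdd_configs_at V W x y"
    obtain m1 m2 where m: "i = (m1, m2)" by force
    have "(\<Prod>z\<in>V. ?k z (occ V W m1 z) (occ V W m2 z)) = (\<Prod>z\<in>V - {x, y}. W z z ^ (1 - occ V W m1 z))"
    proof (rule prod.mono_neutral_cong_right[OF fin])
      fix z assume z: "z \<in> V - {x, y}"
      then have "occ V W m1 z = occ V W m2 z" "occ V W m1 z = 0 \<or> occ V W m1 z = 1"
      proof -
        have "\<forall>z\<in>V - {x, y}. occ V W m1 z = occ V W m2 z \<and> occ V W m1 z \<in> {0, 1}"
          using i m unfolding mdd_configs_at_def by blast
        from bspec[OF this z] show "occ V W m1 z = occ V W m2 z" "occ V W m1 z = 0 \<or> occ V W m1 z = 1" by auto
      qed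
      then show "?k z (occ V W m1 z) (occ V W m2 z) = W z z ^ (1 - occ V W m1 z)"
        using z by (auto simp: mdd_site_def)
    qed (use i m in \<open>auto simp: mdd_configs_at_def source_site_def\<close>)
    then show "(case i of (m1, m2) \<Rightarrow> t m1 m2) = (case i of (m1, m2) \<Rightarrow> (\<Prod>z\<in>V - {x, y}. W z z ^ (1 - occ V W m1 z)) *
      (\<Prod>e\<in>edges V W. edge_weight W e ^ (m1 e + m2 e)))" using m by (simp add: t_def)
  qed (use finD in simp)
  finally show ?thesis
    using matching_sum_eq_dimers[OF fin W nn, where \<kappa> = ?k] x by (simp add: G_mdd_def t_def)
qed

lemma matching_sum_split:
  assumes fin: "finite V" and x: "x \<in> V" and \<kappa>: "\<And>p q. \<kappa> x p q = \<kappa>1 p q + \<kappa>2 p q"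
  shows "matching_sum V W \<kappa> = matching_sum V W (\<kappa>(x := \<kappa>1)) + matching_sum V W (\<kappa>(x := \<kappa>2))"
proof -
  have upd: "(\<Prod>z\<in>V. (\<kappa>(x := k)) z (p z) (q z)) = k (p x) (q x) * (\<Prod>z\<in>V - {x}. \<kappa> z (p z) (q z))" for k p q
  proof -
    have "(\<Prod>z\<in>V - {x}. (\<kappa>(x := k)) z (p z) (q z)) = (\<Prod>z\<in>V - {x}. \<kappa> z (p z) (q z))"
      by (intro prod.cong) auto
    then show ?thesis using prod.remove[OF fin x, of "\<lambda>z. (\<kappa>(x := k)) z (p z) (q z)"] by simp
  qed
  have "(\<Prod>z\<in>V. \<kappa> z (p z) (q z)) = (\<Prod>z\<in>V. (\<kappa>(x := \<kappa>1)) z (p z) (q z)) + (\<Prod>z\<in>V. (\<kappa>(x := \<kappa>2)) z (p z) (q z))" for p q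
    unfolding upd using prod.remove[OF fin x, of "\<lambda>z. \<kappa> z (p z) (q z)"] by (simp add: \<kappa> distrib_right)
  then show ?thesis by (simp add: matching_sum_def distrib_left sum.distrib)
qed

text \<open>Adding the edge \<open>{x, y}\<close> to the first dimer configuration closes the open path from \<open>x\<close> to \<open>y\<close>.\<close>

lemma sum_source_eq_occupied:
  assumes fin: "finite V" and W: "\<And>x y. x \<in> V \<Longrightarrow> y \<in> V \<Longrightarrow> W x y = W y x" and x: "x \<in> V"
  shows "(\<Sum>y\<in>V - {x}. W x y * matching_sum V W (\<lambda>z. if z = x \<or> z = y then source_site else mdd_site (W z z))) =
    matching_sum V W ((\<lambda>z. mdd_site (W z z))(x := mdd_site 0))"
proof -
  let ?P = "Pow (pairs V)" and ?q = "edge_weight W"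
  let ?s = "\<lambda>y z. if z = x \<or> z = y then source_site else mdd_site (W z z)"
  let ?o = "(\<lambda>z. mdd_site (W z z))(x := mdd_site 0)"
  note finP = finite_pairs[OF fin]
  have finM: "finite M" if "M \<in> ?P" for M using that finP finite_subset by blast
  \<comment> \<open>The second dimer configuration is frozen, with degree function \<open>d\<close>;
    only the first edge set changes.\<close>
  have key: "(\<Sum>y\<in>V - {x}. \<Sum>M1\<in>?P. W x y * ((\<Prod>e\<in>M1. ?q e) * (\<Prod>z\<in>V. ?s y z (degree_in M1 z) (d z)))) =
    (\<Sum>M1\<in>?P. (\<Prod>e\<in>M1. ?q e) * (\<Prod>z\<in>V. ?o z (degree_in M1 z) (d z)))" for d
  proof -
    define S1 where "S1 = {(y, M). y \<in> V - {x} \<and> M \<in> ?P \<and> degree_in M x = 0 \<and> degree_in M y = 0}"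
    define S2 where "S2 = {M \<in> ?P. degree_in M x = 1 \<and> (\<forall>z\<in>V. degree_in M z \<le> 1)}"
    define S1' where "S1' = {(y, M) \<in> S1. \<forall>z\<in>V. degree_in M z \<le> 1}"
    have deg0: "degree_in M z = 0 \<longleftrightarrow> (\<forall>e\<in>M. z \<notin> e)" if "M \<in> ?P" for M z
      using finM[OF that] by (auto simp: degree_in_def)
    have deg_ins: "degree_in (insert {x, y} M) z = degree_in M z + (if z = x \<or> z = y then 1 else 0)"
      if "(y, M) \<in> S1" for y M z
    proof -
      have M: "M \<in> ?P" and "\<forall>e\<in>M. x \<notin> e" using that deg0 by (auto simp: S1_def)
      then have n: "{x, y} \<notin> M" by auto
      show ?thesis
      proof (cases "z = x \<or> z = y")
        case True
        then have "{e \<in> insert {x, y} M. z \<in> e} = insert {x, y} {e \<in> M. z \<in> e}" by auto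
        then show ?thesis using True n finM[OF M] by (simp add: degree_in_def)
      next
        case False
        then have "{e \<in> insert {x, y} M. z \<in> e} = {e \<in> M. z \<in> e}" by auto
        then show ?thesis using False by (simp add: degree_in_def)
      qed
    qed
    have pr0: "(\<Prod>z\<in>V. k z) = (0 :: real)" if "z \<in> V" "k z = 0" for k z using that fin by auto
    \<comment> \<open>Adding \<open>{x, y}\<close> is undone by removing the only edge at
      \<open>x\<close>, whose other end point gives back \<open>y\<close>.\<close>
    have bij: "bij_betw (\<lambda>(y, M). insert {x, y} M) S1' S2"
      unfolding bij_betw_def
    proof
      show "inj_on (\<lambda>(y, M). insert {x, y} M) S1'"
      proof (rule inj_onI, clarify)
        fix y M y' M' assume a: "(y, M) \<in> S1'" "(y', M') \<in> S1'" and eq: "insert {x, y} M = insert {x, y'} M'"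
        have n: "\<forall>e\<in>M. x \<notin> e" "\<forall>e\<in>M'. x \<notin> e" "y \<noteq> x" "y' \<noteq> x" using a deg0 by (auto simp: S1'_def S1_def)
        have "{x, y} \<in> insert {x, y'} M'" using eq by blast
        then have "{x, y} = {x, y'}" using n by auto
        then have "y = y'" using n by (auto simp: doubleton_eq_iff)
        moreover have "{x, y} \<notin> M" "{x, y'} \<notin> M'" using n by auto
        ultimately show "y = y' \<and> M = M'" using eq by (metis Diff_insert_absorb)
      qed
      show "(\<lambda>(y, M). insert {x, y} M) ` S1' = S2"
      proof (intro equalityI subsetI)
        fix N assume "N \<in> (\<lambda>(y, M). insert {x, y} M) ` S1'"
        then obtain y M where yM: "(y, M) \<in> S1'" "N = insert {x, y} M" by auto
        then have s: "(y, M) \<in> S1" "\<forall>z\<in>V. degree_in M z \<le> 1" by (auto simp: S1'_def)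
        then show "N \<in> S2"
          using x yM(2) deg_ins[OF s(1)] unfolding S2_def S1_def pairs_def by auto
      next
        fix N assume N: "N \<in> S2"
        then have NP: "N \<in> ?P" and d: "degree_in N x = 1" "\<forall>z\<in>V. degree_in N z \<le> 1" by (auto simp: S2_def)
        then obtain e where e: "{e \<in> N. x \<in> e} = {e}" by (auto simp: degree_in_def card_1_singleton_iff)
        then have eN: "e \<in> N" "x \<in> e" by auto
        then have "e \<in> pairs V" using NP by auto
        then obtain y where y: "e = {x, y}" "y \<in> V" "y \<noteq> x" using eN(2) by (elim pairsE) auto
        define M where "M = N - {e}"
        have "{f \<in> N. y \<in> f} = {e}"
        proof -
          have "card {f \<in> N. y \<in> f} \<le> 1" using d(2) y(2) by (auto simp: degree_in_def)
          moreover have "e \<in> {f \<in> N. y \<in> f}" using eN y by auto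
          moreover have "finite {f \<in> N. y \<in> f}" using finM[OF NP] by simp
          ultimately show ?thesis using card_le_Suc0_iff_eq[of "{f \<in> N. y \<in> f}"] by auto
        qed
        then have "\<forall>f\<in>M. x \<notin> f" "\<forall>f\<in>M. y \<notin> f" using e by (auto simp: M_def)
        moreover have MP: "M \<in> ?P" using NP by (auto simp: M_def)
        ultimately have s: "(y, M) \<in> S1" using y deg0[OF MP] by (auto simp: S1_def)
        have "degree_in M z \<le> 1" if "z \<in> V" for z
        proof -
          have "degree_in M z \<le> degree_in N z" unfolding degree_in_def M_def
            using finM[OF NP] by (intro card_mono) auto
          then show ?thesis using d(2) that by force
        qed
        then have "(y, M) \<in> S1'" using s by (auto simp: S1'_def)
        moreover have "N = insert {x, y} M" using eN y by (auto simp: M_def)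
        ultimately show "N \<in> (\<lambda>(y, M). insert {x, y} M) ` S1'" by (auto simp: image_iff intro!: bexI[of _ "(y, M)"])
      qed
    qed
    have "(\<Sum>y\<in>V - {x}. \<Sum>M1\<in>?P. W x y * ((\<Prod>e\<in>M1. ?q e) * (\<Prod>z\<in>V. ?s y z (degree_in M1 z) (d z)))) =
      (\<Sum>(y, M1)\<in>(V - {x}) \<times> ?P. W x y * ((\<Prod>e\<in>M1. ?q e) * (\<Prod>z\<in>V. ?s y z (degree_in M1 z) (d z))))"
      by (rule sum.cartesian_product)
    also have "\<dots> = (\<Sum>(y, M1)\<in>S1'. W x y * ((\<Prod>e\<in>M1. ?q e) * (\<Prod>z\<in>V. ?s y z (degree_in M1 z) (d z))))"
    proof (rule sum.mono_neutral_right)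
      show "finite ((V - {x}) \<times> ?P)" using fin finP by simp
      show "S1' \<subseteq> (V - {x}) \<times> ?P" by (auto simp: S1'_def S1_def)
      show "\<forall>i\<in>(V - {x}) \<times> ?P - S1'. (case i of (y, M1) \<Rightarrow> W x y * ((\<Prod>e\<in>M1. ?q e) * (\<Prod>z\<in>V. ?s y z (degree_in M1 z) (d z)))) = 0"
      proof
        fix i assume i: "i \<in> (V - {x}) \<times> ?P - S1'"
        obtain y M where yM: "i = (y, M)" by force
        then have a: "y \<in> V" "M \<subseteq> pairs V" "(y, M) \<notin> S1'" "y \<noteq> x" using i by auto
        then have "degree_in M x \<noteq> 0 \<or> degree_in M y \<noteq> 0 \<or> (\<exists>z\<in>V. \<not> degree_in M z \<le> 1)"
          by (auto simp: S1'_def S1_def)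
        then obtain z where "z \<in> V" "?s y z (degree_in M z) (d z) = 0"
          using a x by (auto simp: source_site_def mdd_site_def)
        then show "(case i of (y, M1) \<Rightarrow> W x y * ((\<Prod>e\<in>M1. ?q e) * (\<Prod>z\<in>V. ?s y z (degree_in M1 z) (d z)))) = 0"
          using pr0[of z "\<lambda>z. ?s y z (degree_in M z) (d z)"] unfolding yM by simp
      qed
    qed
    also have "\<dots> = (\<Sum>(y, M)\<in>S1'. (\<Prod>e\<in>insert {x, y} M. ?q e) * (\<Prod>z\<in>V. ?o z (degree_in (insert {x, y} M) z) (d z)))"
    proof (rule sum.cong[OF refl])
      fix i assume a: "i \<in> S1'"
      obtain y M where i: "i = (y, M)" by force
      then have s: "(y, M) \<in> S1" using a by (auto simp: S1'_def)
      have yV: "y \<in> V" "y \<noteq> x" and MP: "M \<in> ?P" and dx: "degree_in M x = 0" "degree_in M y = 0" using s by (auto simp: S1_def)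
      have "{x, y} \<notin> M" using deg0[OF MP] dx by auto
      then have "(\<Prod>e\<in>insert {x, y} M. ?q e) = W x y * (\<Prod>e\<in>M. ?q e)"
        using finM[OF MP] W[OF x yV(1)] by (simp add: edge_weight_doubleton)
      moreover have "(\<Prod>z\<in>V. ?o z (degree_in (insert {x, y} M) z) (d z)) = (\<Prod>z\<in>V. ?s y z (degree_in M z) (d z))"
        by (intro prod.cong refl) (use yV dx in \<open>auto simp: deg_ins[OF s] source_site_def mdd_site_def\<close>)
      ultimately show "(case i of (y, M) \<Rightarrow> W x y * ((\<Prod>e\<in>M. ?q e) * (\<Prod>z\<in>V. ?s y z (degree_in M z) (d z)))) =
        (case i of (y, M) \<Rightarrow> (\<Prod>e\<in>insert {x, y} M. ?q e) * (\<Prod>z\<in>V. ?o z (degree_in (insert {x, y} M) z) (d z)))"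
        unfolding i by simp
    qed
    also have "\<dots> = (\<Sum>N\<in>S2. (\<Prod>e\<in>N. ?q e) * (\<Prod>z\<in>V. ?o z (degree_in N z) (d z)))"
      using sum.reindex_bij_betw[OF bij, of "\<lambda>N. (\<Prod>e\<in>N. ?q e) * (\<Prod>z\<in>V. ?o z (degree_in N z) (d z))"]
      by (simp only: case_prod_unfold)
    also have "\<dots> = (\<Sum>N\<in>?P. (\<Prod>e\<in>N. ?q e) * (\<Prod>z\<in>V. ?o z (degree_in N z) (d z)))"
    proof (rule sum.mono_neutral_left)
      show "\<forall>N\<in>?P - S2. (\<Prod>e\<in>N. ?q e) * (\<Prod>z\<in>V. ?o z (degree_in N z) (d z)) = 0"
      proof
        fix N assume "N \<in> ?P - S2"
        then have "degree_in N x \<noteq> 1 \<or> (\<exists>z\<in>V. \<not> degree_in N z \<le> 1)" by (auto simp: S2_def)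
        then obtain z where "z \<in> V" "?o z (degree_in N z) (d z) = 0"
        proof (elim disjE bexE)
          assume "degree_in N x \<noteq> 1"
          then show ?thesis using that[of x] x by (auto simp: mdd_site_def)
        next
          fix z assume "z \<in> V" "\<not> degree_in N z \<le> 1"
          then show ?thesis using that[of z] by (cases "z = x") (auto simp: mdd_site_def)
        qed
        then show "(\<Prod>e\<in>N. ?q e) * (\<Prod>z\<in>V. ?o z (degree_in N z) (d z)) = 0"
          using pr0[of z "\<lambda>z. ?o z (degree_in N z) (d z)"] by simp
      qed
    qed (use finP in \<open>auto simp: S2_def\<close>)
    finally show ?thesis .
  qed
  have swap: "matching_sum V W \<kappa> = (\<Sum>M2\<in>?P. (\<Prod>e\<in>M2. ?q e) * (\<Sum>M1\<in>?P. (\<Prod>e\<in>M1. ?q e) * (\<Prod>z\<in>V. \<kappa> z (degree_in M1 z) (degree_in M2 z))))" for \<kappa>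
    unfolding matching_sum_def sum_distrib_left by (subst sum.swap) (simp only: mult_ac)
  show ?thesis
    unfolding swap key[symmetric] unfolding sum_distrib_left
    by (subst sum.swap, intro sum.cong refl) (simp only: mult_ac)
qed

text \<open>The constant part produces a monomer of weight \<open>a\<close>, the signed part a site
  covered in both configurations; dividing by \<epsilon>^2 compensates its two half-edges, and 4 is
  the number of spin values.\<close>

definition mdd_weight :: "real \<Rightarrow> real \<Rightarrow> bool \<times> bool \<Rightarrow> real" where
  "mdd_weight a \<epsilon> i = (a + spin i True * spin i False / \<epsilon>\<^sup>2) / 4"

lemma sum_bool_pair: "(\<Sum>i\<in>UNIV. f i) = f (True, True) + f (True, False) + f (False, True) + f (False, False)"
  for f :: "bool \<times> bool \<Rightarrow> real"
proof -
  have "(UNIV :: (bool \<times> bool) set) = {(True, True), (True, False), (False, True), (False, False)}" by auto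
  show ?thesis by (subst \<open>UNIV = _\<close>) simp
qed

lemma card_PiE_bool_pair: "finite V \<Longrightarrow> card (V \<rightarrow>\<^sub>E (UNIV :: (bool \<times> bool) set)) = 4 ^ card V"
  by (simp add: card_PiE card_cartesian_product flip: UNIV_Times_UNIV)

lemma spin_simps [simp]:
  "spin (True, b) True = 1" "spin (False, b) True = - 1" "spin (b, True) False = 1" "spin (b, False) False = - 1"
  by (auto simp: spin_def)

lemma tendsto_power_0: "0 < n \<Longrightarrow> ((\<lambda>\<epsilon> :: real. \<epsilon> ^ n * a) \<longlongrightarrow> 0) (at_right 0)"
proof -
  assume n: "0 < n"
  have "((\<lambda>\<epsilon> :: real. \<epsilon> ^ n * a) \<longlongrightarrow> 0 ^ n * a) (at_right 0)" by (intro tendsto_intros)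
  then show ?thesis using n by (simp add: zero_power)
qed

text \<open>By parity the moment is \<open>a\<close>, 1 / \<epsilon>^2 or 0, and the prefactor
  leaves only the smallest exponents of each parity class.\<close>

lemma mdd_weight_limit:
  "((\<lambda>\<epsilon>. \<epsilon> ^ (p + q) * (\<Sum>i\<in>UNIV. mdd_weight a \<epsilon> i * (spin i True ^ p * spin i False ^ q))) \<longlongrightarrow> mdd_site a p q) (at_right 0)"
proof -
  consider "even p" "even q" | "odd p" "odd q" | "even p \<longleftrightarrow> odd q" by blast
  then show ?thesis
  proof cases
    case 1
    then have "(\<Sum>i\<in>UNIV. mdd_weight a \<epsilon> i * (spin i True ^ p * spin i False ^ q)) = a" for \<epsilon>
      by (simp add: sum_bool_pair mdd_weight_def field_simps)
    moreover have "((\<lambda>\<epsilon>. \<epsilon> ^ (p + q) * a) \<longlongrightarrow> mdd_site a p q) (at_right 0)"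
      using 1 tendsto_power_0[of "p + q" a] by (cases "p + q = 0") (auto simp: mdd_site_def)
    ultimately show ?thesis by simp
  next
    case 2
    then have s: "(\<Sum>i\<in>UNIV. mdd_weight a \<epsilon> i * (spin i True ^ p * spin i False ^ q)) = 1 / \<epsilon>\<^sup>2" for \<epsilon>
      by (simp add: sum_bool_pair mdd_weight_def field_simps)
    have pq: "p + q = 2 + (p + q - 2)" using 2 by (auto elim!: oddE)
    have "((\<lambda>\<epsilon>. \<epsilon> ^ (p + q - 2) * 1) \<longlongrightarrow> mdd_site a p q) (at_right 0)"
    proof (cases "p + q - 2 = 0")
      case True
      then have "p = 1" "q = 1" using 2 by (auto elim!: oddE)
      then show ?thesis by (simp add: mdd_site_def)
    next
      case False
      then have "mdd_site a p q = 0" using 2 by (auto simp: mdd_site_def)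
      then show ?thesis using tendsto_power_0[of "p + q - 2" 1] False by simp
    qed
    then show ?thesis
    proof (rule Lim_transform_eventually)
      show "\<forall>\<^sub>F \<epsilon> in at_right 0. \<epsilon> ^ (p + q - 2) * 1 =
        \<epsilon> ^ (p + q) * (\<Sum>i\<in>UNIV. mdd_weight a \<epsilon> i * (spin i True ^ p * spin i False ^ q))"
        unfolding s by (rule eventually_mono[OF eventually_at_right_less], subst (2) pq) (simp add: power_add power2_eq_square)
    qed
  next
    case 3
    then have "(\<Sum>i\<in>UNIV. mdd_weight a \<epsilon> i * (spin i True ^ p * spin i False ^ q)) = 0" for \<epsilon>
      by (cases "even p") (simp_all add: sum_bool_pair mdd_weight_def field_simps)
    moreover have "mdd_site a p q = 0" using 3 by (auto simp: mdd_site_def)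
    ultimately show ?thesis by simp
  qed
qed

text \<open>The inserted spin raises the first exponent by one, so this is the limit for
  \<open>mdd_site\<close> at a shifted argument, where the monomer case cannot occur.\<close>

lemma mdd_source_limit:
  "((\<lambda>\<epsilon>. \<epsilon> ^ (p + q) * (\<Sum>i\<in>UNIV. mdd_weight a \<epsilon> i * (\<epsilon> * spin i True) * (spin i True ^ p * spin i False ^ q))) \<longlongrightarrow> source_site p q) (at_right 0)"
proof -
  have "mdd_site a (Suc p) q = source_site p q" by (auto simp: mdd_site_def source_site_def)
  then show ?thesis
    using mdd_weight_limit[of "Suc p" q a] by (simp add: sum_distrib_left mult_ac)
qed

text \<open>The components are not exchanged here and \<open>d\<close> selects the first one alone,
  so the quadratic limit reduces to the two-point limit.\<close>

lemma (in reflection_system) rp_model_mdd: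
  assumes rows: "\<And>x. x \<in> V \<Longrightarrow> (\<Sum>y\<in>V. W x y) = 1" and nn: "\<And>x y. x \<in> V \<Longrightarrow> y \<in> V \<Longrightarrow> 0 \<le> W x y"
    and diag: "\<And>x. x \<in> V \<Longrightarrow> W x x = a" and pos: "Z_mdd V W > 0"
  shows "rp_model V B R W (\<lambda>k. k) (\<lambda>i. i) (mdd_weight a) (\<lambda>k. if k then 1 else 0) (Z_mdd V W) (G_mdd V W)"
proof -
  let ?S = "\<lambda>\<epsilon>. spin_avg V W (\<lambda>k. k) \<epsilon> (mdd_weight a \<epsilon>)"
  have Zeq: "Z_mdd V W = matching_sum V W (\<lambda>x. mdd_site (W x x))" by (rule Z_mdd_eq[OF fin W_sym nn])
  have Zlim: "((\<lambda>\<epsilon>. ?S \<epsilon> (\<lambda>_. 1)) \<longlongrightarrow> Z_mdd V W) (at_right 0)"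
    unfolding spin_avg_one Zeq
    by (rule spin_sum_matching_limit[OF fin W_sym]) (simp_all add: diag mdd_weight_limit)
  have Glim: "((\<lambda>\<epsilon>. \<epsilon>\<^sup>2 * ?S \<epsilon> (\<lambda>\<omega>. spin (\<omega> x) True * spin (\<omega> y) True)) \<longlongrightarrow> Z_mdd V W * G_mdd V W x y) (at_right 0)"
    if xy: "x \<in> V" "y \<in> V" for x y
  proof (cases "x = y")
    case True
    \<comment> \<open>On the diagonal the two spins cancel, and the factor \<epsilon>^2 gives the
      value 0 that \<open>G_mdd\<close> prescribes.\<close>
    have "spin i True * spin i True = 1" for i by (simp add: spin_def)
    moreover have "((\<lambda>\<epsilon>. \<epsilon>\<^sup>2 * ?S \<epsilon> (\<lambda>_. 1)) \<longlongrightarrow> 0\<^sup>2 * Z_mdd V W) (at_right 0)"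
      by (intro tendsto_intros Zlim)
    ultimately show ?thesis using True by (simp add: G_mdd_def)
  next
    case False
    have eq: "\<epsilon>\<^sup>2 * ?S \<epsilon> (\<lambda>\<omega>. spin (\<omega> x) True * spin (\<omega> y) True) =
      spin_sum V W (\<lambda>k. k) (\<lambda>z i. mdd_weight a \<epsilon> i * ((if z = x then \<epsilon> * spin i True else 1) *
        (if z = y then \<epsilon> * spin i True else 1))) (\<lambda>_ i k. \<epsilon> * spin i k)" for \<epsilon>
      unfolding spin_sum_insert_eq_spin_avg[OF fin xy] spin_avg_scale[symmetric]
      by (rule arg_cong[where f = "?S \<epsilon>"]) (simp add: power2_eq_square mult_ac)
    have "((\<lambda>\<epsilon>. \<epsilon>\<^sup>2 * ?S \<epsilon> (\<lambda>\<omega>. spin (\<omega> x) True * spin (\<omega> y) True)) \<longlongrightarrow>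
      matching_sum V W (\<lambda>z. if z = x \<or> z = y then source_site else mdd_site (W z z))) (at_right 0)"
      unfolding eq
    proof (rule spin_sum_matching_limit[OF fin W_sym])
      fix z p q assume z: "z \<in> V"
      show "((\<lambda>\<epsilon>. \<epsilon> ^ (p + q) * (\<Sum>i\<in>UNIV. mdd_weight a \<epsilon> i * ((if z = x then \<epsilon> * spin i True else 1) *
          (if z = y then \<epsilon> * spin i True else 1)) * (spin i True ^ p * spin i False ^ q))) \<longlongrightarrow>
        (if z = x \<or> z = y then source_site else mdd_site (W z z)) p q) (at_right 0)"
        using False z mdd_source_limit[of p q a] mdd_weight_limit[of p q a] by (cases "z = x"; cases "z = y") (simp_all add: diag)
    qed
    then show ?thesis using pos by (simp add: G_mdd_eq[OF fin W_sym nn xy False])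
  qed
  show ?thesis
    by unfold_locales (use rows pos Zlim Glim in \<open>simp_all add: UNIV_bool\<close>)
qed

lemma spin_energy_scale: "spin_energy V W J (\<lambda>x k. \<epsilon> * s x k) = \<epsilon>\<^sup>2 * spin_energy V W J s"
  by (simp add: spin_energy_def sum_distrib_left power2_eq_square algebra_simps)

section \<open>Monotonicity and positivity of matching sums\<close>

lemma edge_weight_nonneg:
  assumes "e \<in> pairs V" and "\<And>x y. x \<in> V \<Longrightarrow> y \<in> V \<Longrightarrow> W x y = W y x" "\<And>x y. x \<in> V \<Longrightarrow> y \<in> V \<Longrightarrow> 0 \<le> W x y"
  shows "0 \<le> edge_weight W e"
  using assms(1) by (rule pairsE) (auto simp: edge_weight_doubleton assms(2,3))

lemma matching_sum_mono:
  assumes W: "\<And>x y. x \<in> V \<Longrightarrow> y \<in> V \<Longrightarrow> W x y = W y x" and U: "\<And>x y. x \<in> V \<Longrightarrow> y \<in> V \<Longrightarrow> U x y = U y x"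
    and le: "\<And>x y. x \<in> V \<Longrightarrow> y \<in> V \<Longrightarrow> 0 \<le> U x y \<and> U x y \<le> W x y"
    and \<kappa>: "\<And>x p q. x \<in> V \<Longrightarrow> 0 \<le> \<kappa> x p q \<and> \<kappa> x p q \<le> \<kappa>' x p q"
  shows "matching_sum V U \<kappa> \<le> matching_sum V W \<kappa>'" "0 \<le> matching_sum V U \<kappa>"
proof -
  have e: "0 \<le> edge_weight U e \<and> edge_weight U e \<le> edge_weight W e" if eP: "e \<in> pairs V" for e
  proof -
    obtain x y where "e = {x, y}" "x \<in> V" "y \<in> V" by (rule pairsE[OF eP])
    then show ?thesis using le W U by (simp add: edge_weight_doubleton)
  qed
  have p: "0 \<le> (\<Prod>e\<in>M. edge_weight U e) \<and> (\<Prod>e\<in>M. edge_weight U e) \<le> (\<Prod>e\<in>M. edge_weight W e)"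
    if "M \<in> Pow (pairs V)" for M
    using that e by (auto intro!: prod_nonneg prod_mono)
  have k: "0 \<le> (\<Prod>x\<in>V. \<kappa> x (d x) (d' x)) \<and> (\<Prod>x\<in>V. \<kappa> x (d x) (d' x)) \<le> (\<Prod>x\<in>V. \<kappa>' x (d x) (d' x))" for d d'
    using \<kappa> by (auto intro!: prod_nonneg prod_mono)
  show "matching_sum V U \<kappa> \<le> matching_sum V W \<kappa>'"
    unfolding matching_sum_def using p k
    by (intro sum_mono mult_mono) (auto intro!: mult_nonneg_nonneg intro: order_trans)
  show "0 \<le> matching_sum V U \<kappa>"
    unfolding matching_sum_def using p k by (intro sum_nonneg mult_nonneg_nonneg) auto
qed

text \<open>A fixed-point-free involution along positive weights is a perfect matching; taken in
  both configurations, it gives a positive term among nonnegative ones.\<close>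

lemma perfect_matching_positive:
  assumes fin: "finite V" and W: "\<And>x y. x \<in> V \<Longrightarrow> y \<in> V \<Longrightarrow> W x y = W y x"
    and nn: "\<And>x y. x \<in> V \<Longrightarrow> y \<in> V \<Longrightarrow> 0 \<le> W x y" and a: "\<And>x. x \<in> V \<Longrightarrow> 0 \<le> a x"
    and t: "\<And>x. x \<in> V \<Longrightarrow> t x \<in> V \<and> t x \<noteq> x \<and> t (t x) = x \<and> 0 < W x (t x)"
  shows "0 < matching_sum V W (\<lambda>x. mdd_site (a x))"
proof -
  define M where "M = (\<lambda>x. {x, t x}) ` V"
  have MP: "M \<in> Pow (pairs V)" using t by (auto simp: M_def pairs_def)
  have deg: "degree_in M x = 1" if x: "x \<in> V" for x
  proof -
    have "{e \<in> M. x \<in> e} = {{x, t x}}"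
    proof (intro equalityI subsetI)
      fix e assume "e \<in> {e \<in> M. x \<in> e}"
      then obtain y where y: "y \<in> V" "e = {y, t y}" "x = y \<or> x = t y" by (auto simp: M_def)
      then have "e = {x, t x}" using t[OF y(1)] by auto
      then show "e \<in> {{x, t x}}" by simp
    qed (use x in \<open>auto simp: M_def\<close>)
    then show ?thesis by (simp add: degree_in_def)
  qed
  have pos: "0 < (\<Prod>e\<in>M. edge_weight W e)"
  proof (rule prod_pos)
    fix e assume "e \<in> M"
    then obtain x where x: "x \<in> V" "e = {x, t x}" by (auto simp: M_def)
    then have "edge_weight W e = W x (t x)" using t[OF x(1)] W[of x "t x"] by (simp add: edge_weight_doubleton)
    then show "0 < edge_weight W e" using t[OF x(1)] by simp
  qed
  have e0: "0 \<le> (\<Prod>e\<in>M. edge_weight W e)" if "M \<in> Pow (pairs V)" for M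
  proof (rule prod_nonneg)
    fix e assume "e \<in> M"
    then have "e \<in> pairs V" using that by auto
    then show "0 \<le> edge_weight W e" by (rule edge_weight_nonneg[OF _ W nn])
  qed
  have k0: "0 \<le> (\<Prod>x\<in>V. mdd_site (a x) (d x) (d' x))" for d d'
    using a by (intro prod_nonneg) (auto simp: mdd_site_def)
  let ?t = "\<lambda>M1 M2. (\<Prod>e\<in>M1. edge_weight W e) * (\<Prod>e\<in>M2. edge_weight W e) *
     (\<Prod>x\<in>V. mdd_site (a x) (degree_in M1 x) (degree_in M2 x))"
  have t0: "0 \<le> ?t M1 M2" if "M1 \<in> Pow (pairs V)" "M2 \<in> Pow (pairs V)" for M1 M2
    using that by (intro mult_nonneg_nonneg e0 k0)
  have finP: "finite (Pow (pairs V))" using finite_pairs[OF fin] by simp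
  have "(\<Prod>x\<in>V. mdd_site (a x) (degree_in M x) (degree_in M x)) = 1"
    by (intro prod.neutral) (simp add: deg mdd_site_def)
  then have "0 < ?t M M" using pos by simp
  also have "\<dots> \<le> (\<Sum>M2\<in>Pow (pairs V). ?t M M2)"
    using t0[OF MP] by (intro member_le_sum[OF MP _ finP]) auto
  also have "\<dots> \<le> matching_sum V W (\<lambda>x. mdd_site (a x))"
    unfolding matching_sum_def
    by (rule member_le_sum[OF MP _ finP, where f = "\<lambda>M1. \<Sum>M2\<in>Pow (pairs V). ?t M1 M2"], rule sum_nonneg, rule t0) auto
  finally show ?thesis .
qed

section \<open>The monomer density\<close>

text \<open>The weight of the configurations with a monomer at \<open>x\<close>; its ratio to
  \<open>Z_mdd\<close> is the monomer density.\<close>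

definition monomer_sum :: "'v set \<Rightarrow> ('v \<Rightarrow> 'v \<Rightarrow> real) \<Rightarrow> 'v \<Rightarrow> real" where
  "monomer_sum V W x = matching_sum V W ((\<lambda>z. mdd_site (W z z))(x := (\<lambda>p q. if p = 0 \<and> q = 0 then W x x else 0)))"

text \<open>\<open>Z_mdd\<close> is split by whether \<open>x\<close> is a monomer, and closing open
  paths identifies the occupied part. The term y = x drops out since \<open>G_mdd\<close> vanishes
  there.\<close>

lemma sum_G_mdd:
  assumes fin: "finite V" and W: "\<And>x y. x \<in> V \<Longrightarrow> y \<in> V \<Longrightarrow> W x y = W y x"
    and nn: "\<And>x y. x \<in> V \<Longrightarrow> y \<in> V \<Longrightarrow> 0 \<le> W x y" and pos: "Z_mdd V W > 0" and x: "x \<in> V"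
  shows "(\<Sum>y\<in>V. W x y * G_mdd V W x y) = 1 - monomer_sum V W x / Z_mdd V W"
    "0 \<le> monomer_sum V W x" "monomer_sum V W x \<le> Z_mdd V W"
proof -
  have mdd: "mdd_site (W x x) p q = mdd_site 0 p q + (if p = 0 \<and> q = 0 then W x x else 0)" for p q
    by (simp add: mdd_site_def)
  have Zeq: "Z_mdd V W = matching_sum V W (\<lambda>x. mdd_site (W x x))" by (rule Z_mdd_eq[OF fin W nn])
  have Z: "Z_mdd V W = matching_sum V W ((\<lambda>z. mdd_site (W z z))(x := mdd_site 0)) + monomer_sum V W x"
    unfolding Zeq monomer_sum_def by (rule matching_sum_split[OF fin x]) (rule mdd)
  have "(\<Sum>y\<in>V. W x y * G_mdd V W x y) = (\<Sum>y\<in>V - {x}. W x y * G_mdd V W x y)"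
    using sum.remove[OF fin x, of "\<lambda>y. W x y * G_mdd V W x y"] by (simp add: G_mdd_def)
  also have "\<dots> = (\<Sum>y\<in>V - {x}. W x y * matching_sum V W (\<lambda>z. if z = x \<or> z = y then source_site else mdd_site (W z z))) / Z_mdd V W"
    unfolding sum_divide_distrib 
  proof (rule sum.cong[OF refl])
    fix y assume y: "y \<in> V - {x}"
    then have "G_mdd V W x y = matching_sum V W (\<lambda>z. if z = x \<or> z = y then source_site else mdd_site (W z z)) / Z_mdd V W"
      by (intro G_mdd_eq[OF fin W nn x]) auto
    then show "W x y * G_mdd V W x y = W x y * matching_sum V W (\<lambda>z. if z = x \<or> z = y then source_site else mdd_site (W z z)) / Z_mdd V W"
      by simp
  qed
  also have "\<dots> = (Z_mdd V W - monomer_sum V W x) / Z_mdd V W"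
  proof -
    have "(\<Sum>y\<in>V - {x}. W x y * matching_sum V W (\<lambda>z. if z = x \<or> z = y then source_site else mdd_site (W z z))) =
      matching_sum V W ((\<lambda>z. mdd_site (W z z))(x := mdd_site 0))" by (rule sum_source_eq_occupied[OF fin W x])
    then show ?thesis using Z by simp
  qed
  finally show "(\<Sum>y\<in>V. W x y * G_mdd V W x y) = 1 - monomer_sum V W x / Z_mdd V W"
    using pos by (simp add: diff_divide_distrib)
  have nnk: "0 \<le> matching_sum V W \<kappa>" if "\<And>z p q. z \<in> V \<Longrightarrow> 0 \<le> \<kappa> z p q" for \<kappa>
    using that nn W by (intro matching_sum_mono(2)[where W = W and \<kappa>' = \<kappa>]) auto
  show "0 \<le> monomer_sum V W x"
    unfolding monomer_sum_def using nn x by (intro nnk) (auto simp: mdd_site_def)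
  have "0 \<le> matching_sum V W ((\<lambda>z. mdd_site (W z z))(x := mdd_site 0))"
    using nn by (intro nnk) (auto simp: mdd_site_def)
  then show "monomer_sum V W x \<le> Z_mdd V W" using Z by simp
qed

context reflection_system
begin

text \<open>One site of monomer type in a system of mdd sites. With N sites, monomers alone have
  partition function a^N, so the chessboard estimate bounds the monomer sum by a Z^(1 -
  1/N).\<close>

lemma monomer_chessboard:
  assumes nn: "\<And>x y. x \<in> V \<Longrightarrow> y \<in> V \<Longrightarrow> 0 \<le> W x y"
    and diag: "\<And>x. x \<in> V \<Longrightarrow> W x x = a" and pos: "Z_mdd V W > 0" and x: "x \<in> V"
  shows "monomer_sum V W x * root (card V) (Z_mdd V W) \<le> a * Z_mdd V W"
proof (cases "a = 0")
  case True
  \<comment> \<open>The pure monomer partition function would be 0 here, which the chessboard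
    estimate excludes, but then there are no monomers at all.\<close>
  have "monomer_sum V W x = 0"
    unfolding monomer_sum_def matching_sum_def
    using x fin True diag[OF x] by (intro sum.neutral ballI) (auto intro!: bexI[of _ x] simp: prod_zero_iff)
  then show ?thesis using True by simp
next
  case False
  then have a: "a > 0" using diag[OF x] nn[OF x x] by simp
  let ?N = "card V"
  have N: "?N > 0" using fin nonempty by (simp add: card_gt_0_iff)
  \<comment> \<open>A constant weight on the four spin values retains in the limit only the moment
    of a monomer.\<close>
  define c where "c = (\<lambda>\<epsilon> b i. if b then a / 4 else mdd_weight a \<epsilon> i)"
  define m where "m = (\<lambda>p q :: nat. if p = 0 \<and> q = 0 then a else 0)"
  let ?p = "\<lambda>\<epsilon> :: real. \<lambda>_ :: bool. \<lambda>i k. \<epsilon> * spin i k"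
  let ?Z = "\<lambda>\<epsilon> b. spin_sum V W (\<lambda>k. k) (\<lambda>_. c \<epsilon> b) (\<lambda>_. ?p \<epsilon> b)"
  have Zeq: "Z_mdd V W = matching_sum V W (\<lambda>x. mdd_site (W x x))" by (rule Z_mdd_eq[OF fin W_sym nn])
  have Zf: "((\<lambda>\<epsilon>. ?Z \<epsilon> False) \<longlongrightarrow> Z_mdd V W) (at_right 0)"
    unfolding Zeq
    by (rule spin_sum_matching_limit[OF fin W_sym]) (simp_all add: c_def diag mdd_weight_limit)
  have Zt: "((\<lambda>\<epsilon>. ?Z \<epsilon> True) \<longlongrightarrow> a ^ ?N) (at_right 0)"
  proof -
    have "((\<lambda>\<epsilon>. ?Z \<epsilon> True) \<longlongrightarrow> (\<Sum>\<omega> :: 'v \<Rightarrow> bool \<times> bool\<in>V \<rightarrow>\<^sub>E UNIV. (\<Prod>x\<in>V. a / 4) * exp (0\<^sup>2 * spin_energy V W (\<lambda>k. k) (\<lambda>x. spin (\<omega> x))))) (at_right 0)"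
      unfolding spin_sum_def spin_energy_scale c_def if_True by (intro tendsto_intros)
    then show ?thesis using fin by (simp add: card_PiE_bool_pair power_divide)
  qed
  have mix: "((\<lambda>\<epsilon>. spin_sum V W (\<lambda>k. k) (\<lambda>z. c \<epsilon> (z = x)) (\<lambda>z. ?p \<epsilon> (z = x))) \<longlongrightarrow> monomer_sum V W x) (at_right 0)"
    unfolding monomer_sum_def
  proof (rule spin_sum_matching_limit[OF fin W_sym])
    fix z p q assume z: "z \<in> V"
    show "((\<lambda>\<epsilon>. \<epsilon> ^ (p + q) * (\<Sum>i\<in>UNIV. c \<epsilon> (z = x) i * (spin i True ^ p * spin i False ^ q))) \<longlongrightarrow>
      ((\<lambda>z. mdd_site (W z z))(x := \<lambda>p q. if p = 0 \<and> q = 0 then W x x else 0)) z p q) (at_right 0)"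
    proof (cases "z = x")
      case True
      have s: "(\<Sum>i\<in>UNIV. a / 4 * (spin i True ^ p * spin i False ^ q)) = (if even p \<and> even q then a else 0)"
        by (cases "even p"; cases "even q") (simp_all add: sum_bool_pair)
      have "((\<lambda>\<epsilon>. \<epsilon> ^ (p + q) * (if even p \<and> even q then a else 0)) \<longlongrightarrow> (if p = 0 \<and> q = 0 then a else 0)) (at_right 0)"
        using tendsto_power_0[of "p + q" a] by (cases "p + q = 0") auto
      then have "((\<lambda>\<epsilon>. \<epsilon> ^ (p + q) * (\<Sum>i\<in>UNIV. a / 4 * (spin i True ^ p * spin i False ^ q))) \<longlongrightarrow> (if p = 0 \<and> q = 0 then a else 0)) (at_right 0)"
        unfolding s .
      then show ?thesis by (simp only: True c_def simp_thms if_True fun_upd_same diag[OF x])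
    qed (use mdd_weight_limit[of p q a] diag[OF z] in \<open>simp add: c_def\<close>)
  qed
  have "\<forall>\<^sub>F \<epsilon> in at_right 0. 0 < ?Z \<epsilon> False" using Zf pos by (rule order_tendstoD)
  moreover have "\<forall>\<^sub>F \<epsilon> in at_right 0. 0 < ?Z \<epsilon> True" by (rule order_tendstoD(1)[OF Zt]) (use a in simp)
  ultimately have ev: "\<forall>\<^sub>F \<epsilon> in at_right 0. spin_sum V W (\<lambda>k. k) (\<lambda>z. c \<epsilon> (z = x)) (\<lambda>z. ?p \<epsilon> (z = x)) \<le>
    root ?N (?Z \<epsilon> True) * root ?N (?Z \<epsilon> False) ^ (?N - 1)"
  proof eventually_elim
    case (elim \<epsilon>)
    have "spin_sum V W (\<lambda>k. k) (\<lambda>z. c \<epsilon> (z = x)) (\<lambda>z. ?p \<epsilon> (z = x)) \<le> (\<Prod>z\<in>V. root ?N (?Z \<epsilon> (z = x)))"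
    proof (rule chessboard_estimate[where j = "\<lambda>i. i"])
      fix b show "0 < ?Z \<epsilon> b" using elim by (cases b) auto
    qed auto
    also have "\<dots> = root ?N (?Z \<epsilon> True) * (\<Prod>z\<in>V - {x}. root ?N (?Z \<epsilon> (z = x)))"
      using prod.remove[OF fin x, of "\<lambda>z. root ?N (?Z \<epsilon> (z = x))"] by simp
    also have "(\<Prod>z\<in>V - {x}. root ?N (?Z \<epsilon> (z = x))) = (\<Prod>z\<in>V - {x}. root ?N (?Z \<epsilon> False))"
      by (intro prod.cong) auto
    finally show ?case using fin x by simp
  qed
  have "monomer_sum V W x \<le> root ?N (a ^ ?N) * root ?N (Z_mdd V W) ^ (?N - 1)"
    by (rule tendsto_le[OF trivial_limit_at_right_real _ mix ev]) (intro tendsto_intros Zt Zf)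
  also have "root ?N (a ^ ?N) = a" using a N by (simp add: real_root_power_cancel)
  finally have "monomer_sum V W x * root ?N (Z_mdd V W) \<le> a * root ?N (Z_mdd V W) ^ (?N - 1) * root ?N (Z_mdd V W)"
    using pos by (intro mult_right_mono real_root_ge_zero) auto
  also have "\<dots> = a * root ?N (Z_mdd V W) ^ ?N"
    using N by (metis Suc_diff_1 mult.assoc power_Suc2)
  also have "\<dots> = a * Z_mdd V W" using N pos by simp
  finally show ?thesis .
qed

text \<open>Chessboard estimate with alternating sites: on one sublattice the dimer functional, on the other
  the evaluation at a constant spin \<open>r\<close>. The mixed partition function factorises, so this bounds the
  dimer partition function from below; \<open>r\<^sup>2 = 1 / b\<close> is optimal.\<close>

lemma bipartite_lower_bound:
  fixes par :: "'v \<Rightarrow> bool"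
  assumes nn: "\<And>x y. x \<in> V \<Longrightarrow> y \<in> V \<Longrightarrow> 0 \<le> W x y"
    and par: "\<And>x y. x \<in> V \<Longrightarrow> y \<in> V \<Longrightarrow> par x = par y \<Longrightarrow> W x y = 0"
    and rows: "\<And>x. x \<in> V \<Longrightarrow> (\<Sum>y\<in>V. W x y) = b" and b: "b > 0"
    and half: "card {x \<in> V. par x} = card {x \<in> V. \<not> par x}" and pos: "Z_mdd V W > 0"
  shows "b / exp 1 \<le> root (card V) (Z_mdd V W)"
proof -
  let ?N = "card V"
  define n where "n = card {x \<in> V. par x}"
  have N: "?N > 0" using fin nonempty by (simp add: card_gt_0_iff)
  have "V = {x \<in> V. par x} \<union> {x \<in> V. \<not> par x}" by auto
  then have "?N = card {x \<in> V. par x} + card {x \<in> V. \<not> par x}"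
    using fin by (metis (no_types, lifting) card_Un_disjoint disjoint_iff finite_Un mem_Collect_eq)
  then have n: "?N = 2 * n" "n > 0" using half N by (auto simp: n_def)
  define r where "r = 1 / sqrt b"
  have r: "r\<^sup>2 * b = 1" "(r * b)\<^sup>2 = b" using b by (simp_all add: r_def power_divide power_mult_distrib power2_eq_square)
  define c where "c = (\<lambda>\<epsilon> s i. if s then mdd_weight 0 \<epsilon> i else 1 / 4)"
  define p where "p = (\<lambda>\<epsilon> s i k. if s then \<epsilon> * spin i k else r)"
  let ?Z = "\<lambda>\<epsilon> s. spin_sum V W (\<lambda>k. k) (\<lambda>_. c \<epsilon> s) (\<lambda>_. p \<epsilon> s)"
  have Zt: "((\<lambda>\<epsilon>. ?Z \<epsilon> True) \<longlongrightarrow> Z_mdd V W) (at_right 0)"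
  proof -
    have Zeq: "Z_mdd V W = matching_sum V W (\<lambda>x. mdd_site (W x x))" by (rule Z_mdd_eq[OF fin W_sym nn])
    have "W z z = 0" if "z \<in> V" for z using par that by simp
    then show ?thesis
      unfolding Zeq p_def if_True
      by (intro spin_sum_matching_limit[OF fin W_sym]) (simp_all add: c_def mdd_weight_limit)
  qed
  \<comment> \<open>Constant spins have energy \<open>r\<^sup>2 * b\<close> = 1 per site; this is
    the origin of the e in \<open>q_const\<close>.\<close>
  have Zf: "?Z \<epsilon> False = exp ?N" for \<epsilon>
  proof -
    have "spin_energy V W (\<lambda>k. k) (\<lambda>x k. r) = ?N"
    proof -
      have "spin_energy V W (\<lambda>k. k) (\<lambda>x k. r) = (\<Sum>x\<in>V. \<Sum>y\<in>V. W x y) * r\<^sup>2"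
        by (simp add: spin_energy_def UNIV_bool power2_eq_square sum_distrib_right sum_divide_distrib)
      then show ?thesis using r(1) by (simp add: rows mult.assoc mult.commute[of b])
    qed
    then show ?thesis using fin by (simp add: spin_sum_def c_def p_def card_PiE_bool_pair power_divide)
  qed
  \<comment> \<open>\<open>W\<close> joins opposite classes only, so a dimer site sees nothing but
    the constant field of its neighbours and the sum factorises.\<close>
  have mixed: "spin_sum V W (\<lambda>k. k) (\<lambda>x. c \<epsilon> (par x)) (\<lambda>x. p \<epsilon> (par x)) = ((sinh (\<epsilon> * (r * b)) / \<epsilon>)\<^sup>2) ^ n" for \<epsilon>
  proof -
    have en: "spin_energy V W (\<lambda>k. k) (\<lambda>x. p \<epsilon> (par x) (\<omega> x)) =
      (\<Sum>x\<in>V. if par x then r * b * \<epsilon> * (spin (\<omega> x) True + spin (\<omega> x) False) else 0)" for \<omega>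
    proof -
      define m where "m = (\<lambda>x. if par x then r * \<epsilon> * (spin (\<omega> x) True + spin (\<omega> x) False) else 0)"
      have "W x y * (\<Sum>k\<in>UNIV. p \<epsilon> (par x) (\<omega> x) k * p \<epsilon> (par y) (\<omega> y) k) = W x y * m x + W x y * m y"
        if "x \<in> V" "y \<in> V" for x y
        using par[OF that] by (cases "par x"; cases "par y") (simp_all add: p_def m_def UNIV_bool algebra_simps)
      then have "spin_energy V W (\<lambda>k. k) (\<lambda>x. p \<epsilon> (par x) (\<omega> x)) =
        ((\<Sum>x\<in>V. \<Sum>y\<in>V. W x y * m x) + (\<Sum>x\<in>V. \<Sum>y\<in>V. W x y * m y)) / 2"
        by (simp add: spin_energy_def sum.distrib)
      also have "(\<Sum>x\<in>V. \<Sum>y\<in>V. W x y * m y) = (\<Sum>x\<in>V. \<Sum>y\<in>V. W x y * m x)"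
        by (subst sum.swap) (simp add: W_sym)
      also have "(\<Sum>x\<in>V. \<Sum>y\<in>V. W x y * m x) = (\<Sum>x\<in>V. b * m x)"
        by (simp add: rows flip: sum_distrib_right)
      finally show ?thesis by (simp add: m_def if_distrib mult_ac cong: if_cong)
    qed
    have "spin_sum V W (\<lambda>k. k) (\<lambda>x. c \<epsilon> (par x)) (\<lambda>x. p \<epsilon> (par x)) =
      (\<Sum>\<omega>\<in>V \<rightarrow>\<^sub>E UNIV. \<Prod>x\<in>V. c \<epsilon> (par x) (\<omega> x) * exp (if par x then r * b * \<epsilon> * (spin (\<omega> x) True + spin (\<omega> x) False) else 0))"
      unfolding spin_sum_def en using fin by (simp add: exp_sum prod.distrib)
    also have "\<dots> = (\<Prod>x\<in>V. \<Sum>i\<in>UNIV. c \<epsilon> (par x) i * exp (if par x then r * b * \<epsilon> * (spin i True + spin i False) else 0))"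
      using fin by (subst prod_sum_PiE) auto
    also have "\<dots> = (\<Prod>x\<in>V. if par x then (sinh (\<epsilon> * (r * b)) / \<epsilon>)\<^sup>2 else 1)"
    proof (rule prod.cong)
      fix x
      have exps: "exp (r * b * \<epsilon> * 2) = exp (\<epsilon> * (r * b)) * exp (\<epsilon> * (r * b))" "exp (- (r * b * \<epsilon> * 2)) = exp (- (\<epsilon> * (r * b))) * exp (- (\<epsilon> * (r * b)))"
        "exp (\<epsilon> * (r * b)) * exp (- (\<epsilon> * (r * b))) = 1"
        by (simp_all flip: exp_add)
      show "(\<Sum>i\<in>UNIV. c \<epsilon> (par x) i * exp (if par x then r * b * \<epsilon> * (spin i True + spin i False) else 0)) =
        (if par x then (sinh (\<epsilon> * (r * b)) / \<epsilon>)\<^sup>2 else 1)"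
      proof (cases "par x")
        case True
        have sq: "(sinh (\<epsilon> * (r * b)) / \<epsilon>)\<^sup>2 = (E * E + E' * E' - 2) / (4 * \<epsilon>\<^sup>2)"
          if "E = exp (\<epsilon> * (r * b))" "E' = exp (- (\<epsilon> * (r * b)))" "E * E' = 1" for E E'
        proof -
          have "(E - E')\<^sup>2 = E * E + E' * E' - 2" using that(3) by (simp add: power2_eq_square algebra_simps)
          moreover have "sinh (\<epsilon> * (r * b)) / \<epsilon> = (E - E') / (2 * \<epsilon>)" unfolding sinh_field_def that(1,2) by simp
          ultimately show ?thesis by (simp add: power_divide power_mult_distrib)
        qed
        show ?thesis
          using True unfolding sq[OF refl refl exps(3)] exps(1,2)[symmetric]
          by (simp add: sum_bool_pair c_def mdd_weight_def diff_divide_distrib add_divide_distrib distrib_left right_diff_distrib mult_ac)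
      qed (simp add: sum_bool_pair c_def)
    qed simp
    also have "\<dots> = ((sinh (\<epsilon> * (r * b)) / \<epsilon>)\<^sup>2) ^ n"
      using fin by (simp add: n_def prod.inter_filter[symmetric])
    finally show ?thesis .
  qed
  have "\<forall>\<^sub>F \<epsilon> in at_right 0. 0 < ?Z \<epsilon> True" using Zt pos by (rule order_tendstoD)
  then have ev: "\<forall>\<^sub>F \<epsilon> in at_right 0. ((sinh (\<epsilon> * (r * b)) / \<epsilon>)\<^sup>2) ^ n \<le> root ?N (?Z \<epsilon> True) ^ n * exp 1 ^ n"
  proof eventually_elim
    case (elim \<epsilon>)
    have "((sinh (\<epsilon> * (r * b)) / \<epsilon>)\<^sup>2) ^ n \<le> (\<Prod>x\<in>V. root ?N (?Z \<epsilon> (par x)))"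
      unfolding mixed[symmetric]
    proof (rule chessboard_estimate[where j = "\<lambda>i. i"])
      fix s show "0 < ?Z \<epsilon> s" using elim Zf by (cases s) auto
    qed auto
    also have "\<dots> = (\<Prod>x\<in>V. if par x then root ?N (?Z \<epsilon> True) else exp 1)"
    proof (rule prod.cong)
      have "root ?N (exp ?N) = exp 1" using N by (simp add: exp_of_nat_mult[of _ 1, simplified] real_root_power_cancel)
      then show "root ?N (?Z \<epsilon> (par x)) = (if par x then root ?N (?Z \<epsilon> True) else exp 1)" for x
        by (cases "par x") (simp_all add: Zf)
    qed simp
    also have "\<dots> = root ?N (?Z \<epsilon> True) ^ n * exp 1 ^ n"
      using fin half by (simp add: prod.If_cases n_def Int_def)
    finally show ?case .
  qed
  have sinh_lim: "((\<lambda>\<epsilon>. sinh (\<epsilon> * (r * b)) / \<epsilon>) \<longlongrightarrow> r * b) (at_right 0)"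
  proof -
    have "((\<lambda>s. sinh (s * (r * b))) has_field_derivative r * b) (at 0)" by (auto intro!: derivative_eq_intros)
    from tendsto_diff_quotient_0[OF this] show ?thesis by simp
  qed
  \<comment> \<open>In the limit each dimer site contributes (r b)^2 = b, and half of the sites are
    dimer sites.\<close>
  have "((r * b)\<^sup>2) ^ n \<le> root ?N (Z_mdd V W) ^ n * exp 1 ^ n"
    by (rule tendsto_le[OF trivial_limit_at_right_real _ _ ev]) (intro tendsto_intros Zt sinh_lim)+
  then have "b ^ n \<le> (root ?N (Z_mdd V W) * exp 1) ^ n" unfolding r(2) by (simp only: power_mult_distrib)
  then have "b \<le> root ?N (Z_mdd V W) * exp 1"
    using n(2) pos by (subst (asm) power_mono_iff) (use b in \<open>auto intro!: mult_nonneg_nonneg real_root_ge_zero\<close>)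
  then show ?thesis by (simp add: field_simps)
qed

end

section \<open>The discrete torus\<close>

lemma bij_betw_torus: "bij_betw (\<lambda>f. \<chi> j. f j) (PiE UNIV (\<lambda>_. {0..<int L})) (torus L :: (int ^ 'd :: finite) set)"
  by (rule bij_betw_byWitness[of _ "\<lambda>x j. x $ j"]) (auto simp: torus_def PiE_def)

lemma finite_torus [simp]: "finite (torus L :: (int ^ 'd :: finite) set)"
  using bij_betw_finite[OF bij_betw_torus, of L] by (simp add: finite_PiE)

lemma card_torus: "card (torus L :: (int ^ 'd :: finite) set) = L ^ CARD('d)"
  using bij_betw_same_card[OF bij_betw_torus, symmetric, of L] by (simp add: card_PiE)

lemma torus_rep_in [simp]: "L > 0 \<Longrightarrow> torus_rep L x \<in> torus L"
  by (auto simp: torus_rep_def torus_def)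

lemma torus_rep_id: "x \<in> torus L \<Longrightarrow> torus_rep L x = x"
  by (auto simp: torus_rep_def torus_def vec_eq_iff)

lemma torus_rep_eq_iff: "torus_rep L x = torus_rep L y \<longleftrightarrow> (\<exists>z. x = y + int L *s z)"
proof
  assume a: "torus_rep L x = torus_rep L y"
  have "x $ j mod int L = y $ j mod int L" for j
    using a by (simp add: torus_rep_def vec_eq_iff)
  then have "int L dvd x $ j - y $ j" for j by (simp add: mod_eq_dvd_iff)
  then have "\<exists>q. \<forall>j. x $ j - y $ j = int L * q j" unfolding dvd_def by metis
  then obtain q where q: "\<And>j. x $ j - y $ j = int L * q j" by blast
  then have "x = y + int L *s (\<chi> j. q j)" by (simp add: vec_eq_iff algebra_simps)
  then show "\<exists>z. x = y + int L *s z" by blast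
qed (auto simp: torus_rep_def vec_eq_iff)

lemma torus_rep_periodic: "torus_rep L (x + int L *s z) = torus_rep L x"
  using torus_rep_eq_iff by blast

lemma torus_rep_decomp: "\<exists>z. torus_rep L x = x + int L *s z"
  unfolding torus_rep_eq_iff[symmetric] by (auto simp: torus_rep_def vec_eq_iff)

lemma torus_rep_cong_add: "torus_rep L (torus_rep L x + y) = torus_rep L (x + y)"
  by (simp add: torus_rep_def vec_eq_iff mod_simps)

lemma bij_betw_torus_translate:
  assumes "L > 0"
  shows "bij_betw (\<lambda>y. torus_rep L (y + a)) (torus L) (torus L)"
  by (rule bij_betw_byWitness[of _ "\<lambda>y. torus_rep L (y - a)"])
    (use assms in \<open>auto simp: torus_rep_cong_add torus_rep_cong_add[of L _ "- a", simplified] torus_rep_id\<close>)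

lemma bij_betw_torus_lattice:
  assumes "L > 0"
  shows "bij_betw (\<lambda>(y, z). y + int L *s z) (torus L \<times> UNIV) (UNIV :: (int ^ 'd :: finite) set)"
proof (rule bij_betw_byWitness[of _ "\<lambda>x. (torus_rep L x, \<chi> j. x $ j div int L)"])
  show "\<forall>a\<in>(torus L :: (int ^ 'd) set) \<times> UNIV. (\<lambda>x. (torus_rep L x, \<chi> j. x $ j div int L)) (case a of (y, z) \<Rightarrow> y + int L *s z) = a"
  proof
    fix a :: "(int ^ 'd) \<times> (int ^ 'd)" assume a: "a \<in> torus L \<times> UNIV"
    obtain y z where yz: "a = (y, z)" by force
    have y: "y \<in> torus L" using a yz by simp
    have "(y $ j + int L * z $ j) div int L = z $ j" for j
      using y assms by (simp add: torus_def)
    then show "(\<lambda>x. (torus_rep L x, \<chi> j. x $ j div int L)) (case a of (y, z) \<Rightarrow> y + int L *s z) = a"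
      using y yz by (simp add: torus_rep_periodic torus_rep_id vec_eq_iff)
  qed
  show "\<forall>a'\<in>(UNIV :: (int ^ 'd) set). (case (torus_rep L a', \<chi> j. a' $ j div int L) of (y, z) \<Rightarrow> y + int L *s z) = a'"
    by (simp add: torus_rep_def vec_eq_iff)
qed (use assms in auto)

section \<open>Reflections of the torus\<close>

text \<open>The sites between the planes at c + 1/2 and c + 1/2 + L/2, with coordinates c + 1, ...,
  c + L/2 modulo \<open>L\<close>.\<close>

definition torus_half :: "nat \<Rightarrow> 'd \<Rightarrow> int \<Rightarrow> (int ^ 'd) set" where
  "torus_half L i c = {x \<in> torus L. (x $ i - c - 1) mod int L < int (L div 2)}"

text \<open>The reflection planes bisect bonds. For even \<open>L\<close> the equation 2 t = 2 c + 1
  has no solution modulo \<open>L\<close>, so no site is fixed.\<close>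

definition torus_refl :: "nat \<Rightarrow> 'd \<Rightarrow> int \<Rightarrow> int ^ 'd \<Rightarrow> int ^ 'd" where
  "torus_refl L i c x = torus_rep L (\<chi> j. if j = i then 2 * c + 1 - x $ j else x $ j)"

definition torus_refls :: "nat \<Rightarrow> ((int ^ 'd) set \<times> (int ^ 'd \<Rightarrow> int ^ 'd)) set" where
  "torus_refls L = {(torus_half L i c, torus_refl L i c) | i c. True}"

definition torus_bonds :: "nat \<Rightarrow> ((int ^ 'd) \<times> (int ^ 'd)) set" where
  "torus_bonds L = {(x, torus_rep L (x + axis j s)) | x j s. x \<in> torus L \<and> (s = 1 \<or> s = - 1)}"

lemma torus_refl_nth: "torus_refl L i c x $ j = (if j = i then 2 * c + 1 - x $ j else x $ j) mod int L"
  by (simp add: torus_refl_def torus_rep_def)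

lemma torus_refl_refl: "x \<in> torus L \<Longrightarrow> torus_refl L i c (torus_refl L i c x) = x"
  by (auto simp: vec_eq_iff torus_refl_nth torus_def mod_simps)

lemma mod_reflect:
  fixes t L :: int
  assumes "L > 0"
  shows "(- t - 1) mod L = L - 1 - t mod L"
proof -
  have "- t - 1 = (L - 1 - t mod L) + (- (t div L) - 1) * L"
    using div_mult_mod_eq[of t L] by (simp add: algebra_simps)
  then have "(- t - 1) mod L = (L - 1 - t mod L) mod L" by (metis mod_mult_self1)
  moreover have "0 \<le> t mod L" "t mod L < L" using assms by auto
  ultimately show ?thesis by simp
qed

text \<open>In the coordinate counted from the plane the reflection is t -> L - 1 - t, which
  exchanges the two ranges of length L/2.\<close>

lemma torus_refl_half:
  assumes L: "even L" "L > 0" and x: "x \<in> torus L"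
  shows "torus_refl L i c x \<in> torus_half L i c \<longleftrightarrow> x \<notin> torus_half L i c"
proof -
  define t where "t = x $ i - c - 1"
  have "(torus_refl L i c x $ i - c - 1) mod int L = (- t - 1) mod int L"
    by (simp add: torus_refl_nth mod_simps t_def diff_diff_eq)
  also have "\<dots> = int L - 1 - t mod int L" using L by (intro mod_reflect) simp
  finally have e: "(torus_refl L i c x $ i - c - 1) mod int L = int L - 1 - t mod int L" .
  have "int L = 2 * int (L div 2)" using L(1) by presburger
  moreover have "torus_refl L i c x \<in> torus L" using L by (simp add: torus_refl_def)
  ultimately show ?thesis using x unfolding torus_half_def mem_Collect_eq e t_def[symmetric] by auto
qed

lemma torus_bond_refl:
  assumes L: "L > 0" and b: "(x, y) \<in> torus_bonds L"
  shows "(torus_refl L i c x, torus_refl L i c y) \<in> torus_bonds L"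
proof -
  obtain j s where x: "x \<in> torus L" and s: "s = 1 \<or> s = - 1" and y: "y = torus_rep L (x + axis j s)"
    using b by (auto simp: torus_bonds_def)
  define s' where "s' = (if j = i then - s else s)"
  have "torus_refl L i c y = torus_rep L (torus_refl L i c x + axis j s')"
    unfolding vec_eq_iff
  proof
    fix l show "torus_refl L i c y $ l = torus_rep L (torus_refl L i c x + axis j s') $ l"
      by (cases "l = j"; cases "l = i")
        (auto simp: torus_refl_nth y torus_rep_def axis_def s'_def mod_simps algebra_simps)
  qed
  moreover have "s' = 1 \<or> s' = - 1" using s by (auto simp: s'_def)
  moreover have "torus_refl L i c x \<in> torus L" using L by (simp add: torus_refl_def)
  ultimately show ?thesis unfolding torus_bonds_def by blast
qed

lemma mod_succ:
  fixes t L :: int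
  assumes "L > 0"
  shows "(t + 1) mod L = (if t mod L = L - 1 then 0 else t mod L + 1)"
proof -
  have "(t + 1) mod L = (t mod L + 1) mod L" by (simp add: mod_simps)
  moreover have "0 \<le> t mod L" "t mod L < L" using assms by auto
  ultimately show ?thesis by auto
qed

text \<open>The half torus has two boundaries, between t = -1 and 0 and between t = L/2 - 1 and L/2;
  at both of them the end points of a crossing bond are mirror images.\<close>

lemma torus_bond_cross:
  assumes L: "even L" "L > 0" and b: "(x, y) \<in> torus_bonds L"
    and cross: "x \<in> torus_half L i c \<longleftrightarrow> y \<notin> torus_half L i c"
  shows "y = torus_refl L i c x"
proof -
  obtain j s where x: "x \<in> torus L" and s: "s = 1 \<or> s = - 1" and y: "y = torus_rep L (x + axis j s)"
    using b by (auto simp: torus_bonds_def)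
  have yV: "y \<in> torus L" using L by (simp add: y)
  obtain h where h: "L = 2 * h" "h > 0" using L by (auto elim!: evenE)
  have hL: "int (L div 2) = int h" using h by simp
  define t where "t = x $ i - c - 1"
  have Lp: "int L > 0" using L by simp
  note bounds = pos_mod_bound[OF Lp, of t] pos_mod_sign[OF Lp, of t]
  have yi: "(y $ i - c - 1) mod int L = (t + (if j = i then s else 0)) mod int L"
    by (simp add: y torus_rep_def axis_def t_def diff_diff_eq mod_simps) (simp add: algebra_simps)
  have ij: "j = i"
    using cross x yV by (cases "j = i") (auto simp: torus_half_def yi t_def[symmetric])
  have cr: "t mod int L < int h \<longleftrightarrow> \<not> (t + s) mod int L < int h"
    using cross x yV ij unfolding torus_half_def mem_Collect_eq yi t_def[symmetric] hL by simp
  \<comment> \<open>One condition for both boundaries and both orientations: the midpoint of the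
    bond lies on a reflection plane.\<close>
  have "int L dvd 2 * t + s + 1"
    using s
  proof
    assume s1: "s = 1"
    have m: "(t + 1) mod int L = (if t mod int L = int L - 1 then 0 else t mod int L + 1)" by (rule mod_succ[OF Lp])
    have "t mod int L = int L - 1 \<or> t mod int L = int h - 1"
      using cr bounds h unfolding s1 m by (auto split: if_splits)
    then have "int L dvd 2 * (t mod int L) + 2"
    proof
      assume "t mod int L = int L - 1"
      then have "2 * (t mod int L) + 2 = int L * 2" by simp
      then show ?thesis by (metis dvd_triv_left)
    next
      assume "t mod int L = int h - 1"
      then have "2 * (t mod int L) + 2 = int L" using h by simp
      then show ?thesis by simp
    qed
    moreover have "(2 * (t mod int L) + 2) mod int L = (2 * t + 2) mod int L"
      by (intro mod_add_cong mod_mult_cong) simp_all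
    ultimately have "int L dvd 2 * t + 2" by (simp only: dvd_eq_mod_eq_0)
    then show ?thesis using s1 by (simp add: algebra_simps)
  next
    assume s1: "s = - 1"
    have m: "t mod int L = (if (t - 1) mod int L = int L - 1 then 0 else (t - 1) mod int L + 1)"
      using mod_succ[OF Lp, of "t - 1"] by simp
    have "t mod int L = 0 \<or> t mod int L = int h"
      using cr pos_mod_bound[OF Lp, of "t - 1"] pos_mod_sign[OF Lp, of "t - 1"] m h unfolding s1 by (auto split: if_splits)
    then have "int L dvd 2 * (t mod int L)"
    proof
      assume "t mod int L = int h"
      then have "2 * (t mod int L) = int L" using h by simp
      then show ?thesis by simp
    qed simp
    moreover have "(2 * (t mod int L)) mod int L = (2 * t) mod int L"
      by (intro mod_mult_cong) simp_all
    ultimately have "int L dvd 2 * t" by (simp only: dvd_eq_mod_eq_0)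
    then show ?thesis using s1 by simp
  qed
  then have "int L dvd (x $ i + s) - (2 * c + 1 - x $ i)" by (simp add: t_def algebra_simps)
  then have "(x $ i + s) mod int L = (2 * c + 1 - x $ i) mod int L" by (simp add: mod_eq_dvd_iff)
  then show ?thesis
    using x ij by (auto simp: vec_eq_iff torus_refl_nth y torus_rep_def axis_def)
qed

lemma torus_bond_exists:
  assumes L: "even L" "L > 0" and b: "(x, y) \<in> torus_bonds L"
  shows "\<exists>(P, \<theta>)\<in>torus_refls L. x \<in> P \<longleftrightarrow> y \<notin> P"
proof -
  obtain j s where x: "x \<in> torus L" and s: "s = 1 \<or> s = - 1" and y: "y = torus_rep L (x + axis j s)"
    using b by (auto simp: torus_bonds_def)
  \<comment> \<open>The plane that bisects the given bond.\<close>
  define c where "c = (if s = 1 then x $ j else x $ j - 1)"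
  have yV: "y \<in> torus L" using L by (simp add: y)
  have "L \<ge> 2" using L by (auto elim!: evenE)
  then have h: "0 < int (L div 2)" "\<not> (- 1) mod int L < int (L div 2)" by (simp_all add: zmod_minus1 del: of_nat_div)
  have yj: "(y $ j - c - 1) mod int L = (x $ j + s - c - 1) mod int L"
    by (simp add: y torus_rep_def axis_def diff_diff_eq mod_simps)
  have "x \<in> torus_half L j c \<longleftrightarrow> y \<notin> torus_half L j c"
  proof (cases "s = 1")
    case True
    then have "(x $ j - c - 1) mod int L = - 1 mod int L" "(x $ j + s - c - 1) mod int L = 0" by (simp_all add: c_def)
    then show ?thesis unfolding torus_half_def mem_Collect_eq yj using h x yV by simp
  next
    case False
    then have "(x $ j - c - 1) mod int L = 0" "(x $ j + s - c - 1) mod int L = - 1 mod int L" using s by (auto simp: c_def)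
    then show ?thesis unfolding torus_half_def mem_Collect_eq yj using h x yV by simp
  qed
  then show ?thesis unfolding torus_refls_def by blast
qed

lemma torus_bond_connected:
  fixes s :: "int ^ 'd :: finite \<Rightarrow> real"
  assumes L: "L > 0" and s: "\<And>x y. (x, y) \<in> torus_bonds L \<Longrightarrow> s x = s y" and x: "x \<in> torus L" and y: "y \<in> torus L"
  shows "s x = s y"
proof -
  have zero: "s x = s 0" if "x \<in> torus L" "(\<Sum>j\<in>UNIV. nat (x $ j)) = n" for x n
    using that
  proof (induction n arbitrary: x)
    case 0
    then have "x = 0" by (auto simp: vec_eq_iff torus_def) (metis nat_0_iff order_antisym)
    then show ?case by simp
  next
    case (Suc n)
    then have "(\<Sum>j\<in>UNIV. nat (x $ j)) \<noteq> 0" by simp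
    then obtain j where j: "x $ j > 0" by (metis sum.neutral nat_eq_iff2 not_le_imp_less nat_0_iff)
    define y where "y = x + axis j (- 1)"
    have yj: "y $ l = x $ l - (if l = j then 1 else 0)" for l by (simp add: y_def axis_def)
    have yV: "y \<in> torus L"
      unfolding torus_def
    proof clarify
      fix l
      have "0 \<le> x $ l" "x $ l < int L" using Suc.prems(1) by (auto simp: torus_def)
      then show "0 \<le> y $ l \<and> y $ l < int L" using j by (auto simp: yj)
    qed
    have "(\<Sum>l\<in>UNIV. nat (x $ l)) = Suc (\<Sum>l\<in>UNIV. nat (y $ l))"
    proof -
      have "(\<Sum>l\<in>UNIV. nat (x $ l)) = nat (x $ j) + (\<Sum>l\<in>UNIV - {j}. nat (x $ l))" by (rule sum.remove) auto
      moreover have "(\<Sum>l\<in>UNIV. nat (y $ l)) = nat (y $ j) + (\<Sum>l\<in>UNIV - {j}. nat (y $ l))" by (rule sum.remove) auto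
      moreover have "(\<Sum>l\<in>UNIV - {j}. nat (x $ l)) = (\<Sum>l\<in>UNIV - {j}. nat (y $ l))" by (rule sum.cong) (auto simp: yj)
      moreover have "nat (x $ j) = Suc (nat (y $ j))" using j by (simp add: yj)
      ultimately show ?thesis by simp
    qed
    then have "s y = s 0" using Suc yV by simp
    moreover have "(x, torus_rep L y) \<in> torus_bonds L" unfolding y_def torus_bonds_def using Suc.prems(1) by blast
    ultimately show ?case using s torus_rep_id[OF yV] by metis
  qed
  show ?thesis using zero[OF x refl] zero[OF y refl] by simp
qed

section \<open>Averaging over boxes\<close>

text \<open>Amenability: the boundary of a large box is negligible against its volume.\<close>

lemma infsum_nonneg_of_boxes:
  fixes k :: "int ^ 'd :: finite \<Rightarrow> real"
  assumes summ: "k summable_on UNIV"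
    and box: "\<And>N. 0 < N \<Longrightarrow> 0 \<le> (\<Sum>a\<in>torus N. \<Sum>b\<in>torus N. k (b - a))"
  shows "0 \<le> infsum k UNIV"
proof (rule field_le_epsilon)
  fix e :: real assume e: "0 < e"
  have abs: "(\<lambda>x. \<bar>k x\<bar>) summable_on UNIV"
    using summable_on_iff_abs_summable_on_real[THEN iffD1, OF summ] by simp
  define A where "A = infsum (\<lambda>x. \<bar>k x\<bar>) UNIV"
  have absS: "(\<lambda>x. \<bar>k x\<bar>) summable_on X" for X by (rule summable_on_subset[OF abs subset_UNIV])
  have sumS: "k summable_on X" for X by (rule summable_on_subset[OF summ subset_UNIV])
  from has_sum_finite_approximation[OF has_sum_infsum[OF abs] e]
  obtain F where F: "finite F" "dist (sum (\<lambda>x. \<bar>k x\<bar>) F) A \<le> e" unfolding A_def by auto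
  have split: "infsum g UNIV = infsum g X + infsum g (- X)" if "\<And>X. g summable_on X" for g :: "int ^ 'd \<Rightarrow> real" and X
    using infsum_Un_disjoint[OF that[of X] that[of "- X"] Compl_disjoint] unfolding Compl_partition .
  have tail: "\<bar>infsum k X\<bar> \<le> e" if "X \<inter> F = {}" for X
  proof -
    have "(\<lambda>x. norm (k x)) summable_on X" using absS[of X] by simp
    from norm_infsum_bound[OF this] have "\<bar>infsum k X\<bar> \<le> infsum (\<lambda>x. \<bar>k x\<bar>) X" by simp
    also have "\<dots> \<le> infsum (\<lambda>x. \<bar>k x\<bar>) (- F)"
      by (rule infsum_mono_neutral[OF absS absS]) (use that in auto)
    also have "\<dots> \<le> e"
      using F split[OF absS, of F] by (simp add: A_def dist_real_def)
    finally show ?thesis .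
  qed
  have "\<exists>m. \<forall>z\<in>F. \<forall>j. \<bar>z $ j\<bar> \<le> int m"
  proof -
    have fin: "finite ((\<lambda>(z, j). nat \<bar>z $ j\<bar>) ` (F \<times> UNIV))" using F(1) by simp
    have "nat \<bar>z $ j\<bar> \<le> Max ((\<lambda>(z, j). nat \<bar>z $ j\<bar>) ` (F \<times> UNIV))" if "z \<in> F" for z j
      using that fin by (intro Max_ge) (auto simp: image_iff)
    then show ?thesis by (intro exI[of _ "Max ((\<lambda>(z, j). nat \<bar>z $ j\<bar>) ` (F \<times> UNIV))"]) (metis nat_le_iff)
  qed
  then obtain m where m: "\<And>z j. z \<in> F \<Longrightarrow> \<bar>z $ j\<bar> \<le> int m" by blast
  \<comment> \<open>The share of the box at distance at least \<open>m\<close> from its boundary,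
    which tends to 1.\<close>
  define \<rho> where "\<rho> = (\<lambda>N. ((real N - 2 * real m) / real N) ^ CARD('d))"
  have bound: "0 \<le> \<rho> N * (infsum k UNIV + e) + (1 - \<rho> N) * A" if N: "N > 2 * m" for N
  proof -
    let ?T = "torus N :: (int ^ 'd) set"
    define I where "I = {a :: int ^ 'd. \<forall>j. int m \<le> a $ j \<and> a $ j < int N - int m}"
    have I: "int m \<le> a $ j" "a $ j < int N - int m" if "a \<in> I" for a j using that by (simp_all add: I_def)
    have IT: "I \<subseteq> ?T"
    proof
      fix a assume a: "a \<in> I"
      have "0 \<le> a $ j \<and> a $ j < int N" for j using I[OF a, of j] by simp
      then show "a \<in> ?T" by (simp add: torus_def)
    qed
    have cardI: "card I = (N - 2 * m) ^ CARD('d)"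
    proof -
      have "bij_betw (\<lambda>a. a + (\<chi> j. int m)) (torus (N - 2 * m)) I"
        by (rule bij_betw_byWitness[of _ "\<lambda>a. a - (\<chi> j. int m)"])
          (use N in \<open>auto simp: I_def torus_def of_nat_diff less_diff_eq algebra_simps\<close>)
      from bij_betw_same_card[OF this] show ?thesis by (simp add: card_torus)
    qed
    have row: "(\<Sum>b\<in>?T. k (b - a)) = infsum k ((\<lambda>b. b - a) ` ?T)" for a
      by (simp add: sum.reindex inj_on_def)
    \<comment> \<open>From a point of \<open>I\<close> all of \<open>F\<close> lies within the box,
      so the row sum misses only a tail of size at most \<open>e\<close>; rows of boundary points
      are merely bounded by \<open>A\<close>.\<close>
    have inner: "(\<Sum>b\<in>?T. k (b - a)) \<le> infsum k UNIV + e" if a: "a \<in> I" for a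
    proof -
      have disj: "- ((\<lambda>b. b - a) ` ?T) \<inter> F = {}"
      proof -
        have "z \<in> (\<lambda>b. b - a) ` ?T" if z: "z \<in> F" for z
        proof (rule image_eqI[of _ _ "z + a"])
          have "0 \<le> z $ j + a $ j \<and> z $ j + a $ j < int N" for j
            using m[OF z, of j] I[OF a, of j] by (simp add: abs_le_iff)
          then show "z + a \<in> ?T" by (simp add: torus_def)
        qed simp
        then show ?thesis by blast
      qed
      show ?thesis unfolding row using split[OF sumS, of "(\<lambda>b. b - a) ` ?T"] tail[OF disj] by linarith
    qed
    have outer: "(\<Sum>b\<in>?T. k (b - a)) \<le> A" for a
    proof -
      have "infsum k ((\<lambda>b. b - a) ` ?T) \<le> infsum (\<lambda>x. \<bar>k x\<bar>) UNIV"
        by (rule infsum_mono_neutral[OF sumS abs]) auto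
      then show ?thesis unfolding row A_def .
    qed
    have "0 \<le> (\<Sum>a\<in>?T. \<Sum>b\<in>?T. k (b - a))" using N by (intro box) simp
    also have "\<dots> = (\<Sum>a\<in>?T - I. \<Sum>b\<in>?T. k (b - a)) + (\<Sum>a\<in>I. \<Sum>b\<in>?T. k (b - a))"
      by (rule sum.subset_diff[OF IT]) simp
    also have "\<dots> \<le> (\<Sum>a\<in>?T - I. A) + (\<Sum>a\<in>I. infsum k UNIV + e)"
      by (intro add_mono sum_mono outer inner)
    also have "\<dots> = (real N ^ CARD('d) - (real N - 2 * real m) ^ CARD('d)) * A + (real N - 2 * real m) ^ CARD('d) * (infsum k UNIV + e)"
    proof -
      have fI: "finite I" using IT finite_subset finite_torus by blast
      have "card I \<le> card ?T" using IT by (intro card_mono) auto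
      then have "real (card (?T - I)) = real N ^ CARD('d) - (real N - 2 * real m) ^ CARD('d)"
        using N by (simp add: card_Diff_subset[OF fI IT] cardI card_torus of_nat_diff)
      moreover have "real (card I) = (real N - 2 * real m) ^ CARD('d)" using N by (simp add: cardI of_nat_diff)
      ultimately show ?thesis by simp
    qed
    finally have "0 \<le> ((real N ^ CARD('d) - (real N - 2 * real m) ^ CARD('d)) * A + (real N - 2 * real m) ^ CARD('d) * (infsum k UNIV + e)) / real N ^ CARD('d)"
      by simp
    also have "\<dots> = \<rho> N * (infsum k UNIV + e) + (1 - \<rho> N) * A"
      using N by (simp add: \<rho>_def power_divide field_simps)
    finally show ?thesis .
  qed
  have "(\<lambda>N. (real N - 2 * real m) / real N) \<longlonglongrightarrow> 1"
  proof -
    have "(\<lambda>N. 1 - 2 * real m / real N) \<longlonglongrightarrow> 1 - 0"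
      by (intro tendsto_intros lim_const_over_n)
    moreover have "\<forall>\<^sub>F N in sequentially. 1 - 2 * real m / real N = (real N - 2 * real m) / real N"
      using eventually_gt_at_top[of 0] by eventually_elim (simp add: diff_divide_distrib)
    ultimately show ?thesis by (simp add: tendsto_cong)
  qed
  from tendsto_power[OF this, of "CARD('d)"] have rho: "\<rho> \<longlonglongrightarrow> 1" unfolding \<rho>_def by simp
  have "(\<lambda>N. \<rho> N * (infsum k UNIV + e) + (1 - \<rho> N) * A) \<longlonglongrightarrow> 1 * (infsum k UNIV + e) + (1 - 1) * A"
    by (intro tendsto_intros rho)
  then have "0 \<le> 1 * (infsum k UNIV + e) + (1 - 1) * A"
    by (rule tendsto_lowerbound) (auto intro!: eventually_mono[OF eventually_gt_at_top[of "2 * m"]] bound)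
  then show "0 \<le> infsum k UNIV + e" by simp
qed

section \<open>Admissible weights and their periodisation\<close>

lemma has_sum_finite_sum:
  fixes f :: "'a \<Rightarrow> 'b \<Rightarrow> real"
  assumes "finite F" "\<And>x. x \<in> F \<Longrightarrow> (f x has_sum s x) A"
  shows "((\<lambda>z. \<Sum>x\<in>F. f x z) has_sum (\<Sum>x\<in>F. s x)) A"
  using assms by (induction F rule: finite_induct) (auto intro!: has_sum_add)

lemma summable_on_finite_sum:
  fixes f :: "'a \<Rightarrow> 'b \<Rightarrow> real"
  assumes "finite F" "\<And>x. x \<in> F \<Longrightarrow> f x summable_on A"
  shows "(\<lambda>z. \<Sum>x\<in>F. f x z) summable_on A"
proof -
  have "((\<lambda>z. \<Sum>x\<in>F. f x z) has_sum (\<Sum>x\<in>F. infsum (f x) A)) A"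
    by (rule has_sum_finite_sum[OF assms(1) has_sum_infsum]) (rule assms(2))
  then show ?thesis by (auto simp: summable_on_def)
qed

locale lattice_weight =
  fixes w :: "int ^ 'd :: finite \<Rightarrow> int ^ 'd \<Rightarrow> real"
  assumes adm: "admissible w"
begin

lemma w_nonneg: "0 \<le> w x y" and w_sym: "w x y = w y x"
  and w_trans: "w (x + z) (y + z) = w x y" and w_generates: "group_closure {x. 0 < w 0 x} = UNIV"
  and w_sum: "(w 0 has_sum 1) UNIV" and w_OS: "OS_positive w"
  using adm by (auto simp: admissible_def)

lemma w_eq: "w x y = w 0 (y - x)"
  using w_trans[of 0 x "y - x"] by simp

lemma w_minus: "w 0 (- x) = w 0 x"
  using w_eq[of x 0] w_sym[of x 0] by simp

lemma w_summable: "(\<lambda>y. w x y) summable_on A"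
proof -
  have "w 0 summable_on UNIV" using w_sum by (auto simp: summable_on_def)
  moreover have "bij_betw (\<lambda>y. y - x) UNIV UNIV"
    by (rule bij_betw_byWitness[of _ "\<lambda>y. y + x"]) auto
  ultimately have "(\<lambda>y. w 0 (y - x)) summable_on UNIV" by (simp add: summable_on_reindex_bij_betw[of _ UNIV UNIV "w 0"])
  then have "(\<lambda>y. w x y) summable_on UNIV" by (simp add: w_eq[of x])
  then show ?thesis by (rule summable_on_subset) simp
qed

lemma inj_lattice: "L > 0 \<Longrightarrow> inj_on (\<lambda>z. y + int L *s z) (A :: (int ^ 'd) set)"
  by (auto simp: inj_on_def vec_eq_iff)

lemma w_shift_summable: "L > 0 \<Longrightarrow> (\<lambda>z. w x (y + int L *s z)) summable_on A"
  using summable_on_reindex[OF inj_lattice[where L = L and y = y and A = A], of "w x"] w_summable by (simp add: o_def)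

lemma periodised_eq: "L > 0 \<Longrightarrow> periodised L w x y = infsum (w x) (range (\<lambda>z. y + int L *s z))"
  unfolding periodised_def using infsum_reindex[OF inj_lattice[where L = L and y = y and A = UNIV], of "w x"] by (simp add: o_def)

lemma periodised_nonneg: "0 \<le> periodised L w x y"
  unfolding periodised_def by (intro infsum_nonneg w_nonneg)

lemma periodised_trans: "periodised L w (x + t) (y + t) = periodised L w x y"
  unfolding periodised_def
proof (rule infsum_cong)
  fix z show "w (x + t) (y + t + int L *s z) = w x (y + int L *s z)"
    using w_trans[of x t "y + int L *s z"] by (simp add: add_ac)
qed

lemma periodised_sym: "periodised L w x y = periodised L w y x"
proof -
  have "bij_betw (\<lambda>z :: int ^ 'd. - z) UNIV UNIV" by (rule bij_betw_byWitness[of _ "\<lambda>z. - z"]) auto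
  then have "periodised L w y x = infsum (\<lambda>z. w y (x + int L *s (- z))) UNIV"
    unfolding periodised_def by (rule infsum_reindex_bij_betw[symmetric])
  also have "\<dots> = periodised L w x y"
    unfolding periodised_def
  proof (rule infsum_cong)
    fix z :: "int ^ 'd"
    have "w y (x + int L *s (- z)) = w (x + int L *s (- z)) y" by (rule w_sym)
    also have "\<dots> = w x (y + int L *s z)"
      using w_trans[of x "int L *s (- z)" "y + int L *s z"] by (simp add: vec_eq_iff algebra_simps)
    finally show "w y (x + int L *s (- z)) = w x (y + int L *s z)" .
  qed
  finally show ?thesis ..
qed

lemma periodised_rep: "periodised L w x (torus_rep L y) = periodised L w x y"
proof -
  obtain a where a: "torus_rep L y = y + int L *s a" using torus_rep_decomp by blast
  have "bij_betw (\<lambda>z :: int ^ 'd. a + z) UNIV UNIV" by (rule bij_betw_byWitness[of _ "\<lambda>z. z - a"]) auto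
  then have "periodised L w x y = infsum (\<lambda>z. w x (y + int L *s (a + z))) UNIV"
    unfolding periodised_def by (rule infsum_reindex_bij_betw[symmetric])
  then show ?thesis
    unfolding periodised_def a by (simp add: vec.scale_right_distrib add.assoc)
qed

lemma periodised_rep_left: "periodised L w (torus_rep L x) y = periodised L w x y"
  using periodised_rep periodised_sym by metis

lemma w_le_periodised: "L > 0 \<Longrightarrow> w x y \<le> periodised L w x y"
  unfolding periodised_def
  using finite_sum_le_infsum[of "\<lambda>z. w x (y + int L *s z)" UNIV "{0}"] w_shift_summable w_nonneg by simp

text \<open>Unfolding the torus. Applied to constants it gives the row sums, to cosines the
  eigenvalues, to parity indicators the rows of the odd part.\<close>

lemma sum_periodised:
  assumes L: "L > 0" and f: "\<And>y. f (torus_rep L y) = f y" and b: "\<And>y. \<bar>f y\<bar> \<le> C"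
  shows "(\<Sum>y\<in>torus L. periodised L w x y * f y) = infsum (\<lambda>v. w 0 v * f (x + v)) UNIV"
proof -
  have fz: "f (y + int L *s z) = f y" for y z using f torus_rep_periodic by metis
  have summ: "(\<lambda>y. w x y * f y) summable_on A" for A
  proof -
    have "(\<lambda>y. w x y * C) summable_on A" using w_summable by (rule summable_on_cmult_left)
    then have "(\<lambda>y. norm (w x y * f y)) summable_on A"
      by (rule summable_on_comparison_test) (auto simp: abs_mult w_nonneg intro!: mult_left_mono b)
    then show ?thesis by (simp add: summable_on_iff_abs_summable_on_real[THEN iffD2])
  qed
  have "(\<Sum>y\<in>torus L. periodised L w x y * f y) = (\<Sum>y\<in>torus L. infsum (\<lambda>y. w x y * f y) (range (\<lambda>z. y + int L *s z)))"
  proof (rule sum.cong)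
    fix y
    have "infsum (\<lambda>y. w x y * f y) (range (\<lambda>z. y + int L *s z)) = infsum (\<lambda>z. w x (y + int L *s z) * f y) UNIV"
      using infsum_reindex[OF inj_lattice[OF L, where y = y and A = UNIV], of "\<lambda>y. w x y * f y"] by (simp add: o_def fz)
    also have "\<dots> = periodised L w x y * f y"
      unfolding periodised_def by (rule infsum_cmult_left) (rule w_shift_summable[OF L])
    finally show "periodised L w x y * f y = infsum (\<lambda>y. w x y * f y) (range (\<lambda>z. y + int L *s z))" ..
  qed simp
  also have "\<dots> = infsum (\<lambda>y. w x y * f y) (\<Union>y\<in>torus L. range (\<lambda>z. y + int L *s z))"
  proof (rule sum_infsum)
    fix y y' :: "int ^ 'd" assume y: "y \<in> torus L" "y' \<in> torus L" "y \<noteq> y'"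
    show "range (\<lambda>z. y + int L *s z) \<inter> range (\<lambda>z. y' + int L *s z) = {}"
    proof (rule ccontr)
      assume "range (\<lambda>z. y + int L *s z) \<inter> range (\<lambda>z. y' + int L *s z) \<noteq> {}"
      then obtain z z' where "y + int L *s z = y' + int L *s z'" by blast
      then have "torus_rep L y = torus_rep L y'" by (metis torus_rep_periodic)
      then show False using y by (simp add: torus_rep_id)
    qed
  qed (auto simp: summ)
  also have "(\<Union>y\<in>torus L. range (\<lambda>z. y + int L *s z)) = (UNIV :: (int ^ 'd) set)"
    using bij_betw_torus_lattice[OF L, where 'd = 'd] unfolding bij_betw_def by (force simp: image_iff)
  also have "infsum (\<lambda>y. w x y * f y) UNIV = infsum (\<lambda>v. w x (x + v) * f (x + v)) UNIV"
    by (rule infsum_reindex_bij_betw[symmetric]) (rule bij_betw_byWitness[of _ "\<lambda>y. y - x"], auto)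
  also have "\<dots> = infsum (\<lambda>v. w 0 v * f (x + v)) UNIV"
    by (simp add: w_eq[of x])
  finally show ?thesis .
qed

lemma sum_periodised_one: "L > 0 \<Longrightarrow> (\<Sum>y\<in>torus L. periodised L w x y) = 1"
  using sum_periodised[where L = L and f = "\<lambda>_. 1" and x = x and C = 1] w_sum by (simp add: infsumI)

section \<open>OS-positivity on the lattice and on the torus\<close>

lemma reflect_nth: "reflect i x $ j = (if j = i then 1 - x $ i else x $ j)"
  by (simp add: reflect_def axis_def)

text \<open>Only real weights occur, so positivity on complex functions also contains the symmetry of the
  reflected kernel, and hence the invariance under coordinate reflections.\<close>

lemma OS_sym:
  assumes x: "0 < x $ i" and y: "0 < y $ i"
  shows "w x (reflect i y) = w y (reflect i x)"
proof (cases "x = y")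
  case False
  \<comment> \<open>With the values 1 and \<open>\<i>\<close> the imaginary part of the form is the
    difference of the two kernel entries.\<close>
  define f where "f = (\<lambda>v. if v = x then 1 else if v = y then \<i> else (0 :: complex))"
  have supp: "{v. f v \<noteq> 0} = {x, y}" by (auto simp: f_def)
  have "(\<Sum>a | f a \<noteq> 0. \<Sum>b | f b \<noteq> 0. cnj (f a) * complex_of_real (w a (reflect i b)) * f b) \<in> \<real>\<^sub>\<ge>\<^sub>0"
    using w_OS[unfolded OS_positive_def, rule_format, of f i] x y by (simp add: supp half_space_def)
  then have "Im (\<Sum>a | f a \<noteq> 0. \<Sum>b | f b \<noteq> 0. cnj (f a) * complex_of_real (w a (reflect i b)) * f b) = 0"
    unfolding complex_nonneg_Reals_iff by blast
  then show ?thesis unfolding supp using False by (simp add: f_def)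
qed simp

lemma w_flip:
  "w (\<chi> j. if j = i then - x $ j else x $ j) (\<chi> j. if j = i then - y $ j else y $ j) = w x y"
proof -
  define flip where "flip = (\<lambda>x :: int ^ 'd. \<chi> j. if j = i then - x $ j else x $ j)"
  \<comment> \<open>Such a \<open>z\<close> is the displacement from \<open>axis i 1\<close> to a
    mirrored point; exchanging the two points by \<open>OS_sym\<close> turns it into
    \<open>- flip z\<close>.\<close>
  have neg: "w 0 (flip z) = w 0 z" if "z $ i < 0" for z
  proof -
    define b where "b = (\<chi> j. if j = i then - z $ i else z $ j)"
    have "w (axis i 1) (reflect i b) = w b (reflect i (axis i 1))"
      using that by (intro OS_sym) (auto simp: b_def axis_def)
    moreover have "reflect i b - axis i 1 = z" "reflect i (axis i 1) - b = - flip z"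
      by (auto simp: vec_eq_iff reflect_nth b_def axis_def flip_def)
    ultimately show ?thesis using w_eq w_minus by metis
  qed
  have "w 0 (flip z) = w 0 z" for z
  proof -
    consider "z $ i < 0" | "z $ i = 0" | "z $ i > 0" by linarith
    then show ?thesis
    proof cases
      case 2
      then have "flip z = z" by (auto simp: flip_def vec_eq_iff)
      then show ?thesis by simp
    next
      case 3
      then have "w 0 (flip (- z)) = w 0 (- z)" by (intro neg) simp
      moreover have "flip (- z) = - flip z" by (auto simp: flip_def vec_eq_iff)
      ultimately show ?thesis by (simp add: w_minus)
    qed (rule neg)
  qed
  moreover have "flip y - flip x = flip (y - x)" by (auto simp: flip_def vec_eq_iff)
  ultimately have "w (flip x) (flip y) = w x y" using w_eq by metis
  then show ?thesis by (simp add: flip_def)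
qed

text \<open>Coefficients of coinciding points are added up, so points may repeat and families
  indexed by products can be used directly.\<close>

lemma OS_family:
  assumes I: "finite I" and pt: "\<And>a. a \<in> I \<Longrightarrow> 0 < pt a $ i"
  shows "0 \<le> (\<Sum>a\<in>I. \<Sum>b\<in>I. f a * f b * w (pt a) (reflect i (pt b)))"
proof -
  define F where "F = (\<lambda>v. \<Sum>a | a \<in> I \<and> pt a = v. f a)"
  let ?S = "{v. complex_of_real (F v) \<noteq> 0}"
  have sub: "?S \<subseteq> pt ` I"
  proof
    fix v assume "v \<in> ?S"
    then have "{a. a \<in> I \<and> pt a = v} \<noteq> {}" unfolding F_def by (metis (mono_tags, lifting) mem_Collect_eq of_real_0 sum.empty)
    then show "v \<in> pt ` I" by auto
  qed
  have finS: "finite ?S" using sub I finite_subset by blast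
  have "(\<Sum>x\<in>?S. \<Sum>y\<in>?S. cnj (complex_of_real (F x)) * complex_of_real (w x (reflect i y)) * complex_of_real (F y)) \<in> \<real>\<^sub>\<ge>\<^sub>0"
    using w_OS[unfolded OS_positive_def, rule_format, of "\<lambda>v. complex_of_real (F v)" i] finS sub pt
    by (auto simp: half_space_def)
  then have "complex_of_real (\<Sum>x\<in>?S. \<Sum>y\<in>?S. F x * w x (reflect i y) * F y) \<in> \<real>\<^sub>\<ge>\<^sub>0" by simp
  then have "0 \<le> (\<Sum>x\<in>?S. \<Sum>y\<in>?S. F x * w x (reflect i y) * F y)"
    by (simp only: nonneg_Reals_of_real_iff)
  also have "\<dots> = (\<Sum>x\<in>pt ` I. \<Sum>y\<in>pt ` I. F x * w x (reflect i y) * F y)"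
    by (intro sum.mono_neutral_cong_left) (use I sub in \<open>auto intro!: sum.neutral sum.mono_neutral_left\<close>)
  also have "\<dots> = (\<Sum>x\<in>pt ` I. (\<Sum>y\<in>pt ` I. w x (reflect i y) * F y) * F x)"
    by (simp add: sum_distrib_left sum_distrib_right mult_ac)
  also have "\<dots> = (\<Sum>a\<in>I. (\<Sum>b\<in>I. w (pt a) (reflect i (pt b)) * f b) * f a)"
  proof -
    have fibre: "(\<Sum>v\<in>pt ` I. g v * F v) = (\<Sum>a\<in>I. g (pt a) * f a)" for g
    proof -
      have "(\<Sum>v\<in>pt ` I. g v * F v) = (\<Sum>v\<in>pt ` I. \<Sum>a | a \<in> I \<and> pt a = v. g (pt a) * f a)"
        unfolding F_def sum_distrib_left by (intro sum.cong refl) auto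
      then show ?thesis using sum.image_gen[OF I, of "\<lambda>a. g (pt a) * f a" pt] by simp
    qed
    show ?thesis unfolding fibre ..
  qed
  finally show ?thesis by (simp add: sum_distrib_left sum_distrib_right mult_ac)
qed

text \<open>The images with \<open>z\<^sub>i = n \<le> 0\<close>: since \<open>L\<close> is even, the points may be shifted by \<open>- L n / 2\<close> in direction
  \<open>i\<close>, which turns the displacement by \<open>L n\<close> into an ordinary reflection.\<close>

lemma slice_nonneg:
  assumes L: "even L" "L > 0" and F: "finite F" "\<And>x. x \<in> F \<Longrightarrow> 1 \<le> x $ i" and n: "n \<le> 0"
  shows "0 \<le> infsum (\<lambda>z. \<Sum>x\<in>F. \<Sum>y\<in>F. f x * f y * w x (reflect i y + int L *s z)) {z. z $ i = n}"
proof -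
  define k where "k = (\<lambda>z. \<Sum>x\<in>F. \<Sum>y\<in>F. f x * f y * w x (reflect i y + int L *s z))"
  \<comment> \<open>The slice is moved to \<open>a $ i = 0\<close> and extended by 0, so that
    averaging over boxes of the full lattice applies.\<close>
  define k0 where "k0 = (\<lambda>a. if a $ i = 0 then k (a + axis i n) else 0)"
  have ksum: "k summable_on A" for A
    unfolding k_def by (intro summable_on_finite_sum summable_on_cmult_right w_shift_summable L F)
  obtain h where h: "L = 2 * h" using L by (auto elim: evenE)
  have "0 \<le> infsum k0 UNIV"
  proof (rule infsum_nonneg_of_boxes)
    have bij: "bij_betw (\<lambda>a. a + axis i n) {a. a $ i = 0} {z. z $ i = n}"
      by (rule bij_betw_byWitness[of _ "\<lambda>a. a - axis i n"]) (auto simp: axis_def)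
    have "(\<lambda>a. k (a + axis i n)) summable_on {a. a $ i = 0}"
      using ksum summable_on_reindex_bij_betw[OF bij, of k] by simp
    then show "k0 summable_on UNIV"
      unfolding k0_def by (rule summable_on_cong_neutral[THEN iffD1, rotated -1]) auto
    fix N :: nat assume "0 < N"
    let ?T = "\<lambda>t. {a \<in> torus N. a $ i = t} :: (int ^ 'd) set"
    \<comment> \<open>The point \<open>x\<close> is translated by \<open>L\<close> times
      \<open>a\<close> across direction \<open>i\<close> and by - L n / 2 along it. As n \<le> 0 it
      stays in the half space, and the two shifts along \<open>i\<close> add up to L n after
      reflection.\<close>
    define pt where "pt = (\<lambda>(x, a). x + int L *s (\<chi> j. if j = i then 0 else a $ j) + axis i (- int h * n))"
    have pos: "0 < pt p $ i" if "p \<in> F \<times> ?T t" for p t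
    proof -
      obtain x a where p: "p = (x, a)" by force
      have "1 \<le> x $ i" using F that p by auto
      moreover have "0 \<le> - int h * n" using n by (simp add: mult_nonneg_nonpos)
      ultimately show ?thesis by (simp add: p pt_def axis_def)
    qed
    have slice: "(\<Sum>a\<in>?T t. \<Sum>b\<in>?T t. k0 (b - a)) \<ge> 0" for t
    proof -
      have eq: "w (pt (x, a)) (reflect i (pt (y, b))) = w x (reflect i y + int L *s (b - a + axis i n))"
        if "a \<in> ?T t" "b \<in> ?T t" for x y a b
      proof -
        have "reflect i (pt (y, b)) - pt (x, a) = (reflect i y + int L *s (b - a + axis i n)) - x"
          using that by (auto simp: vec_eq_iff reflect_nth pt_def axis_def h algebra_simps)
        then show ?thesis using w_eq by metis
      qed
      have "0 \<le> (\<Sum>p\<in>F \<times> ?T t. \<Sum>q\<in>F \<times> ?T t. f (fst p) * f (fst q) * w (pt p) (reflect i (pt q)))"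
        using F pos by (intro OS_family) auto
      also have "\<dots> = (\<Sum>x\<in>F. \<Sum>a\<in>?T t. \<Sum>y\<in>F. \<Sum>b\<in>?T t. f x * f y * w x (reflect i y + int L *s (b - a + axis i n)))"
        unfolding sum.cartesian_product' by (intro sum.cong refl) (simp add: eq)
      also have "\<dots> = (\<Sum>a\<in>?T t. \<Sum>x\<in>F. \<Sum>b\<in>?T t. \<Sum>y\<in>F. f x * f y * w x (reflect i y + int L *s (b - a + axis i n)))"
        by (rule trans[OF sum.swap], rule sum.cong[OF refl], rule sum.cong[OF refl], rule sum.swap)
      also have "\<dots> = (\<Sum>a\<in>?T t. \<Sum>b\<in>?T t. k (b - a + axis i n))"
        unfolding k_def by (rule sum.cong[OF refl], rule sum.swap)
      also have "\<dots> = (\<Sum>a\<in>?T t. \<Sum>b\<in>?T t. k0 (b - a))"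
        by (intro sum.cong refl) (auto simp: k0_def)
      finally show ?thesis .
    qed
    have "(\<Sum>a\<in>torus N. \<Sum>b\<in>torus N. k0 (b - a)) = (\<Sum>a\<in>torus N. \<Sum>b\<in>?T (a $ i). k0 (b - a))"
      by (intro sum.cong refl sum.mono_neutral_right) (auto simp: k0_def)
    also have "\<dots> = (\<Sum>t\<in>(\<lambda>a :: int ^ 'd. a $ i) ` torus N. \<Sum>a\<in>?T t. \<Sum>b\<in>?T (a $ i). k0 (b - a))"
      using sum.image_gen[OF finite_torus, of "\<lambda>a. \<Sum>b\<in>?T (a $ i). k0 (b - a)" N "\<lambda>a. a $ i"] by simp
    also have "\<dots> = (\<Sum>t\<in>(\<lambda>a :: int ^ 'd. a $ i) ` torus N. \<Sum>a\<in>?T t. \<Sum>b\<in>?T t. k0 (b - a))"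
      by (intro sum.cong refl) auto
    also have "\<dots> \<ge> 0" by (intro sum_nonneg slice)
    finally show "0 \<le> (\<Sum>a\<in>torus N. \<Sum>b\<in>torus N. k0 (b - a))" .
  qed
  also have "infsum k0 UNIV = infsum (\<lambda>a. k (a + axis i n)) {a. a $ i = 0}"
    by (rule infsum_cong_neutral) (auto simp: k0_def)
  also have "\<dots> = infsum k {z. z $ i = n}"
    by (rule infsum_reindex_bij_betw) (rule bij_betw_byWitness[of _ "\<lambda>a. a - axis i n"], auto simp: axis_def)
  finally show ?thesis by (simp add: k_def)
qed

text \<open>The images are sorted by n = \<open>z $ i\<close>. Slices with n \<le> 0 are nonnegative
  directly; a point reflection of the strip 1, ..., L/2 exchanges n with 1 - n and covers the
  others.\<close>

lemma periodised_psd: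
  assumes L: "even L" "L > 0" and F: "finite F" "\<And>x. x \<in> F \<Longrightarrow> 1 \<le> x $ i \<and> x $ i \<le> int (L div 2)"
  shows "0 \<le> (\<Sum>x\<in>F. \<Sum>y\<in>F. f x * f y * periodised L w x (reflect i y))"
proof -
  define k where "k = (\<lambda>z. \<Sum>x\<in>F. \<Sum>y\<in>F. f x * f y * w x (reflect i y + int L *s z))"
  have ksum: "k summable_on A" for A
    unfolding k_def by (intro summable_on_finite_sum summable_on_cmult_right w_shift_summable L F)
  have slice: "0 \<le> infsum k {z. z $ i = n}" for n
  proof (cases "n \<le> 0")
    case True
    show ?thesis unfolding k_def by (rule slice_nonneg) (use L F True in auto)
  next
    case False
    define h where "h = int (L div 2)"
    have h: "int L = 2 * h" using L(1) unfolding h_def by presburger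
    \<comment> \<open>It maps the coordinates 1, ..., L/2 in direction \<open>i\<close> onto
      themselves; here the upper bound on the points of \<open>F\<close> enters.\<close>
    define star where "star = (\<lambda>x :: int ^ 'd. - x + axis i (h + 1))"
    have ss: "star (star x) = x" for x by (simp add: star_def)
    define F' where "F' = star ` F"
    have inj: "inj_on star A" for A by (rule inj_on_inverseI[of _ star]) (rule ss)
    have bij: "bij_betw (\<lambda>z :: int ^ 'd. - z + axis i 1) {z. z $ i = 1 - n} {z. z $ i = n}"
      by (rule bij_betw_byWitness[of _ "\<lambda>z. - z + axis i 1"]) (auto simp: axis_def)
    have "0 \<le> infsum (\<lambda>z. \<Sum>x\<in>F'. \<Sum>y\<in>F'. f (star x) * f (star y) * w x (reflect i y + int L *s z)) {z. z $ i = 1 - n}"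
      using F L False by (intro slice_nonneg) (auto simp: F'_def star_def axis_def h_def)
    also have "\<dots> = infsum (\<lambda>z. k (- z + axis i 1)) {z. z $ i = 1 - n}"
    proof (rule infsum_cong)
      fix z :: "int ^ 'd"
      have "w (star x) (reflect i (star y) + int L *s z) = w x (reflect i y + int L *s (- z + axis i 1))" for x y
      proof -
        have "reflect i (star y) + int L *s z - star x = - ((reflect i y + int L *s (- z + axis i 1)) - x)"
          by (auto simp: vec_eq_iff reflect_nth star_def axis_def h algebra_simps)
        then show ?thesis using w_eq w_minus by metis
      qed
      then show "(\<Sum>x\<in>F'. \<Sum>y\<in>F'. f (star x) * f (star y) * w x (reflect i y + int L *s z)) = k (- z + axis i 1)"
        unfolding F'_def k_def by (simp add: sum.reindex[OF inj] ss)
    qed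
    also have "\<dots> = infsum k {z. z $ i = n}" by (rule infsum_reindex_bij_betw[OF bij])
    finally show ?thesis .
  qed
  have "(\<Sum>x\<in>F. \<Sum>y\<in>F. f x * f y * periodised L w x (reflect i y)) = infsum k UNIV"
  proof -
    have "(k has_sum (\<Sum>x\<in>F. \<Sum>y\<in>F. f x * f y * periodised L w x (reflect i y))) UNIV"
      unfolding k_def periodised_def
      by (intro has_sum_finite_sum has_sum_cmult_right has_sum_infsum w_shift_summable L F)
    then show ?thesis by (simp add: infsumI)
  qed
  also have "infsum k UNIV = infsum (\<lambda>n. infsum k {z. z $ i = n}) UNIV"
  proof -
    have bij: "bij_betw snd (Sigma UNIV (\<lambda>n. {z :: int ^ 'd. z $ i = n})) UNIV"
      by (rule bij_betw_byWitness[of _ "\<lambda>z. (z $ i, z)"]) auto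
    have "(\<lambda>p. k (snd p)) summable_on Sigma UNIV (\<lambda>n. {z. z $ i = n})"
      using ksum summable_on_reindex_bij_betw[OF bij, of k] by simp
    then show ?thesis
      using infsum_Sigma_banach[of "\<lambda>p. k (snd p)" UNIV "\<lambda>n. {z. z $ i = n}"] infsum_reindex_bij_betw[OF bij, of k] by simp
  qed
  also have "\<dots> \<ge> 0" by (intro infsum_nonneg slice)
  finally show ?thesis .
qed

text \<open>\<open>u\<close> unrolls the half torus to the strip 1, ..., L/2 of the lattice, where
  the torus reflection becomes \<open>reflect\<close> up to periods.\<close>

lemma torus_psd:
  assumes L: "even L" "L > 0"
  shows "psd_on (torus_half L i c) (\<lambda>x y. periodised L w x (torus_refl L i c y))"
  unfolding psd_on_def
proof
  fix f :: "int ^ 'd \<Rightarrow> real"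
  let ?P = "torus_half L i c :: (int ^ 'd) set"
  define u where "u = (\<lambda>x :: int ^ 'd. \<chi> j. if j = i then (x $ i - c - 1) mod int L + 1 else x $ j)"
  define u' where "u' = (\<lambda>x :: int ^ 'd. \<chi> j. if j = i then (x $ i + c) mod int L else x $ j)"
  have u'u: "u' (u x) = x" if "x \<in> ?P" for x
  proof -
    have "((x $ i - c - 1) mod int L + 1 + c) mod int L = x $ i mod int L"
    proof -
      have "((x $ i - c - 1) mod int L + (1 + c)) mod int L = ((x $ i - c - 1) + (1 + c)) mod int L"
        by (rule mod_add_left_eq)
      then show ?thesis by (simp add: add.assoc)
    qed
    then show ?thesis using that by (auto simp: u_def u'_def vec_eq_iff torus_half_def torus_def)
  qed
  have inj: "inj_on u ?P" by (rule inj_on_inverseI[of _ u']) (rule u'u)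
  have finP: "finite ?P" by (rule finite_subset[of _ "torus L"]) (auto simp: torus_half_def)
  have cong1: "\<exists>z. x = u x + axis i c + int L *s z" for x
  proof -
    have "torus_rep L x = torus_rep L (u x + axis i c)"
      unfolding vec_eq_iff
    proof
      fix j
      have "((x $ i - c - 1) mod int L + (1 + c)) mod int L = ((x $ i - c - 1) + (1 + c)) mod int L"
        by (rule mod_add_left_eq)
      then show "torus_rep L x $ j = torus_rep L (u x + axis i c) $ j"
        by (auto simp: torus_rep_def u_def axis_def add.assoc)
    qed
    then show ?thesis by (simp add: torus_rep_eq_iff)
  qed
  have W: "periodised L w x (torus_refl L i c y) = periodised L w (u x) (reflect i (u y))" for x y
  proof -
    have "torus_rep L x = torus_rep L (u x + axis i c)" using cong1[of x] by (simp add: torus_rep_eq_iff)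
    moreover have "torus_rep L (torus_refl L i c y) = torus_rep L (reflect i (u y) + axis i c)"
    proof -
      obtain z where z: "y = u y + axis i c + int L *s z" using cong1 by blast
      have "torus_rep L (\<chi> j. if j = i then 2 * c + 1 - y $ j else y $ j) = torus_rep L (reflect i (u y) + axis i c)"
        unfolding torus_rep_eq_iff
        by (rule exI[of _ "\<chi> j. if j = i then - z $ i else z $ j"], subst (1 2) z)
          (auto simp: vec_eq_iff reflect_nth axis_def)
      then show ?thesis by (simp add: torus_refl_def torus_rep_def)
    qed
    ultimately have "periodised L w x (torus_refl L i c y) = periodised L w (u x + axis i c) (reflect i (u y) + axis i c)"
      by (metis periodised_rep periodised_rep_left)
    then show ?thesis by (simp add: periodised_trans)
  qed
  have "0 \<le> (\<Sum>x\<in>u ` ?P. \<Sum>y\<in>u ` ?P. f (u' x) * f (u' y) * periodised L w x (reflect i y))"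
  proof (rule periodised_psd[OF L])
    fix x assume "x \<in> u ` ?P"
    then show "1 \<le> x $ i \<and> x $ i \<le> int (L div 2)" using L by (auto simp: u_def torus_half_def)
  qed (use finP in simp)
  also have "\<dots> = (\<Sum>x\<in>?P. \<Sum>y\<in>?P. f x * f y * periodised L w x (torus_refl L i c y))"
    by (simp add: sum.reindex[OF inj] u'u W)
  finally show "0 \<le> (\<Sum>x\<in>?P. \<Sum>y\<in>?P. f x * f y * periodised L w x (torus_refl L i c y))" .
qed

lemma periodised_refl: "periodised L w (torus_refl L i c x) (torus_refl L i c y) = periodised L w x y"
proof -
  define flip where "flip = (\<lambda>x :: int ^ 'd. \<chi> j. if j = i then - x $ j else x $ j)"
  have "periodised L w (torus_refl L i c x) (torus_refl L i c y) =
    periodised L w (flip x + axis i (2 * c + 1)) (flip y + axis i (2 * c + 1))"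
  proof -
    have "(\<chi> j. if j = i then 2 * c + 1 - x $ j else x $ j) = flip x + axis i (2 * c + 1)" for x :: "int ^ 'd"
      by (auto simp: vec_eq_iff flip_def axis_def)
    then show ?thesis by (simp add: torus_refl_def periodised_rep periodised_rep_left)
  qed
  also have "\<dots> = periodised L w (flip x) (flip y)" by (rule periodised_trans)
  also have "\<dots> = periodised L w x y"
  proof -
    have bij: "bij_betw flip UNIV UNIV" by (rule bij_betw_byWitness[of _ flip]) (auto simp: flip_def vec_eq_iff)
    have wflip: "w (flip a) (flip b) = w a b" for a b
      using w_flip[of i a b] by (simp add: flip_def)
    have "flip (y + int L *s z) = flip y + int L *s flip z" for z by (auto simp: flip_def vec_eq_iff)
    then have "periodised L w x y = infsum (\<lambda>z. w (flip x) (flip y + int L *s flip z)) UNIV"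
      unfolding periodised_def by (metis wflip)
    also have "\<dots> = periodised L w (flip x) (flip y)"
      unfolding periodised_def by (rule infsum_reindex_bij_betw[OF bij])
    finally show ?thesis ..
  qed
  finally show ?thesis .
qed

theorem torus_reflection_system:
  assumes L: "even L" "L > 0"
  shows "reflection_system (torus L) (torus_bonds L) (torus_refls L) (periodised L w)"
proof
  show "(torus L :: (int ^ 'd) set) \<noteq> {}" using torus_rep_in[OF L(2)] by blast
  fix P :: "(int ^ 'd) set" and \<theta> :: "int ^ 'd \<Rightarrow> int ^ 'd" assume "(P, \<theta>) \<in> torus_refls L"
  then obtain i c where P: "P = torus_half L i c" "\<theta> = torus_refl L i c" by (auto simp: torus_refls_def)
  show "P \<subseteq> torus L" by (auto simp: P torus_half_def)
  show "psd_on P (\<lambda>x y. periodised L w x (\<theta> y))" unfolding P by (rule torus_psd[OF L])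
  show "x \<in> torus L \<Longrightarrow> \<theta> x \<in> torus L" for x unfolding P using L by (simp add: torus_refl_def)
  show "x \<in> torus L \<Longrightarrow> \<theta> (\<theta> x) = x" for x unfolding P by (rule torus_refl_refl)
  show "x \<in> torus L \<Longrightarrow> (\<theta> x \<in> P) = (x \<notin> P)" for x unfolding P by (rule torus_refl_half[OF L])
  show "(x, y) \<in> torus_bonds L \<Longrightarrow> (\<theta> x, \<theta> y) \<in> torus_bonds L" for x y unfolding P by (rule torus_bond_refl[OF L(2)])
  show "(x, y) \<in> torus_bonds L \<Longrightarrow> (x \<in> P) = (y \<notin> P) \<Longrightarrow> y = \<theta> x" for x y unfolding P by (rule torus_bond_cross[OF L])
  show "periodised L w (\<theta> x) (\<theta> y) = periodised L w x y" for x y unfolding P by (rule periodised_refl)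
next
  show "torus_bonds L \<subseteq> torus L \<times> (torus L :: (int ^ 'd) set)" using L by (auto simp: torus_bonds_def)
  show "\<exists>(P, \<theta>)\<in>torus_refls L. (x \<in> P) = (y \<notin> P)" if "(x, y) \<in> torus_bonds L" for x y :: "int ^ 'd"
    by (rule torus_bond_exists[OF L that])
  show "s x = s y" if "\<And>x y. (x, y) \<in> torus_bonds L \<Longrightarrow> s x = s y" "x \<in> torus L" "y \<in> torus L"
    for s :: "int ^ 'd \<Rightarrow> real" and x y by (rule torus_bond_connected[OF L(2) that])
  show "periodised L w x y = periodised L w y x" for x y by (rule periodised_sym)
qed simp

section \<open>Parity and the odd part of the weight\<close>

definition parity :: "int ^ 'd \<Rightarrow> bool" where
  "parity x = even (\<Sum>j\<in>UNIV. x $ j)"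

text \<open>The bipartite weight whose pure dimer model bounds the partition function from below;
  its diagonal is 0, so it has no monomers.\<close>

definition odd_part :: "nat \<Rightarrow> int ^ 'd \<Rightarrow> int ^ 'd \<Rightarrow> real" where
  "odd_part L x y = (if parity x = parity y then 0 else periodised L w x y)"

lemma parity_cong:
  assumes "\<And>j. even (x $ j - y $ j)"
  shows "parity x = parity y"
proof -
  have "even (\<Sum>j\<in>UNIV. x $ j - y $ j)" using assms by (intro dvd_sum) auto
  then show ?thesis by (auto simp: parity_def sum_subtractf)
qed

lemma even_mod: "even L \<Longrightarrow> even (a mod int L) = even a"
  by (simp add: dvd_mod_iff)

lemma parity_rep: "even L \<Longrightarrow> parity (torus_rep L x) = parity x"
  by (rule parity_cong) (simp add: torus_rep_def even_mod)

lemma parity_add: "parity (x + y) = (parity x = parity y)"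
  by (auto simp: parity_def sum.distrib)

text \<open>The reflected coordinate t changes by 2 (c - t) + 1, and reduction modulo an even
  \<open>L\<close> keeps parity.\<close>

lemma parity_refl:
  assumes "even L"
  shows "parity (torus_refl L i c x) = (\<not> parity x)"
proof -
  have "parity (torus_refl L i c x) = parity (x + axis i 1)"
    by (rule parity_cong) (auto simp: torus_refl_nth even_mod assms axis_def)
  moreover have "(\<Sum>j\<in>UNIV. axis i (1 :: int) $ j) = 1" by (simp add: axis_def)
  ultimately show ?thesis by (simp add: parity_add) (simp add: parity_def)
qed

theorem torus_reflection_system_odd:
  assumes L: "even L" "L > 0"
  shows "reflection_system (torus L) (torus_bonds L) (torus_refls L) (odd_part L)"
proof -
  interpret S: reflection_system "torus L" "torus_bonds L" "torus_refls L" "periodised L w"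
    by (rule torus_reflection_system[OF L])
  show ?thesis
  proof
    fix P :: "(int ^ 'd) set" and \<theta> :: "int ^ 'd \<Rightarrow> int ^ 'd" assume R: "(P, \<theta>) \<in> torus_refls L"
    then obtain i c where P: "P = torus_half L i c" "\<theta> = torus_refl L i c" by (auto simp: torus_refls_def)
    have par: "parity (\<theta> x) = (\<not> parity x)" for x unfolding P by (rule parity_refl[OF L(1)])
    show "odd_part L (\<theta> x) (\<theta> y) = odd_part L x y" for x y
      by (simp add: odd_part_def par) (simp add: P periodised_refl)
    show "psd_on P (\<lambda>x y. odd_part L x (\<theta> y))"
      unfolding psd_on_def
    proof
      fix f :: "int ^ 'd \<Rightarrow> real"
      \<comment> \<open>The signs of \<open>f\<close> are staggered. As a reflection reverses
        parity, averaging the forms of \<open>f\<close> and \<open>g\<close> keeps exactly the terms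
        of \<open>odd_part\<close>.\<close>
      define g where "g = (\<lambda>x. if parity x then f x else - f x)"
      have "(\<Sum>x\<in>P. \<Sum>y\<in>P. f x * f y * odd_part L x (\<theta> y)) =
        ((\<Sum>x\<in>P. \<Sum>y\<in>P. f x * f y * periodised L w x (\<theta> y)) + (\<Sum>x\<in>P. \<Sum>y\<in>P. g x * g y * periodised L w x (\<theta> y))) / 2"
        unfolding sum.distrib[symmetric] sum_divide_distrib
        by (intro sum.cong refl) (auto simp: odd_part_def par g_def)
      then show "0 \<le> (\<Sum>x\<in>P. \<Sum>y\<in>P. f x * f y * odd_part L x (\<theta> y))"
        using psd_onD[OF S.W_psd[OF R], of f] psd_onD[OF S.W_psd[OF R], of g] by simp
    qed
  qed (use S.nonempty S.half S.refl_in S.refl_refl S.refl_half S.bonds S.bond_refl S.bond_cross S.bond_exists S.bond_connected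
      periodised_sym in \<open>auto simp: odd_part_def\<close>)
qed

end

section \<open>Fourier analysis on the torus\<close>

lemma lattice_dot_add: "lattice_dot k (x + y) = lattice_dot k x + lattice_dot k y"
  by (simp add: lattice_dot_def distrib_left sum.distrib)

lemma lattice_dot_minus: "lattice_dot k (- x) = - lattice_dot k x"
  by (simp add: lattice_dot_def sum_negf)

lemma lattice_dot_diff: "lattice_dot k (x - y) = lattice_dot k x - lattice_dot k y"
  using lattice_dot_add[of k x "- y"] by (simp add: lattice_dot_minus)

lemma lattice_dot_0 [simp]: "lattice_dot k 0 = 0" "lattice_dot 0 x = 0"
  by (simp_all add: lattice_dot_def)

lemma bij_betw_dual_torus:
  assumes L: "even L" "L > 0"
  shows "bij_betw (\<lambda>m. \<chi> j. 2 * pi / of_nat L * of_int (m j)) (PiE UNIV (\<lambda>_. {1 - int (L div 2)..int (L div 2)}))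
    (dual_torus L :: (real ^ 'd :: finite) set)"
  unfolding bij_betw_def
proof
  have inj1: "m = m'" if "2 * pi / of_nat L * real_of_int m = 2 * pi / of_nat L * of_int m'" for m m'
    using that L by simp
  show "inj_on (\<lambda>m. \<chi> j :: 'd. 2 * pi / of_nat L * real_of_int (m j)) (PiE UNIV (\<lambda>_. {1 - int (L div 2)..int (L div 2)}))"
    by (rule inj_onI) (auto simp: vec_eq_iff fun_eq_iff intro!: inj1)
  obtain h where h: "L = 2 * h" "h > 0" using L by (auto elim!: evenE)
  have bounds: "- pi < 2 * pi / of_nat L * of_int m \<and> 2 * pi / of_nat L * of_int m \<le> pi \<longleftrightarrow> m \<in> {1 - int (L div 2)..int (L div 2)}" for m
  proof -
    have "2 * pi / of_nat L * of_int m = pi * (of_int m / of_nat h)" using h by simp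
    moreover have "- pi < pi * t \<longleftrightarrow> - 1 < t" "pi * t \<le> pi \<longleftrightarrow> t \<le> 1" for t
      using mult_less_cancel_left_pos[OF pi_gt_zero, of "- 1" t] mult_le_cancel_left_pos[OF pi_gt_zero, of t 1] by simp_all
    moreover have "- 1 < real_of_int m / of_nat h \<longleftrightarrow> - int h < m" "real_of_int m / of_nat h \<le> 1 \<longleftrightarrow> m \<le> int h"
      using h(2) by (simp_all add: field_simps) linarith+
    ultimately have "- pi < 2 * pi / of_nat L * of_int m \<and> 2 * pi / of_nat L * of_int m \<le> pi \<longleftrightarrow> - int h < m \<and> m \<le> int h" by (simp only:)
    then show ?thesis unfolding h(1) by simp linarith
  qed
  show "(\<lambda>m. \<chi> j :: 'd. 2 * pi / of_nat L * real_of_int (m j)) ` (PiE UNIV (\<lambda>_. {1 - int (L div 2)..int (L div 2)})) = dual_torus L"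
  proof (intro equalityI subsetI)
    fix k assume "k \<in> (\<lambda>m. \<chi> j :: 'd. 2 * pi / of_nat L * real_of_int (m j)) ` (PiE UNIV (\<lambda>_. {1 - int (L div 2)..int (L div 2)}))"
    then obtain m where m': "m \<in> PiE UNIV (\<lambda>_. {1 - int (L div 2)..int (L div 2)})" and m2: "k = (\<chi> j :: 'd. 2 * pi / of_nat L * real_of_int (m j))"
      by blast
    have m: "m j \<in> {1 - int (L div 2)..int (L div 2)}" for j using m' by (rule PiE_mem) simp
    show "k \<in> dual_torus L"
      unfolding dual_torus_def mem_Collect_eq
    proof
      show "\<exists>m :: int ^ 'd. k = (\<chi> j. 2 * pi / real L * real_of_int (m $ j))"
        by (rule exI[of _ "\<chi> j. m j"]) (simp add: m2)
      show "\<forall>j. - pi < k $ j \<and> k $ j \<le> pi" using bounds m by (simp add: m2)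
    qed
  next
    fix k :: "real ^ 'd" assume k: "k \<in> dual_torus L"
    then obtain m :: "int ^ 'd" where m: "k = (\<chi> j. 2 * pi / of_nat L * of_int (m $ j))" by (auto simp: dual_torus_def)
    have "m $ j \<in> {1 - int (L div 2)..int (L div 2)}" for j
      using k bounds[of "m $ j"] by (simp add: dual_torus_def m)
    then show "k \<in> (\<lambda>m. \<chi> j :: 'd. 2 * pi / of_nat L * real_of_int (m j)) ` (PiE UNIV (\<lambda>_. {1 - int (L div 2)..int (L div 2)}))"
      unfolding m by (intro image_eqI[of _ _ "\<lambda>j. m $ j"]) auto
  qed
qed

lemma finite_dual_torus: "even L \<Longrightarrow> L > 0 \<Longrightarrow> finite (dual_torus L :: (real ^ 'd :: finite) set)"
  using bij_betw_finite[OF bij_betw_dual_torus, of L] by (simp add: finite_PiE)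

lemma sum_roots_of_unity:
  assumes L: "even L" "L > 0"
  shows "(\<Sum>m\<in>{1 - int (L div 2)..int (L div 2)}. cis (2 * pi / of_nat L * of_int m * of_int a)) = (if int L dvd a then of_nat L else 0)"
proof -
  define z where "z = cis (2 * pi / of_nat L * of_int a)"
  define c where "c = 1 - int (L div 2)"
  have "(\<Sum>m\<in>{1 - int (L div 2)..int (L div 2)}. cis (2 * pi / of_nat L * of_int m * of_int a)) =
    (\<Sum>t<L. cis (2 * pi / of_nat L * of_int (c + int t) * of_int a))"
    by (rule sum.reindex_bij_witness[of _ "\<lambda>t. c + int t" "\<lambda>m. nat (m - c)"]) (use L in \<open>auto simp: c_def elim!: evenE\<close>)
  also have "\<dots> = cis (2 * pi / of_nat L * of_int c * of_int a) * (\<Sum>t<L. z ^ t)"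
  proof -
    have "cis (2 * pi / of_nat L * of_int (c + int t) * of_int a) = cis (2 * pi / of_nat L * of_int c * of_int a) * z ^ t" for t
      unfolding z_def Complex.DeMoivre cis_mult by (rule arg_cong[where f = cis]) (simp add: algebra_simps add_divide_distrib)
    then show ?thesis by (simp only: sum_distrib_left)
  qed
  also have "\<dots> = (if int L dvd a then of_nat L else 0)"
  proof (cases "int L dvd a")
    case True
    then obtain b where b: "a = int L * b" by auto
    have 1: "cis (2 * pi / of_nat L * of_int m * of_int a) = 1" for m
    proof -
      have "2 * pi / of_nat L * of_int m * of_int a = 2 * pi * of_int (m * b)" using L by (simp add: b)
      then show ?thesis by (simp only: cis_multiple_2pi Ints_of_int)
    qed
    show ?thesis using True 1[of c] 1[of 1] by (simp add: z_def)
  next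
    case False
    have "z \<noteq> 1"
    proof
      assume "z = 1"
      then have "cos (2 * pi / of_nat L * of_int a) = 1" by (simp add: z_def complex_eq_iff)
      then obtain n :: int where "2 * pi / of_nat L * of_int a = n * 2 * pi" by (auto simp: cos_one_2pi_int)
      then have "real_of_int a = real_of_int (n * int L)" using L by (simp add: field_simps)
      then have "a = n * int L" by (simp only: of_int_eq_iff)
      then show False using False by simp
    qed
    moreover have "z ^ L = 1"
    proof -
      have "real L * (2 * pi / of_nat L * of_int a) = 2 * pi * of_int a" using L by simp
      then show ?thesis unfolding z_def Complex.DeMoivre by (simp only: cis_multiple_2pi Ints_of_int)
    qed
    ultimately show ?thesis using False by (simp add: geometric_sum)
  qed
  finally show ?thesis .
qed

lemma sum_dual_torus:
  fixes x :: "int ^ 'd :: finite"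
  assumes L: "even L" "L > 0"
  shows "(\<Sum>k\<in>dual_torus L. cos (lattice_dot k x)) = (if torus_rep L x = 0 then of_nat L ^ CARD('d) else 0)"
proof -
  let ?I = "{1 - int (L div 2)..int (L div 2)}"
  have "(\<Sum>k\<in>dual_torus L. cis (lattice_dot k x)) =
    (\<Sum>m\<in>PiE UNIV (\<lambda>_. ?I). cis (lattice_dot (\<chi> j. 2 * pi / of_nat L * of_int (m j)) x))"
    by (rule sum.reindex_bij_betw[OF bij_betw_dual_torus[OF L], symmetric])
  also have "\<dots> = (\<Sum>m\<in>PiE UNIV (\<lambda>_. ?I). \<Prod>j\<in>UNIV. cis (2 * pi / of_nat L * of_int (m j) * of_int (x $ j)))"
  proof (rule sum.cong)
    have cis_sum: "cis (\<Sum>j\<in>A. f j) = (\<Prod>j\<in>A. cis (f j))" for f and A :: "'d set"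
      by (induction A rule: infinite_finite_induct) (auto simp: cis_mult[symmetric])
    show "cis (lattice_dot (\<chi> j. 2 * pi / of_nat L * of_int (m j)) x) =
      (\<Prod>j\<in>UNIV. cis (2 * pi / of_nat L * of_int (m j) * of_int (x $ j)))" for m
      by (simp add: lattice_dot_def cis_sum)
  qed simp
  also have "\<dots> = (\<Prod>j\<in>UNIV. \<Sum>m\<in>?I. cis (2 * pi / of_nat L * of_int m * of_int (x $ j)))"
    by (rule prod_sum_PiE[symmetric]) auto
  also have "\<dots> = (\<Prod>j\<in>UNIV. if int L dvd x $ j then of_nat L else 0)"
    by (simp only: sum_roots_of_unity[OF L])
  also have "\<dots> = (if \<forall>j. int L dvd x $ j then of_nat L ^ CARD('d) else 0)" by auto
  also have "(\<forall>j. int L dvd x $ j) \<longleftrightarrow> torus_rep L x = 0"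
    by (simp add: torus_rep_def vec_eq_iff dvd_eq_mod_eq_0)
  finally have "Re (\<Sum>k\<in>dual_torus L. cis (lattice_dot k x)) = Re (if torus_rep L x = 0 then of_nat L ^ CARD('d) else 0)"
    by simp
  then show ?thesis by (auto simp flip: of_nat_power split: if_splits)
qed

lemma card_dual_torus:
  assumes L: "even L" "L > 0"
  shows "card (dual_torus L :: (real ^ 'd :: finite) set) = L ^ CARD('d)"
proof -
  have "torus_rep L (0 :: int ^ 'd) = 0" by (simp add: torus_rep_def vec_eq_iff)
  then have "real (card (dual_torus L :: (real ^ 'd) set)) = real (L ^ CARD('d))"
    using sum_dual_torus[OF L, of "0 :: int ^ 'd"] by simp
  then show ?thesis by (simp only: of_nat_eq_iff)
qed

lemma zero_in_dual_torus: "(0 :: real ^ 'd) \<in> dual_torus L"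
  by (auto simp: dual_torus_def vec_eq_iff intro!: exI[of _ 0])

lemma dual_torus_dot_periodic:
  fixes k :: "real ^ 'd :: finite"
  assumes "k \<in> dual_torus L" "L > 0"
  shows "\<exists>n :: int. lattice_dot k (torus_rep L x) = lattice_dot k x + 2 * pi * n"
proof -
  obtain m :: "int ^ 'd" where m: "k = (\<chi> j. 2 * pi / of_nat L * of_int (m $ j))" using assms by (auto simp: dual_torus_def)
  obtain z where z: "torus_rep L x = x + int L *s z" using torus_rep_decomp by blast
  have "lattice_dot k (int L *s z) = 2 * pi * of_int (\<Sum>j\<in>UNIV. m $ j * z $ j)"
    using assms(2) by (simp add: lattice_dot_def m sum_distrib_left mult_ac)
  then show ?thesis unfolding z lattice_dot_add by metis
qed

lemma cos_dot_periodic: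
  assumes "k \<in> dual_torus L" "L > 0"
  shows "cos (lattice_dot k (torus_rep L x) + \<phi>) = cos (lattice_dot k x + \<phi>)"
proof -
  obtain n :: int where "lattice_dot k (torus_rep L x) = lattice_dot k x + 2 * pi * n"
    using dual_torus_dot_periodic[OF assms] by blast
  then have "lattice_dot k (torus_rep L x) + \<phi> = (lattice_dot k x + \<phi>) + 2 * pi * of_int n" by simp
  then show ?thesis by (simp only: cos_add[of "lattice_dot k x + \<phi>"] cos_int_2pin sin_int_2pin mult_1_right mult_zero_right diff_zero)
qed

lemma sum_torus_translate:
  assumes L: "L > 0" and F: "\<And>y. F (torus_rep L y) = F y"
  shows "(\<Sum>y\<in>torus L. F (y + a)) = (\<Sum>y\<in>torus L. F y)"
  using sum.reindex_bij_betw[OF bij_betw_torus_translate[OF L, of a], of F] by (simp add: F)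

section \<open>The transform of the weight and the eigenfunctions of its periodisation\<close>

context lattice_weight
begin

text \<open>The real form of \<open>weight_hat\<close>; the sine part cancels by symmetry of
  \<open>w\<close>.\<close>

definition what :: "real ^ 'd \<Rightarrow> real" where
  "what k = infsum (\<lambda>x. w 0 x * cos (lattice_dot k x)) UNIV"

lemma w_bounded_summable:
  assumes "\<And>x. \<bar>f x\<bar> \<le> 1"
  shows "(\<lambda>x. w 0 x * f x) summable_on UNIV"
proof -
  have "(\<lambda>x. norm (w 0 x * f x)) summable_on UNIV"
    by (rule summable_on_comparison_test[OF w_summable[of 0]]) (auto simp: abs_mult w_nonneg intro!: mult_left_le assms)
  then show ?thesis by (rule summable_on_iff_abs_summable_on_real[THEN iffD2])
qed

lemma infsum_odd:
  assumes "\<And>x. f (- x) = - f x"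
  shows "infsum (\<lambda>x. w 0 x * f x) UNIV = 0"
proof -
  have "bij_betw (\<lambda>z :: int ^ 'd. - z) UNIV UNIV" by (rule bij_betw_byWitness[of _ "\<lambda>z. - z"]) auto
  then have "infsum (\<lambda>x. w 0 x * f x) UNIV = infsum (\<lambda>x. w 0 (- x) * f (- x)) UNIV"
    by (rule infsum_reindex_bij_betw[symmetric])
  also have "\<dots> = - infsum (\<lambda>x. w 0 x * f x) UNIV"
    by (simp add: w_minus assms infsum_uminus)
  finally show ?thesis by simp
qed

lemma weight_hat_eq: "weight_hat w k = complex_of_real (what k)"
proof -
  let ?f = "\<lambda>x. complex_of_real (w 0 x) * exp (\<i> * complex_of_real (lattice_dot k x))"
  have e: "?f x = complex_of_real (w 0 x) * cis (lattice_dot k x)" for x by (simp add: cis_conv_exp)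
  have "(\<lambda>x. norm (?f x)) summable_on UNIV"
    unfolding e by (simp add: norm_mult w_nonneg) (rule w_summable)
  then have summ: "?f summable_on UNIV" by (rule summable_on_iff_abs_summable_on_complex[THEN iffD2])
  have "Re (weight_hat w k) = what k"
    unfolding weight_hat_def what_def infsum_Re[OF summ, symmetric] by (simp add: e del: infsum_Re)
  moreover have "Im (weight_hat w k) = 0"
    unfolding weight_hat_def infsum_Im[OF summ, symmetric]
    using infsum_odd[of "\<lambda>x. sin (lattice_dot k x)"] by (simp add: e lattice_dot_minus)
  ultimately show ?thesis by (simp add: complex_eq_iff)
qed

lemma what_le_1: "what k \<le> 1" and what_ge: "- 1 \<le> what k"
proof -
  have s: "infsum (w 0) UNIV = 1" using w_sum by (rule infsumI)
  have summ: "(\<lambda>x. w 0 x * cos (lattice_dot k x)) summable_on UNIV" by (rule w_bounded_summable) simp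
  have "what k \<le> infsum (w 0) UNIV"
    unfolding what_def by (rule infsum_mono[OF summ w_summable]) (simp add: mult_left_le w_nonneg)
  then show "what k \<le> 1" by (simp add: s)
  have "infsum (\<lambda>x. - w 0 x) UNIV \<le> what k"
    unfolding what_def
  proof (rule infsum_mono[OF _ summ])
    show "(\<lambda>x. - w 0 x) summable_on UNIV" using w_summable[of 0] by (simp add: summable_on_uminus)
    show "- w 0 x \<le> w 0 x * cos (lattice_dot k x)" for x
      using mult_left_mono[OF cos_ge_minus_one[of "lattice_dot k x"] w_nonneg[of 0 x]] by simp
  qed
  then show "- 1 \<le> what k" by (simp add: s infsum_uminus)
qed

text \<open>Equality would force cos(k.x) = 1 on the support of \<open>w\<close>, hence k.x in 2 pi
  Z on the group generated by it, which is the whole lattice. In the box (-pi, pi]^d only k = 0 has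
  this property.\<close>

lemma what_less_1:
  assumes k: "k \<in> dual_torus L" "k \<noteq> 0"
  shows "what k < 1"
proof (rule ccontr)
  assume "\<not> ?thesis"
  then have one: "what k = 1" using what_le_1[of k] by simp
  have summ: "(\<lambda>x. w 0 x * cos (lattice_dot k x)) summable_on UNIV" by (rule w_bounded_summable) simp
  have eq: "w 0 x * (1 - cos (lattice_dot k x)) = w 0 x - w 0 x * cos (lattice_dot k x)" for x by (simp add: right_diff_distrib)
  have hs: "((\<lambda>x. w 0 x * (1 - cos (lattice_dot k x))) has_sum (1 - 1)) UNIV"
    unfolding eq using has_sum_add[OF w_sum has_sum_uminusI[OF has_sum_infsum[OF summ]]] one by (simp add: what_def)
  have zero: "w 0 x * (1 - cos (lattice_dot k x)) = 0" for x
    by (rule nonneg_has_sum_le_0D[OF hs]) (auto simp: w_nonneg intro!: mult_nonneg_nonneg)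
  have H: "\<exists>n :: int. lattice_dot k x = 2 * pi * n" if "x \<in> group_closure {x. 0 < w 0 x}" for x
    using that
  proof (induction rule: group_closure.induct)
    case (base x)
    then have "cos (lattice_dot k x) = 1" using zero[of x] by auto
    then show ?case by (auto simp: cos_one_2pi_int mult_ac)
  next
    case (diff x y)
    then obtain n m :: int where "lattice_dot k x = 2 * pi * n" "lattice_dot k y = 2 * pi * m" by blast
    then have "lattice_dot k (x - y) = 2 * pi * of_int (n - m)" by (simp add: lattice_dot_diff algebra_simps)
    then show ?case by blast
  qed
  have "k $ j = 0" for j
  proof -
    have "lattice_dot k (axis j 1) = k $ j"
    proof -
      have "lattice_dot k (axis j 1) = (\<Sum>i\<in>UNIV. if i = j then k $ j else 0)"
        unfolding lattice_dot_def by (rule sum.cong) (auto simp: axis_def)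
      then show ?thesis by simp
    qed
    then obtain n :: int where n: "k $ j = 2 * pi * n" using H[of "axis j 1"] w_generates by auto
    have "- pi < k $ j" "k $ j \<le> pi" using k by (auto simp: dual_torus_def)
    then have "- pi < pi * (2 * n)" "pi * (2 * n) \<le> pi * 1" by (simp_all add: n mult_ac)
    then have "- 1 < 2 * real_of_int n" "2 * real_of_int n \<le> 1"
      using mult_less_cancel_left_pos[OF pi_gt_zero, of "- 1" "2 * real_of_int n"] by (simp_all add: mult_le_cancel_left_pos)
    then have "n = 0" by linarith
    then show ?thesis by (simp add: n)
  qed
  then show False using k(2) by (simp add: vec_eq_iff)
qed

text \<open>The phase \<phi> treats cosine and sine waves at once, as the infrared bound is stated
  for real functions.\<close>

lemma periodised_eigen:
  assumes k: "k \<in> dual_torus L" "L > 0"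
  shows "(\<Sum>y\<in>torus L. periodised L w x y * cos (lattice_dot k y + \<phi>)) = what k * cos (lattice_dot k x + \<phi>)"
proof -
  have s1: "(\<lambda>v. w 0 v * cos (lattice_dot k v)) summable_on UNIV" "(\<lambda>v. w 0 v * sin (lattice_dot k v)) summable_on UNIV"
    by (rule w_bounded_summable, simp)+
  have "(\<Sum>y\<in>torus L. periodised L w x y * cos (lattice_dot k y + \<phi>)) = infsum (\<lambda>v. w 0 v * cos (lattice_dot k (x + v) + \<phi>)) UNIV"
    by (rule sum_periodised[OF k(2), of "\<lambda>y. cos (lattice_dot k y + \<phi>)" 1]) (simp_all add: cos_dot_periodic[OF k])
  also have "\<dots> = infsum (\<lambda>v. w 0 v * cos (lattice_dot k v) * cos (lattice_dot k x + \<phi>) + - (w 0 v * sin (lattice_dot k v) * sin (lattice_dot k x + \<phi>))) UNIV"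
  proof (rule infsum_cong)
    fix v
    have "lattice_dot k (x + v) + \<phi> = lattice_dot k v + (lattice_dot k x + \<phi>)" by (simp add: lattice_dot_add)
    then show "w 0 v * cos (lattice_dot k (x + v) + \<phi>) = w 0 v * cos (lattice_dot k v) * cos (lattice_dot k x + \<phi>) + - (w 0 v * sin (lattice_dot k v) * sin (lattice_dot k x + \<phi>))"
      by (simp only: cos_add) (simp add: algebra_simps)
  qed
  also have "\<dots> = infsum (\<lambda>v. w 0 v * cos (lattice_dot k v) * cos (lattice_dot k x + \<phi>)) UNIV + infsum (\<lambda>v. - (w 0 v * sin (lattice_dot k v) * sin (lattice_dot k x + \<phi>))) UNIV"
    by (intro infsum_add summable_on_cmult_left summable_on_uminus[THEN iffD2] s1)
  also have "\<dots> = what k * cos (lattice_dot k x + \<phi>) - infsum (\<lambda>v. w 0 v * sin (lattice_dot k v)) UNIV * sin (lattice_dot k x + \<phi>)"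
    using infsum_cmult_left[of "cos (lattice_dot k x + \<phi>)" "\<lambda>v. w 0 v * cos (lattice_dot k v)"]
      infsum_cmult_left[of "sin (lattice_dot k x + \<phi>)" "\<lambda>v. w 0 v * sin (lattice_dot k v)"] s1
    by (simp add: infsum_uminus what_def)
  also have "infsum (\<lambda>v. w 0 v * sin (lattice_dot k v)) UNIV = 0"
    by (rule infsum_odd) (simp add: lattice_dot_minus)
  finally show ?thesis by simp
qed

lemma what_plus_a_const_nonneg:
  assumes k: "k \<in> dual_torus L"
  shows "0 \<le> what k + a_const w"
proof -
  have "(INF k\<in>cbox (\<chi> j. - pi) (\<chi> j. pi). Re (weight_hat w k)) \<le> Re (weight_hat w k)"
  proof (rule cINF_lower)
    show "bdd_below ((\<lambda>k. Re (weight_hat w k)) ` cbox (\<chi> j. - pi) (\<chi> j. pi))"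
      by (rule bdd_belowI2[of _ "- 1"]) (simp add: weight_hat_eq what_ge)
    show "k \<in> cbox (\<chi> j. - pi) (\<chi> j. pi)"
      using k by (auto simp: mem_box_cart dual_torus_def intro: less_imp_le)
  qed
  then show ?thesis by (simp add: weight_hat_eq a_const_def)
qed

end

text \<open>What the rest of the argument takes from either model: \<open>g\<close> is the two-point
  function from the origin, read as a periodic function, and \<open>p\<close> is the deficit in the
  sum rule.\<close>

locale torus_two_point = lattice_weight w for w :: "int ^ 'd :: finite \<Rightarrow> int ^ 'd \<Rightarrow> real" +
  fixes L :: nat and g :: "int ^ 'd \<Rightarrow> real" and p :: real
  assumes L: "even L" "L > 0"
    and g_nonneg: "0 \<le> g x" and g_rep: "g (torus_rep L x) = g x" and g_minus: "g (- x) = g x"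
    and g_infrared: "\<And>h :: int ^ 'd \<Rightarrow> real.
      (\<Sum>x\<in>torus L. \<Sum>y\<in>torus L. (h x - (\<Sum>z\<in>torus L. periodised L w x z * h z)) *
        (h y - (\<Sum>z\<in>torus L. periodised L w y z * h z)) * g (y - x)) \<le>
      (\<Sum>x\<in>torus L. h x * (h x - (\<Sum>z\<in>torus L. periodised L w x z * h z)))"
    and g_row: "(\<Sum>y\<in>torus L. periodised L w 0 y * g y) = 1 - p" and p: "0 \<le> p"
    and g_refl: "x \<in> torus_half L i c \<Longrightarrow> y \<in> torus_half L i c \<Longrightarrow>
      (g (torus_refl L i c y - x))\<^sup>2 \<le> g (torus_refl L i c x - x) * g (torus_refl L i c y - y)"
begin

definition ghat :: "real ^ 'd \<Rightarrow> real" where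
  "ghat k = (\<Sum>x\<in>torus L. g x * cos (lattice_dot k x))"

definition M :: real where "M = (\<Sum>x\<in>torus L. g x) / of_nat L ^ CARD('d)"

definition green_torus :: real where
  "green_torus = (\<Sum>k\<in>dual_torus L - {0}. 1 / (1 - what k)) / of_nat L ^ CARD('d)"

lemma vol_pos: "real L ^ CARD('d) > 0" using L by simp

text \<open>The infrared bound is tested with eigenfunctions. A cosine and a sine wave are added,
  since their sum turns the double sum into the volume times \<open>ghat k\<close>.\<close>

lemma ghat_le:
  assumes k: "k \<in> dual_torus L" "k \<noteq> 0"
  shows "ghat k \<le> 1 / (1 - what k)"
proof -
  define \<Delta> where "\<Delta> = 1 - what k"
  have pos: "\<Delta> > 0" using what_less_1[OF k] by (simp add: \<Delta>_def)
  have ir: "\<Delta>\<^sup>2 * (\<Sum>x\<in>torus L. \<Sum>y\<in>torus L. cos (lattice_dot k x + \<phi>) * cos (lattice_dot k y + \<phi>) * g (y - x)) \<le>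
    \<Delta> * (\<Sum>x\<in>torus L. (cos (lattice_dot k x + \<phi>))\<^sup>2)" for \<phi>
  proof -
    have "cos (lattice_dot k x + \<phi>) - what k * cos (lattice_dot k x + \<phi>) = \<Delta> * cos (lattice_dot k x + \<phi>)" for x
      by (simp add: \<Delta>_def left_diff_distrib)
    then show ?thesis
      using g_infrared[of "\<lambda>x. cos (lattice_dot k x + \<phi>)"]
      by (simp add: periodised_eigen[OF k(1) L(2)] sum_distrib_left power2_eq_square mult_ac)
  qed
  have sin: "cos (t + - (pi / 2)) = sin t" for t by (simp add: cos_diff flip: diff_conv_add_uminus)
  have "\<Delta>\<^sup>2 * (real L ^ CARD('d) * ghat k) = \<Delta>\<^sup>2 * (\<Sum>x\<in>torus L. \<Sum>y\<in>torus L. cos (lattice_dot k x + 0) * cos (lattice_dot k y + 0) * g (y - x)) +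
    \<Delta>\<^sup>2 * (\<Sum>x\<in>torus L. \<Sum>y\<in>torus L. cos (lattice_dot k x + - (pi / 2)) * cos (lattice_dot k y + - (pi / 2)) * g (y - x))"
  proof -
    have row: "(\<Sum>y\<in>torus L. g (y - x) * cos (lattice_dot k (y - x))) = ghat k" for x
      using sum_torus_translate[OF L(2), of "\<lambda>y. g y * cos (lattice_dot k y)" "- x"] cos_dot_periodic[OF k(1) L(2), of _ 0]
      by (simp add: g_rep ghat_def)
    have "(\<Sum>x\<in>torus L. \<Sum>y\<in>torus L. cos (lattice_dot k x) * cos (lattice_dot k y) * g (y - x)) +
      (\<Sum>x\<in>torus L. \<Sum>y\<in>torus L. sin (lattice_dot k x) * sin (lattice_dot k y) * g (y - x)) =
      (\<Sum>x\<in>torus L. \<Sum>y\<in>torus L. g (y - x) * cos (lattice_dot k (y - x)))"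
      unfolding sum.distrib[symmetric] lattice_dot_diff cos_diff by (intro sum.cong refl) (simp add: algebra_simps)
    also have "\<dots> = real L ^ CARD('d) * ghat k" by (simp add: row card_torus)
    finally show ?thesis unfolding sin by (simp add: distrib_left[symmetric])
  qed
  also have "\<dots> \<le> \<Delta> * (\<Sum>x\<in>torus L. (cos (lattice_dot k x + 0))\<^sup>2) + \<Delta> * (\<Sum>x\<in>torus L. (cos (lattice_dot k x + - (pi / 2)))\<^sup>2)"
    by (intro add_mono ir)
  also have "\<dots> = \<Delta> * real L ^ CARD('d)"
    unfolding sin by (simp add: distrib_left[symmetric] sum.distrib[symmetric] card_torus)
  finally have "(\<Delta> * real L ^ CARD('d)) * (\<Delta> * ghat k) \<le> (\<Delta> * real L ^ CARD('d)) * 1" by (simp add: power2_eq_square mult_ac)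
  then have "\<Delta> * ghat k \<le> 1" using pos vol_pos by (simp only: mult_le_cancel_left_pos mult_pos_pos)
  then show ?thesis using pos by (simp add: \<Delta>_def[symmetric] field_simps)
qed

lemma sum_ghat: "(\<Sum>k\<in>dual_torus L. ghat k) = real L ^ CARD('d) * g 0"
proof -
  have "(\<Sum>k\<in>dual_torus L. ghat k) = (\<Sum>x\<in>torus L. g x * (\<Sum>k\<in>dual_torus L. cos (lattice_dot k x)))"
    unfolding ghat_def sum_distrib_left by (rule sum.swap)
  also have "\<dots> = (\<Sum>x\<in>torus L. if x = (0 :: int ^ 'd) then real L ^ CARD('d) * g 0 else 0)"
    by (rule sum.cong[OF refl]) (simp add: sum_dual_torus[OF L] torus_rep_id)
  also have "\<dots> = real L ^ CARD('d) * g 0"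
  proof -
    have "(0 :: int ^ 'd) \<in> torus L" using L by (simp add: torus_def)
    then show ?thesis by simp
  qed
  finally show ?thesis .
qed

text \<open>Parseval's identity applied to the sum rule.\<close>

lemma sum_what_ghat: "(\<Sum>k\<in>dual_torus L. what k * ghat k) = real L ^ CARD('d) * (1 - p)"
proof -
  let ?W = "periodised L w 0"
  have what: "what k = (\<Sum>y\<in>torus L. ?W y * cos (lattice_dot k y))" if "k \<in> dual_torus L" for k
    using periodised_eigen[OF that L(2), of 0 0] by simp
  have "(\<Sum>k\<in>dual_torus L. what k * ghat k) =
    (\<Sum>k\<in>dual_torus L. \<Sum>y\<in>torus L. \<Sum>x\<in>torus L. ?W y * g x * (cos (lattice_dot k y) * cos (lattice_dot k x)))"
    by (intro sum.cong refl) (simp add: what ghat_def sum_product mult.assoc mult.left_commute)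
  also have "\<dots> = (\<Sum>y\<in>torus L. \<Sum>k\<in>dual_torus L. \<Sum>x\<in>torus L. ?W y * g x * (cos (lattice_dot k y) * cos (lattice_dot k x)))"
    by (rule sum.swap)
  also have "\<dots> = (\<Sum>y\<in>torus L. \<Sum>x\<in>torus L. \<Sum>k\<in>dual_torus L. ?W y * g x * (cos (lattice_dot k y) * cos (lattice_dot k x)))"
    by (rule sum.cong[OF refl], rule sum.swap)
  also have "\<dots> = (\<Sum>y\<in>torus L. ?W y * (real L ^ CARD('d) * g y))"
  proof (rule sum.cong[OF refl])
    fix y :: "int ^ 'd" assume y: "y \<in> torus L"
    \<comment> \<open>Cosines are orthogonal only up to the sign of the site, so both
      \<open>y\<close> and its negative are picked up; evenness of \<open>g\<close> merges the
      two.\<close>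
    define y' where "y' = torus_rep L (- y)"
    have y': "y' \<in> torus L" using L by (simp add: y'_def)
    have k: "(\<Sum>k\<in>dual_torus L. cos (lattice_dot k y) * cos (lattice_dot k x)) = (if x = y then real L ^ CARD('d) / 2 else 0) + (if x = y' then real L ^ CARD('d) / 2 else 0)"
      if x: "x \<in> torus L" for x
    proof -
      have "(\<Sum>k\<in>dual_torus L. cos (lattice_dot k y) * cos (lattice_dot k x)) =
        ((\<Sum>k\<in>dual_torus L. cos (lattice_dot k (x - y))) + (\<Sum>k\<in>dual_torus L. cos (lattice_dot k (x + y)))) / 2"
        unfolding sum.distrib[symmetric] sum_divide_distrib
        by (intro sum.cong refl) (simp add: lattice_dot_diff lattice_dot_add cos_add cos_diff algebra_simps)
      moreover have "torus_rep L (x - y) = 0 \<longleftrightarrow> x = y"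
      proof -
        have "torus_rep L (x - y) = 0 \<longleftrightarrow> torus_rep L x = torus_rep L y"
          by (auto simp: torus_rep_def vec_eq_iff mod_eq_dvd_iff dvd_eq_mod_eq_0)
        then show ?thesis using x y by (simp add: torus_rep_id)
      qed
      moreover have "torus_rep L (x + y) = 0 \<longleftrightarrow> x = y'"
      proof -
        have "torus_rep L (x + y) = 0 \<longleftrightarrow> torus_rep L x = torus_rep L (- y)"
          by (auto simp: torus_rep_def vec_eq_iff mod_eq_dvd_iff dvd_eq_mod_eq_0)
        then show ?thesis using x by (simp add: torus_rep_id y'_def)
      qed
      ultimately show ?thesis by (cases "x = y"; cases "x = y'") (simp_all only: sum_dual_torus[OF L] if_True if_False, simp_all)
    qed
    have "(\<Sum>x\<in>torus L. \<Sum>k\<in>dual_torus L. ?W y * g x * (cos (lattice_dot k y) * cos (lattice_dot k x))) =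
      (\<Sum>x\<in>torus L. (if x = y then ?W y * g y * (real L ^ CARD('d) / 2) else 0) + (if x = y' then ?W y * g y' * (real L ^ CARD('d) / 2) else 0))"
    proof (rule sum.cong[OF refl])
      fix x :: "int ^ 'd" assume x: "x \<in> torus L"
      show "(\<Sum>k\<in>dual_torus L. ?W y * g x * (cos (lattice_dot k y) * cos (lattice_dot k x))) =
        (if x = y then ?W y * g y * (real L ^ CARD('d) / 2) else 0) + (if x = y' then ?W y * g y' * (real L ^ CARD('d) / 2) else 0)"
        unfolding sum_distrib_left[symmetric] k[OF x] distrib_left by (intro arg_cong2[of _ _ _ _ "(+)"]) (simp_all split: if_split)
    qed
    also have "\<dots> = ?W y * g y * (real L ^ CARD('d) / 2) + ?W y * g y' * (real L ^ CARD('d) / 2)"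
      using y y' by (simp add: sum.distrib)
    also have "g y' = g y" by (simp add: y'_def g_rep g_minus)
    finally show "(\<Sum>x\<in>torus L. \<Sum>k\<in>dual_torus L. ?W y * g x * (cos (lattice_dot k y) * cos (lattice_dot k x))) = ?W y * (real L ^ CARD('d) * g y)"
      by simp
  qed
  also have "\<dots> = real L ^ CARD('d) * (\<Sum>y\<in>torus L. ?W y * g y)" by (simp add: sum_distrib_left mult_ac)
  finally show ?thesis by (simp add: g_row)
qed

lemma ghat_0: "ghat 0 = real L ^ CARD('d) * M"
  using L by (simp add: ghat_def M_def)

lemma what_0: "what 0 = 1"
  by (simp add: what_def infsumI[OF w_sum])

text \<open>The infrared bound may be multiplied by \<open>what k + a_const w\<close> because this
  is nonnegative. In (u + a) / (1 - u) = (1 + a) / (1 - u) - 1 the terms -1 of the N - 1 nonzero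
  modes turn 1 - p into 2 - p - 1/N.\<close>

theorem M_bound: "2 - p - 1 / real L ^ CARD('d) + a_const w * g 0 \<le> (1 + a_const w) * (M + green_torus)"
proof -
  let ?a = "a_const w"
  note fin = finite_dual_torus[OF L]
  have "real L ^ CARD('d) * (1 - p) + ?a * (real L ^ CARD('d) * g 0) = (\<Sum>k\<in>dual_torus L. (what k + ?a) * ghat k)"
    by (simp add: sum_what_ghat[symmetric] sum_ghat[symmetric] distrib_right sum.distrib sum_distrib_left)
  also have "\<dots> = (1 + ?a) * ghat 0 + (\<Sum>k\<in>dual_torus L - {0}. (what k + ?a) * ghat k)"
    using sum.remove[OF fin zero_in_dual_torus, of "\<lambda>k. (what k + ?a) * ghat k"] by (simp add: what_0)
  also have "(\<Sum>k\<in>dual_torus L - {0}. (what k + ?a) * ghat k) \<le> (\<Sum>k\<in>dual_torus L - {0}. (1 + ?a) * (1 / (1 - what k)) - 1)"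
  proof (rule sum_mono)
    fix k assume "k \<in> dual_torus L - {0 :: real ^ 'd}"
    then have k: "k \<in> dual_torus L" "k \<noteq> 0" by auto
    have "(what k + ?a) * ghat k \<le> (what k + ?a) * (1 / (1 - what k))"
      by (intro mult_left_mono ghat_le what_plus_a_const_nonneg[of _ L] k)
    also have "\<dots> = (1 + ?a) * (1 / (1 - what k)) - 1" using what_less_1[OF k] by (simp add: field_simps)
    finally show "(what k + ?a) * ghat k \<le> (1 + ?a) * (1 / (1 - what k)) - 1" .
  qed
  also have "(\<Sum>k\<in>dual_torus L - {0}. (1 + ?a) * (1 / (1 - what k)) - 1) = (1 + ?a) * (real L ^ CARD('d) * green_torus) - (real L ^ CARD('d) - 1)"
  proof -
    have "real (card (dual_torus L - {0 :: real ^ 'd})) = real L ^ CARD('d) - 1"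
      using zero_in_dual_torus[of L, where 'd = 'd] fin L by (subst card_Diff_singleton) (simp_all add: card_dual_torus[OF L] of_nat_diff)
    moreover have "(\<Sum>k\<in>dual_torus L - {0 :: real ^ 'd}. 1 / (1 - what k)) = real L ^ CARD('d) * green_torus"
      using vol_pos by (simp add: green_torus_def)
    ultimately show ?thesis by (simp only: sum_subtractf sum_distrib_left[symmetric] sum_constant mult_1_right)
  qed
  finally have "real L ^ CARD('d) * (1 - p) + ?a * (real L ^ CARD('d) * g 0) \<le> (1 + ?a) * (real L ^ CARD('d) * M) + ((1 + ?a) * (real L ^ CARD('d) * green_torus) - (real L ^ CARD('d) - 1))"
    by (simp add: ghat_0)
  then have "real L ^ CARD('d) * (2 - p - 1 / real L ^ CARD('d) + ?a * g 0) \<le> real L ^ CARD('d) * ((1 + ?a) * (M + green_torus))"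
    using vol_pos by (simp add: algebra_simps)
  then show ?thesis using vol_pos by (simp only: mult_le_cancel_left_pos)
qed

text \<open>The infrared bound summed without the factor \<open>what k\<close>; it controls the
  value at the origin, which reflections do not reach.\<close>

lemma g_0_le: "g 0 \<le> M + green_torus"
proof -
  have "real L ^ CARD('d) * g 0 = ghat 0 + (\<Sum>k\<in>dual_torus L - {0}. ghat k)"
    unfolding sum_ghat[symmetric] by (rule sum.remove[OF finite_dual_torus[OF L] zero_in_dual_torus])
  also have "(\<Sum>k\<in>dual_torus L - {0}. ghat k) \<le> (\<Sum>k\<in>dual_torus L - {0}. 1 / (1 - what k))"
    by (intro sum_mono ghat_le) auto
  also have "\<dots> = real L ^ CARD('d) * green_torus" using vol_pos by (simp add: green_torus_def)
  finally have "real L ^ CARD('d) * g 0 \<le> real L ^ CARD('d) * (M + green_torus)" by (simp add: ghat_0 distrib_left)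
  then show ?thesis using vol_pos by (simp only: mult_le_cancel_left_pos)
qed

end

section \<open>Pointwise lower bounds\<close>

text \<open>The leftmost maximiser cannot be interior: its left neighbour would be strictly smaller
  and the product of its neighbours too small. Products instead of logarithms admit zero
  values.\<close>

lemma quasi_convex_sequence:
  fixes u :: "nat \<Rightarrow> real"
  assumes u: "\<And>n. 0 \<le> u n" and conv: "\<And>n. l < n \<Longrightarrow> n < h \<Longrightarrow> (u n)\<^sup>2 \<le> u (n - 1) * u (Suc n)"
    and ends: "u l \<le> c" "u h \<le> c" and n: "l \<le> n" "n \<le> h"
  shows "u n \<le> c"
proof -
  define s where "s = Max (u ` {l..h})"
  have le: "u k \<le> s" if "k \<in> {l..h}" for k using that by (simp add: s_def)
  have "s \<in> u ` {l..h}" unfolding s_def using n by (intro Max_in) auto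
  then have "\<exists>k. k \<in> {l..h} \<and> u k = s" by auto
  then obtain k where k: "k \<in> {l..h}" "u k = s" and least: "\<And>i. i < k \<Longrightarrow> \<not> (i \<in> {l..h} \<and> u i = s)"
    using exists_least_iff[of "\<lambda>k. k \<in> {l..h} \<and> u k = s"] by blast
  have "s \<le> c"
  proof (rule ccontr)
    assume "\<not> ?thesis"
    then have s: "c < s" by simp
    then have "k \<noteq> l" "k \<noteq> h" using k ends by auto
    then have kk: "l < k" "k < h" using k by auto
    have "u (k - 1) < s" using le[of "k - 1"] least[of "k - 1"] kk by force
    moreover have "0 < s" using s u[of l] ends by linarith
    moreover have "u (Suc k) \<le> s" using kk by (intro le) auto
    ultimately have "u (k - 1) * u (Suc k) < s * s" 
      using u[of "k - 1"] mult_left_mono[of "u (Suc k)" s "u (k - 1)"] mult_strict_right_mono[of "u (k - 1)" s s] by linarith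
    then show False using conv[OF kk] k by (simp add: power2_eq_square)
  qed
  then show ?thesis using le[of n] n by simp
qed

lemma card_torus_slab:
  fixes i :: "'d :: finite" and S :: "int set"
  assumes L: "L > 0" and S: "finite S"
  shows "real (card {x \<in> torus L :: (int ^ 'd) set. x $ i \<in> S}) * real L \<le> real (card S) * real L ^ CARD('d)"
proof -
  define fib where "fib = (\<lambda>t. {x \<in> torus L :: (int ^ 'd) set. x $ i = t})"
  have fin: "finite (fib t)" for t by (simp add: fib_def)
  have eq: "card (fib t) = card (fib 0)" if "t \<in> {0..<int L}" for t
  proof (rule bij_betw_same_card)
    show "bij_betw (\<lambda>x. \<chi> j. if j = i then 0 else x $ j) (fib t) (fib 0)"
      by (rule bij_betw_byWitness[of _ "\<lambda>x. \<chi> j. if j = i then t else x $ j"])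
        (use that in \<open>auto simp: fib_def torus_def vec_eq_iff\<close>)
  qed
  have "(torus L :: (int ^ 'd) set) = (\<Union>t\<in>{0..<int L}. fib t)" by (auto simp: fib_def torus_def)
  moreover have "card (\<Union>t\<in>{0..<int L}. fib t) = (\<Sum>t\<in>{0..<int L}. card (fib t))"
  proof (rule card_UN_disjoint)
    show "\<forall>t\<in>{0..<int L}. \<forall>t'\<in>{0..<int L}. t \<noteq> t' \<longrightarrow> fib t \<inter> fib t' = {}" by (auto simp: fib_def)
  qed (simp_all add: fin)
  ultimately have "card (torus L :: (int ^ 'd) set) = (\<Sum>t\<in>{0..<int L}. card (fib t))" by (simp only:)
  also have "\<dots> = (\<Sum>t\<in>{0..<int L}. card (fib 0))" by (rule sum.cong[OF refl eq])
  finally have "L ^ CARD('d) = card (fib 0) * L" unfolding card_torus by simp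
  then have vol: "real L ^ CARD('d) = real (card (fib 0)) * real L" unfolding of_nat_power[symmetric] of_nat_mult[symmetric] of_nat_eq_iff .
  have "{x \<in> torus L :: (int ^ 'd) set. x $ i \<in> S} = (\<Union>t\<in>S. fib t)" by (auto simp: fib_def)
  then have "card {x \<in> torus L :: (int ^ 'd) set. x $ i \<in> S} \<le> (\<Sum>t\<in>S. card (fib t))"
    using card_UN_le[OF S, of fib] by simp
  also have "\<dots> \<le> (\<Sum>t\<in>S. card (fib 0))"
  proof (rule sum_mono)
    fix t show "card (fib t) \<le> card (fib 0)"
    proof (cases "t \<in> {0..<int L}")
      case False
      then have "fib t = {}" by (auto simp: fib_def torus_def)
      then show ?thesis by simp
    next
      case True
      then show ?thesis by (intro eq_imp_le eq)
    qed
  qed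
  finally have "card {x \<in> torus L :: (int ^ 'd) set. x $ i \<in> S} \<le> card S * card (fib 0)"
    by simp
  then have "card {x \<in> torus L :: (int ^ 'd) set. x $ i \<in> S} * L \<le> card S * card (fib 0) * L" by (rule mult_le_mono1)
  then have "real (card {x \<in> torus L :: (int ^ 'd) set. x $ i \<in> S}) * real L \<le> real (card S) * real (card (fib 0)) * real L"
    unfolding of_nat_mult[symmetric] of_nat_le_iff .
  then show ?thesis by (simp only: vol mult.assoc)
qed

section \<open>Positivity of the nearest-neighbour weights\<close>

context lattice_weight
begin

lemma w_OS_cauchy_schwarz:
  assumes x: "0 < x $ i" and y: "0 < y $ i"
  shows "(w x (reflect i y))\<^sup>2 \<le> w x (reflect i x) * w y (reflect i y)"
proof (rule quadratic_discriminant)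
  fix s t :: real
  have "0 \<le> (\<Sum>a\<in>UNIV. \<Sum>b\<in>UNIV. (if a then s else t) * (if b then s else t) *
    w (if a then x else y) (reflect i (if b then x else y)))"
    by (rule OS_family) (use x y in auto)
  also have "\<dots> = s\<^sup>2 * w x (reflect i x) + 2 * s * t * w x (reflect i y) + t\<^sup>2 * w y (reflect i y)"
    using OS_sym[OF x y] by (simp add: UNIV_bool power2_eq_square algebra_simps)
  finally show "0 \<le> s\<^sup>2 * w x (reflect i x) + 2 * s * t * w x (reflect i y) + t\<^sup>2 * w y (reflect i y)" .
qed

text \<open>If this weight vanished, Cauchy--Schwarz against the point \<open>axis i 1\<close> would
  make \<open>w 0 v\<close> vanish whenever v_i is nonzero, and the support could not generate the
  lattice.\<close>

lemma w_axis_pos: "0 < w 0 (axis i 1)"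
proof (rule ccontr)
  assume "\<not> ?thesis"
  then have z: "w 0 (axis i 1) = 0" using w_nonneg[of 0 "axis i 1"] by simp
  have neg: "w 0 v = 0" if v: "v $ i < 0" for v
  proof -
    define y where "y = (\<chi> j. if j = i then - v $ i else v $ j)"
    have "(w (axis i 1) (reflect i y))\<^sup>2 \<le> w (axis i 1) (reflect i (axis i 1)) * w y (reflect i y)"
      by (rule w_OS_cauchy_schwarz) (use v in \<open>auto simp: y_def axis_def\<close>)
    also have "w (axis i 1) (reflect i (axis i 1)) = 0"
    proof -
      have "reflect i (axis i 1) - axis i 1 = - axis i (1 :: int)" by (auto simp: vec_eq_iff reflect_nth axis_def)
      then show ?thesis using z w_eq[of "axis i 1"] w_minus by metis
    qed
    finally have "w (axis i 1) (reflect i y) = 0" by simp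
    moreover have "reflect i y - axis i 1 = v" by (auto simp: vec_eq_iff reflect_nth axis_def y_def)
    ultimately show ?thesis by (simp add: w_eq[of "axis i 1"])
  qed
  have "x $ i = 0" if "x \<in> group_closure {x. 0 < w 0 x}" for x
    using that
  proof (induction rule: group_closure.induct)
    case (base x)
    then show ?case
    proof (cases "x = 0")
      case False
      then have "0 < w 0 x" using base by simp
      then show ?thesis using neg[of x] neg[of "- x"] w_minus[of x] by (cases "x $ i" "0 :: int" rule: linorder_cases) auto
    qed simp
  qed simp
  from this[of "axis i 1"] show False by (simp add: w_generates axis_def)
qed

end

section \<open>Comparison of the two-point function with its values on an axis\<close>

context torus_two_point
begin

lemma g_cong: "(\<And>j. int L dvd x $ j - y $ j) \<Longrightarrow> g x = g y"
proof -
  assume "\<And>j. int L dvd x $ j - y $ j"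
  then have "torus_rep L x = torus_rep L y" by (auto simp: torus_rep_def vec_eq_iff mod_eq_dvd_iff)
  then show ?thesis using g_rep by metis
qed

text \<open>Reflection at the plane 1/2 of points at heights \<open>a\<close> and \<open>b\<close>
  whose mirrored difference is \<open>z\<close>. They are at distances 2 a - 1 and 2 b - 1 from
  their own mirror images, which is why odd distances occur.\<close>

lemma g_axis_convex:
  assumes z: "z $ i = 1 - a - b" and ab: "1 \<le> a" "1 \<le> b" "2 * a \<le> int L" "2 * b \<le> int L"
  shows "(g z)\<^sup>2 \<le> g (axis i (2 * a - 1)) * g (axis i (2 * b - 1))"
proof -
  define x where "x = axis i a"
  define y where "y = torus_rep L (\<chi> j. if j = i then b else z $ j)"
  have yi: "y $ i = b" using ab by (simp add: y_def torus_rep_def)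
  have half: "(t - 1) mod int L < int (L div 2)" if "1 \<le> t" "2 * t \<le> int L" for t
  proof -
    have "int L = 2 * int (L div 2)" using L(1) by presburger
    moreover have "(t - 1) mod int L = t - 1" using that by (intro mod_pos_pos_trivial) auto
    ultimately show ?thesis using that by linarith
  qed
  have "x \<in> torus_half L i 0" using ab L half[of a] by (auto simp: x_def torus_half_def torus_def axis_def)
  moreover have "y \<in> torus_half L i 0" using ab L half[of b] by (simp add: torus_half_def yi) (simp add: y_def)
  ultimately have "(g (torus_refl L i 0 y - x))\<^sup>2 \<le> g (torus_refl L i 0 x - x) * g (torus_refl L i 0 y - y)"
    by (rule g_refl)
  moreover have dvd_mod: "int L dvd s mod int L - t" if "s = t" for s t using that by (simp add: mod_eq_dvd_iff[symmetric])
  have "g (torus_refl L i 0 y - x) = g z"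
    by (rule g_cong) (auto simp: torus_refl_nth x_def axis_def z yi mod_eq_dvd_iff[symmetric] mod_simps algebra_simps,
      auto simp: y_def torus_rep_def mod_eq_dvd_iff[symmetric])
  moreover have "g (torus_refl L i 0 v - v) = g (axis i (2 * v $ i - 1))" for v
  proof -
    have "g (torus_refl L i 0 v - v) = g (- axis i (2 * v $ i - 1))"
      by (rule g_cong) (auto simp: torus_refl_nth axis_def mod_eq_dvd_iff[symmetric] mod_simps algebra_simps)
    then show ?thesis by (simp only: g_minus)
  qed
  ultimately show ?thesis by (simp add: yi x_def)
qed

text \<open>On the axis, the values at 2 k - 1 are quasi-convex in k and symmetric under k -> L/2 +
  1 - k, hence largest at the ends of [m, L/2 + 1 - m]. A general \<open>z\<close> is then compared
  with two axis values.\<close>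

lemma g_le_axis:
  assumes n: "odd n" "1 \<le> n" and z: "n \<le> z $ i mod int L" "z $ i mod int L \<le> int L - n"
  shows "g z \<le> g (axis i n)"
proof -
  obtain h where h: "L = 2 * h" "h > 0" using L by (auto elim!: evenE)
  obtain m :: nat where m: "n = 2 * int m - 1" "1 \<le> m"
    using n by (elim oddE) (auto intro!: that[of "nat (_ + 1)"])
  define u where "u = (\<lambda>k. g (axis i (2 * int k - 1)))"
  have refl: "u (h + 1 - m) = u m"
  proof -
    have "m \<le> h" using z n m h by linarith
    have "u (h + 1 - m) = g (- axis i (2 * int m - 1))"
      unfolding u_def by (rule g_cong) (use \<open>m \<le> h\<close> in \<open>auto simp: axis_def h of_nat_diff algebra_simps\<close>)
    then show ?thesis by (simp only: g_minus u_def)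
  qed
  have u_le: "u k \<le> u m" if "m \<le> k" "k \<le> h + 1 - m" for k
  proof (rule quasi_convex_sequence[where u = u and l = m and h = "h + 1 - m"])
    fix k assume k: "m < k" "k < h + 1 - m"
    \<comment> \<open>Heights k - 1 and k + 1 make \<open>z\<close> the negative of the axis point
      at 2 k - 1.\<close>
    have "(g (- axis i (2 * int k - 1)))\<^sup>2 \<le> g (axis i (2 * (int k - 1) - 1)) * g (axis i (2 * (int k + 1) - 1))"
      by (rule g_axis_convex) (use k m h in \<open>auto simp: axis_def\<close>)
    then show "(u k)\<^sup>2 \<le> u (k - 1) * u (Suc k)"
      using k by (simp add: u_def g_minus of_nat_diff algebra_simps)
  qed (use that refl g_nonneg in \<open>auto simp: u_def\<close>)
  define s where "s = nat (z $ i mod int L)"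
  have s: "int s = z $ i mod int L" using L by (simp add: s_def)
  define z' where "z' = (\<chi> j. if j = i then - int s else - z $ j)"
  \<comment> \<open>Splitting s + 1 as evenly as possible keeps both heights between m and h + 1 -
    m.\<close>
  define a where "a = (s + 1) div 2"
  define b where "b = s + 1 - a"
  have ab: "m \<le> a" "m \<le> b" "a \<le> h + 1 - m" "b \<le> h + 1 - m" "a + b = s + 1"
    using z m h unfolding s[symmetric] a_def b_def by linarith+
  have "g z = g (- z)" by (simp add: g_minus)
  also have "g (- z) = g z'"
  proof (rule g_cong)
    have "- (z $ i) - - (z $ i mod int L) = int L * - (z $ i div int L)"
      using div_mult_mod_eq[of "z $ i" "int L"] by (simp add: algebra_simps)
    then show "int L dvd (- z) $ j - z' $ j" for j by (cases "j = i") (simp_all add: z'_def s)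
  qed
  finally have zz': "g z = g z'" .
  have "(g z')\<^sup>2 \<le> g (axis i (2 * int a - 1)) * g (axis i (2 * int b - 1))"
    by (rule g_axis_convex) (use ab m h in \<open>auto simp: z'_def\<close>)
  also have "\<dots> \<le> u m * u m"
    unfolding u_def[symmetric] using u_le[of a] u_le[of b] ab g_nonneg by (intro mult_mono) (auto simp: u_def)
  finally have "(g z)\<^sup>2 \<le> (u m)\<^sup>2" by (simp add: zz' power2_eq_square)
  then have "g z \<le> u m" by (rule power2_le_imp_le) (simp add: u_def g_nonneg)
  then show ?thesis by (simp add: u_def m)
qed

text \<open>A bound away from the origin that is independent of \<open>L\<close>; the sum over
  directions serves as a crude maximum.\<close>

definition g_max :: real where "g_max = (\<Sum>i\<in>UNIV. 1 / w 0 (axis i 1))"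

text \<open>Some coordinate is nonzero, so \<open>g x\<close> is at most the nearest-neighbour value
  in that direction, and a single term of the sum rule bounds this value.\<close>

lemma g_le_max:
  assumes x: "x \<in> torus L" "x \<noteq> 0"
  shows "g x \<le> g_max"
proof -
  obtain i where i: "x $ i \<noteq> 0" using x by (auto simp: vec_eq_iff)
  have b: "0 \<le> x $ i" "x $ i < int L" using x by (auto simp: torus_def)
  have L2: "2 \<le> L" using L by presburger
  have "g x \<le> g (axis i 1)"
    by (rule g_le_axis) (use i b in auto)
  also have "g (axis i 1) \<le> 1 / w 0 (axis i 1)"
  proof -
    have t: "axis i (1 :: int) \<in> torus L" using L2 by (auto simp: torus_def axis_def)
    have "w 0 (axis i 1) * g (axis i 1) \<le> periodised L w 0 (axis i 1) * g (axis i 1)"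
      by (intro mult_right_mono w_le_periodised g_nonneg L)
    also have "\<dots> \<le> (\<Sum>y\<in>torus L. periodised L w 0 y * g y)"
      by (rule member_le_sum[OF t]) (auto intro!: mult_nonneg_nonneg periodised_nonneg g_nonneg)
    also have "\<dots> \<le> 1" using g_row p by simp
    finally show ?thesis using w_axis_pos[of i] by (simp add: field_simps)
  qed
  also have "\<dots> \<le> g_max"
    unfolding g_max_def by (rule member_le_sum) (auto intro: less_imp_le w_axis_pos)
  finally show ?thesis .
qed

lemma g_max_pos: "0 < g_max"
  unfolding g_max_def by (rule sum_pos) (auto intro: w_axis_pos)

lemma side_le_volume: "real L \<le> real L ^ CARD('d)"
  by (rule self_le_power) (use L in auto)

text \<open>The slab within \<open>n\<close> of the origin fills at most a fraction 2 n / L of the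
  torus; elsewhere \<open>g\<close> is at most its value at distance \<open>n\<close> on the axis.
  The origin is kept apart, as \<open>g_max\<close> does not bound \<open>g 0\<close>.\<close>

lemma M_le:
  assumes n: "odd n" "2 * n \<le> L"
  shows "M \<le> g 0 / real L + 2 * real n / real L * g_max + g (axis i (int n))"
proof -
  let ?N = "real L ^ CARD('d)"
  define S where "S = {0..<int n} \<union> {int L - int n<..<int L}"
  define near where "near = {x \<in> torus L :: (int ^ 'd) set. x $ i \<in> S}"
  have n1: "1 \<le> n" using n by (auto elim: oddE)
  have zero: "(0 :: int ^ 'd) \<in> near" using n1 L by (auto simp: near_def S_def torus_def)
  have "(\<Sum>x\<in>torus L. g x) = (\<Sum>x\<in>near. g x) + (\<Sum>x\<in>torus L - near. g x)"
    by (rule sum.subset_diff[THEN trans[OF _ add.commute]]) (auto simp: near_def)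
  also have "(\<Sum>x\<in>near. g x) = g 0 + (\<Sum>x\<in>near - {0}. g x)"
    using zero by (intro sum.remove) (auto simp: near_def)
  also have "(\<Sum>x\<in>near - {0}. g x) \<le> real (card near) * g_max"
  proof -
    have "(\<Sum>x\<in>near - {0}. g x) \<le> real (card (near - {0})) * g_max"
      by (rule sum_bounded_above) (auto simp: near_def intro: g_le_max)
    also have "\<dots> \<le> real (card near) * g_max"
      using g_max_pos by (intro mult_right_mono) (auto simp: near_def intro!: card_mono)
    finally show ?thesis .
  qed
  also have "(\<Sum>x\<in>torus L - near. g x) \<le> ?N * g (axis i (int n))"
  proof -
    have "(\<Sum>x\<in>torus L - near. g x) \<le> real (card (torus L - near)) * g (axis i (int n))"
    proof (rule sum_bounded_above)
      fix x :: "int ^ 'd" assume x: "x \<in> torus L - near"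
      then have "0 \<le> x $ i" "x $ i < int L" by (auto simp: torus_def)
      moreover from this have "x $ i mod int L = x $ i" by simp
      ultimately show "g x \<le> g (axis i (int n))"
        using x n n1 by (intro g_le_axis) (auto simp: near_def S_def)
    qed
    also have "\<dots> \<le> real (card (torus L :: (int ^ 'd) set)) * g (axis i (int n))"
      using g_nonneg by (intro mult_right_mono) (auto intro!: card_mono)
    finally show ?thesis by (simp add: card_torus)
  qed
  also have "real (card near) * g_max \<le> 2 * real n * ?N / real L * g_max"
  proof -
    have "card S \<le> card {0..<int n} + card {int L - int n<..<int L}" unfolding S_def by (rule card_Un_le)
    then have "card S \<le> 2 * n" by simp
    have "real (card near) * real L \<le> real (card S) * ?N"
      unfolding near_def by (rule card_torus_slab[OF L(2)]) (simp add: S_def)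
    also have "\<dots> \<le> real (2 * n) * ?N" by (intro mult_right_mono) (use \<open>card S \<le> 2 * n\<close> in auto)
    finally have "real (card near) \<le> 2 * real n * ?N / real L" using L by (simp add: field_simps)
    then show ?thesis using g_max_pos by (intro mult_right_mono) auto
  qed
  finally have "(\<Sum>x\<in>torus L. g x) \<le> g 0 + 2 * real n * ?N / real L * g_max + ?N * g (axis i (int n))" by simp
  then have "M \<le> (g 0 + 2 * real n * ?N / real L * g_max + ?N * g (axis i (int n))) / ?N"
    unfolding M_def using L by (intro divide_right_mono) auto
  also have "\<dots> = g 0 / ?N + 2 * real n / real L * g_max + g (axis i (int n))"
    using L by (simp add: add_divide_distrib)
  also have "g 0 / ?N \<le> g 0 / real L"
    using side_le_volume L g_nonneg[of 0] by (intro divide_left_mono) auto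
  finally show ?thesis by simp
qed

text \<open>A bootstrap: \<open>g_0_le\<close> bounds \<open>g 0\<close> through the mean, and the
  mean contains \<open>g 0\<close> with weight at most 1/2, as the torus has at least two
  sites.\<close>

lemma g_0_bound: "g 0 \<le> 2 * (g_max + green_torus)"
proof -
  let ?N = "real L ^ CARD('d)"
  have L2: "2 \<le> L" using L by presburger
  have "(\<Sum>x\<in>torus L. g x) = g 0 + (\<Sum>x\<in>torus L - {0}. g x)"
    using L by (intro sum.remove[OF finite_torus]) (auto simp: torus_def)
  also have "(\<Sum>x\<in>torus L - {0}. g x) \<le> real (card (torus L - {0 :: int ^ 'd})) * g_max"
    by (rule sum_bounded_above) (auto intro: g_le_max)
  also have "\<dots> \<le> real (card (torus L :: (int ^ 'd) set)) * g_max"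
    using g_max_pos by (intro mult_right_mono) (auto intro!: card_mono)
  finally have "M \<le> (g 0 + ?N * g_max) / ?N"
    unfolding M_def using L by (intro divide_right_mono) (auto simp: card_torus)
  also have "\<dots> = g 0 / ?N + g_max" using L by (simp add: add_divide_distrib)
  also have "g 0 / ?N \<le> g 0 / 2"
  proof (rule divide_left_mono)
    have "2 \<le> real L" using L2 by simp
    then show "2 \<le> ?N" using side_le_volume by linarith
  qed (use g_nonneg L in auto)
  finally show ?thesis using g_0_le by simp
qed

end

section \<open>The infinite-volume limit\<close>

lemma eventually_even_at_top: "eventually P even_at_top \<longleftrightarrow> eventually (\<lambda>L. even L \<longrightarrow> P L) at_top"
  by (simp add: even_at_top_def eventually_inf_principal)

lemma even_at_top_neq_bot [simp]: "even_at_top \<noteq> bot"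
proof
  assume "even_at_top = bot"
  then have "eventually (\<lambda>L. False) even_at_top" by simp
  then obtain N :: nat where N: "\<And>L. L \<ge> N \<Longrightarrow> even L \<Longrightarrow> False"
    unfolding eventually_even_at_top eventually_at_top_linorder by blast
  show False by (rule N[of "2 * N"]) auto
qed

lemma even_at_top_le: "even_at_top \<le> at_top"
  by (simp add: even_at_top_def)

lemma eventually_even_pos: "\<forall>\<^sub>F L in even_at_top. even L \<and> L > 0"
  using eventually_gt_at_top[of "0 :: nat"] unfolding eventually_even_at_top by eventually_elim simp

lemma tendsto_inverse_side: "((\<lambda>L. 1 / real L) \<longlongrightarrow> 0) even_at_top"
  using tendsto_mono[OF even_at_top_le lim_1_over_n] by simp

context lattice_weight
begin

lemma a_const_nonneg: "0 \<le> a_const w" by (simp add: a_const_def)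

lemma two_point_limit:
  fixes g :: "nat \<Rightarrow> int ^ 'd \<Rightarrow> real" and p r :: "nat \<Rightarrow> real"
  defines "bound \<equiv> \<lambda>q. ereal ((2 - q) / (1 + a_const w)) - enn2ereal (green w)"
  assumes tp: "\<And>L. even L \<Longrightarrow> L > 0 \<Longrightarrow> torus_two_point w L (g L) (p L)"
    and pr: "\<And>L. even L \<Longrightarrow> L > 0 \<Longrightarrow> p L \<le> r L" and r: "(r \<longlongrightarrow> q) even_at_top"
  shows "bound q \<le> Liminf even_at_top (\<lambda>L. ereal ((\<Sum>x\<in>torus L. g L x) / of_nat L ^ CARD('d)))" (is "_ \<le> Liminf _ (\<lambda>L. ereal (?M L))")
    and "0 < bound q \<Longrightarrow> \<exists>c>0. \<forall>\<^sub>F L in even_at_top. \<forall>n :: nat. odd n \<and> real n < c * real L \<longrightarrow> c \<le> g L (axis i (int n))"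
proof -
  let ?a = "a_const w"
  let ?q = "(2 - q) / (1 + a_const w)"
  define \<gamma>L where "\<gamma>L = (\<lambda>L. (\<Sum>k\<in>dual_torus L - {0}. 1 / (1 - what k)) / of_nat L ^ CARD('d))"
  define f where "f = (\<lambda>L. (2 - r L - 1 / real L) / (1 + ?a) - \<gamma>L L)"
  define C where "C = (\<Sum>i\<in>UNIV. 1 / w 0 (axis i 1))"
  have fM: "f L \<le> ?M L" if L: "even L" "L > 0" for L
  proof -
    interpret T: torus_two_point w L "g L" "p L" by (rule tp[OF L])
    have "1 / real L ^ CARD('d) \<le> 1 / real L" using T.side_le_volume L by (intro divide_left_mono) auto
    moreover have "0 \<le> ?a * g L 0" using a_const_nonneg T.g_nonneg by (intro mult_nonneg_nonneg)
    ultimately have "2 - r L - 1 / real L \<le> (1 + ?a) * (?M L + \<gamma>L L)"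
      using T.M_bound pr[OF L] unfolding T.M_def T.green_torus_def \<gamma>L_def by linarith
    then have "(2 - r L - 1 / real L) / (1 + ?a) \<le> ?M L + \<gamma>L L" using a_const_nonneg by (simp add: divide_le_eq mult.commute)
    then show ?thesis by (simp add: f_def)
  qed
  have axis_bound: "?M L \<le> 2 * (C + \<gamma>L L) / real L + 2 * real n / real L * C + g L (axis i (int n))"
    if L: "even L" "L > 0" and n: "odd n" "2 * n \<le> L" for L n
  proof -
    interpret T: torus_two_point w L "g L" "p L" by (rule tp[OF L])
    have "g L 0 / real L \<le> 2 * (C + \<gamma>L L) / real L"
      using T.g_0_bound L by (intro divide_right_mono) (auto simp: T.g_max_def T.green_torus_def \<gamma>L_def C_def)
    then show ?thesis using T.M_le[OF n, of i] by (simp add: T.M_def T.g_max_def C_def)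
  qed
  have Cpos: "0 < C" unfolding C_def by (rule sum_pos) (auto intro: w_axis_pos)
  have lim: "(f \<longlongrightarrow> ?q - enn2real (green w)) even_at_top" and \<gamma>lim: "(\<gamma>L \<longlongrightarrow> enn2real (green w)) even_at_top"
    if fin: "green w < \<infinity>"
  proof -
    have "((\<lambda>L. (\<Sum>k\<in>dual_torus L - {0}. 1 / (1 - weight_hat w k)) / of_nat L ^ CARD('d)) \<longlongrightarrow> complex_of_real (enn2real (green w))) even_at_top"
      using adm fin by (simp add: admissible_def)
    moreover have "(\<Sum>k\<in>dual_torus L - {0}. 1 / (1 - weight_hat w k)) / of_nat L ^ CARD('d) = complex_of_real (\<gamma>L L)" for L
      by (simp add: \<gamma>L_def weight_hat_eq)
    ultimately show \<gamma>: "(\<gamma>L \<longlongrightarrow> enn2real (green w)) even_at_top" by (simp add: tendsto_of_real_iff)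
    have "(f \<longlongrightarrow> (2 - q - 0) / (1 + ?a) - enn2real (green w)) even_at_top"
      unfolding f_def using a_const_nonneg by (intro tendsto_intros r \<gamma> tendsto_inverse_side) auto
    then show "(f \<longlongrightarrow> ?q - enn2real (green w)) even_at_top" by simp
  qed
  have bound_eq: "bound q = ereal (?q - enn2real (green w))" if "green w < \<infinity>"
  proof -
    have "enn2ereal (green w) = ereal (enn2real (green w))"
      using that by (cases "green w" rule: ennreal_cases) (auto simp: enn2ereal_ennreal)
    then show ?thesis by (simp add: bound_def)
  qed
  \<comment> \<open>An infinite Green function makes the bound trivial, so the limit in
    admissibility is called upon only when it is provided.\<close>
  have bound_inf: "bound q = - \<infinity>" if "\<not> green w < \<infinity>"
    using that by (simp add: bound_def less_top[symmetric])
  show "bound q \<le> Liminf even_at_top (\<lambda>L. ereal (?M L))"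
  proof (cases "green w < \<infinity>")
    case True
    have "Liminf even_at_top (\<lambda>L. ereal (f L)) = bound q"
      unfolding bound_eq[OF True] by (rule lim_imp_Liminf) (simp_all add: lim[OF True])
    moreover have "Liminf even_at_top (\<lambda>L. ereal (f L)) \<le> Liminf even_at_top (\<lambda>L. ereal (?M L))"
      using eventually_even_pos by (intro Liminf_mono) (auto elim!: eventually_mono intro: fM)
    ultimately show ?thesis by simp
  qed (simp add: bound_inf)
  assume pos: "0 < bound q"
  then have fin: "green w < \<infinity>" using bound_inf by force
  \<comment> \<open>Half of the gap, so that the mean eventually exceeds it.\<close>
  define \<delta> where "\<delta> = (?q - enn2real (green w)) / 2"
  have \<delta>: "0 < \<delta>" using pos by (simp add: bound_eq[OF fin] \<delta>_def)
  \<comment> \<open>The three entries ensure 2 n \<le> L, a value below what remains of \<delta>,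
    and a slab term of at most \<delta> / 4.\<close>
  define c where "c = min (1 / 2) (min (\<delta> / 4) (\<delta> / (8 * C)))"
  have c: "0 < c" "c \<le> 1 / 2" "c \<le> \<delta> / 4" "c \<le> \<delta> / (8 * C)" using \<delta> Cpos by (auto simp: c_def)
  have "\<forall>\<^sub>F L in even_at_top. \<delta> < f L"
  proof (rule order_tendstoD(1)[OF lim[OF fin]])
    have "?q - enn2real (green w) = 2 * \<delta>" by (simp only: \<delta>_def) simp
    then show "\<delta> < ?q - enn2real (green w)" using \<delta> by linarith
  qed
  moreover have "((\<lambda>L. 2 * (C + \<gamma>L L) * (1 / real L)) \<longlongrightarrow> 2 * (C + enn2real (green w)) * 0) even_at_top"
    by (intro tendsto_intros \<gamma>lim[OF fin] tendsto_inverse_side)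
  then have "\<forall>\<^sub>F L in even_at_top. 2 * (C + \<gamma>L L) * (1 / real L) < \<delta> / 4"
    by (rule order_tendstoD) (use \<delta> in simp)
  ultimately have "\<forall>\<^sub>F L in even_at_top. \<forall>n :: nat. odd n \<and> real n < c * real L \<longrightarrow> c \<le> g L (axis i (int n))"
    using eventually_even_pos
  proof eventually_elim
    case (elim L)
    show ?case
    proof (intro allI impI)
      fix n :: nat assume n: "odd n \<and> real n < c * real L"
      have L: "even L" "L > 0" "0 < real L" using elim by auto
      have "c * real L \<le> 1 / 2 * real L" using c by (intro mult_right_mono) auto
      then have "real (2 * n) \<le> real L" using n by simp
      then have "2 * n \<le> L" by (simp only: of_nat_le_iff)
      then have "?M L \<le> 2 * (C + \<gamma>L L) / real L + 2 * real n / real L * C + g L (axis i (int n))"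
        using n by (intro axis_bound L) auto
      moreover have "2 * real n / real L * C \<le> \<delta> / 4"
      proof -
        have "real n / real L < c" using n L(3) by (simp add: divide_less_eq)
        then have "real n / real L \<le> \<delta> / (8 * C)" using c(4) by linarith
        then have "real n / real L * (2 * C) \<le> \<delta> / (8 * C) * (2 * C)" using Cpos by (intro mult_right_mono) auto
        then show ?thesis using Cpos by (simp add: mult_ac)
      qed
      moreover have "2 * (C + \<gamma>L L) / real L < \<delta> / 4" using elim by simp
      moreover have "\<delta> < ?M L" using fM[OF L(1,2)] elim by linarith
      ultimately show "c \<le> g L (axis i (int n))" using c(3) \<delta> by linarith
    qed
  qed
  then show "\<exists>c>0. \<forall>\<^sub>F L in even_at_top. \<forall>n :: nat. odd n \<and> real n < c * real L \<longrightarrow> c \<le> g L (axis i (int n))"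
    using c(1) by blast
qed

text \<open>Translations preserve the periodised weight, hence the limiting \<open>G\<close>, which
  therefore depends on differences only.\<close>

lemma rp_model_two_point:
  assumes L: "even L" "L > 0"
    and rp: "rp_model (torus L) (torus_bonds L) (torus_refls L) (periodised L w) J j f d Z G"
    and nn: "\<And>x y. x \<in> torus L \<Longrightarrow> y \<in> torus L \<Longrightarrow> 0 \<le> G x y"
    and row: "(\<Sum>y\<in>torus L. periodised L w 0 y * G 0 y) = 1 - p" and p: "0 \<le> p"
  shows "torus_two_point w L (\<lambda>x. G 0 (torus_rep L x)) p"
proof -
  interpret rp_model "torus L" "torus_bonds L" "torus_refls L" "periodised L w" J j f d Z G by (rule rp)
  have zero: "(0 :: int ^ 'd) \<in> torus L" using L by (simp add: torus_def)
  have trans: "G x y = G 0 (torus_rep L (y - x))" if "x \<in> torus L" "y \<in> torus L" for x y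
  proof -
    have "G (torus_rep L (x + - x)) (torus_rep L (y + - x)) = G x y"
      by (rule two_point_invariant[OF bij_betw_torus_translate[OF L(2), of "- x"] _ that])
        (simp only: periodised_rep periodised_rep_left periodised_trans)
    then show ?thesis using torus_rep_id[OF zero] by simp
  qed
  show ?thesis
  proof
    show "0 \<le> G 0 (torus_rep L x)" for x using nn zero L by simp
    show "G 0 (torus_rep L (torus_rep L x)) = G 0 (torus_rep L x)" for x
      using L by (simp add: torus_rep_id)
    show "G 0 (torus_rep L (- x)) = G 0 (torus_rep L x)" for x
    proof -
      have "G 0 (torus_rep L x) = G (torus_rep L x) 0" using two_point_sym zero L by simp
      also have "\<dots> = G 0 (torus_rep L (0 - torus_rep L x))" using zero L by (intro trans) auto
      also have "torus_rep L (0 - torus_rep L x) = torus_rep L (- x)" by (simp add: torus_rep_def vec_eq_iff mod_simps)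
      finally show ?thesis by simp
    qed
    show "(\<Sum>x\<in>torus L. \<Sum>y\<in>torus L. (h x - (\<Sum>z\<in>torus L. periodised L w x z * h z)) *
        (h y - (\<Sum>z\<in>torus L. periodised L w y z * h z)) * G 0 (torus_rep L (y - x))) \<le>
      (\<Sum>x\<in>torus L. h x * (h x - (\<Sum>z\<in>torus L. periodised L w x z * h z)))" for h :: "int ^ 'd \<Rightarrow> real"
      using infrared_bound[of h] by (simp add: trans cong: sum.cong)
    show "(\<Sum>y\<in>torus L. periodised L w 0 y * G 0 (torus_rep L y)) = 1 - p"
      using row by (simp add: torus_rep_id cong: sum.cong)
    show "(G 0 (torus_rep L (torus_refl L i c y - x)))\<^sup>2 \<le>
        G 0 (torus_rep L (torus_refl L i c x - x)) * G 0 (torus_rep L (torus_refl L i c y - y))"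
      if x: "x \<in> torus_half L i c" and y: "y \<in> torus_half L i c" for x y i c
    proof -
      have R: "(torus_half L i c, torus_refl L i c) \<in> torus_refls L" by (auto simp: torus_refls_def)
      have V: "x \<in> torus L" "y \<in> torus L" using x y by (auto simp: torus_half_def)
      show ?thesis using two_point_reflection[OF R x y] V refl_in[OF R] by (simp add: trans)
    qed
  qed (use L p in auto)
qed

section \<open>The permutation model on the torus\<close>

lemma exists_w_pos: "\<exists>v. 0 < w 0 v"
proof (rule ccontr)
  assume "\<not> ?thesis"
  then have "w 0 v = 0" for v using w_nonneg[of 0 v] by (metis less_eq_real_def)
  then have "w 0 = (\<lambda>_. 0)" by blast
  then have "(w 0 has_sum 0) UNIV" by simp
  then show False using w_sum has_sum_unique by fastforce
qed

text \<open>A translation by a vector of positive weight is a permutation of positive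
  weight.\<close>

lemma Z_per_pos:
  assumes L: "L > 0"
  shows "0 < Z_per (torus L) (periodised L w)"
proof -
  obtain v where v: "0 < w 0 v" using exists_w_pos by blast
  define \<pi> where "\<pi> = (\<lambda>x. if x \<in> torus L then torus_rep L (x + v) else x)"
  have "bij_betw \<pi> (torus L) (torus L)"
    using bij_betw_torus_translate[OF L, of v] by (simp add: \<pi>_def cong: bij_betw_cong)
  then have perm: "\<pi> permutes torus L" by (rule bij_imp_permutes) (simp add: \<pi>_def)
  show ?thesis
    unfolding Z_per_def
  proof (rule sum_pos2[of _ \<pi>])
    show "0 < (\<Prod>x\<in>torus L. periodised L w x (\<pi> x))"
    proof (rule prod_pos)
      fix x :: "int ^ 'd" assume x: "x \<in> torus L"
      have "0 < w x (x + v)" using v w_eq[of x "x + v"] by simp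
      also have "\<dots> \<le> periodised L w x (x + v)" by (rule w_le_periodised[OF L])
      finally show "0 < periodised L w x (\<pi> x)" using x by (simp add: \<pi>_def periodised_rep)
    qed
  qed (use perm in \<open>auto intro!: finite_permutations prod_nonneg periodised_nonneg\<close>)
qed

lemma per_two_point:
  assumes L: "even L" "L > 0"
  shows "torus_two_point w L (torus_G G_per L w) 0"
proof -
  let ?V = "torus L :: (int ^ 'd) set" and ?W = "periodised L w"
  interpret reflection_system ?V "torus_bonds L" "torus_refls L" ?W by (rule torus_reflection_system[OF L])
  note Z = Z_per_pos[OF L(2)]
  have rp: "rp_model ?V (torus_bonds L) (torus_refls L) ?W Not prod.swap per_site (\<lambda>_. 1) (Z_per ?V ?W) (\<lambda>x y. G_per ?V ?W y x)"
    by (rule rp_model_per[OF _ Z]) (simp add: sum_periodised_one L)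
  interpret M: rp_model ?V "torus_bonds L" "torus_refls L" ?W Not prod.swap per_site "\<lambda>_. 1" "Z_per ?V ?W" "\<lambda>x y. G_per ?V ?W y x"
    by (rule rp)
  have zero: "(0 :: int ^ 'd) \<in> ?V" using L by (simp add: torus_def)
  have sym: "G_per ?V ?W y x = G_per ?V ?W x y" if "x \<in> ?V" "y \<in> ?V" for x y using M.two_point_sym that by simp
  have "torus_two_point w L (\<lambda>x. G_per ?V ?W (torus_rep L x) 0) 0"
  proof (rule rp_model_two_point[OF L rp])
    show "0 \<le> G_per ?V ?W y x" for x y
      unfolding G_per_def using Z by (intro divide_nonneg_pos sum_nonneg prod_nonneg periodised_nonneg) auto
    have "(\<Sum>y\<in>?V. ?W 0 y * G_per ?V ?W y 0) = (\<Sum>y\<in>?V. ?W y 0 * G_per ?V ?W 0 y)"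
      by (rule sum.cong) (simp_all add: sym zero periodised_sym[of L 0])
    then show "(\<Sum>y\<in>?V. ?W 0 y * G_per ?V ?W y 0) = 1 - 0"
      using sum_G_per[OF _ zero Z] by simp
  qed simp
  moreover have "torus_G G_per L w = (\<lambda>x. G_per ?V ?W (torus_rep L x) 0)"
    using sym zero L by (auto simp: torus_G_def)
  ultimately show ?thesis by simp
qed

section \<open>The monomer double-dimer model on the torus\<close>

lemma periodised_diag: "periodised L w x x = periodised L w 0 0"
  using periodised_trans[of L 0 x 0] by simp

text \<open>All but little of the mass of \<open>w\<close> lies on a finite set, and for large
  \<open>L\<close> the only multiple of \<open>L\<close> in that set is 0.\<close>

lemma periodised_diag_limit: "((\<lambda>L. periodised L w 0 0) \<longlongrightarrow> w 0 0) even_at_top"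
proof (rule tendsto_mono[OF even_at_top_le], rule order_tendstoI)
  fix a assume a: "a < w 0 0"
  show "\<forall>\<^sub>F L in at_top. a < periodised L w 0 0"
    using eventually_gt_at_top[of 0]
  proof eventually_elim
    case (elim L)
    then show ?case using a w_le_periodised[of L 0 0] by simp
  qed
next
  fix a assume a: "w 0 0 < a"
  define F0 where "F0 = a"
  have "\<forall>\<^sub>F F in finite_subsets_at_top UNIV. 1 - (a - w 0 0) < sum (w 0) F"
    using w_sum a unfolding has_sum_def by (intro order_tendstoD(1)) auto
  then obtain F0 where F0: "finite F0" "\<And>F. finite F \<Longrightarrow> F0 \<subseteq> F \<Longrightarrow> 1 - (a - w 0 0) < sum (w 0) F"
    unfolding eventually_finite_subsets_at_top by auto
  define F where "F = insert 0 F0"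
  have F: "finite F" "1 - (a - w 0 0) < sum (w 0) F" using F0 by (auto simp: F_def)
  define K where "K = (\<Sum>x\<in>F. \<Sum>j\<in>UNIV. \<bar>x $ j\<bar>)"
  have K: "\<bar>x $ j\<bar> \<le> K" if "x \<in> F" for x j
  proof -
    have "\<bar>x $ j\<bar> \<le> (\<Sum>j\<in>UNIV. \<bar>x $ j\<bar>)" by (rule member_le_sum) auto
    also have "\<dots> \<le> K" unfolding K_def by (rule member_le_sum[OF that]) (auto intro: sum_nonneg F)
    finally show ?thesis .
  qed
  show "\<forall>\<^sub>F L in at_top. periodised L w 0 0 < a"
    using eventually_gt_at_top[of "nat K"]
  proof eventually_elim
    case (elim L)
    then have L: "L > 0" and KL: "K < int L" by auto
    have "periodised L w 0 0 = infsum (w 0) (range (\<lambda>z. 0 + int L *s z))" by (rule periodised_eq[OF L])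
    also have "\<dots> \<le> infsum (w 0) (insert 0 (UNIV - F))"
    proof (rule infsum_mono_neutral)
      fix x assume "x \<in> range (\<lambda>z. 0 + int L *s z) - insert 0 (UNIV - F)"
      then obtain z where x: "x = int L *s z" "x \<in> F" "x \<noteq> 0" by auto
      then obtain j where j: "z $ j \<noteq> 0" by (auto simp: vec_eq_iff)
      have "int L * 1 \<le> int L * \<bar>z $ j\<bar>" using j by (intro mult_left_mono) auto
      then have "int L \<le> \<bar>x $ j\<bar>" by (simp add: x(1) abs_mult)
      then show "w 0 x \<le> 0" using K[OF x(2), of j] KL by linarith
    qed (simp_all add: w_summable w_nonneg)
    also have "\<dots> = w 0 0 + infsum (w 0) (UNIV - F)"
      by (rule infsum_insert) (auto simp: w_summable F_def)
    also have "infsum (w 0) (UNIV - F) = infsum (w 0) UNIV - infsum (w 0) F"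
      by (rule infsum_Diff) (auto simp: w_summable)
    also have "\<dots> = 1 - sum (w 0) F" using F(1) infsumI[OF w_sum] by simp
    finally show ?case using F(2) by simp
  qed
qed

lemma b_const_eq: "b_const w = infsum (\<lambda>v. w 0 v * (if parity v then 0 else 1)) UNIV"
proof -
  have "odd (\<Sum>j\<in>UNIV. \<bar>x $ j\<bar>) \<longleftrightarrow> \<not> parity x" for x :: "int ^ 'd"
  proof -
    have "parity (\<chi> j. \<bar>x $ j\<bar>) = parity x" by (rule parity_cong) (auto simp: abs_if)
    then show ?thesis by (simp add: parity_def)
  qed
  then show ?thesis unfolding b_const_def by (intro infsum_cong_neutral) auto
qed

lemma odd_part_rows:
  assumes L: "even L" "L > 0"
  shows "(\<Sum>y\<in>torus L. odd_part L x y) = b_const w"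
proof -
  have "(\<Sum>y\<in>torus L. odd_part L x y) = (\<Sum>y\<in>torus L. periodised L w x y * (if parity x = parity y then 0 else 1))"
    by (intro sum.cong) (auto simp: odd_part_def)
  also have "\<dots> = infsum (\<lambda>v. w 0 v * (if parity x = parity (x + v) then 0 else 1)) UNIV"
    by (rule sum_periodised[OF L(2), of _ 1]) (simp_all add: parity_rep[OF L(1)])
  also have "\<dots> = b_const w" unfolding b_const_eq by (intro infsum_cong) (auto simp: parity_add)
  finally show ?thesis .
qed

lemma odd_part_bounds: "0 \<le> odd_part L x y" "odd_part L x y \<le> periodised L w x y" "odd_part L x y = odd_part L y x"
  by (auto simp: odd_part_def periodised_nonneg intro: periodised_sym)

text \<open>Positivity comes from a perfect matching along an odd vector. The comparison holds
  because \<open>odd_part\<close> only drops nonnegative weights, among them all monomers.\<close>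

lemma Z_mdd_odd_part:
  assumes L: "even L" "L > 0" and b: "b_const w > 0"
  shows "0 < Z_mdd (torus L) (odd_part L)" "Z_mdd (torus L) (odd_part L) \<le> Z_mdd (torus L) (periodised L w)"
proof -
  have "\<exists>v. \<not> parity v \<and> 0 < w 0 v"
  proof (rule ccontr)
    assume n: "\<nexists>v. \<not> parity v \<and> 0 < w 0 v"
    have "w 0 v * (if parity v then 0 else 1) = 0" for v
      using n w_nonneg[of 0 v] by (auto simp: less_eq_real_def)
    then have "b_const w = 0" unfolding b_const_eq by (simp only: infsum_0_simp)
    then show False using b by simp
  qed
  then obtain v where v: "\<not> parity v" "0 < w 0 v" by blast
  \<comment> \<open>Even sites move by \<open>v\<close> and odd sites back by \<open>- v\<close>, so
    the two sublattices are matched.\<close>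
  define t where "t = (\<lambda>x. torus_rep L (if parity x then x + v else x - v))"
  have pv: "parity (x - v) = (\<not> parity x)" for x using parity_add[of "x - v" v] v by simp
  have t: "t x = torus_rep L (if parity x then x + v else x - v)" for x by (simp add: t_def)
  have par_t: "parity (t x) = (\<not> parity x)" for x
    using v by (simp add: t_def parity_rep[OF L(1)] parity_add pv)
  have Zo: "Z_mdd (torus L) (odd_part L) = matching_sum (torus L) (odd_part L) (\<lambda>x. mdd_site 0)"
    using Z_mdd_eq[of "torus L :: (int ^ 'd) set" "odd_part L"] odd_part_bounds by (simp add: odd_part_def)
  have Z: "Z_mdd (torus L) (periodised L w) = matching_sum (torus L) (periodised L w) (\<lambda>x. mdd_site (periodised L w x x))"
    by (rule Z_mdd_eq) (simp_all add: periodised_nonneg periodised_sym)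
  show "0 < Z_mdd (torus L) (odd_part L)"
    unfolding Zo
  proof (rule perfect_matching_positive)
    fix x :: "int ^ 'd" assume x: "x \<in> torus L"
    have "t (t x) = x"
      using x torus_rep_cong_add[of L "x + v" "- v"] torus_rep_cong_add[of L "x - v" v]
      by (cases "parity x") (simp_all add: t[of "t x"] par_t, simp_all add: t torus_rep_id)
    moreover have "t x \<noteq> x" using par_t[of x] by metis
    moreover have "0 < odd_part L x (t x)"
    proof -
      have "0 < w x (if parity x then x + v else x - v)" using v w_eq[of x "x + v"] w_eq[of x "x - v"] w_minus[of v] by simp
      also have "\<dots> \<le> periodised L w x (if parity x then x + v else x - v)" by (rule w_le_periodised[OF L(2)])
      finally show ?thesis using par_t[of x] by (simp add: odd_part_def) (simp add: t_def periodised_rep)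
    qed
    ultimately show "t x \<in> torus L \<and> t x \<noteq> x \<and> t (t x) = x \<and> 0 < odd_part L x (t x)" using L by (simp add: t_def)
  qed (simp_all add: odd_part_bounds(1) odd_part_bounds(3))
  show "Z_mdd (torus L) (odd_part L) \<le> Z_mdd (torus L) (periodised L w)"
    unfolding Zo Z
    by (rule matching_sum_mono) (auto simp: odd_part_bounds(1,2) odd_part_bounds(3) periodised_sym mdd_site_def periodised_nonneg)
qed

text \<open>With N sites and diagonal weight a, the two chessboard estimates combine to p \<le> a /
  Z^(1/N) \<le> e a / b, where Z is bounded below by the partition function of the odd part.\<close>

lemma mdd_two_point:
  assumes L: "even L" "L > 0" and b: "b_const w > 0"
  shows "\<exists>p \<le> min 1 (exp 1 * periodised L w 0 0 / b_const w). torus_two_point w L (torus_G G_mdd L w) p"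
proof -
  let ?V = "torus L :: (int ^ 'd) set" and ?W = "periodised L w"
  interpret reflection_system ?V "torus_bonds L" "torus_refls L" ?W by (rule torus_reflection_system[OF L])
  interpret O: reflection_system ?V "torus_bonds L" "torus_refls L" "odd_part L" by (rule torus_reflection_system_odd[OF L])
  note Zo = Z_mdd_odd_part[OF L b]
  have Z: "0 < Z_mdd ?V ?W" using Zo by linarith
  have zero: "(0 :: int ^ 'd) \<in> ?V" using L by (simp add: torus_def)
  define p where "p = monomer_sum ?V ?W 0 / Z_mdd ?V ?W"
  have sG: "(\<Sum>y\<in>?V. ?W 0 y * G_mdd ?V ?W 0 y) = 1 - p" "0 \<le> monomer_sum ?V ?W 0" "monomer_sum ?V ?W 0 \<le> Z_mdd ?V ?W"
    unfolding p_def by (intro sum_G_mdd fin W_sym periodised_nonneg Z zero; assumption)+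
  have rp: "rp_model ?V (torus_bonds L) (torus_refls L) ?W (\<lambda>k. k) (\<lambda>i. i) (mdd_weight (?W 0 0)) (\<lambda>k. if k then 1 else 0) (Z_mdd ?V ?W) (G_mdd ?V ?W)"
    by (rule rp_model_mdd[OF _ periodised_nonneg periodised_diag Z]) (simp add: sum_periodised_one L)
  have "torus_two_point w L (\<lambda>x. G_mdd ?V ?W 0 (torus_rep L x)) p"
  proof (rule rp_model_two_point[OF L rp])
    show "0 \<le> G_mdd ?V ?W x y" if xy: "x \<in> ?V" "y \<in> ?V" for x y
    proof (cases "x = y")
      case False
      have "0 \<le> matching_sum ?V ?W (\<lambda>z. if z = x \<or> z = y then source_site else mdd_site (?W z z))"
        by (rule matching_sum_mono(2)[where W = ?W and \<kappa>' = "\<lambda>z. if z = x \<or> z = y then source_site else mdd_site (?W z z)"])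
          (auto simp: W_sym periodised_nonneg source_site_def mdd_site_def)
      moreover have "G_mdd ?V ?W x y = matching_sum ?V ?W (\<lambda>z. if z = x \<or> z = y then source_site else mdd_site (?W z z)) / Z_mdd ?V ?W"
        by (rule G_mdd_eq[OF fin W_sym periodised_nonneg xy False])
      ultimately show ?thesis using Z by simp
    qed (simp add: G_mdd_def)
    show "0 \<le> p" using sG(2) Z by (simp add: p_def)
  qed (rule sG(1))
  moreover have "torus_G G_mdd L w = (\<lambda>x. G_mdd ?V ?W 0 (torus_rep L x))" by (simp add: torus_G_def fun_eq_iff)
  moreover have "p \<le> 1" using sG(3) Z by (simp add: p_def)
  moreover have "p \<le> exp 1 * ?W 0 0 / b_const w"
  proof -
    have N: "card ?V > 0" using L by (simp add: card_torus)
    have "b_const w / exp 1 \<le> root (card ?V) (Z_mdd ?V (odd_part L))"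
    proof (rule O.bipartite_lower_bound[where par = parity])
      show "card {x \<in> ?V. parity x} = card {x \<in> ?V. \<not> parity x}"
      proof (rule bij_betw_same_card)
        \<comment> \<open>A reflection exchanges the sublattices; \<open>undefined\<close> stands
          for an arbitrary coordinate direction.\<close>
        show "bij_betw (torus_refl L undefined 0) {x \<in> ?V. parity x} {x \<in> ?V. \<not> parity x}"
          by (rule bij_betw_byWitness[of _ "torus_refl L undefined 0"])
            (use L in \<open>auto simp: torus_refl_refl parity_refl torus_refl_def[THEN arg_cong[of _ _ "\<lambda>x. x \<in> torus L"]]\<close>)
      qed
    qed (use odd_part_rows[OF L] b Zo odd_part_bounds in \<open>auto simp: odd_part_def\<close>)
    also have "\<dots> \<le> root (card ?V) (Z_mdd ?V ?W)" using Zo N by simp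
    finally have "monomer_sum ?V ?W 0 * (b_const w / exp 1) \<le> monomer_sum ?V ?W 0 * root (card ?V) (Z_mdd ?V ?W)"
      using sG(2) by (rule mult_left_mono)
    also have "\<dots> \<le> ?W 0 0 * Z_mdd ?V ?W"
      by (rule monomer_chessboard[OF periodised_nonneg periodised_diag Z zero])
    finally have "p * (b_const w / exp 1) \<le> ?W 0 0" using Z by (simp add: p_def divide_le_eq mult_ac)
    then show ?thesis using b by (simp add: field_simps)
  qed
  ultimately show ?thesis by (intro exI[of _ p]) simp
qed

end

theorem theorem3p2:
  fixes w :: "int ^ 'd \<Rightarrow> int ^ 'd \<Rightarrow> real" and i1 :: "'d :: finite"
  assumes "admissible w"
  shows "Liminf even_at_top (\<lambda>L. ereal (torus_M G_per L w)) \<ge> per_bound w \<and>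
    (b_const w > 0 \<longrightarrow>
       Liminf even_at_top (\<lambda>L. ereal (torus_M G_mdd L w)) \<ge> mdd_bound w) \<and>
    (per_bound w > 0 \<longrightarrow>
       (\<exists>c > 0. \<forall>\<^sub>F L in even_at_top. \<forall>n :: nat. odd n \<and> real n < c * real L \<longrightarrow>
          torus_G G_per L w (axis i1 (int n)) \<ge> c)) \<and>
    (b_const w > 0 \<and> mdd_bound w > 0 \<longrightarrow>
       (\<exists>c > 0. \<forall>\<^sub>F L in even_at_top. \<forall>n :: nat. odd n \<and> real n < c * real L \<longrightarrow>
          torus_G G_mdd L w (axis i1 (int n)) \<ge> c))"
proof -
  interpret lattice_weight w by unfold_locales (rule assms)
  have per: "per_bound w = ereal ((2 - 0) / (1 + a_const w)) - enn2ereal (green w)" by (simp add: per_bound_def)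
  have per_limit: "per_bound w \<le> Liminf even_at_top (\<lambda>L. ereal (torus_M G_per L w))"
    "0 < per_bound w \<Longrightarrow> \<exists>c>0. \<forall>\<^sub>F L in even_at_top. \<forall>n :: nat. odd n \<and> real n < c * real L \<longrightarrow> c \<le> torus_G G_per L w (axis i1 (int n))"
    unfolding per torus_M_def
    by (rule two_point_limit[where g = "\<lambda>L. torus_G G_per L w" and p = "\<lambda>_. 0" and r = "\<lambda>_. 0" and q = 0];
      use per_two_point in simp)+
  define r where "r = (\<lambda>L. min 1 (exp 1 * periodised L w 0 0 / b_const w))"
  \<comment> \<open>Only even positive \<open>L\<close> matter; for other \<open>L\<close> the
    chosen value is arbitrary.\<close>
  define p where "p = (\<lambda>L. SOME p. p \<le> r L \<and> torus_two_point w L (torus_G G_mdd L w) p)"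
  have p: "p L \<le> r L \<and> torus_two_point w L (torus_G G_mdd L w) (p L)" if "b_const w > 0" "even L" "L > 0" for L
    unfolding p_def by (rule someI_ex) (use mdd_two_point[OF that(2,3,1)] in \<open>auto simp: r_def\<close>)
  have r: "(r \<longlongrightarrow> q_const w) even_at_top" if "b_const w > 0"
    unfolding r_def q_const_def using that by (intro tendsto_intros periodised_diag_limit) auto
  have mdd_limit: "mdd_bound w \<le> Liminf even_at_top (\<lambda>L. ereal (torus_M G_mdd L w))"
    "0 < mdd_bound w \<Longrightarrow> \<exists>c>0. \<forall>\<^sub>F L in even_at_top. \<forall>n :: nat. odd n \<and> real n < c * real L \<longrightarrow> c \<le> torus_G G_mdd L w (axis i1 (int n))"
    if b: "b_const w > 0"
    unfolding mdd_bound_def torus_M_def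
    by (rule two_point_limit[where g = "\<lambda>L. torus_G G_mdd L w" and p = p and r = r and q = "q_const w"]; use p[OF b] r[OF b] in blast)+
  show ?thesis using per_limit mdd_limit by blast
qed


end
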